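(* Let $(M,F)$ be a forward complete Berwald manifold with $\mathbf{K}_M\leq k$, $\mathfrak{i}_M\geq \varsigma$ and $\lambda_F\leq \lambda$. Then \[ \mathrm{Conv}(M,F)\geq \min\left\{\frac{\pi}{2\sqrt{k}},\ \frac{\varsigma}{\lambda(1+\lambda)} \right\}. \]
   Context: A Finsler manifold $(M,F)$ is a connected smooth manifold with a Finsler metric $F:TM\to[0,\infty)$ (smooth off the zero section, $F(x,cy)=cF(x,y)$ for $c>0$, fundamental tensor $g_{ij}(x,y)=\frac12\frac{\partial^2F^2}{\partial y^i\partial y^j}$ positive definite for $y\neq0$); $F$ need not be reversible. For $y\in T_xM\setminus\{0\}$, $g_y(u,v)=g_{ij}(x,y)u^iv^j$. $d(p,q)$ is the infimum of $F$-lengths of curves from $p$ to $q$ (possibly non-symmetric), $B^+_p(r)=\{q:d(p,q)<r\}$. Forward complete means that every geodesic extends to all positive times. $\mathfrak{i}_M=\inf_{p}d(p,\mathrm{Cut}_p)$ is the injectivity radius, $\mathrm{Cut}_p$ being the cut locus of $p$. The reversibility is $\lambda_F=\sup_{X\in TM\setminus0}\frac{F(-X)}{F(X)}$. Chern connection: the forms $\omega^i_j=\Gamma^i_{jk}(x,y)\,dx^k$ on $\pi^*TM$ determined by $\Gamma^i_{jk}=\Gamma^i_{kj}$ and $dg_{ij}-g_{kj}\omega^k_i-g_{ik}\omega^k_j=\frac{2A_{ijk}}{F}(dy^k+N^k_l\,dx^l)$, with $A_{ijk}=\frac F4\frac{\partial^3F^2}{\partial y^i\partial y^j\partial y^k}$,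 $N^k_l=\Gamma^k_{lm}y^m$. $(M,F)$ is Berwald if $\frac{\partial\Gamma^i_{jk}}{\partial y^s}=0$. The curvature is $\Omega^i_j=d\omega^i_j-\omega^k_j\wedge\omega^i_k=\frac12R^i_{j\,kl}dx^k\wedge dx^l+P^i_{j\,kl}dx^k\wedge\frac{dy^l+N^l_sdx^s}{F}$. With $R_{jikl}=g_{is}R^s_{j\,kl}$ the flag curvature is $\mathbf K(y,V)=\frac{V^iy^jR_{jikl}y^lV^k}{g_y(y,y)g_y(V,V)-[g_y(y,V)]^2}$; $\mathbf{K}_M\le k$ means that all flag curvatures are at most $k$. By convention $\pi/(2\sqrt k)=+\infty$ when $k\le 0$. A subset $A\subset M$ is strongly (geodesically) convex if for any $p,q\in A$ there exists a geodesic $\gamma_{pq}$ such that $\gamma_{pq}$ is the unique minimizer in $M$ from $p$ to $q$, and $\gamma_{pq}$ is the only geodesic contained in $A$ from $p$ to $q$. The convexity radius at $x$ is $\mathrm{Conv}_x=\sup\{r>0: B^+_x(s)\text{ is strongly convex for any }s<r\}$, and $\mathrm{Conv}(M,F)=\inf_{x\in M}\mathrm{Conv}_x$. *)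

theory Defs
  imports "HOL-Analysis.Analysis"
begin

section \<open>Smooth functions on open subsets of normed spaces\<close>

primrec Ck_on :: "nat \<Rightarrow> 'a::real_normed_vector set \<Rightarrow> ('a \<Rightarrow> 'b::real_normed_vector) \<Rightarrow> bool" where
  "Ck_on 0 S f \<longleftrightarrow> continuous_on S f"
| "Ck_on (Suc k) S f \<longleftrightarrow> (\<forall>x\<in>S. f differentiable (at x)) \<and>
     (\<forall>v. Ck_on k S (\<lambda>x. frechet_derivative f (at x) v))"

definition smooth_on :: "'a::real_normed_vector set \<Rightarrow> ('a \<Rightarrow> 'b::real_normed_vector) \<Rightarrow> bool" where
  "smooth_on S f \<longleftrightarrow> (\<forall>k. Ck_on k S f)"


section \<open>Smooth manifolds\<close>

text \<open>The manifold is the whole type \<open>'m\<close>, a second countable Hausdorff space, together with a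
  smooth atlas. A chart is a pair of a domain and a total coordinate map, whose values outside the
  domain are irrelevant. The dimension is \<open>CARD('n)\<close>.\<close>

type_synonym ('m, 'n) chart = "'m set \<times> ('m \<Rightarrow> real ^ 'n)"

abbreviation cdom :: "('m, 'n) chart \<Rightarrow> 'm set" where "cdom \<equiv> fst"
abbreviation cmap :: "('m, 'n) chart \<Rightarrow> 'm \<Rightarrow> real ^ 'n" where "cmap \<equiv> snd"

definition cimg :: "('m, 'n) chart \<Rightarrow> (real ^ 'n) set" where
  "cimg c = cmap c ` cdom c"

definition cinv :: "('m, 'n) chart \<Rightarrow> real ^ 'n \<Rightarrow> 'm" where
  "cinv c = inv_into (cdom c) (cmap c)"

definition smooth_atlas :: "('m::topological_space, 'n::finite) chart set \<Rightarrow> bool" where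
  "smooth_atlas A \<longleftrightarrow>
     (\<forall>c\<in>A. open (cdom c) \<and> open (cimg c) \<and>
            homeomorphism (cdom c) (cimg c) (cmap c) (cinv c)) \<and>
     (\<Union>c\<in>A. cdom c) = UNIV \<and>
     (\<forall>c\<in>A. \<forall>d\<in>A. smooth_on (cmap c ` (cdom c \<inter> cdom d)) (cmap d \<circ> cinv c))"

text \<open>A tangent vector at \<open>p\<close> is given by its components in every chart around \<open>p\<close>, which are
  related by the derivatives of the coordinate changes. The components with respect to
  charts that are not in the atlas or not around \<open>p\<close> are fixed to be \<open>0\<close>.\<close>

type_synonym ('m, 'n) tvec = "('m, 'n) chart \<Rightarrow> real ^ 'n"

definition tangent_space ::
    "('m::topological_space, 'n::finite) chart set \<Rightarrow> 'm \<Rightarrow> ('m, 'n) tvec set" where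
  "tangent_space A p = {X.
     (\<forall>c. \<not> (c \<in> A \<and> p \<in> cdom c) \<longrightarrow> X c = 0) \<and>
     (\<forall>c\<in>A. \<forall>d\<in>A. p \<in> cdom c \<inter> cdom d \<longrightarrow>
        X d = frechet_derivative (cmap d \<circ> cinv c) (at (cmap c p)) (X c))}"

abbreviation zero_tvec :: "('m, 'n::finite) tvec" where
  "zero_tvec \<equiv> (\<lambda>c. 0)"

text \<open>The tangent vector at \<open>p\<close> with components \<open>y\<close> in the chart \<open>c\<close>, i.e. the sum of the
  \<open>y\<^sup>i \<partial>/\<partial>x\<^sup>i\<close>.\<close>

definition tvec_of ::
    "('m::topological_space, 'n::finite) chart set \<Rightarrow> ('m, 'n) chart \<Rightarrow> 'm \<Rightarrow> real ^ 'n \<Rightarrow> ('m, 'n) tvec"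
  where
  "tvec_of A c p y = (\<lambda>d. if d \<in> A \<and> p \<in> cdom d
     then frechet_derivative (cmap d \<circ> cinv c) (at (cmap c p)) y else 0)"


section \<open>Local coordinate expressions\<close>

text \<open>Throughout this section \<open>L\<close> is a Finsler function \<open>F(x,y)\<close> in the coordinates of a chart.\<close>

definition pdx :: "'n \<Rightarrow> (real ^ 'n \<Rightarrow> real ^ 'n \<Rightarrow> real) \<Rightarrow> real ^ 'n \<Rightarrow> real ^ 'n::finite \<Rightarrow> real" where
  "pdx i f x y = deriv (\<lambda>t. f (x + t *\<^sub>R axis i 1) y) 0"

definition pdy :: "'n \<Rightarrow> (real ^ 'n \<Rightarrow> real ^ 'n \<Rightarrow> real) \<Rightarrow> real ^ 'n \<Rightarrow> real ^ 'n::finite \<Rightarrow> real" where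
  "pdy i f x y = deriv (\<lambda>t. f x (y + t *\<^sub>R axis i 1)) 0"

definition fund_tensor ::
    "(real ^ 'n \<Rightarrow> real ^ 'n \<Rightarrow> real) \<Rightarrow> 'n \<Rightarrow> 'n \<Rightarrow> real ^ 'n \<Rightarrow> real ^ 'n::finite \<Rightarrow> real" where
  "fund_tensor L i j x y = 1 / 2 * pdy i (pdy j (\<lambda>x y. (L x y)\<^sup>2)) x y"

definition fund_form ::
    "(real ^ 'n \<Rightarrow> real ^ 'n \<Rightarrow> real) \<Rightarrow> real ^ 'n \<Rightarrow> real ^ 'n \<Rightarrow> real ^ 'n \<Rightarrow> real ^ 'n::finite \<Rightarrow> real" where
  "fund_form L x y u v = (\<Sum>i\<in>UNIV. \<Sum>j\<in>UNIV. fund_tensor L i j x y * u $ i * v $ j)"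

definition cartan ::
    "(real ^ 'n \<Rightarrow> real ^ 'n \<Rightarrow> real) \<Rightarrow> 'n \<Rightarrow> 'n \<Rightarrow> 'n \<Rightarrow> real ^ 'n \<Rightarrow> real ^ 'n::finite \<Rightarrow> real" where
  "cartan L i j k x y = L x y / 4 * pdy i (pdy j (pdy k (\<lambda>x y. (L x y)\<^sup>2))) x y"

text \<open>The structure equations of the Chern connection at the point \<open>(x,y)\<close>, where
  \<open>G i j k\<close> stands for \<open>\<Gamma>\<^sup>i\<^sub>j\<^sub>k\<close>. The second and third conjunct are the \<open>dx\<^sup>l\<close>- and \<open>dy\<^sup>k\<close>-components
  of the almost-compatibility equation
  \<open>dg\<^sub>i\<^sub>j - g\<^sub>k\<^sub>j \<omega>\<^sup>k\<^sub>i - g\<^sub>i\<^sub>k \<omega>\<^sup>k\<^sub>j = 2 A\<^sub>i\<^sub>j\<^sub>k / F (dy\<^sup>k + N\<^sup>k\<^sub>l dx\<^sup>l)\<close>.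
  As \<open>N\<^sup>k\<^sub>l = \<Gamma>\<^sup>k\<^sub>l\<^sub>m y\<^sup>m\<close>, these equations are pointwise linear in \<open>\<Gamma>\<close>.\<close>

definition chern_equations ::
    "(real ^ 'n \<Rightarrow> real ^ 'n \<Rightarrow> real) \<Rightarrow> real ^ 'n \<Rightarrow> real ^ 'n::finite \<Rightarrow> ('n \<Rightarrow> 'n \<Rightarrow> 'n \<Rightarrow> real) \<Rightarrow> bool"
  where
  "chern_equations L x y G \<longleftrightarrow>
     (\<forall>i j k. G i j k = G i k j) \<and>
     (\<forall>i j l. pdx l (fund_tensor L i j) x y
              - (\<Sum>k\<in>UNIV. fund_tensor L k j x y * G k i l)
              - (\<Sum>k\<in>UNIV. fund_tensor L i k x y * G k j l)
            = (\<Sum>k\<in>UNIV. 2 * cartan L i j k x y / L x y * (\<Sum>m\<in>UNIV. G k l m * y $ m))) \<and>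
     (\<forall>i j k. pdy k (fund_tensor L i j) x y = 2 * cartan L i j k x y / L x y)"

text \<open>For \<open>y \<noteq> 0\<close> the structure equations have exactly one solution; for \<open>y = 0\<close> the value of
  \<open>chern\<close> is meaningless.\<close>

definition chern ::
    "(real ^ 'n \<Rightarrow> real ^ 'n \<Rightarrow> real) \<Rightarrow> 'n \<Rightarrow> 'n \<Rightarrow> 'n \<Rightarrow> real ^ 'n \<Rightarrow> real ^ 'n::finite \<Rightarrow> real" where
  "chern L i j k x y = (THE G. chern_equations L x y G) i j k"

definition nonlin_conn ::
    "(real ^ 'n \<Rightarrow> real ^ 'n \<Rightarrow> real) \<Rightarrow> 'n \<Rightarrow> 'n \<Rightarrow> real ^ 'n \<Rightarrow> real ^ 'n::finite \<Rightarrow> real" where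
  "nonlin_conn L k l x y = (\<Sum>m\<in>UNIV. chern L k l m x y * y $ m)"

text \<open>The horizontal derivative \<open>\<delta>/\<delta>x\<^sup>k = \<partial>/\<partial>x\<^sup>k - N\<^sup>s\<^sub>k \<partial>/\<partial>y\<^sup>s\<close>, dual to \<open>dx\<^sup>k\<close> in the coframe
  \<open>dx\<^sup>k, dy\<^sup>k + N\<^sup>k\<^sub>l dx\<^sup>l\<close>.\<close>

definition hder :: "(real ^ 'n \<Rightarrow> real ^ 'n \<Rightarrow> real) \<Rightarrow> 'n \<Rightarrow> (real ^ 'n \<Rightarrow> real ^ 'n \<Rightarrow> real) \<Rightarrow>
    real ^ 'n \<Rightarrow> real ^ 'n::finite \<Rightarrow> real" where
  "hder L k f x y = pdx k f x y - (\<Sum>s\<in>UNIV. nonlin_conn L s k x y * pdy s f x y)"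

text \<open>The coefficients \<open>R\<^sub>j\<^sup>i\<^sub>k\<^sub>l\<close>, skew in \<open>k, l\<close>, of the \<open>dx\<^sup>k \<and> dx\<^sup>l\<close>-part of
  \<open>\<Omega>\<^sup>i\<^sub>j = d\<omega>\<^sup>i\<^sub>j - \<omega>\<^sup>h\<^sub>j \<and> \<omega>\<^sup>i\<^sub>h\<close> in that coframe: here \<open>\<omega>\<^sup>i\<^sub>j = \<Gamma>\<^sup>i\<^sub>j\<^sub>l dx\<^sup>l\<close>, so the horizontal part is
  \<open>(\<delta>\<^sub>k \<Gamma>\<^sup>i\<^sub>j\<^sub>l - \<Gamma>\<^sup>h\<^sub>j\<^sub>k \<Gamma>\<^sup>i\<^sub>h\<^sub>l) dx\<^sup>k \<and> dx\<^sup>l\<close>, which is skew-symmetrized. The arguments are in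
  the order \<open>i j k l\<close>.\<close>

definition hh_curv ::
    "(real ^ 'n \<Rightarrow> real ^ 'n \<Rightarrow> real) \<Rightarrow> 'n \<Rightarrow> 'n \<Rightarrow> 'n \<Rightarrow> 'n \<Rightarrow> real ^ 'n \<Rightarrow> real ^ 'n::finite \<Rightarrow> real" where
  "hh_curv L i j k l x y =
     hder L k (chern L i j l) x y - hder L l (chern L i j k) x y
     + (\<Sum>h\<in>UNIV. chern L i h k x y * chern L h j l x y - chern L i h l x y * chern L h j k x y)"

text \<open>\<open>R\<^sub>j\<^sub>i\<^sub>k\<^sub>l = g\<^sub>i\<^sub>s R\<^sub>j\<^sup>s\<^sub>k\<^sub>l\<close>\<close>

definition hh_curv_low ::
    "(real ^ 'n \<Rightarrow> real ^ 'n \<Rightarrow> real) \<Rightarrow> 'n \<Rightarrow> 'n \<Rightarrow> 'n \<Rightarrow> 'n \<Rightarrow> real ^ 'n \<Rightarrow> real ^ 'n::finite \<Rightarrow> real" where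
  "hh_curv_low L j i k l x y = (\<Sum>s\<in>UNIV. fund_tensor L i s x y * hh_curv L s j k l x y)"

definition flag_curv ::
    "(real ^ 'n \<Rightarrow> real ^ 'n \<Rightarrow> real) \<Rightarrow> real ^ 'n \<Rightarrow> real ^ 'n \<Rightarrow> real ^ 'n::finite \<Rightarrow> real" where
  "flag_curv L x y V =
     (\<Sum>i\<in>UNIV. \<Sum>j\<in>UNIV. \<Sum>k\<in>UNIV. \<Sum>l\<in>UNIV.
        V $ i * y $ j * hh_curv_low L j i k l x y * y $ l * V $ k) /
     (fund_form L x y y y * fund_form L x y V V - (fund_form L x y y V)\<^sup>2)"


section \<open>Finsler manifolds\<close>

text \<open>A Finsler function on \<open>TM\<close> is written as a curried function \<open>F p X\<close>, relevant only for
  \<open>X \<in> tangent_space A p\<close>. Its expression in a chart is obtained as follows.\<close>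

type_synonym ('m, 'n) finsler_fun = "'m \<Rightarrow> ('m, 'n) tvec \<Rightarrow> real"

definition local_F :: "('m::topological_space, 'n::finite) chart set \<Rightarrow> ('m, 'n) finsler_fun \<Rightarrow>
    ('m, 'n) chart \<Rightarrow> real ^ 'n \<Rightarrow> real ^ 'n \<Rightarrow> real" where
  "local_F A F c x y = F (cinv c x) (tvec_of A c (cinv c x) y)"

definition finsler_metric ::
    "('m::topological_space, 'n::finite) chart set \<Rightarrow> ('m, 'n) finsler_fun \<Rightarrow> bool" where
  "finsler_metric A F \<longleftrightarrow>
     (\<forall>p. \<forall>X\<in>tangent_space A p. 0 \<le> F p X) \<and>
     (\<forall>p. \<forall>X\<in>tangent_space A p. \<forall>a>0. F p (\<lambda>c. a *\<^sub>R X c) = a * F p X) \<and>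
     (\<forall>c\<in>A. smooth_on (cimg c \<times> (- {0})) (\<lambda>(x, y). local_F A F c x y)) \<and>
     (\<forall>c\<in>A. \<forall>x\<in>cimg c. \<forall>y. y \<noteq> 0 \<longrightarrow>
        (\<forall>u. u \<noteq> 0 \<longrightarrow> fund_form (local_F A F c) x y u u > 0))"

definition finsler_manifold ::
    "('m::{t2_space, second_countable_topology}, 'n::finite) chart set \<Rightarrow> ('m, 'n) finsler_fun \<Rightarrow> bool"
  where
  "finsler_manifold A F \<longleftrightarrow>
     connected (UNIV :: 'm set) \<and> smooth_atlas A \<and> finsler_metric A F"

definition berwald ::
    "('m::topological_space, 'n::finite) chart set \<Rightarrow> ('m, 'n) finsler_fun \<Rightarrow> bool" where
  "berwald A F \<longleftrightarrow> (\<forall>c\<in>A. \<forall>x\<in>cimg c. \<forall>y. y \<noteq> 0 \<longrightarrow>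
     (\<forall>i j k s. pdy s (chern (local_F A F c) i j k) x y = 0))"

definition flag_curv_le ::
    "('m::topological_space, 'n::finite) chart set \<Rightarrow> ('m, 'n) finsler_fun \<Rightarrow> real \<Rightarrow> bool" where
  "flag_curv_le A F \<kappa> \<longleftrightarrow> (\<forall>c\<in>A. \<forall>x\<in>cimg c. \<forall>y V. y \<noteq> 0 \<and> V \<notin> span {y} \<longrightarrow>
     flag_curv (local_F A F c) x y V \<le> \<kappa>)"

definition reversibility ::
    "('m::topological_space, 'n::finite) chart set \<Rightarrow> ('m, 'n) finsler_fun \<Rightarrow> ereal" where
  "reversibility A F =
     (SUP (p, X)\<in>{(p, X). X \<in> tangent_space A p \<and> X \<noteq> zero_tvec}.
        ereal (F p (\<lambda>c. - X c) / F p X))"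


section \<open>Curves, distance and geodesics\<close>

definition velocity :: "('m::topological_space, 'n::finite) chart set \<Rightarrow> real set \<Rightarrow>
    (real \<Rightarrow> 'm) \<Rightarrow> real \<Rightarrow> ('m, 'n) tvec" where
  "velocity A I \<gamma> t = (\<lambda>c. if c \<in> A \<and> \<gamma> t \<in> cdom c
     then vector_derivative (cmap c \<circ> \<gamma>) (at t within I) else 0)"

definition C1_curve :: "('m::topological_space, 'n::finite) chart set \<Rightarrow> real set \<Rightarrow>
    (real \<Rightarrow> 'm) \<Rightarrow> bool" where
  "C1_curve A I \<gamma> \<longleftrightarrow> continuous_on I \<gamma> \<and>
     (\<forall>c\<in>A. \<forall>t\<in>I. \<gamma> t \<in> cdom c \<longrightarrow>
        (cmap c \<circ> \<gamma>) differentiable (at t within I) \<and>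
        continuous (at t within I) (\<lambda>s. velocity A I \<gamma> s c))"

text \<open>Piecewise C1 curves on \<open>[0,1]\<close>, with break points in the finite set \<open>S\<close>.\<close>

definition pw_C1_curve :: "('m::topological_space, 'n::finite) chart set \<Rightarrow>
    (real \<Rightarrow> 'm) \<Rightarrow> bool" where
  "pw_C1_curve A \<gamma> \<longleftrightarrow> continuous_on {0..1} \<gamma> \<and>
     (\<exists>S. finite S \<and> (\<forall>a b. 0 \<le> a \<and> a < b \<and> b \<le> 1 \<and> {a<..<b} \<inter> S = {} \<longrightarrow>
        C1_curve A {a..b} \<gamma>))"

definition curve_length :: "('m::topological_space, 'n::finite) chart set \<Rightarrow> ('m, 'n) finsler_fun \<Rightarrow>
    real \<Rightarrow> real \<Rightarrow> (real \<Rightarrow> 'm) \<Rightarrow> real" where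
  "curve_length A F a b \<gamma> = integral {a..b} (\<lambda>t. F (\<gamma> t) (velocity A {a..b} \<gamma> t))"

definition fdist :: "('m::topological_space, 'n::finite) chart set \<Rightarrow> ('m, 'n) finsler_fun \<Rightarrow>
    'm \<Rightarrow> 'm \<Rightarrow> real" where
  "fdist A F p q = Inf {curve_length A F 0 1 \<gamma> | \<gamma>. pw_C1_curve A \<gamma> \<and> \<gamma> 0 = p \<and> \<gamma> 1 = q}"

definition forward_ball :: "('m::topological_space, 'n::finite) chart set \<Rightarrow> ('m, 'n) finsler_fun \<Rightarrow>
    'm \<Rightarrow> real \<Rightarrow> 'm set" where
  "forward_ball A F p r = {q. fdist A F p q < r}"

text \<open>Geodesics on an interval \<open>I\<close>: C1 curves whose coordinates satisfy
  \<open>u\<^sup>i'' + \<Gamma>\<^sup>i\<^sub>j\<^sub>k(u, u') u\<^sup>j' u\<^sup>k' = 0\<close>; they are automatically parametrized with constant speed.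
  Constant curves are included: where \<open>u' = 0\<close>, the products with \<open>u\<^sup>j' u\<^sup>k'\<close> vanish
  whatever the value of \<open>chern\<close>.\<close>

definition geodesic :: "('m::topological_space, 'n::finite) chart set \<Rightarrow> ('m, 'n) finsler_fun \<Rightarrow>
    real set \<Rightarrow> (real \<Rightarrow> 'm) \<Rightarrow> bool" where
  "geodesic A F I \<gamma> \<longleftrightarrow> C1_curve A I \<gamma> \<and>
     (\<forall>c\<in>A. \<forall>t\<in>I. \<gamma> t \<in> cdom c \<longrightarrow>
        (let v = velocity A I \<gamma> t c in
         ((\<lambda>s. velocity A I \<gamma> s c) has_vector_derivative
            (\<chi> i. - (\<Sum>j\<in>UNIV. \<Sum>k\<in>UNIV.
               chern (local_F A F c) i j k (cmap c (\<gamma> t)) v * v $ j * v $ k))) (at t within I)))"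

definition geodesic_from_to :: "('m::topological_space, 'n::finite) chart set \<Rightarrow> ('m, 'n) finsler_fun \<Rightarrow>
    'm \<Rightarrow> 'm \<Rightarrow> (real \<Rightarrow> 'm) \<Rightarrow> bool" where
  "geodesic_from_to A F p q \<gamma> \<longleftrightarrow> geodesic A F {0..1} \<gamma> \<and> \<gamma> 0 = p \<and> \<gamma> 1 = q"

definition forward_complete ::
    "('m::topological_space, 'n::finite) chart set \<Rightarrow> ('m, 'n) finsler_fun \<Rightarrow> bool" where
  "forward_complete A F \<longleftrightarrow> (\<forall>a b \<gamma>. a < b \<and> geodesic A F {a..<b} \<gamma> \<longrightarrow>
     (\<exists>\<sigma>. geodesic A F {a..} \<sigma> \<and> (\<forall>t\<in>{a..<b}. \<sigma> t = \<gamma> t)))"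


section \<open>Injectivity radius and convexity radius\<close>

text \<open>The cut points of \<open>p\<close> along unit speed geodesics \<open>\<gamma>\<close> starting at \<open>p\<close>: the last points up to which
  \<open>\<gamma>\<close> is minimizing, provided that \<open>\<gamma>\<close> is not minimizing forever.\<close>

definition cut_locus :: "('m::topological_space, 'n::finite) chart set \<Rightarrow> ('m, 'n) finsler_fun \<Rightarrow>
    'm \<Rightarrow> 'm set" where
  "cut_locus A F p = {\<gamma> (Sup T) | \<gamma> T.
     geodesic A F {0..} \<gamma> \<and> \<gamma> 0 = p \<and> (\<forall>t\<ge>0. F (\<gamma> t) (velocity A {0..} \<gamma> t) = 1) \<and>
     T = {t. 0 \<le> t \<and> fdist A F p (\<gamma> t) = t} \<and> bdd_above T}"

definition injectivity_radius ::
    "('m::topological_space, 'n::finite) chart set \<Rightarrow> ('m, 'n) finsler_fun \<Rightarrow> ereal" where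
  "injectivity_radius A F = (INF p. INF q\<in>cut_locus A F p. ereal (fdist A F p q))"

text \<open>Minimizing curves are identified up to reparametrization by requiring a parametrization on
  \<open>[0,1]\<close> proportional to arc length; the case \<open>t = 1\<close> says that the length is minimal.\<close>

definition minimizer :: "('m::topological_space, 'n::finite) chart set \<Rightarrow> ('m, 'n) finsler_fun \<Rightarrow>
    'm \<Rightarrow> 'm \<Rightarrow> (real \<Rightarrow> 'm) \<Rightarrow> bool" where
  "minimizer A F p q \<gamma> \<longleftrightarrow> pw_C1_curve A \<gamma> \<and> \<gamma> 0 = p \<and> \<gamma> 1 = q \<and>
     (\<forall>t\<in>{0..1}. curve_length A F 0 t \<gamma> = t * fdist A F p q)"

definition strongly_convex :: "('m::topological_space, 'n::finite) chart set \<Rightarrow> ('m, 'n) finsler_fun \<Rightarrow>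
    'm set \<Rightarrow> bool" where
  "strongly_convex A F S \<longleftrightarrow> (\<forall>p\<in>S. \<forall>q\<in>S. \<exists>\<gamma>.
     geodesic_from_to A F p q \<gamma> \<and>
     minimizer A F p q \<gamma> \<and>
     (\<forall>\<sigma>. minimizer A F p q \<sigma> \<longrightarrow> (\<forall>t\<in>{0..1}. \<sigma> t = \<gamma> t)) \<and>
     \<gamma> ` {0..1} \<subseteq> S \<and>
     (\<forall>\<sigma>. geodesic_from_to A F p q \<sigma> \<and> \<sigma> ` {0..1} \<subseteq> S \<longrightarrow> (\<forall>t\<in>{0..1}. \<sigma> t = \<gamma> t)))"

definition convexity_radius_at :: "('m::topological_space, 'n::finite) chart set \<Rightarrow>
    ('m, 'n) finsler_fun \<Rightarrow> 'm \<Rightarrow> ereal" where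
  "convexity_radius_at A F x =
     (SUP r\<in>{r::real. r > 0 \<and> (\<forall>s<r. strongly_convex A F (forward_ball A F x s))}. ereal r)"

definition convexity_radius ::
    "('m::topological_space, 'n::finite) chart set \<Rightarrow> ('m, 'n) finsler_fun \<Rightarrow> ereal" where
  "convexity_radius A F = (INF x. convexity_radius_at A F x)"

definition pi_half_over_sqrt :: "real \<Rightarrow> ereal" where
  "pi_half_over_sqrt k = (if k > 0 then ereal (pi / (2 * sqrt k)) else \<infinity>)"

end

theory Submission imports Defs begin

text \<open>
  The flag curvature bound acts through a certificate along a minimizer \<open>c0\<close> of length \<open>l\<close> issuing from \<open>x\<close>.
  Let \<open>E = F\<^sup>2/2\<close>, let \<open>p\<close> be the momentum of \<open>c0\<close> and let \<open>h = a cot (a (s + \<eta>))\<close> with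
  \<open>a\<^sup>2 = k' l\<^sup>2\<close>, \<open>k' > k\<close>, which solves the Riccati equation \<open>h' = - a\<^sup>2 - h\<^sup>2\<close>. In a Berwald manifold the Christoffel
  symbols \<open>\<Gamma>\<close> depend on the base point only, and the index form inequality yields
  \<open>p(z + \<Gamma>(z,z)/2) + (h/2) g(z,z) \<le> (s/2) (f\<^sup>2 - l\<^sup>2)\<close>
  for every minimizer from \<open>x\<close> that is close to \<open>c0\<close>, has length \<open>f\<close> and is displaced from \<open>c0\<close> by \<open>z\<close> at time \<open>s\<close>.
  At \<open>s = 1\<close> and \<open>l < pi/(2 sqrt k)\<close> the coefficient \<open>h\<close> is positive, so \<open>d(x,-)\<close> has no interior local maximum along a
  geodesic inside the injectivity radius. To see that the minimizer from \<open>p\<close> to \<open>q\<close> stays in a small ball about \<open>x\<close>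
  containing both, move the end point from \<open>p\<close> to \<open>q\<close> along the radial minimizers through \<open>x\<close>: the maximum of \<open>d(x,-)\<close> on
  the minimizer from \<open>p\<close> varies continuously, and as soon as it exceeded its values at the end points it would be attained in
  the interior.
  Minimizers exist and depend continuously on their end points by a metric form of Hopf--Rinow, which rests on the local
  minimality of short geodesics, proved by a calibration and a contraction argument.
\<close>

text \<open>The constant comes from one estimate: if d(x,p) < s and d(x,y) < s, then d(p,y) <= lam
  d(x,p) + d(x,y) < (1 + lam) s. Hence (1 + lam) r <= sigma keeps every minimizer between points of
  the ball within the range of unique minimizers, and lam >= 1 leads from there to the stated bound.
  As sigma may be negative, positivity of the convexity radius at each point is a separate, purely
  local fact. Two obstacles shape the rest. The energy is not twice differentiable on the zero
  section, so estimates are made on unit vectors, moved by homogeneity, and segments of velocities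
  that meet 0 are treated by hand. And d(x,-) is never differentiated: neither Jacobi fields nor a
  smooth exponential map occur. The certificate is a one-sided inequality between two given
  minimizers, which is why it can be carried from chart to chart with a small loss at each change.
  Minimizers are handled metrically, as curves on which the distance is proportional to the
  parameter; that they solve the geodesic equation follows from the equality case of the local
  triangle inequality.\<close>

notation scaleR (infixr "*r" 75)
abbreviation hvd (infix "hvd" 50) where "f hvd D == f has_vector_derivative D"

section \<open>Directional derivatives and smooth functions\<close>

text \<open>The direction comes first, so that \<open>dird v f\<close> is again a function of the
  point and derivatives can be iterated.\<close>

definition dird :: "'a::real_normed_vector => ('a => 'b::real_normed_vector) => 'a => 'b" where
 "dird v f x = frechet_derivative f (at x) v"

lemma dird_eqI: "(f has_derivative f') (at x) ==> dird v f x = f' v"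
 unfolding dird_def using frechet_derivative_at by metis

lemma Ck_on_cong_imp:
 assumes "open S"
 shows "Ck_on k S f ==> (!!x. x : S ==> f x = g x) ==> Ck_on k S g"
proof (induction k arbitrary: f g)
 case 0
 thus ?case unfolding Ck_on.simps by (rule continuous_on_eq)
next
 case (Suc k)
 have d: "(g has_derivative frechet_derivative f (at x)) (at x)" if "x : S" for x
 proof (rule has_derivative_transform_within_open[OF _ assms that])
  show "(f has_derivative frechet_derivative f (at x)) (at x)"
   using Suc.prems(1) that by (intro frechet_derivative_works[THEN iffD1]) simp
  show "!!y. y : S ==> f y = g y" by (rule Suc.prems(2))
 qed
 have "frechet_derivative f (at x) = frechet_derivative g (at x)" if "x : S" for x
  by (rule frechet_derivative_at[OF d[OF that]])
 hence "Ck_on k S (%x. frechet_derivative g (at x) v)" for v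
  using Suc.prems(1) by (rule_tac Suc.IH[of "%x. frechet_derivative f (at x) v"]) simp_all
 moreover have "g differentiable at x" if "x : S" for x using d[OF that] differentiableI by blast
 ultimately show ?case by simp
qed

lemma Ck_on_SucI:
 assumes "open S" and d: "!!x. x : S ==> (f has_derivative f' x) (at x)"
  and "!!v. Ck_on k S (%x. f' x v)"
 shows "Ck_on (Suc k) S f"
proof -
 have "f' x = frechet_derivative f (at x)" if "x : S" for x
  by (rule frechet_derivative_at[OF d[OF that]])
 hence "Ck_on k S (%x. frechet_derivative f (at x) v)" for v
  using Ck_on_cong_imp[OF assms(1) assms(3)] by simp
 thus ?thesis using d by (auto simp: differentiable_def)
qed

lemma Ck_on_SucD:
 assumes "Ck_on (Suc k) S f"
 shows "x : S ==> (f has_derivative (%v. dird v f x)) (at x)" "Ck_on k S (dird v f)"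
 using assms by (auto simp: dird_def[abs_def] frechet_derivative_works)

lemma Ck_on_Suc_imp: "Ck_on (Suc k) S f ==> Ck_on k S f"
proof (induction k arbitrary: f)
 case 0
 thus ?case
  by (auto intro!: continuous_at_imp_continuous_on differentiable_imp_continuous_within)
next
 case (Suc k)
 show ?case using Suc.prems by (subst Ck_on.simps) (auto intro!: Suc.IH)
qed

lemma Ck_on_const: "Ck_on k S (%x. c)"
proof (induction k arbitrary: c)
 case (Suc k)
 thus ?case by (simp add: frechet_derivative_const)
qed auto

lemma Ck_on_bounded_linear:
 assumes "open S" "bounded_linear f"
 shows "Ck_on k S f"
proof (cases k)
 case (Suc j)
 show ?thesis unfolding Suc
  using assms by (intro Ck_on_SucI[where f'="%x. f"] bounded_linear_imp_has_derivative Ck_on_const)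
qed (use assms in "auto intro: linear_continuous_on")

lemma Ck_on_add:
 assumes "open S"
 shows "Ck_on k S f ==> Ck_on k S g ==> Ck_on k S (%x. f x + g x)"
proof (induction k arbitrary: f g)
 case (Suc k)
 thus ?case
  using Ck_on_SucD[OF Suc.prems(1)] Ck_on_SucD[OF Suc.prems(2)]
  by (intro Ck_on_SucI[where f'="%x v. dird v f x + dird v g x"] has_derivative_add Suc.IH assms) auto
qed (auto intro: continuous_intros)

lemma Ck_on_linear_compose:
 assumes "open S" "bounded_linear T"
 shows "Ck_on k S f ==> Ck_on k S (%x. T (f x))"
proof (induction k arbitrary: f)
 case 0
 thus ?case using assms by (auto intro: bounded_linear.continuous_on)
next
 case (Suc k)
 show ?case
  using Ck_on_SucD[OF Suc.prems]
  by (intro Ck_on_SucI[where f'="%x v. T (dird v f x)"] Suc.IH assms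
    bounded_linear.has_derivative[OF assms(2)]) auto
qed

lemma Ck_on_mult:
 fixes f g :: "'a::real_normed_vector => real"
 assumes "open S"
 shows "Ck_on k S f ==> Ck_on k S g ==> Ck_on k S (%x. f x * g x)"
proof (induction k arbitrary: f g)
 case (Suc k)
 thus ?case
  using Ck_on_SucD[OF Suc.prems(1)] Ck_on_SucD[OF Suc.prems(2)]
  by (intro Ck_on_SucI[where f'="%x v. f x * dird v g x + dird v f x * g x"] has_derivative_mult
    Ck_on_add Suc.IH assms Ck_on_Suc_imp[OF Suc.prems(1)] Ck_on_Suc_imp[OF Suc.prems(2)]) auto
qed (auto intro: continuous_intros)

lemma Ck_on_inverse:
 fixes f :: "'a::real_normed_vector => real"
 assumes "open S" "!!x. x : S ==> f x ~= 0"
 shows "Ck_on k S f ==> Ck_on k S (%x. inverse (f x))"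
proof (induction k)
 case (Suc k)
 have m: "Ck_on k S (%x. - 1 :: real)" by (rule Ck_on_const)
 show ?case
 proof (rule Ck_on_SucI[where f'="%x v. (- 1) * ((inverse (f x) * dird v f x) * inverse (f x))"])
  fix x assume x: "x : S"
  show "((%x. inverse (f x)) has_derivative (%v. (- 1) * ((inverse (f x) * dird v f x) * inverse (f x)))) (at x)"
   using Deriv.has_derivative_inverse[OF assms(2)[OF x] Ck_on_SucD(1)[OF Suc.prems x]] by simp
 next
  fix v show "Ck_on k S (%x. (- 1) * ((inverse (f x) * dird v f x) * inverse (f x)))"
   by (intro Ck_on_mult[OF assms(1)] m Suc.IH Ck_on_Suc_imp[OF Suc.prems] Ck_on_SucD(2)[OF Suc.prems])
 qed (rule assms)
qed (use assms in "auto intro: continuous_intros")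

lemma Ck_on_sum:
 assumes "open S" "finite J" "!!i. i : J ==> Ck_on k S (f i)"
 shows "Ck_on k S (%x. SUM i:J. f i x)"
 using assms(2,3)
 by (induction J rule: finite_induct) (auto intro: Ck_on_const Ck_on_add[OF assms(1)])

lemma Ck_on_prod:
 fixes f :: "'i => 'a::real_normed_vector => real"
 assumes "open S" "finite J" "!!i. i : J ==> Ck_on k S (f i)"
 shows "Ck_on k S (%x. PROD i:J. f i x)"
 using assms(2,3)
 by (induction J rule: finite_induct) (auto intro: Ck_on_const Ck_on_mult[OF assms(1)])

lemma smooth_on_dird: "smooth_on S f ==> smooth_on S (dird v f)"
 unfolding smooth_on_def using Ck_on_SucD(2) by blast

lemma smooth_on_has_derivative:
 "smooth_on S f ==> x : S ==> (f has_derivative (%v. dird v f x)) (at x)"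
 unfolding smooth_on_def using Ck_on_SucD(1) by blast

lemma smooth_on_continuous: "smooth_on S f ==> continuous_on S f"
 unfolding smooth_on_def by (metis Ck_on.simps(1))

lemma smooth_on_const: "smooth_on S (%x. c)"
 unfolding smooth_on_def using Ck_on_const by blast

lemma smooth_on_cong_imp:
 "smooth_on S f ==> open S ==> (!!x. x : S ==> f x = g x) ==> smooth_on S g"
 unfolding smooth_on_def using Ck_on_cong_imp by blast

lemma smooth_on_add: "open S ==> smooth_on S f ==> smooth_on S g ==> smooth_on S (%x. f x + g x)"
 unfolding smooth_on_def using Ck_on_add by blast

lemma smooth_on_mult:
 fixes f g :: "'a::real_normed_vector => real"
 shows "open S ==> smooth_on S f ==> smooth_on S g ==> smooth_on S (%x. f x * g x)"
 unfolding smooth_on_def using Ck_on_mult by blast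

lemma smooth_on_inverse:
 fixes f :: "'a::real_normed_vector => real"
 shows "open S ==> (!!x. x : S ==> f x ~= 0) ==> smooth_on S f ==> smooth_on S (%x. inverse (f x))"
 unfolding smooth_on_def using Ck_on_inverse by blast

lemma smooth_on_bounded_linear: "open S ==> bounded_linear f ==> smooth_on S f"
 unfolding smooth_on_def using Ck_on_bounded_linear by blast

lemma smooth_on_linear_compose:
 "open S ==> bounded_linear T ==> smooth_on S f ==> smooth_on S (%x. T (f x))"
 unfolding smooth_on_def using Ck_on_linear_compose by blast

lemma smooth_on_sum:
 "open S ==> finite J ==> (!!i. i : J ==> smooth_on S (f i)) ==> smooth_on S (%x. SUM i:J. f i x)"
 unfolding smooth_on_def by (simp add: Ck_on_sum)

lemma smooth_on_prod:
 fixes f :: "'i => 'a::real_normed_vector => real"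
 shows "open S ==> finite J ==> (!!i. i : J ==> smooth_on S (f i)) ==> smooth_on S (%x. PROD i:J. f i x)"
 unfolding smooth_on_def by (simp add: Ck_on_prod)

lemma dird_linear:
 assumes "smooth_on S f" "x : S"
 shows "linear (%v. dird v f x)"
 using smooth_on_has_derivative[OF assms] has_derivative_linear by blast

lemma dird_simps:
 assumes "smooth_on S f" "x : S"
 shows "dird (u + v) f x = dird u f x + dird v f x" "dird (c *r u) f x = c *r dird u f x"
  "dird (- u) f x = - dird u f x" "dird (u - v) f x = dird u f x - dird v f x" "dird 0 f x = 0"
 using linear_add[OF dird_linear[OF assms]] linear_cmul[OF dird_linear[OF assms]] linear_neg[OF dird_linear[OF assms]]
  linear_diff[OF dird_linear[OF assms]] linear_0[OF dird_linear[OF assms]] by auto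

lemma dird_basis:
 fixes f :: "'a::euclidean_space => 'b::real_normed_vector"
 assumes "smooth_on S f" "x : S"
 shows "dird v f x = (SUM b:Basis. (v \<bullet> b) *r dird b f x)"
proof -
 have "dird v f x = dird (SUM b:Basis. (v \<bullet> b) *r b) f x" by (simp add: euclidean_representation)
 also have "... = (SUM b:Basis. (v \<bullet> b) *r dird b f x)"
  by (simp only: linear_sum[OF dird_linear[OF assms]] linear_cmul[OF dird_linear[OF assms]])
 finally show ?thesis .
qed

text \<open>Smoothness controls each fixed direction only; expanding the direction in the basis
  makes the derivative jointly continuous in direction and point.\<close>

lemma continuous_on_dird:
 fixes f :: "'a::euclidean_space => 'b::real_normed_vector" and g h :: "'c::topological_space => 'a"
 assumes "smooth_on S f" "continuous_on T g" "continuous_on T h" "h ` T <= S"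
 shows "continuous_on T (%z. dird (g z) f (h z))"
proof -
 have "continuous_on T (%z. SUM b:Basis. (g z \<bullet> b) *r dird b f (h z))"
  by (intro continuous_intros assms(2) continuous_on_compose2[OF smooth_on_continuous[OF smooth_on_dird[OF assms(1)]] assms(3,4)])
 thus ?thesis
  by (rule continuous_on_eq) (use assms dird_basis[OF assms(1)] in force)
qed

lemma continuous_on_dird2:
 fixes f :: "'a::euclidean_space => 'b::real_normed_vector" and g h :: "'c::topological_space => 'a"
 assumes "smooth_on S f" "open S" "continuous_on T g1" "continuous_on T g2" "continuous_on T h" "h ` T <= S"
 shows "continuous_on T (%z. dird (g1 z) (dird (g2 z) f) (h z))"
proof -
 have eq: "dird u (dird v f) x = (SUM b:Basis. (v \<bullet> b) *r dird u (dird b f) x)" if "x : S" for u v x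
 proof -
  have "((%x. SUM b:Basis. (v \<bullet> b) *r dird b f x) has_derivative
    (%u. SUM b:Basis. (v \<bullet> b) *r dird u (dird b f) x)) (at x)"
   by (intro has_derivative_sum has_derivative_scaleR_right smooth_on_has_derivative[OF smooth_on_dird[OF assms(1)] that])
  hence "(dird v f has_derivative (%u. SUM b:Basis. (v \<bullet> b) *r dird u (dird b f) x)) (at x)"
   by (rule has_derivative_transform_within_open[OF _ assms(2) that]) (metis dird_basis[OF assms(1)])
  thus ?thesis by (rule dird_eqI)
 qed
 have "continuous_on T (%z. SUM b:Basis. (g2 z \<bullet> b) *r dird (g1 z) (dird b f) (h z))"
  by (intro continuous_intros assms continuous_on_dird[OF smooth_on_dird[OF assms(1)]])
 thus ?thesis
  by (rule continuous_on_eq) (use assms eq in force)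
qed

lemma line_derivative:
 assumes "(f has_derivative f') (at (p + t *r u))"
 shows "((%t. f (p + t *r u)) hvd f' u) (at t)"
proof -
 have "((%t. p + t *r u) has_derivative (%s. s *r u)) (at t)"
  by (auto intro!: derivative_eq_intros)
 from has_derivative_compose[OF this assms]
 show ?thesis
  using has_derivative_linear[OF assms] unfolding has_vector_derivative_def
  by (simp add: linear_cmul)
qed

lemma dird_line:
 fixes f :: "'a::real_normed_vector => real"
 assumes "smooth_on S f" "p + t *r u : S"
 shows "((%t. f (p + t *r u)) has_real_derivative dird u f (p + t *r u)) (at t)"
 using line_derivative[OF smooth_on_has_derivative[OF assms]]
 by (simp add: has_real_derivative_iff_has_vector_derivative)

text \<open>The mean value theorem in direction \<open>u\<close>, applied to the difference along
  two parallel lines, and then in direction \<open>v\<close>.\<close>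

lemma second_difference:
 fixes f :: "'a::real_normed_vector => real"
 assumes f: "smooth_on S f" and s: "0 < s"
  and S: "!!a b. 0 <= a ==> a <= s ==> 0 <= b ==> b <= s ==> x + a *r u + b *r v : S"
 obtains a b where "0 <= a" "a <= s" "0 <= b" "b <= s"
  "f (x + s *r u + s *r v) - f (x + s *r u) - f (x + s *r v) + f x = s * s * dird v (dird u f) (x + a *r u + b *r v)"
proof -
 have d: "((%t. f (x + t *r u + b *r v)) has_real_derivative dird u f (x + t *r u + b *r v)) (at t)"
  if "0 <= t" "t <= s" "0 <= b" "b <= s" for t b
  using dird_line[OF f, of "x + b *r v" t u] S[OF that] by (simp add: ac_simps)
 obtain a where a: "0 < a" "a < s" "f (x + s *r u + s *r v) - f (x + s *r u + 0 *r v) - (f (x + 0 *r u + s *r v) - f (x + 0 *r u + 0 *r v))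
   = (s - 0) * (dird u f (x + a *r u + s *r v) - dird u f (x + a *r u + 0 *r v))"
  using MVT2[OF s DERIV_diff[OF d[of _ s] d[of _ 0]]] s by auto
 obtain b where b: "0 < b" "b < s" "dird u f (x + a *r u + s *r v) - dird u f (x + a *r u + 0 *r v) =
   (s - 0) * dird v (dird u f) (x + a *r u + b *r v)"
  using MVT2[OF s dird_line[OF smooth_on_dird[OF f, of u] S, of a]] a by auto
 show thesis using a b by (intro that[of a b]) auto
qed

text \<open>Schwarz's theorem: the second difference is symmetric in \<open>u\<close> and
  \<open>v\<close>, so the two mixed derivatives have equal values at two points arbitrarily close
  to \<open>x\<close>, and both are continuous at \<open>x\<close>.\<close>

lemma dird_commute:
 fixes f :: "'a::real_normed_vector => real"
 assumes f: "smooth_on S f" and S: "open S" "x : S"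
 shows "dird u (dird v f) x = dird v (dird u f) x"
proof (rule ccontr)
 let ?g = "dird u (dird v f)" and ?h = "dird v (dird u f)"
 assume ne: "?g x ~= ?h x"
 define e where "e = abs(?g x - ?h x) / 2"
 have e: "e > 0" using ne unfolding e_def by simp
 have "isCont ?g x" "isCont ?h x"
  using smooth_on_continuous[OF smooth_on_dird[OF smooth_on_dird[OF f]]] S continuous_on_eq_continuous_at by blast+
 hence "\<forall>\<^sub>F z in nhds x. z : S & abs(?g z - ?g x) < e & abs(?h z - ?h x) < e"
  using e S by (intro eventually_conj eventually_nhds_in_open) (auto simp: isCont_def tendsto_iff dist_real_def eventually_nhds_conv_at)
 then obtain r where r: "r > 0" "!!z. dist z x < r ==> z : S & abs(?g z - ?g x) < e & abs(?h z - ?h x) < e"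
  unfolding eventually_nhds_metric by blast
 define s where "s = r / (norm u + norm v + 1)"
 \<comment> \<open>With this \<open>s\<close> the whole parallelogram at \<open>x\<close> with sides
   \<open>s *r u\<close> and \<open>s *r v\<close> lies in the ball of radius
   \<open>r\<close>.\<close>
 have n: "norm u + norm v + 1 > 0" by (simp add: add_nonneg_pos)
 hence s: "0 < s" using r unfolding s_def by simp
 have near: "dist (x + a *r u + b *r v) x < r" if "0 <= a" "a <= s" "0 <= b" "b <= s" for a b
 proof -
  have "norm (a *r u + b *r v) <= s * norm u + s * norm v"
   using that by (intro norm_triangle_mono) (auto intro!: mult_right_mono)
  also have "... < s * (norm u + norm v + 1)" using s by (simp add: algebra_simps)
  also have "... = r" using n unfolding s_def by simp
  finally show ?thesis by (simp add: dist_norm add.assoc)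
 qed
 have near': "dist (x + a *r v + b *r u) x < r" if "0 <= a" "a <= s" "0 <= b" "b <= s" for a b
  using near[OF that(3,4,1,2)] by (simp add: ac_simps)
 obtain a b where "0 <= a" "a <= s" "0 <= b" "b <= s"
  and 1: "f (x + s *r u + s *r v) - f (x + s *r u) - f (x + s *r v) + f x = s * s * ?h (x + a *r u + b *r v)"
  using second_difference[OF f s, of x u v] near r(2) by metis
 moreover obtain a' b' where "0 <= a'" "a' <= s" "0 <= b'" "b' <= s"
  and 2: "f (x + s *r v + s *r u) - f (x + s *r v) - f (x + s *r u) + f x = s * s * ?g (x + a' *r v + b' *r u)"
  using second_difference[OF f s, of x v u] near' r(2) by metis
 moreover have "s * s * ?h (x + a *r u + b *r v) = s * s * ?g (x + a' *r v + b' *r u)"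
  using 1 2 unfolding add.assoc[of x] add.commute[of "s *r v"] by linarith
 ultimately show False
  using r(2)[OF near] r(2)[OF near'] s unfolding e_def by (smt (verit) mult_cancel_left mult_pos_pos field_sum_of_halves)
qed

lemma taylor2:
 fixes f :: "'a::real_normed_vector => real"
 assumes f: "smooth_on S f" and S: "!!t. 0 <= t ==> t <= 1 ==> x + t *r v : S"
 obtains t where "0 < t" "t < 1" "f (x + v) = f x + dird v f x + dird v (dird v f) (x + t *r v) / 2"
proof -
 define df where "df m = (if m = 0 then (%t. f (x + t *r v)) else if m = 1 then (%t. dird v f (x + t *r v))
  else (%t. dird v (dird v f) (x + t *r v)))" for m :: nat
 have "EX t. 0 < t & t < 1 & f (x + 1 *r v) = (\<Sum>m<2. df m 0 / fact m * 1 ^ m) + df 2 t / fact 2 * 1 ^ 2"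
 proof (rule Maclaurin)
  show "ALL m t. m < 2 & 0 <= t & t <= 1 --> (df m has_real_derivative df (Suc m) t) (at t)"
   using dird_line[OF f] dird_line[OF smooth_on_dird[OF f]] S
   by (auto simp: df_def less_2_cases_iff)
 qed (auto simp: df_def)
 thus ?thesis using that by (auto simp: df_def numeral_2_eq_2)
qed

text \<open>The remainder in \<open>taylor2\<close> is the second derivative at an intermediate
  point. Uniform continuity on a compact neighbourhood of \<open>K\<close> times the unit sphere
  compares it with the value at \<open>x\<close>, with one \<open>de\<close> for all
  \<open>x\<close> in \<open>K\<close>.\<close>

lemma taylor2_uniform:
 fixes f :: "'a::euclidean_space => real"
 assumes f: "smooth_on S f" and S: "open S" and K: "compact K" "K <= S" and "et > 0"
 obtains de where "de > 0" "!!x v. x : K ==> norm v <= de ==> x + v : S &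
   abs(f (x + v) - f x - dird v f x - dird v (dird v f) x / 2) <= et * (norm v)\<^sup>2"
proof -
 obtain e where e: "e > 0" "(UN x:K. cball x e) <= S"
  using compact_subset_open_imp_cball_epsilon_subset[OF K(1) S K(2)] by metis
 define K' where "K' = {x + y | x y. x : K & y : cball (0::'a) e}"
 have K': "compact K'" unfolding K'_def by (intro compact_sums K compact_cball)
 have K'S: "K' <= S"
 proof
  fix z assume "z : K'"
  then obtain x y where "x : K" "y : cball 0 e" "z = x + y" unfolding K'_def by blast
  hence "z : cball x e" by (simp add: dist_norm)
  thus "z : S" using e `x : K` by blast
 qed
 have inK': "x + v : K'" if "x : K" "norm v <= e" for x v
  using that unfolding K'_def mem_Collect_eq by (intro exI[of _ x] exI[of _ v]) auto
 define G where "G z = dird (snd z) (dird (snd z) f) (fst z)" for z :: "'a \<times> 'a"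
 have "continuous_on (K' \<times> sphere 0 1) G"
  unfolding G_def using K'S by (intro continuous_on_dird2[OF f S] continuous_intros) auto
 hence "uniformly_continuous_on (K' \<times> sphere 0 1) G"
  by (intro compact_uniformly_continuous compact_Times K' compact_sphere)
 then obtain d where d: "d > 0" "!!z z'. z : K' \<times> sphere 0 1 ==> z' : K' \<times> sphere 0 1 ==> dist z' z < d ==> dist (G z') (G z) < et"
  using `et > 0` unfolding uniformly_continuous_on_def by metis
 show thesis
 proof (rule that[of "min e (d/2)"])
  show "min e (d/2) > 0" using e d by auto
  fix x v :: 'a assume x: "x : K" and v: "norm v <= min e (d/2)"
  have seg: "x + t *r v : K'" if "0 <= t" "t <= 1" for t
   by (rule inK'[OF x]) (use that v in "auto intro: order_trans[OF mult_left_le_one_le]")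
  obtain t where t: "0 < t" "t < 1" "f (x + v) = f x + dird v f x + dird v (dird v f) (x + t *r v) / 2"
   using taylor2[OF f, of x v] seg K'S by blast
  \<comment> \<open>The second derivative is quadratic in \<open>v\<close>, so the modulus of
    continuity of \<open>G\<close> on unit directions produces the factor |v|^2.\<close>
  have hom: "dird v (dird v f) y = (norm v)\<^sup>2 * G (y, v /\<^sub>R norm v)" if "y : K'" "v ~= 0" for y
  proof -
   have y: "y : S" using that K'S by auto
   let ?w = "v /\<^sub>R norm v"
   have v': "v = norm v *r ?w" using that by simp
   have ev: "dird v f z = norm v * dird ?w f z" if "z : S" for z
    using dird_simps(2)[OF f that, of "norm v" ?w] v' by simp
   have "(dird v f has_derivative (%u. norm v * dird u (dird ?w f) y)) (at y)"
    by (rule has_derivative_transform_within_open[OF has_derivative_mult_right[OF smooth_on_has_derivative[OF smooth_on_dird[OF f] y]] S y])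
     (use ev in auto)
   hence "dird v (dird v f) y = norm v * dird v (dird ?w f) y" by (rule dird_eqI)
   also have "dird v (dird ?w f) y = norm v * dird ?w (dird ?w f) y"
    using dird_simps(2)[OF smooth_on_dird[OF f] y, of "norm v" ?w] v' by simp
   finally show ?thesis by (simp add: G_def power2_eq_square)
  qed
  have "abs(dird v (dird v f) (x + t *r v) - dird v (dird v f) x) <= et * (norm v)\<^sup>2"
  proof (cases "v = 0")
   case False
   have "dist (x + t *r v, v /\<^sub>R norm v) (x, v /\<^sub>R norm v) = t * norm v"
    using t by (simp add: dist_prod_def dist_norm)
   also have "... <= norm v" using t by (simp add: mult_left_le_one_le)
   also have "... < d" using v d by auto
   finally have "dist (G (x + t *r v, v /\<^sub>R norm v)) (G (x, v /\<^sub>R norm v)) < et"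
    using seg[of t] seg[of 0] t False by (intro d(2)) auto
   hence "\<bar>G (x + t *r v, v /\<^sub>R norm v) - G (x, v /\<^sub>R norm v)\<bar> <= et" by (simp add: dist_real_def)
   hence "(norm v)\<^sup>2 * \<bar>G (x + t *r v, v /\<^sub>R norm v) - G (x, v /\<^sub>R norm v)\<bar> <= (norm v)\<^sup>2 * et"
    by (intro mult_left_mono) auto
   thus ?thesis
    using hom[OF seg[of t] False] hom[of x] seg[of 0] t False
    by (simp add: abs_mult right_diff_distrib[symmetric] mult.commute)
  qed (use t seg[of 0] K'S f in "auto simp: dird_simps(5)[OF smooth_on_dird[OF f]]")
  thus "x + v : S & abs(f (x + v) - f x - dird v f x - dird v (dird v f) x / 2) <= et * (norm v)\<^sup>2"
   using t(3) seg[of 1] K'S by (auto simp: abs_real_def split: if_splits)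
 qed
qed

section \<open>The Chern connection in a chart\<close>

lemma linear_eq_axis:
 fixes f h :: "real ^ 'n::finite => 'b::real_vector"
 assumes "linear f" "linear h" "!!i. f (axis i 1) = h (axis i 1)"
 shows "f v = h v"
proof -
 have "f b = h b" if "b : Basis" for b
  using that assms(3) by (auto simp: Basis_vec_def)
 thus ?thesis using linear_eq_stdbasis[OF assms(1,2)] by metis
qed

lemma linear_axis_sum:
 fixes f :: "real ^ 'n::finite => real"
 assumes "linear f"
 shows "f v = (SUM i:UNIV. v $ i * f (axis i 1))"
proof -
 have "f v = f (SUM i:UNIV. v $ i *r axis i 1)"
  using basis_expansion[of v] by (simp add: scalar_mult_eq_scaleR)
 thus ?thesis by (simp add: linear_sum[OF assms] linear_cmul[OF assms])
qed

text \<open>The situation at one point (x,y): \<open>g\<close> is the fundamental tensor,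
  \<open>B xi\<close> its derivative in x along \<open>xi\<close>, \<open>C xi\<close> its
  derivative in y along \<open>xi\<close>. \<open>C_y\<close> is Euler's relation for
  \<open>g\<close>, which has degree 0 in y.\<close>

locale koszul =
 fixes g :: "real ^ 'n::finite => real ^ 'n => real"
  and B C :: "real ^ 'n => real ^ 'n => real ^ 'n => real" and y :: "real ^ 'n"
 assumes g_sym: "g a b = g b a" and g_lin: "linear (g a)" and g_pos: "a ~= 0 ==> g a a > 0"
  and B_sym: "B a b c = B a c b" and B_lin1: "linear (%a. B a b c)" and B_lin2: "linear (%b. B a b c)"
  and C_sym1: "C a b c = C b a c" and C_sym2: "C a b c = C a c b" and C_lin: "linear (%a. C a b c)"
  and C_y: "C y a b = 0"
begin

lemma g_lin1: "linear (%a. g a b)" using g_lin[of b] by (subst g_sym) 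
lemma B_lin3: "linear (B a b)" 
proof -
 have "B a b = (%c. B a c b)" using B_sym by blast
 thus ?thesis using B_lin2 by simp
qed
lemma C_lin2: "linear (%b. C a b c)" using C_lin[of a c] by (subst C_sym1)
lemma C_lin3: "linear (C a b)" 
proof -
 have "C a b = (%c. C a c b)" using C_sym2 by blast
 thus ?thesis using C_lin2 by simp
qed
lemma C_y2: "C a y b = 0" using C_y C_sym1 by metis
lemma C_y3: "C a b y = 0" using C_y2 C_sym2 by metis

lemmas lin_rules = linear_add[OF g_lin] linear_add[OF g_lin1] linear_cmul[OF g_lin] linear_cmul[OF g_lin1]
 linear_add[OF B_lin1] linear_add[OF B_lin2] linear_add[OF B_lin3]
 linear_cmul[OF B_lin1] linear_cmul[OF B_lin2] linear_cmul[OF B_lin3]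
 linear_add[OF C_lin] linear_add[OF C_lin2] linear_add[OF C_lin3]
 linear_cmul[OF C_lin] linear_cmul[OF C_lin2] linear_cmul[OF C_lin3]
 linear_diff[OF g_lin] linear_diff[OF g_lin1]

lemma g_eqI: "(!!c. g a c = g b c) ==> a = b"
 using g_pos[of "a - b"] by (force simp: lin_rules)

definition gmat :: "real ^ 'n ^ 'n" where "gmat = (\<chi> i j. g (axis i 1) (axis j 1))"

lemma gmat_mult: "(gmat *v v) \<bullet> w = g v w"
proof -
 have "(gmat *v v) $ i = g v (axis i 1)" for i
  using linear_axis_sum[OF g_lin1, of v "axis i 1"]
  by (simp add: gmat_def matrix_vector_mult_def g_sym[of "axis i 1"] mult.commute)
 thus ?thesis
  using linear_axis_sum[OF g_lin, of v w] by (simp add: inner_vec_def mult.commute)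
qed

lemma det_gmat: "det gmat ~= 0"
proof -
 have "v = 0" if "gmat *v v = 0" for v using gmat_mult[of v v] g_pos[of v] that by fastforce
 hence "invertible gmat"
  by (simp add: invertible_left_inverse matrix_left_invertible_ker)
 thus ?thesis by (simp add: invertible_det_nz)
qed

text \<open>The vector that represents a linear form with respect to \<open>g\<close>. Cramer's rule
  is used because it displays the smooth dependence on all entries.\<close>

definition rep :: "(real ^ 'n => real) => real ^ 'n" where
 "rep l = (\<chi> k. det (\<chi> i j. if j = k then l (axis i 1) else g (axis i 1) (axis j 1)) / det gmat)"

lemma g_rep:
 assumes "linear l"
 shows "g (rep l) w = l w"
proof -
 have "rep l = (\<chi> k. det (\<chi> i j. if j = k then (\<chi> i. l (axis i 1)) $ i else gmat $ i $ j) / det gmat)"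
  by (simp add: rep_def gmat_def cong: if_cong)
 hence "gmat *v (rep l) = (\<chi> i. l (axis i 1))"
  using cramer[OF det_gmat] by blast
 hence "g (rep l) w = (\<chi> i. l (axis i 1)) \<bullet> w" by (metis gmat_mult)
 also have "... = l w" using linear_axis_sum[OF assms, of w] by (simp add: inner_vec_def mult.commute)
 finally show ?thesis .
qed

text \<open>The almost-compatibility equation contains the unknown also inside \<open>C\<close>, as
  the connection applied to \<open>y\<close>. Since \<open>C\<close> vanishes when an argument is
  \<open>y\<close>, it can be solved in three stages: the value at (y,y), then at (xi,y), then at
  (xi,et). Each stage uses the previous one.\<close>

definition Qv where "Qv = rep (%ze. B y y ze - B ze y y / 2)"
definition Nv where "Nv xi = rep (%ze. (B xi y ze + B y xi ze - B ze xi y - C Qv xi ze) / 2)"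
definition Gv where "Gv xi et = rep (%ze. (B xi et ze - C (Nv xi) et ze + B et xi ze - C (Nv et) xi ze - B ze xi et + C (Nv ze) xi et) / 2)"

lemma g_Qv: "g Qv ze = B y y ze - B ze y y / 2"
 unfolding Qv_def by (rule g_rep) (auto intro!: linearI simp: lin_rules algebra_simps)

lemma g_Nv: "g (Nv xi) ze = (B xi y ze + B y xi ze - B ze xi y - C Qv xi ze) / 2"
 unfolding Nv_def by (rule g_rep) (auto intro!: linearI simp: lin_rules field_simps)

lemma Nv_lin: "linear Nv"
 by (rule linearI; rule g_eqI; simp add: g_Nv lin_rules field_simps)

lemma g_Gv: "g (Gv xi et) ze = (B xi et ze - C (Nv xi) et ze + B et xi ze - C (Nv et) xi ze - B ze xi et + C (Nv ze) xi et) / 2"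
 unfolding Gv_def
 by (rule g_rep) (auto intro!: linearI simp: lin_rules linear_add[OF Nv_lin] linear_cmul[OF Nv_lin] field_simps)

lemma Gv_sym: "Gv xi et = Gv et xi"
 by (rule g_eqI) (simp add: g_Gv B_sym[of _ xi et] C_sym2[of _ xi et])

lemma Gv_lin: "linear (Gv xi)"
 by (rule linearI; rule g_eqI; simp add: g_Gv lin_rules linear_add[OF Nv_lin] linear_cmul[OF Nv_lin] field_simps)

lemma Nv_y: "Nv y = Qv"
 by (rule g_eqI) (simp add: g_Nv g_Qv C_y2)

lemma Gv_y: "Gv xi y = Nv xi"
 by (rule g_eqI) (simp add: g_Gv g_Nv C_y2 C_y3 Nv_y)

definition solves where
 "solves Ga \<longleftrightarrow> (ALL a b. Ga a b = Ga b a) & (ALL xi et ze. B xi et ze = g (Ga et xi) ze + g et (Ga ze xi) + C (Ga xi y) et ze)"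

lemma solves_Gv: "solves Gv"
 unfolding solves_def
proof (intro conjI allI)
 fix xi et ze
 show "B xi et ze = g (Gv et xi) ze + g et (Gv ze xi) + C (Gv xi y) et ze"
  using B_sym[of ze xi et] B_sym[of et xi ze] B_sym[of xi et ze] C_sym2[of "Nv ze" xi et] C_sym2[of "Nv et" xi ze] C_sym2[of "Nv xi" et ze]
  by (simp add: g_Gv Gv_y g_sym[of et "Gv ze xi"] field_simps)
qed (rule Gv_sym)

lemma solves_unique:
 assumes "solves Ga"
 shows "Ga = Gv"
proof -
 have s: "Ga a b = Ga b a" for a b using assms unfolding solves_def by blast
 have e: "B xi et ze = g (Ga et xi) ze + g (Ga ze xi) et + C (Ga xi y) et ze" for xi et ze
  using assms g_sym unfolding solves_def by metis
 \<comment> \<open>The Koszul combination of the compatibility equation over three permutations of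
   the arguments. Setting two arguments to \<open>y\<close>, then one, reproduces the three stages
   of the construction.\<close>
 have k: "g (Ga xi et) ze = (B xi et ze - C (Ga xi y) et ze + B et xi ze - C (Ga et y) xi ze - B ze xi et + C (Ga ze y) xi et) / 2" for xi et ze
  using e[of xi et ze] e[of et xi ze] e[of ze xi et] s[of xi et] s[of xi ze] s[of et ze] by (simp add: field_simps)
 have Q: "Ga y y = Qv"
  by (rule g_eqI) (use k[of y y] in "simp add: g_Qv C_y2 C_y3 field_simps")
 have N: "Ga xi y = Nv xi" for xi
  by (rule g_eqI) (use k[of xi y] in "simp add: g_Nv C_y2 C_y3 Q")
 show ?thesis
  by (intro ext g_eqI) (simp add: k g_Gv N)
qed

end

section \<open>Homogeneity of the energy and identification of the Chern connection\<close>

lemma dird_cong: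
 assumes "open S" "x : S" "smooth_on S f" "!!z. z : S ==> f z = h z"
 shows "dird u f x = dird u h x"
 using has_derivative_transform_within_open[OF smooth_on_has_derivative[OF assms(3,2)] assms(1,2,4)]
 by (rule dird_eqI[symmetric]) 

lemma dird_scale:
 fixes f :: "'a::real_normed_vector => real"
 assumes "smooth_on S f" "x : S"
 shows "dird u (%z. c * f z) x = c * dird u f x"
 by (rule dird_eqI[OF has_derivative_mult_right[OF smooth_on_has_derivative[OF assms]]])

lemma dird_linear2:
 fixes f :: "'a::real_normed_vector => real"
 assumes "open S" "smooth_on S f" "x : S"
 shows "linear (%v. dird u (dird v f) x)"
 using dird_linear[OF smooth_on_dird[OF assms(2)] assms(3), of u] dird_commute[OF assms(2,1,3), of u] by simp

lemma smooth_on_det: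
 fixes M :: "'a::real_normed_vector => real ^ 'n ^ 'n::finite"
 assumes "open S" "!!i j. smooth_on S (%z. M z $ i $ j)"
 shows "smooth_on S (%z. det (M z))"
 unfolding det_def using assms
 by (intro smooth_on_sum smooth_on_mult smooth_on_const smooth_on_prod finite_permutations) auto

lemma sum_axis: "(SUM j:UNIV. f j * axis k (1::real) $ j) = f (k :: 'n::finite)"
proof -
 have "f j * axis k (1::real) $ j = (if j = k then f k else 0)" for j by (simp add: axis_def)
 thus ?thesis by simp
qed

locale finsler_dom =
 fixes U :: "(real ^ 'n::finite) set" and F :: "real ^ 'n => real ^ 'n => real"
 assumes open_U: "open U"
  and smooth_F: "smooth_on (U \<times> (- {0})) (%(x, y). F x y)"
  and F_nonneg: "x : U ==> 0 <= F x y"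
  and F_hom: "x : U ==> 0 < a ==> F x (a *r y) = a * F x y"
  and F_posdef: "x : U ==> y ~= 0 ==> u ~= 0 ==> fund_form F x y u u > 0"
begin

text \<open>\<open>Z\<close> is the tangent bundle over the chart without its zero section and
  \<open>E\<close> the energy; \<open>g\<close>, \<open>B\<close>, \<open>C\<close> are the tensors
  of the locale \<open>koszul\<close>.\<close>

definition Z where "Z = U \<times> (- {0 :: real ^ 'n})"
definition E where "E z = (F (fst z) (snd z))\<^sup>2 / 2"
definition g where "g z et ze = dird (0, et) (dird (0, ze) E) z"
definition B where "B z xi et ze = dird (xi, 0) (dird (0, et) (dird (0, ze) E)) z"
definition C where "C z xi et ze = dird (0, xi) (dird (0, et) (dird (0, ze) E)) z"

lemma open_Z: "open Z" unfolding Z_def by (intro open_Times open_U) auto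
lemma Z_iff: "(x, y) : Z \<longleftrightarrow> x : U & y ~= 0" unfolding Z_def by auto

lemma smooth_E: "smooth_on Z E"
proof -
 have "smooth_on Z (%z. (1/2) * ((%(x, y). F x y) z * (%(x, y). F x y) z))"
  by (intro smooth_on_mult[OF open_Z] smooth_on_const smooth_F[folded Z_def])
 thus ?thesis
  by (rule smooth_on_cong_imp[OF _ open_Z]) (auto simp: E_def power2_eq_square split: prod.splits)
qed

lemmas smooth_E1 = smooth_on_dird[OF smooth_E]
lemmas smooth_E2 = smooth_on_dird[OF smooth_E1]

lemma F_zero: "x : U ==> F x 0 = 0"
 using F_hom[of x 2 0] by simp

lemma pdy_eq:
 assumes "(x, y) : Z" "smooth_on Z h" "!!x y. (x, y) : Z ==> f x y = h (x, y)"
 shows "pdy i f x y = dird (0, axis i 1) h (x, y)"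
proof -
 have d: "((%t. h ((x, y) + t *r (0, axis i 1))) has_real_derivative dird (0, axis i 1) h (x, y)) (at 0)"
  using dird_line[OF assms(2), of "(x, y)" 0 "(0, axis i 1)"] assms(1) by simp
 have o: "open ((%t. (x, y) + t *r (0, axis i 1)) -` Z)"
  by (intro continuous_open_vimage continuous_intros open_Z) 
 have "((%t. f x (y + t *r axis i 1)) has_real_derivative dird (0, axis i 1) h (x, y)) (at 0)"
  by (rule has_field_derivative_transform_within_open[OF d o]) (use assms in auto)
 thus ?thesis unfolding pdy_def by (rule DERIV_imp_deriv)
qed

lemma pdx_eq:
 assumes "(x, y) : Z" "smooth_on Z h" "!!x y. (x, y) : Z ==> f x y = h (x, y)"
 shows "pdx i f x y = dird (axis i 1, 0) h (x, y)"
proof -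
 have d: "((%t. h ((x, y) + t *r (axis i 1, 0))) has_real_derivative dird (axis i 1, 0) h (x, y)) (at 0)"
  using dird_line[OF assms(2), of "(x, y)" 0 "(axis i 1, 0)"] assms(1) by simp
 have o: "open ((%t. (x, y) + t *r (axis i 1, 0)) -` Z)"
  by (intro continuous_open_vimage continuous_intros open_Z) 
 have "((%t. f (x + t *r axis i 1) y) has_real_derivative dird (axis i 1, 0) h (x, y)) (at 0)"
  by (rule has_field_derivative_transform_within_open[OF d o]) (use assms in auto)
 thus ?thesis unfolding pdx_def by (rule DERIV_imp_deriv)
qed

lemma pdy_F2: "(x, y) : Z ==> pdy j (%x y. (F x y)\<^sup>2) x y = 2 * dird (0, axis j 1) E (x, y)"
 using dird_scale[OF smooth_E, of "(x, y)" "(0, axis j 1)" 2] smooth_on_mult[OF open_Z smooth_on_const smooth_E]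
 by (subst pdy_eq[where h="%z. 2 * E z"]) (auto, simp add: E_def)

lemma pdy_pdy_F2: "(x, y) : Z ==> pdy i (pdy j (%x y. (F x y)\<^sup>2)) x y = 2 * g (x, y) (axis i 1) (axis j 1)"
 using dird_scale[OF smooth_E1, of "(x, y)" "(0, axis i 1)" 2] smooth_on_mult[OF open_Z smooth_on_const smooth_E1]
 by (subst pdy_eq[where h="%z. 2 * dird (0, axis j 1) E z"]) (auto simp: g_def pdy_F2)

lemma fund_tensor_eq: "(x, y) : Z ==> fund_tensor F i j x y = g (x, y) (axis i 1) (axis j 1)"
 unfolding fund_tensor_def by (simp add: pdy_pdy_F2)

lemma smooth_g: "smooth_on Z (%z. g z et ze)"
 unfolding g_def by (rule smooth_E2)

lemma pdy_fund: "(x, y) : Z ==> pdy k (fund_tensor F i j) x y = C (x, y) (axis k 1) (axis i 1) (axis j 1)"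
 by (subst pdy_eq[where h="%z. g z (axis i 1) (axis j 1)"]) (auto simp: fund_tensor_eq smooth_g, simp add: C_def g_def)

lemma pdx_fund: "(x, y) : Z ==> pdx k (fund_tensor F i j) x y = B (x, y) (axis k 1) (axis i 1) (axis j 1)"
 by (subst pdx_eq[where h="%z. g z (axis i 1) (axis j 1)"]) (auto simp: fund_tensor_eq smooth_g, simp add: B_def g_def)

lemma cartan_eq: "(x, y) : Z ==> cartan F i j k x y = F x y / 2 * C (x, y) (axis i 1) (axis j 1) (axis k 1)"
 unfolding cartan_def
 using dird_scale[OF smooth_E2, of "(x, y)" "(0, axis i 1)" 2] smooth_on_mult[OF open_Z smooth_on_const smooth_E2]
 by (subst pdy_eq[where h="%z. 2 * dird (0, axis j 1) (dird (0, axis k 1) E) z"]) (auto simp: pdy_pdy_F2 C_def g_def)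

lemma lin_fst: "linear (%v. (v, 0))" and lin_snd: "linear (%v. (0, v))"
 by (auto intro!: linearI)

lemma g_linear1: "z : Z ==> linear (%a. g z a b)"
 unfolding g_def using linear_compose[OF lin_snd dird_linear[OF smooth_E1]] by (simp add: o_def)
lemma g_symm: "z : Z ==> g z a b = g z b a"
 unfolding g_def by (rule dird_commute[OF smooth_E open_Z])
lemma g_linear2: "z : Z ==> linear (g z a)"
 unfolding g_def using linear_compose[OF lin_snd dird_linear2[OF open_Z smooth_E]] by (simp add: o_def)
lemma B_symm: "z : Z ==> B z a b c = B z a c b"
 unfolding B_def by (intro dird_cong[OF open_Z] smooth_E2 dird_commute[OF smooth_E open_Z])
lemma B_linear1: "z : Z ==> linear (%a. B z a b c)"
 unfolding B_def using linear_compose[OF lin_fst dird_linear[OF smooth_E2]] by (simp add: o_def)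
lemma B_linear2: "z : Z ==> linear (%b. B z a b c)"
 unfolding B_def using linear_compose[OF lin_snd dird_linear2[OF open_Z smooth_E1]] by (simp add: o_def)
lemma C_symm1: "z : Z ==> C z a b c = C z b a c"
 unfolding C_def by (rule dird_commute[OF smooth_E1 open_Z])
lemma C_symm2: "z : Z ==> C z a b c = C z a c b"
 unfolding C_def by (intro dird_cong[OF open_Z] smooth_E2 dird_commute[OF smooth_E open_Z])
lemma C_linear1: "z : Z ==> linear (%a. C z a b c)"
 unfolding C_def using linear_compose[OF lin_snd dird_linear[OF smooth_E2]] by (simp add: o_def)

text \<open>Positive homogeneity in y. The factor is a function of \<open>a\<close> instead of an
  exponent: a y-derivative then simply divides it by \<open>a\<close>, an x-derivative leaves it
  alone.\<close>

definition hom where "hom f c \<longleftrightarrow> (ALL x:U. ALL y. y ~= 0 --> (ALL a>0. f (x, a *r y) = c a * f (x, y)))"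

lemma homD: "hom f c ==> (x, y) : Z ==> a > 0 ==> f (x, a *r y) = c a * f (x, y)"
 unfolding hom_def Z_iff by blast

lemma hom_E: "hom E (%a. a\<^sup>2)"
 unfolding hom_def E_def by (auto simp: F_hom power_mult_distrib)

lemma hom_dird:
 assumes f: "smooth_on Z f" "hom f c"
 shows "hom (dird (0, et) f) (%a. c a / a)" "hom (dird (xi, 0) f) c"
proof -
 have main: "dird (xi, a *r et) f (x, a *r y) = c a * dird (xi, et) f (x, y)" if "(x, y) : Z" "a > 0" for x y a xi et
 proof -
  have z: "(x, a *r y) : Z" using that unfolding Z_iff by auto
  have "((%z. (fst z, a *r snd z)) has_derivative (%z. (fst z, a *r snd z))) (at (x, y))"
   by (auto intro!: derivative_eq_intros)
  hence "((%z. f (fst z, a *r snd z)) has_derivative (%z. dird (fst z, a *r snd z) f (x, a *r y))) (at (x, y))"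
   using has_derivative_compose[of "%z. (fst z, a *r snd z)"] smooth_on_has_derivative[OF f(1) z] by fastforce
  hence "((%z. c a * f z) has_derivative (%z. dird (fst z, a *r snd z) f (x, a *r y))) (at (x, y))"
   by (rule has_derivative_transform_within_open[OF _ open_Z that(1)]) (use homD[OF f(2)] that in auto)
  from dird_eqI[OF this, of "(xi, et)"] show ?thesis using dird_scale[OF f(1) that(1)] by simp
 qed
 have "dird (0, et) f (x, a *r y) = c a / a * dird (0, et) f (x, y)" if "(x, y) : Z" "a > 0" for x y a
 proof -
  have "(x, a *r y) : Z" using that unfolding Z_iff by auto
  hence "a * dird (0, et) f (x, a *r y) = dird (0, a *r et) f (x, a *r y)"
   using dird_simps(2)[OF f(1), of "(x, a *r y)" a "(0, et)"] by simp
  thus ?thesis using main[OF that, of 0 et] that by (simp add: field_simps)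
 qed
 thus "hom (dird (0, et) f) (%a. c a / a)" unfolding hom_def Z_iff by blast
 show "hom (dird (xi, 0) f) c" unfolding hom_def using main[of _ _ _ xi 0] unfolding Z_iff by auto
qed

text \<open>Euler's relation; the degree is the derivative of the factor \<open>c\<close> at
  1.\<close>

lemma euler:
 assumes f: "smooth_on Z f" "hom f c" and "(c has_real_derivative k) (at 1)" and z: "(x, y) : Z"
 shows "dird (0, y) f (x, y) = k * f (x, y)"
proof -
 have "((%t. f ((x, 0) + t *r (0, y))) has_real_derivative dird (0, y) f ((x, 0) + 1 *r (0, y))) (at 1)"
  by (rule dird_line[OF f(1)]) (use z in simp)
 moreover have "((%t. c t * f (x, y)) has_real_derivative k * f (x, y)) (at 1)"
  using assms(3) by (auto intro!: derivative_eq_intros)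
 hence "((%t. f ((x, 0) + t *r (0, y))) has_real_derivative k * f (x, y)) (at 1)"
  by (rule has_field_derivative_transform_within_open[of _ _ _ "{0<..}"]) (use homD[OF f(2) z] in auto)
 ultimately show ?thesis using DERIV_unique by fastforce
qed

lemma c_deriv: "((%a::real. a\<^sup>2) has_real_derivative 2) (at 1)" "((%a::real. a\<^sup>2 / a) has_real_derivative 1) (at 1)"
 "((%a::real. a\<^sup>2 / a / a) has_real_derivative 0) (at 1)"
 by (auto intro!: derivative_eq_intros)

lemma euler_E: "(x, y) : Z ==> dird (0, y) E (x, y) = 2 * E (x, y)"
 by (rule euler[OF smooth_E hom_E c_deriv(1)])
text \<open>The fibre derivative of the energy is the Legendre transform g(y,-). This covector is
  the momentum that occurs from here on as \<open>dird (0, ze) E\<close>.\<close>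

lemma euler_Ey: "(x, y) : Z ==> dird (0, ze) E (x, y) = g (x, y) y ze"
 using euler[OF smooth_E1 hom_dird(1)[OF smooth_E hom_E] c_deriv(2), of x y ze] by (simp add: g_def)
lemma C_y0: "(x, y) : Z ==> C (x, y) y a b = 0"
 using euler[OF smooth_E2 hom_dird(1)[OF smooth_E1 hom_dird(1)[OF smooth_E hom_E]] c_deriv(3), of x y a b]
 by (simp add: C_def)
lemma g_yy: "(x, y) : Z ==> g (x, y) y y = 2 * E (x, y)"
 using euler_E euler_Ey by simp
lemma B_yy: assumes "(x, y) : Z" shows "dird (xi, 0) E (x, y) = B (x, y) xi y y / 2"
proof -
 have "B (x, y) xi y y = dird (xi, 0) (dird (0, y) (dird (0, y) E)) (x, y)" by (simp add: B_def)
 also have "... = dird (0, y) (dird (xi, 0) (dird (0, y) E)) (x, y)"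
  by (rule dird_commute[OF smooth_E1 open_Z assms])
 also have "... = dird (xi, 0) (dird (0, y) E) (x, y)"
  using euler[OF smooth_E2 hom_dird(2)[OF smooth_E1 hom_dird(1)[OF smooth_E hom_E]] c_deriv(2) assms] by simp
 also have "... = dird (0, y) (dird (xi, 0) E) (x, y)"
  by (rule dird_commute[OF smooth_E open_Z assms])
 also have "... = 2 * dird (xi, 0) E (x, y)"
  using euler[OF smooth_E1 hom_dird(2)[OF smooth_E hom_E] c_deriv(1) assms] by simp
 finally show ?thesis by simp
qed
lemma B_y: assumes "(x, y) : Z" shows "dird (xi, 0) (dird (0, ze) E) (x, y) = B (x, y) xi y ze"
proof -
 have "B (x, y) xi y ze = dird (0, y) (dird (xi, 0) (dird (0, ze) E)) (x, y)"
  unfolding B_def by (rule dird_commute[OF smooth_E1 open_Z assms])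
 also have "... = dird (xi, 0) (dird (0, ze) E) (x, y)"
  using euler[OF smooth_E2 hom_dird(2)[OF smooth_E1 hom_dird(1)[OF smooth_E hom_E]] c_deriv(2) assms] by simp
 finally show ?thesis by simp
qed

lemma fund_form_eq: assumes z: "(x, y) : Z" shows "fund_form F x y u v = g (x, y) u v"
proof -
 have "g (x, y) u v = (SUM i:UNIV. u $ i * (SUM j:UNIV. v $ j * g (x, y) (axis i 1) (axis j 1)))"
  using linear_axis_sum[OF g_linear1[OF z], of u v] linear_axis_sum[OF g_linear2[OF z], of _ v] by simp
 thus ?thesis unfolding fund_form_def by (simp add: fund_tensor_eq[OF z] sum_distrib_left mult_ac)
qed

lemma g_posdef: "(x, y) : Z ==> u ~= 0 ==> g (x, y) u u > 0"
 using F_posdef[of x y u] fund_form_eq[of x y u u] unfolding Z_iff by auto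

lemma F_pos: "(x, y) : Z ==> F x y > 0"
 using g_posdef[of x y y] g_yy[of x y] F_nonneg[of x y] unfolding Z_iff E_def
 by (cases "F x y = 0") auto

lemma koszul:
 assumes z: "(x, y) : Z"
 shows "koszul (g (x, y)) (B (x, y)) (C (x, y)) y"
 by (rule koszul.intro)
  (rule g_symm[OF z] g_linear2[OF z] g_posdef[OF z] B_symm[OF z] B_linear1[OF z] B_linear2[OF z]
   C_symm1[OF z] C_symm2[OF z] C_linear1[OF z] C_y0[OF z]; assumption?)+

definition Gam where "Gam x y xi et = (\<chi> i. SUM j:UNIV. SUM k:UNIV. chern F i j k x y * xi $ j * et $ k)"

text \<open>Both sides are linear in every argument, so the index equations are the invariant ones
  tested on axis vectors. The dy-component is the definition of the Cartan tensor.\<close>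

lemma chern_equations_iff:
 fixes Ga :: "real ^ 'n => real ^ 'n => real ^ 'n"
 assumes z: "(x, y) : Z" and Ga: "!!xi et. Ga xi et = (\<chi> i. SUM j:UNIV. SUM k:UNIV. G i j k * xi $ j * et $ k)"
 shows "chern_equations F x y G \<longleftrightarrow> koszul.solves (g (x, y)) (B (x, y)) (C (x, y)) y Ga"
proof -
 interpret k: koszul "g (x, y)" "B (x, y)" "C (x, y)" y by (rule koszul[OF z])
 have ax: "Ga (axis j 1) (axis k 1) $ i = G i j k" for i j k
  unfolding Ga by (simp add: sum_axis)
 have l1: "linear (%a. Ga a b)" and l2: "linear (Ga a)" for a b
  by (auto intro!: linearI simp: Ga vec_eq_iff algebra_simps sum.distrib sum_distrib_left)
 have s: "(ALL i j k. G i j k = G i k j) \<longleftrightarrow> (ALL a b. Ga a b = Ga b a)"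
 proof
  assume G: "ALL i j k. G i j k = G i k j"
  show "ALL a b. Ga a b = Ga b a"
  proof (intro allI)
   fix a b
   have 1: "Ga (axis i 1) (axis j 1) = Ga (axis j 1) (axis i 1)" for i j
    unfolding vec_eq_iff ax using G by blast
   have 2: "Ga (axis i 1) b = Ga b (axis i 1)" for i
    by (rule linear_eq_axis[OF l2 l1 1])
   show "Ga a b = Ga b a" by (rule linear_eq_axis[OF l1 l2 2])
  qed
 qed (use ax in metis)
 have c3: "pdy k (fund_tensor F i j) x y = 2 * cartan F i j k x y / F x y" for i j k
  using k.C_sym1[of "axis k 1" "axis i 1" "axis j 1"] k.C_sym2[of "axis i 1" "axis k 1" "axis j 1"] F_pos[OF z]
  by (simp add: pdy_fund[OF z] cartan_eq[OF z])
 have e: "(pdx l (fund_tensor F i j) x y - (SUM k:UNIV. fund_tensor F k j x y * G k i l)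
       - (SUM k:UNIV. fund_tensor F i k x y * G k j l)
      = (SUM k:UNIV. 2 * cartan F i j k x y / F x y * (SUM m:UNIV. G k l m * y $ m))) \<longleftrightarrow>
   (B (x, y) (axis l 1) (axis i 1) (axis j 1) = g (x, y) (Ga (axis i 1) (axis l 1)) (axis j 1)
     + g (x, y) (axis i 1) (Ga (axis j 1) (axis l 1)) + C (x, y) (Ga (axis l 1) y) (axis i 1) (axis j 1))" for i j l
 proof -
  have 1: "(SUM k:UNIV. fund_tensor F k j x y * G k i l) = g (x, y) (Ga (axis i 1) (axis l 1)) (axis j 1)"
   by (subst linear_axis_sum[OF k.g_lin1]) (simp add: ax fund_tensor_eq[OF z] mult.commute)
  have 2: "(SUM k:UNIV. fund_tensor F i k x y * G k j l) = g (x, y) (axis i 1) (Ga (axis j 1) (axis l 1))"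
   by (subst linear_axis_sum[OF k.g_lin]) (simp add: ax fund_tensor_eq[OF z] mult.commute)
  have 3: "(SUM k:UNIV. 2 * cartan F i j k x y / F x y * (SUM m:UNIV. G k l m * y $ m)) = C (x, y) (Ga (axis l 1) y) (axis i 1) (axis j 1)"
  proof -
   have "Ga (axis l 1) y $ k = (SUM m:UNIV. G k l m * y $ m)" for k
    unfolding Ga by (subst sum.swap) (simp add: sum_axis sum_distrib_right[symmetric])
   thus ?thesis
    by (subst linear_axis_sum[OF k.C_lin]) (simp add: c3[symmetric] pdy_fund[OF z] mult.commute)
  qed
  show ?thesis unfolding 1 2 3 pdx_fund[OF z] by (auto simp: algebra_simps)
 qed
 have "(ALL i j l. B (x, y) (axis l 1) (axis i 1) (axis j 1) = g (x, y) (Ga (axis i 1) (axis l 1)) (axis j 1)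
     + g (x, y) (axis i 1) (Ga (axis j 1) (axis l 1)) + C (x, y) (Ga (axis l 1) y) (axis i 1) (axis j 1)) \<longleftrightarrow>
   (ALL xi et ze. B (x, y) xi et ze = g (x, y) (Ga et xi) ze + g (x, y) et (Ga ze xi) + C (x, y) (Ga xi y) et ze)" (is "?l = (ALL xi et ze. ?b xi et ze = ?r xi et ze)")
 proof
  assume h: ?l
  note sim = k.lin_rules linear_add[OF l1] linear_add[OF l2] linear_cmul[OF l1] linear_cmul[OF l2] algebra_simps
  have a: "?b (axis l 1) (axis i 1) ze = ?r (axis l 1) (axis i 1) ze" for l i ze
   by (rule linear_eq_axis[where f="%ze. ?b (axis l 1) (axis i 1) ze"]) (use h in "auto intro!: linearI simp: sim")
  have b: "?b (axis l 1) et ze = ?r (axis l 1) et ze" for l et ze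
   by (rule linear_eq_axis[where f="%et. ?b (axis l 1) et ze"]) (use a in "auto intro!: linearI simp: sim")
  have "?b xi et ze = ?r xi et ze" for xi et ze
   by (rule linear_eq_axis[where f="%xi. ?b xi et ze"]) (use b in "auto intro!: linearI simp: sim")
  thus "ALL xi et ze. ?b xi et ze = ?r xi et ze" by blast
 qed blast
 with c3 show ?thesis unfolding chern_equations_def k.solves_def s e by simp
qed

text \<open>Existence and uniqueness in \<open>koszul\<close> resolve the definite description in
  \<open>chern\<close>.\<close>

lemma chern_Gv:
 assumes z: "(x, y) : Z"
 shows "Gam x y = koszul.Gv (g (x, y)) (B (x, y)) (C (x, y)) y"
  and "chern F i j k x y = Gam x y (axis j 1) (axis k 1) $ i"
proof -
 interpret k: koszul "g (x, y)" "B (x, y)" "C (x, y)" y by (rule koszul[OF z])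
 define G where "G i j k = k.Gv (axis j 1) (axis k 1) $ i" for i j k
 have GG: "k.Gv xi et = (\<chi> i. SUM j:UNIV. SUM k:UNIV. G i j k * xi $ j * et $ k)" for xi et
 proof -
  have "k.Gv xi et $ i = (SUM j:UNIV. xi $ j * (SUM k:UNIV. et $ k * G i j k))" for i
  proof -
   have 1: "linear (%a. k.Gv a b $ i)" for b
    using linear_add[OF k.Gv_lin] linear_cmul[OF k.Gv_lin] by (auto intro!: linearI simp: k.Gv_sym[of _ b])
   have 2: "linear (%b. k.Gv a b $ i)" for a
    using linear_add[OF k.Gv_lin] linear_cmul[OF k.Gv_lin] by (auto intro!: linearI)
   show ?thesis
    using linear_axis_sum[OF 1, of xi et] linear_axis_sum[OF 2, of _ et] unfolding G_def by simp
  qed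
  thus ?thesis by (simp add: vec_eq_iff sum_distrib_left mult_ac)
 qed
 have ex: "chern_equations F x y G"
  using chern_equations_iff[OF z GG] k.solves_Gv by blast
 have un: "G' = G" if "chern_equations F x y G'" for G'
 proof -
  define Ga' where "Ga' xi et = (\<chi> i. SUM j:UNIV. SUM k:UNIV. G' i j k * xi $ j * et $ k)" for xi et :: "real ^ 'n"
  have "Ga' = k.Gv" using chern_equations_iff[OF z Ga'_def] k.solves_unique that by blast
  moreover have "Ga' (axis j 1) (axis k 1) $ i = G' i j k" for i j k
   unfolding Ga'_def by (simp add: sum_axis)
  ultimately show ?thesis unfolding G_def by (intro ext) metis
 qed
 have "(THE G. chern_equations F x y G) = G" using ex un by (rule the_equality)
 hence ch: "chern F i j k x y = G i j k" for i j k by (simp add: chern_def)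
 show e: "Gam x y = k.Gv" by (intro ext) (simp add: Gam_def GG ch)
 show "chern F i j k x y = Gam x y (axis j 1) (axis k 1) $ i" unfolding ch e G_def ..
qed

end

section \<open>Smoothness of the connection; the geodesic spray\<close>

lemma smooth_on_vec:
 fixes f :: "'a::real_normed_vector => real ^ 'n::finite"
 assumes "open S" "!!i. smooth_on S (%z. f z $ i)"
 shows "smooth_on S f"
proof -
 have "smooth_on S (%z. SUM i:UNIV. f z $ i *r axis i (1::real))"
  by (intro smooth_on_sum[OF assms(1)] smooth_on_linear_compose[OF assms(1) _ assms(2)] bounded_linear_scaleR_left) auto
 thus ?thesis
  by (rule smooth_on_cong_imp[OF _ assms(1)]) (simp add: basis_expansion flip: scalar_mult_eq_scaleR)
qed

lemma smooth_on_component: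
 fixes f :: "'a::real_normed_vector => real ^ 'n::finite"
 assumes "open S" "smooth_on S f"
 shows "smooth_on S (%z. f z $ i)"
 by (rule smooth_on_linear_compose[OF assms(1) bounded_linear_vec_nth assms(2)])

context finsler_dom begin

text \<open>Cramer's rule gives quotients of determinants with smooth entries. Through this lemma
  smoothness passes from \<open>E\<close> to \<open>Q\<close>, then to the nonlinear connection,
  then to \<open>Gam\<close>.\<close>

lemma smooth_rep:
 assumes l: "!!i. smooth_on Z (%z. l z (axis i 1))"
 shows "smooth_on Z (%z. koszul.rep (g z) (l z))"
proof (rule smooth_on_vec[OF open_Z])
 fix m
 have nz: "det (\<chi> i j. g z (axis i 1) (axis j 1)) ~= 0" if "z : Z" for z
 proof -
  obtain x y where xy: "z = (x, y)" by (cases z)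
  interpret k: koszul "g (x, y)" "B (x, y)" "C (x, y)" y by (rule koszul) (use that xy in simp)
  show ?thesis using k.det_gmat by (simp add: k.gmat_def xy)
 qed
 have 1: "smooth_on Z (%z. (\<chi> i j. if j = m then l z (axis i 1) else g z (axis i 1) (axis j 1)) $ i $ j)" for i j
  using l smooth_g by (cases "j = m") auto
 have 2: "smooth_on Z (%z. det (\<chi> i j. if j = m then l z (axis i 1) else g z (axis i 1) (axis j 1))
   * inverse (det (\<chi> i j. g z (axis i 1) (axis j 1))))"
  by (intro smooth_on_mult[OF open_Z] smooth_on_inverse[OF open_Z] smooth_on_det[OF open_Z] nz 1) (simp_all add: smooth_g)
 show "smooth_on Z (%z. koszul.rep (g z) (l z) $ m)"
 proof (rule smooth_on_cong_imp[OF 2 open_Z])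
  fix z assume "z : Z"
  then obtain x y where xy: "z = (x, y)" "(x, y) : Z" by (cases z) auto
  interpret k: koszul "g (x, y)" "B (x, y)" "C (x, y)" y by (rule koszul) (use xy in simp)
  show "det (\<chi> i j. if j = m then l z (axis i 1) else g z (axis i 1) (axis j 1))
   * inverse (det (\<chi> i j. g z (axis i 1) (axis j 1))) = koszul.rep (g z) (l z) $ m"
   by (simp add: k.rep_def k.gmat_def xy field_simps cong: if_cong)
 qed
qed

lemma smooth_dird_var:
 assumes "smooth_on Z f" "smooth_on Z (v :: _ => real ^ 'n)"
 shows "smooth_on Z (%z. dird (v z, 0) f z :: real)" "smooth_on Z (%z. dird (0, v z) f z :: real)"
proof -
 have "smooth_on Z (%z. SUM i:UNIV. v z $ i * dird (axis i 1, 0) f z)"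
  by (intro smooth_on_sum[OF open_Z] smooth_on_mult[OF open_Z] smooth_on_component[OF open_Z assms(2)] smooth_on_dird assms) auto
 thus "smooth_on Z (%z. dird (v z, 0) f z)"
  by (rule smooth_on_cong_imp[OF _ open_Z])
   (use linear_axis_sum[OF linear_compose[OF lin_fst dird_linear[OF assms(1)]]] in "simp add: o_def")
 have "smooth_on Z (%z. SUM i:UNIV. v z $ i * dird (0, axis i 1) f z)"
  by (intro smooth_on_sum[OF open_Z] smooth_on_mult[OF open_Z] smooth_on_component[OF open_Z assms(2)] smooth_on_dird assms) auto
 thus "smooth_on Z (%z. dird (0, v z) f z)"
  by (rule smooth_on_cong_imp[OF _ open_Z])
   (use linear_axis_sum[OF linear_compose[OF lin_snd dird_linear[OF assms(1)]]] in "simp add: o_def")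
qed

lemma smooth_snd: "smooth_on Z snd"
 by (rule smooth_on_bounded_linear[OF open_Z bounded_linear_snd])

lemma smooth_diff: "smooth_on Z f ==> smooth_on Z h ==> smooth_on Z (%z. f z - h z :: real)"
 using smooth_on_add[OF open_Z, of f "%z. (- 1) * h z"] smooth_on_mult[OF open_Z smooth_on_const, of h "- 1"] by simp

lemma smooth_divc: "smooth_on Z f ==> smooth_on Z (%z. f z / c :: real)"
 using smooth_on_mult[OF open_Z smooth_on_const, of f "inverse c"] by (simp add: field_simps)

text \<open>The geodesic spray: the geodesic equation is u'' = - Q(u,u').\<close>

definition Q where "Q x y = Gam x y y y"

lemma Q_zero: "Q x 0 = 0" by (simp add: Q_def Gam_def vec_eq_iff)

lemma Q_Qv: "(x, y) : Z ==> Q x y = koszul.Qv (g (x, y)) (B (x, y)) y"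
 using koszul.Gv_y[OF koszul] koszul.Nv_y[OF koszul] by (simp add: Q_def chern_Gv)

text \<open>The Euler-Lagrange equation of \<open>E\<close> in implicit form. It determines
  \<open>Q\<close> by derivatives of the energy alone, which is what smoothness, homogeneity and the
  behaviour under coordinate changes need.\<close>

lemma g_Q:
 assumes z: "(x, y) : Z"
 shows "g (x, y) (Q x y) ze = dird (y, 0) (dird (0, ze) E) (x, y) - dird (ze, 0) E (x, y)"
 using koszul.g_Qv[OF koszul[OF z]] by (simp add: Q_Qv[OF z] B_y[OF z] B_yy[OF z])

lemma g_eqI: "(x, y) : Z ==> (!!c. g (x, y) a c = g (x, y) b c) ==> a = b"
 using koszul.g_eqI[OF koszul] by blast

lemma Q_hom:
 assumes x: "x : U" and a: "a > 0"
 shows "Q x (a *r y) = a\<^sup>2 *r Q x y"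
proof (cases "y = 0")
 case False
 hence z: "(x, y) : Z" "(x, a *r y) : Z" using x a unfolding Z_iff by auto
 have g: "g (x, a *r y) u v = g (x, y) u v" for u v
  using homD[OF hom_dird(1)[OF smooth_E1 hom_dird(1)[OF smooth_E hom_E]] z(1) a] a
  by (simp add: g_def power2_eq_square)
 show ?thesis
 proof (rule g_eqI[OF z(2)])
  fix c
  have "dird (a *r y, 0) (dird (0, c) E) (x, a *r y) = a * dird (y, 0) (dird (0, c) E) (x, a *r y)"
   using dird_simps(2)[OF smooth_E1 z(2), of a "(y, 0)"] by simp
  also have "... = a\<^sup>2 * dird (y, 0) (dird (0, c) E) (x, y)"
   using homD[OF hom_dird(2)[OF smooth_E1 hom_dird(1)[OF smooth_E hom_E]] z(1) a] a
   by (simp add: power2_eq_square)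
  finally show "g (x, a *r y) (Q x (a *r y)) c = g (x, a *r y) (a\<^sup>2 *r Q x y) c"
   using homD[OF hom_dird(2)[OF smooth_E hom_E] z(1) a, of c]
   unfolding g_Q[OF z(2)] by (simp add: g linear_cmul[OF g_linear1[OF z(1)]] g_Q[OF z(1)] algebra_simps)
 qed
qed (simp add: Q_zero)

lemma Z_cases: assumes "z : Z" obtains x y where "z = (x, y)" "(x, y) : Z" "x = fst z" "y = snd z"
 using assms by (cases z) auto

lemma smooth_Q: "smooth_on Z (%z. Q (fst z) (snd z))"
proof -
 define l where "l z v = dird (snd z, 0) (dird (0, v) E) z - dird (v, 0) E z" for z v
 have "smooth_on Z (%z. l z (axis i 1))" for i
  unfolding l_def by (intro smooth_diff smooth_dird_var smooth_E1 smooth_snd)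
 from smooth_rep[of l, OF this] show ?thesis
 proof (rule smooth_on_cong_imp[OF _ open_Z])
  fix z assume "z : Z"
  then obtain x y where z: "z = (x, y)" "(x, y) : Z" by (rule Z_cases)
  interpret k: koszul "g (x, y)" "B (x, y)" "C (x, y)" y by (rule koszul[OF z(2)])
  show "koszul.rep (g z) (l z) = Q (fst z) (snd z)"
   unfolding l_def z fst_conv snd_conv Q_Qv[OF z(2)] k.Qv_def by (simp add: B_y[OF z(2)] B_yy[OF z(2)])
 qed
qed

lemma smooth_Nv: "smooth_on Z (%z. koszul.Nv (g z) (B z) (C z) (snd z) xi)"
proof -
 define l where "l z ze = (dird (xi, 0) (dird (0, ze) E) z + dird (snd z, 0) (dird (0, xi) (dird (0, ze) E)) z
   - dird (ze, 0) (dird (0, xi) E) z - dird (0, Q (fst z) (snd z)) (dird (0, xi) (dird (0, ze) E)) z) / 2" for z ze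
 have "smooth_on Z (%z. l z (axis i 1))" for i
  unfolding l_def by (intro smooth_divc smooth_diff smooth_on_add[OF open_Z] smooth_dird_var smooth_E2 smooth_snd smooth_Q)
 from smooth_rep[of l, OF this] show ?thesis
 proof (rule smooth_on_cong_imp[OF _ open_Z])
  fix z assume "z : Z"
  then obtain x y where z: "z = (x, y)" "(x, y) : Z" by (rule Z_cases)
  interpret k: koszul "g (x, y)" "B (x, y)" "C (x, y)" y by (rule koszul[OF z(2)])
  have "l z ze = (B (x, y) xi y ze + B (x, y) y xi ze - B (x, y) ze xi y - C (x, y) k.Qv xi ze) / 2" for ze
   unfolding l_def z fst_conv snd_conv B_y[OF z(2)] Q_Qv[OF z(2)] k.B_sym[of ze xi y] by (simp add: B_def C_def)
  thus "koszul.rep (g z) (l z) = koszul.Nv (g z) (B z) (C z) (snd z) xi"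
   unfolding z fst_conv snd_conv k.Nv_def by presburger
 qed
qed

lemma smooth_Gam: "smooth_on Z (%z. Gam (fst z) (snd z) xi et)"
proof -
 define N where "N xi z = koszul.Nv (g z) (B z) (C z) (snd z) xi" for xi z
 define D where "D a b = dird (0, a) (dird (0, b) E)" for a b
 define l where "l z ze = (dird (xi, 0) (D et ze) z - dird (0, N xi z) (D et ze) z + dird (et, 0) (D xi ze) z
   - dird (0, N et z) (D xi ze) z - dird (ze, 0) (D xi et) z + dird (0, N ze z) (D xi et) z) / 2" for z ze
 have N: "smooth_on Z (N xi)" for xi unfolding N_def by (rule smooth_Nv)
 have D: "smooth_on Z (D a b)" for a b unfolding D_def by (rule smooth_E2)
 have "smooth_on Z (%z. l z (axis i 1))" for i
  unfolding l_def by (intro smooth_divc smooth_diff smooth_on_add[OF open_Z] smooth_dird_var(2)[OF D N] smooth_on_dird[OF D])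
 from smooth_rep[of l, OF this] show ?thesis
 proof (rule smooth_on_cong_imp[OF _ open_Z])
  fix z assume "z : Z"
  then obtain x y where z: "z = (x, y)" "(x, y) : Z" by (rule Z_cases)
  interpret k: koszul "g (x, y)" "B (x, y)" "C (x, y)" y by (rule koszul[OF z(2)])
  show "koszul.rep (g z) (l z) = Gam (fst z) (snd z) xi et"
   unfolding z fst_conv snd_conv chern_Gv(1)[OF z(2)] k.Gv_def l_def N_def D_def B_def C_def ..
 qed
qed

lemma Gam_sym: "(x, y) : Z ==> Gam x y a b = Gam x y b a"
 using koszul.Gv_sym[OF koszul] by (simp add: chern_Gv)

lemma Gam_linear2: "linear (Gam x y a)" and Gam_linear1: "linear (%a. Gam x y a b)"
 by (auto intro!: linearI simp: Gam_def vec_eq_iff algebra_simps sum.distrib sum_distrib_left)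

lemma compat:
 assumes z: "(x, y) : Z"
 shows "B (x, y) xi et ze = g (x, y) (Gam x y et xi) ze + g (x, y) et (Gam x y ze xi) + C (x, y) (Gam x y xi y) et ze"
 using koszul.solves_Gv[OF koszul[OF z]] unfolding koszul.solves_def[OF koszul[OF z]] chern_Gv(1)[OF z] by blast

text \<open>The energy is constant in horizontal directions: put \<open>y\<close> twice into the
  compatibility equation, where the Cartan term vanishes.\<close>

lemma dird_x_E:
 assumes z: "(x, y) : Z"
 shows "dird (xi, 0) E (x, y) = dird (0, Gam x y xi y) E (x, y)"
proof -
 have "C (x, y) (Gam x y xi y) y y = 0"
  using C_symm1[OF z, of _ y y] C_y0[OF z] by simp
 hence "B (x, y) xi y y = 2 * g (x, y) y (Gam x y xi y)"
  using compat[OF z, of xi y y] g_symm[OF z] Gam_sym[OF z] by simp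
 thus ?thesis by (simp add: B_yy[OF z] euler_Ey[OF z])
qed

lemma E_zero: "x : U ==> E (x, 0) = 0" by (simp add: E_def F_zero)

lemma F_eq_sqrt: "x : U ==> F x y = sqrt (2 * E (x, y))"
 using F_nonneg[of x y] by (simp add: E_def)

end

section \<open>Uniform bounds over compact sets of base points\<close>

lemma compact_image_bound:
 fixes f :: "'a::topological_space => 'b::real_normed_vector"
 assumes "continuous_on S f" "compact S"
 obtains M where "M > 0" "!!x. x : S ==> norm (f x) <= M"
proof -
 have "bounded (f ` S)" using compact_imp_bounded[OF compact_continuous_image[OF assms]] .
 then obtain b where "b > 0" "ALL x:f ` S. norm x <= b" unfolding bounded_pos by blast
 thus thesis by (intro that) auto
qed

lemma dird_bound:
 fixes f :: "'a::euclidean_space => 'b::real_normed_vector"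
 assumes "smooth_on S f" "compact K" "K <= S"
 obtains M where "M >= 0" "!!z v. z : K ==> norm (dird v f z) <= M * norm v"
proof -
 have "continuous_on (K \<times> sphere 0 1) (%p. dird (snd p) f (fst p))"
  using assms by (intro continuous_on_dird[OF assms(1)] continuous_intros) auto
 then obtain M where M': "M > 0" "!!p. p : K \<times> sphere 0 1 ==> norm (dird (snd p) f (fst p)) <= M"
  using compact_image_bound compact_Times[OF assms(2) compact_sphere] by blast
 have M: "norm (dird v f z) <= M" if "z : K" "norm v = 1" for z v
  using M'(2)[of "(z, v)"] that by simp
 show thesis
 proof (rule that[of M])
  fix z v assume z: "z : K"
  show "norm (dird v f z) <= M * norm v"
  proof (cases "v = 0")
   case False
   have "dird v f z = norm v *r dird (v /\<^sub>R norm v) f z"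
    using dird_simps(2)[OF assms(1), of z "norm v" "v /\<^sub>R norm v"] z assms(3) False by auto
   thus ?thesis using M[OF z, of "v /\<^sub>R norm v"] False by (simp add: mult.commute mult_left_mono)
  qed (use z assms dird_simps(5)[OF assms(1)] in auto)
 qed (use M' in simp)
qed

text \<open>Bounds on the finitely many axis entries suffice. The weight \<open>c\<close> carries
  the degree of homogeneity in the velocity.\<close>

lemma bilinear_bound:
 fixes be :: "'z => real ^ 'n::finite => real ^ 'n => real"
 assumes lin: "!!z b. z : T ==> linear (%a. be z a b)" "!!z a. z : T ==> linear (be z a)"
  and c: "!!z. z : T ==> c z >= 0"
  and M: "!!i j. EX M>=0. ALL z:T. abs(be z (axis i 1) (axis j 1)) <= M * c z"
 obtains M where "M >= 0" "!!z a b. z : T ==> abs(be z a b) <= M * c z * norm a * norm b"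
proof -
 obtain m where m: "!!i j. m i j >= 0" "!!i j z. z : T ==> abs(be z (axis i 1) (axis j 1)) <= m i j * c z"
  using M by metis
 show thesis
 proof (rule that[of "SUM i:UNIV. SUM j:UNIV. m i j"])
  fix z a b assume z: "z : T"
  have "be z a b = (SUM i:UNIV. SUM j:UNIV. a $ i * b $ j * be z (axis i 1) (axis j 1))"
   by (subst linear_axis_sum[OF lin(1)[OF z]], subst linear_axis_sum[OF lin(2)[OF z]])
    (simp add: sum_distrib_left mult_ac)
  also have "abs(...) <= (SUM i:UNIV. SUM j:UNIV. m i j * (c z * norm a * norm b))"
  proof (rule order_trans[OF sum_abs sum_mono], rule order_trans[OF sum_abs sum_mono])
   fix i j
   have "abs(a $ i * b $ j * be z (axis i 1) (axis j 1)) <= (norm a * norm b) * (m i j * c z)"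
    unfolding abs_mult using m z c component_le_norm_cart[of a i] component_le_norm_cart[of b j]
    by (intro mult_mono mult_nonneg_nonneg) auto
   thus "abs(a $ i * b $ j * be z (axis i 1) (axis j 1)) <= m i j * (c z * norm a * norm b)"
    by (simp add: mult_ac)
  qed
  finally show "abs(be z a b) <= (SUM i:UNIV. SUM j:UNIV. m i j) * c z * norm a * norm b"
   by (simp add: sum_distrib_right mult.assoc)
 qed (use m in "auto intro: sum_nonneg")
qed

context finsler_dom begin

lemma hom_bound:
 assumes f: "smooth_on Z f" "hom f c" and K: "compact K" "K <= U" and c: "!!a. a > 0 ==> c a >= (0::real)"
 shows "EX M>=0. ALL z:K \<times> (- {0}). abs(f z :: real) <= M * c (norm (snd z))"
proof -
 have "continuous_on (K \<times> sphere 0 1) f"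
  by (rule continuous_on_subset[OF smooth_on_continuous[OF f(1)]]) (use K in "auto simp: Z_def")
 then obtain M where M': "M > 0" "!!p. p : K \<times> sphere 0 1 ==> norm (f p) <= M"
  using compact_image_bound compact_Times[OF K(1) compact_sphere] by blast
 have M: "abs(f (x, y)) <= M" if "x : K" "norm y = 1" for x y
  using M'(2)[of "(x, y)"] that by simp
 have "abs(f (x, y)) <= M * c (norm y)" if "x : K" "y ~= 0" for x y
 proof -
  have "f (x, norm y *r (y /\<^sub>R norm y)) = c (norm y) * f (x, y /\<^sub>R norm y)"
   using that K by (intro homD[OF f(2)]) (auto simp: Z_iff)
  hence "abs(f (x, y)) = c (norm y) * \<bar>f (x, y /\<^sub>R norm y)\<bar>" using that c by (simp add: abs_mult)
  also have "... <= c (norm y) * M" using that c by (intro mult_left_mono M) auto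
  finally show ?thesis by (simp add: mult.commute)
 qed
 thus ?thesis using M' by (intro exI[of _ M]) auto
qed

text \<open>The five estimates: \<open>E\<close> is comparable to |y|^2 from both sides;
  \<open>E\<close> is uniformly convex in the velocity; \<open>E\<close> is controlled to second
  order in the base point; the momentum is Lipschitz in the base point. The constants come from
  compactness on unit vectors and scale by homogeneity.\<close>

lemma energy_bounds:
 assumes K: "compact K" "convex K" "K <= U"
 obtains c C where "c > 0" "C > 0"
  "!!x y. x : K ==> c / 2 * (norm y)\<^sup>2 <= E (x, y)"
  "!!x y. x : K ==> E (x, y) <= C / 2 * (norm y)\<^sup>2"
  "!!x v w. x : K ==> v ~= 0 ==> E (x, v) + dird (0, w - v) E (x, v) + c / 2 * (norm (w - v))\<^sup>2 <= E (x, w)"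
  "!!a u v. a : K ==> u : K ==> v ~= 0 ==>
    E (u, v) + dird (a - u, 0) E (u, v) - C * (norm v)\<^sup>2 * (norm (a - u))\<^sup>2 <= E (a, v)"
  "!!a u v ze. a : K ==> u : K ==> v ~= 0 ==>
    abs(dird (0, ze) E (a, v) - dird (0, ze) E (u, v)) <= C * norm v * norm ze * norm (a - u)"
proof (cases "K = {}")
 case False
 let ?T = "K \<times> (- {0 :: real ^ 'n})"
 have T: "?T <= Z" using K by (auto simp: Z_def)
 have c1: "!!a::real. a > 0 ==> a\<^sup>2 / a = a" "!!a::real. a > 0 ==> a\<^sup>2 / a / a = 1" by (auto simp: power2_eq_square)
 obtain M1 where M1: "M1 >= 0" "!!z a b. z : ?T ==> abs(dird (a, 0) (dird (b, 0) E) z) <= M1 * (norm (snd z))\<^sup>2 * norm a * norm b"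
 proof (rule bilinear_bound[of ?T "%z a b. dird (a, 0) (dird (b, 0) E) z" "%z. (norm (snd z))\<^sup>2"])
  show "EX M>=0. ALL z:?T. abs(dird (axis i 1, 0) (dird (axis j 1, 0) E) z) <= M * (norm (snd z))\<^sup>2" for i j :: 'n
   using hom_bound[OF smooth_E2 hom_dird(2)[OF smooth_E1 hom_dird(2)[OF smooth_E hom_E]] K(1,3)] by simp
 qed (use T linear_compose[OF lin_fst dird_linear[OF smooth_E1]] linear_compose[OF lin_fst dird_linear2[OF open_Z smooth_E]] in "auto simp: o_def")
 obtain M2 where M2: "M2 >= 0" "!!z a b. z : ?T ==> abs(dird (a, 0) (dird (0, b) E) z) <= M2 * norm (snd z) * norm a * norm b"
 proof (rule bilinear_bound[of ?T "%z a b. dird (a, 0) (dird (0, b) E) z" "%z. norm (snd z)"])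
  show "EX M>=0. ALL z:?T. abs(dird (axis i 1, 0) (dird (0, axis j 1) E) z) <= M * norm (snd z)" for i j :: 'n
   using hom_bound[OF smooth_E2 hom_dird(2)[OF smooth_E1 hom_dird(1)[OF smooth_E hom_E]] K(1,3)] by (auto simp: power2_eq_square)
 qed (use T linear_compose[OF lin_fst dird_linear[OF smooth_E1]] linear_compose[OF lin_snd dird_linear2[OF open_Z smooth_E]] in "auto simp: o_def")
 obtain M3 where M3: "M3 >= 0" "!!z. z : ?T ==> abs(E z) <= M3 * (norm (snd z))\<^sup>2"
  using hom_bound[OF smooth_E hom_E K(1,3)] by auto
 define W where "W = K \<times> sphere (0 :: real ^ 'n) 1 \<times> sphere (0 :: real ^ 'n) 1"
 define G where "G p = g (fst p, fst (snd p)) (snd (snd p)) (snd (snd p))" for p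
 have "continuous_on W G"
  unfolding W_def G_def g_def using K by (intro continuous_on_dird2[OF smooth_E open_Z] continuous_intros) (auto simp: Z_def)
 moreover have "compact W" unfolding W_def by (intro compact_Times K compact_sphere)
 moreover have "W ~= {}"
 proof -
  obtain x where "x : K" using False by blast
  hence "(x, axis undefined 1, axis undefined 1) : W" unfolding W_def by simp
  thus ?thesis by blast
 qed
 ultimately obtain p0 where p0': "p0 : W" "ALL p:W. G p0 <= G p"
  using continuous_attains_inf[of W G] by blast
 have p0: "p0 : K \<times> sphere 0 1 \<times> sphere 0 1" using p0'(1) W_def by simp
 define c where "c = g (fst p0, fst (snd p0)) (snd (snd p0)) (snd (snd p0))"
 have c: "c > 0" unfolding c_def using p0 K by (intro g_posdef) (auto simp: Z_iff)
 have gc: "c * (norm et)\<^sup>2 <= g (x, y) et et" if "x : K" "y ~= 0" for x y et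
 proof (cases "et = 0")
  case True
  have "(x, y) : Z" using that T by auto
  thus ?thesis using True linear_0[OF g_linear1, of "(x, y)"] by simp
 next
  case False
  have z: "(x, y /\<^sub>R norm y) : Z" using that T by auto
  have "g (x, y) et et = g (x, norm y *r (y /\<^sub>R norm y)) et et" using that by simp
  also have "... = g (x, y /\<^sub>R norm y) et et"
   using homD[OF hom_dird(1)[OF smooth_E1 hom_dird(1)[OF smooth_E hom_E]] z, of "norm y"] that
   by (simp add: g_def power2_eq_square)
  also have "... = g (x, y /\<^sub>R norm y) (norm et *r (et /\<^sub>R norm et)) (norm et *r (et /\<^sub>R norm et))" using False by simp
  also have "... = (norm et)\<^sup>2 * g (x, y /\<^sub>R norm y) (et /\<^sub>R norm et) (et /\<^sub>R norm et)"
   unfolding linear_cmul[OF g_linear1[OF z]] linear_cmul[OF g_linear2[OF z]] by (simp add: power2_eq_square)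
  finally have e: "g (x, y) et et = (norm et)\<^sup>2 * g (x, y /\<^sub>R norm y) (et /\<^sub>R norm et) (et /\<^sub>R norm et)" .
  have cl: "c <= g (x, y /\<^sub>R norm y) (et /\<^sub>R norm et) (et /\<^sub>R norm et)"
   using bspec[OF p0'(2), of "(x, y /\<^sub>R norm y, et /\<^sub>R norm et)"] that False unfolding c_def G_def W_def by simp
  thus ?thesis unfolding e using mult_left_mono[OF cl zero_le_power2[of "norm et"]] by (simp only: mult.commute)
 qed
 have E1: "c / 2 * (norm y)\<^sup>2 <= E (x, y)" if "x : K" for x y
 proof (cases "y = 0")
  case False
  thus ?thesis using gc[OF that False, of y] g_yy[of x y] that T by auto
 qed (use E_zero that K in auto)
 define C where "C = 2 * M3 + M1 + M2 + 1"
 have C: "C > 0" "M1 <= C" "M2 <= C" "2 * M3 <= C" using M1 M2 M3 unfolding C_def by auto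
 show thesis
 proof (rule that[OF c C(1) E1])
  fix x y assume x: "x : K"
  show "E (x, y) <= C / 2 * (norm y)\<^sup>2"
  proof (cases "y = 0")
   case False
   have "E (x, y) <= M3 * (norm y)\<^sup>2" using M3(2)[of "(x, y)"] x False by auto
   also have "... <= C / 2 * (norm y)\<^sup>2" using C by (intro mult_right_mono) auto
   finally show ?thesis .
  qed (use E_zero x K in auto)
 next
  fix x v w assume x: "x : K" and v: "v ~= (0 :: real ^ 'n)"
  have z: "(x, v) : Z" using x v T by auto
  show "E (x, v) + dird (0, w - v) E (x, v) + c / 2 * (norm (w - v))\<^sup>2 <= E (x, w)"
  proof (cases "ALL t. 0 <= t & t <= 1 --> v + t *r (w - v) ~= 0")
   case True
   hence "(x, v) + t *r (0, w - v) : Z" if "0 <= t" "t <= 1" for t using that x T by auto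
   then obtain t where t: "0 < t" "t < 1" "E ((x, v) + (0, w - v)) = E (x, v) + dird (0, w - v) E (x, v) +
     dird (0, w - v) (dird (0, w - v) E) ((x, v) + t *r (0, w - v)) / 2"
    using taylor2[OF smooth_E] by blast
   have "c * (norm (w - v))\<^sup>2 <= g (x, v + t *r (w - v)) (w - v) (w - v)"
    using gc[OF x] True t by auto
   thus ?thesis using t(3) by (simp add: g_def)
  next
   case False
   then obtain t where t: "0 <= t" "t <= 1" "v + t *r (w - v) = 0" by blast
   hence "t ~= 0" using v by auto
   define k where "k = (1 - t) / t"
   have k: "k >= 0" using t `t ~= 0` unfolding k_def by auto
   have "t *r w = (t - 1) *r v" using t(3) by (simp add: algebra_simps)
   hence "w = ((t - 1) / t) *r v" using `t ~= 0` by (metis divideR_right divide_inverse_commute scaleR_scaleR)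
   hence w: "w = - k *r v" unfolding k_def using `t ~= 0` by (simp add: minus_divide_left)
   have wv: "w - v = (- (k + 1)) *r v" unfolding w by (simp add: algebra_simps)
   have d: "dird (0, w - v) E (x, v) = - (k + 1) * (2 * E (x, v))"
    unfolding wv using dird_simps(2)[OF smooth_E z, of "- (k + 1)" "(0, v)"] euler_E[OF z] by simp
   have nwv: "norm (w - v) = (k + 1) * norm v" unfolding wv norm_scaleR using k by simp
   have nw: "norm w = k * norm v" unfolding w norm_scaleR using k by simp
   have "c / 2 * (norm (w - v))\<^sup>2 = (k\<^sup>2 + 1 + 2 * k) * (c / 2 * (norm v)\<^sup>2)"
    unfolding nwv by (simp add: power2_eq_square algebra_simps)
   also have "... = c / 2 * (norm w)\<^sup>2 + (1 + 2 * k) * (c / 2 * (norm v)\<^sup>2)"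
    unfolding nw by (simp add: power2_eq_square algebra_simps)
   also have "... <= E (x, w) + (1 + 2 * k) * E (x, v)"
    using E1[OF x, of v] E1[OF x, of w] k by (intro add_mono mult_left_mono) auto
   finally show ?thesis unfolding d by (simp add: algebra_simps)
  qed
 next
  fix a u v assume a: "a : K" "u : K" and v: "v ~= (0 :: real ^ 'n)"
  have seg: "u + t *r (a - u) : K" if "0 <= t" "t <= 1" for t
   using convexD_alt[OF K(2) a(2,1), of t] that by (simp add: algebra_simps)
  hence segZ: "(u, v) + t *r (a - u, 0) : Z" if "0 <= t" "t <= 1" for t using that v T by auto
  obtain t where t: "0 < t" "t < 1" "E ((u, v) + (a - u, 0)) = E (u, v) + dird (a - u, 0) E (u, v) +
    dird (a - u, 0) (dird (a - u, 0) E) ((u, v) + t *r (a - u, 0)) / 2"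
   using taylor2[OF smooth_E segZ] by blast
  have "abs(dird (a - u, 0) (dird (a - u, 0) E) ((u, v) + t *r (a - u, 0))) <= M1 * (norm v)\<^sup>2 * norm (a - u) * norm (a - u)"
   using M1(2)[of "(u, v) + t *r (a - u, 0)"] seg[of t] t v by simp
  also have "... <= C * (norm v)\<^sup>2 * norm (a - u) * norm (a - u)" using C by (intro mult_right_mono) auto
  finally have "- (2 * (C * (norm v)\<^sup>2 * (norm (a - u))\<^sup>2)) <= dird (a - u, 0) (dird (a - u, 0) E) ((u, v) + t *r (a - u, 0))"
   using C by (simp add: power2_eq_square mult.assoc abs_le_iff)
  thus "E (u, v) + dird (a - u, 0) E (u, v) - C * (norm v)\<^sup>2 * (norm (a - u))\<^sup>2 <= E (a, v)"
   using t(3) by simp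
  fix ze
  have "((%t. dird (0, ze) E ((u, v) + t *r (a - u, 0))) has_real_derivative
    dird (a - u, 0) (dird (0, ze) E) ((u, v) + t *r (a - u, 0))) (at t)" if "0 <= t" "t <= 1" for t
   by (rule dird_line[OF smooth_E1 segZ[OF that]])
  from MVT2[OF zero_less_one this] obtain t where t: "0 < t" "t < 1"
    "dird (0, ze) E (a, v) - dird (0, ze) E (u, v) = dird (a - u, 0) (dird (0, ze) E) ((u, v) + t *r (a - u, 0))"
   by auto
  have "abs(dird (a - u, 0) (dird (0, ze) E) ((u, v) + t *r (a - u, 0))) <= M2 * norm v * norm (a - u) * norm ze"
   using M2(2)[of "(u, v) + t *r (a - u, 0)"] seg[of t] t v by simp
  also have "... <= C * norm v * norm (a - u) * norm ze" using C by (intro mult_right_mono) auto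
  finally show "abs(dird (0, ze) E (a, v) - dird (0, ze) E (u, v)) <= C * norm v * norm ze * norm (a - u)"
   unfolding t(3) by (simp add: mult_ac)
 qed
next
 case True
 show thesis by (rule that[of 1 1]) (use True in auto)
qed

text \<open>\<open>Q\<close> is smooth off the zero section only, so the Lipschitz estimate is
  restricted to the ball of radius |e|/2 around a nonzero \<open>e\<close>, which stays away from 0.
  It is proved for |e| = 1 and rescaled by degree 2.\<close>

lemma Q_bounds:
 assumes K: "compact K" "convex K" "K <= U"
 obtains C where "C > 0" "!!x v. x : K ==> norm (Q x v) <= C * (norm v)\<^sup>2"
  "!!x x' e v v'. x : K ==> x' : K ==> e ~= 0 ==> v : cball e (norm e / 2) ==> v' : cball e (norm e / 2) ==>
   norm (Q x v - Q x' v') <= C * ((norm e)\<^sup>2 * norm (x - x') + norm e * norm (v - v'))"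
proof -
 define R where "R = {v :: real ^ 'n. 1/2 <= norm v & norm v <= 3/2}"
 have "R = cball 0 (3/2) - ball 0 (1/2)" unfolding R_def by auto
 hence R: "compact R" by (simp add: compact_diff)
 have R0: "0 ~: R" unfolding R_def by simp
 have KR: "compact (K \<times> R)" by (rule compact_Times[OF K(1) R])
 have KRZ: "K \<times> R <= Z" using R0 K by (auto simp: Z_def)
 obtain M where M: "M >= 0" "!!z u. z : K \<times> R ==> norm (dird u (%z. Q (fst z) (snd z)) z) <= M * norm u"
  using dird_bound[OF smooth_Q KR KRZ] by blast
 obtain M' where M'': "M' > 0" "!!p. p : K \<times> R ==> norm (Q (fst p) (snd p)) <= M'"
  using compact_image_bound[OF continuous_on_subset[OF smooth_on_continuous[OF smooth_Q] KRZ] KR] by blast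
 have M': "norm (Q x v) <= M'" if "x : K" "v : R" for x v
  using M''(2)[of "(x, v)"] that by simp
 have lip: "norm (Q x v - Q x' v') <= M * (norm (x - x') + norm (v - v'))"
  if "x : K" "x' : K" "norm e = 1" "v : cball e (1/2)" "v' : cball e (1/2)" for x x' e v v'
 proof -
  have sub: "cball e (1/2) <= R"
  proof
   fix w assume "w : cball e (1/2)"
   hence "norm (e - w) <= 1/2" by (simp add: dist_norm)
   thus "w : R" unfolding R_def using that(3) norm_triangle_ineq2[of e w] norm_triangle_ineq2[of w e]
    by (simp add: norm_minus_commute)
  qed
  let ?S = "K \<times> cball e (1/2)"
  have "norm ((%z. Q (fst z) (snd z)) (x, v) - (%z. Q (fst z) (snd z)) (x', v')) <= M * norm ((x, v) - (x', v'))"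
  proof (rule differentiable_bound[of ?S _ "%z u. dird u (%z. Q (fst z) (snd z)) z"])
   show "convex ?S" by (intro convex_Times K convex_cball)
   fix z assume z: "z : ?S"
   have "z : Z" using z sub KRZ by auto
   thus "((%z. Q (fst z) (snd z)) has_derivative (%u. dird u (%z. Q (fst z) (snd z)) z)) (at z within ?S)"
    using smooth_on_has_derivative[OF smooth_Q] has_derivative_at_withinI by blast
   show "onorm (%u. dird u (%z. Q (fst z) (snd z)) z) <= M"
    using z sub by (intro onorm_le M(2)) auto
  qed (use that in auto)
  also have "... <= M * (norm (x - x') + norm (v - v'))"
   using M(1) by (intro mult_left_mono) (simp add: norm_Pair_le)
  finally show ?thesis by simp
 qed
 define C where "C = M + M'"
 have C: "C > 0" "M <= C" "M' <= C" using M(1) M''(1) unfolding C_def by auto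
 show thesis
 proof (rule that[OF C(1)])
  fix x v assume x: "x : K"
  show "norm (Q x v) <= C * (norm v)\<^sup>2"
  proof (cases "v = 0")
   case False
   have q: "norm (Q x v) = (norm v)\<^sup>2 * norm (Q x (v /\<^sub>R norm v))"
    using Q_hom[of x "norm v" "v /\<^sub>R norm v"] x K False by auto
   have b: "norm (Q x (v /\<^sub>R norm v)) <= C"
    using M'[OF x, of "v /\<^sub>R norm v"] False C by (simp add: R_def)
   show ?thesis unfolding q using mult_left_mono[OF b zero_le_power2[of "norm v"]] by (simp only: mult.commute)
  qed (simp add: Q_zero)
 next
  fix x x' e v v' :: "real ^ 'n" assume a: "x : K" "x' : K" "e ~= 0" "v : cball e (norm e / 2)" "v' : cball e (norm e / 2)"
  have s: "w /\<^sub>R norm e : cball (e /\<^sub>R norm e) (1/2)" if "w : cball e (norm e / 2)" for w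
  proof -
   have n: "norm (e /\<^sub>R norm e - w /\<^sub>R norm e) = norm (e - w) / norm e"
    by (simp add: scaleR_diff_right[symmetric] divide_inverse mult.commute)
   show ?thesis unfolding mem_cball dist_norm n using that a(3) by (simp add: dist_norm field_simps)
  qed
  have q: "Q y w = (norm e)\<^sup>2 *r Q y (w /\<^sub>R norm e)" if "y : K" for y w
   using Q_hom[of y "norm e" "w /\<^sub>R norm e"] that K a(3) by auto
  have nn: "norm (v /\<^sub>R norm e - v' /\<^sub>R norm e) = norm (v - v') / norm e"
   by (simp add: scaleR_diff_right[symmetric] divide_inverse mult.commute)
  have "norm (Q x v - Q x' v') = (norm e)\<^sup>2 * norm (Q x (v /\<^sub>R norm e) - Q x' (v' /\<^sub>R norm e))"
   unfolding q[OF a(1), of v] q[OF a(2), of v'] by (simp add: scaleR_diff_right[symmetric])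
  also have "... <= (norm e)\<^sup>2 * (M * (norm (x - x') + norm (v /\<^sub>R norm e - v' /\<^sub>R norm e)))"
   by (intro mult_left_mono lip[of _ _ "e /\<^sub>R norm e"] a s) (use a in auto)
  also have "... = M * ((norm e)\<^sup>2 * norm (x - x') + norm e * norm (v - v'))"
   unfolding nn using a(3) by (simp add: field_simps power2_eq_square)
  also have "... <= C * ((norm e)\<^sup>2 * norm (x - x') + norm e * norm (v - v'))"
   using C by (intro mult_right_mono) auto
  finally show "norm (Q x v - Q x' v') <= C * ((norm e)\<^sup>2 * norm (x - x') + norm e * norm (v - v'))" .
 qed
qed

end

section \<open>Geodesics in a chart\<close>

lemma has_derivative_sandwich_zero:
 fixes h k :: "real => real"
 assumes k: "(k has_real_derivative 0) (at t within I)" and "k t = 0" "t : I"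
  and ev: "eventually (%s. 0 <= h s & h s <= k s) (at t within I)" and "h t = 0"
 shows "(h has_real_derivative 0) (at t within I)"
proof -
 have 1: "((%s. (k s - k t) / (s - t)) \<longlongrightarrow> 0) (at t within I)"
  using k by (simp add: has_field_derivative_iff)
 have "((%s. abs(h s / (s - t))) \<longlongrightarrow> 0) (at t within I)"
 proof (rule tendsto_sandwich[OF _ _ tendsto_const tendsto_rabs_zero[OF 1]])
  show "eventually (%s. abs(h s / (s - t)) <= abs((k s - k t) / (s - t))) (at t within I)"
   using ev by eventually_elim (auto simp: assms abs_divide divide_right_mono)
 qed auto
 hence "((%s. h s / (s - t)) \<longlongrightarrow> 0) (at t within I)" by (rule tendsto_rabs_zero_cancel)
 thus ?thesis
  by (simp add: has_field_derivative_iff assms)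
qed

lemma has_vector_derivative_Pair':
 assumes "(f hvd f') (at t within I)" "(h hvd h') (at t within I)"
 shows "((%x. (f x, h x)) hvd (f', h')) (at t within I)"
 using has_derivative_Pair assms unfolding has_vector_derivative_def by fastforce

lemma chain_vec:
 assumes "(u hvd u') (at t within I)" "(f has_derivative f') (at (u t))"
 shows "((%s. f (u s)) hvd f' u') (at t within I)"
 using vector_derivative_diff_chain_within[OF assms(1) has_derivative_at_withinI[OF assms(2)]] by (simp add: o_def)

lemma onorm_scaleR_vec_le:
 fixes c :: "'a::real_normed_vector"
 shows "norm c <= M ==> onorm (%h::real. h *r c) <= M"
 by (rule onorm_le) (simp add: mult.commute[of M] mult_left_mono)

lemma deriv_nonneg_finite_mono:
 fixes f :: "real => real"
 assumes "finite S" "a <= b" "continuous_on {a..b} f"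
  and d: "!!x. x : {a<..<b} - S ==> (f has_real_derivative f' x) (at x)"
  and nn: "!!x. x : {a<..<b} - S ==> 0 <= f' x"
 shows "f a <= f b"
proof -
 define F where "F x = (if x : {a<..<b} - S then f' x else 0)" for x
 have "(F has_integral (f b - f a)) {a..b}"
  by (rule fundamental_theorem_of_calculus_interior_strong[OF assms(1,2) _ assms(3)])
   (use d in "auto simp: F_def has_real_derivative_iff_has_vector_derivative[symmetric]")
 hence "0 <= f b - f a" by (rule has_integral_nonneg) (use nn in "auto simp: F_def")
 thus ?thesis by simp
qed

text \<open>D exp(K x) increases and D exp(- K x) decreases; the sign \<open>k\<close> covers times
  after and before \<open>s\<close>.\<close>

lemma gronwall_zero:
 fixes D :: "real => real"
 assumes I: "convex I" "s : I" "t : I" and d: "!!x. x : I ==> (D has_real_derivative D' x) (at x within I)"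
  and K: "!!x. x : I ==> abs(D' x) <= K * D x" and "D s = 0"
 shows "D t <= 0"
proof -
 have mono: "k * D a * exp (k * K * a) <= k * D b * exp (k * K * b)" if ab: "a : I" "b : I" "a <= b" and k: "k = 1 | k = -1" for a b k
 proof (rule deriv_nonneg_finite_mono[of "{}" a b _ "%x. (k * D' x + K * D x) * exp (k * K * x)"])
  have sub: "{a..b} <= I" using closed_segment_subset[OF ab(1,2) I(1)] ab(3) by (simp add: closed_segment_eq_real_ivl)
  have der: "((%x. k * D x * exp (k * K * x)) has_real_derivative (k * D' x + K * D x) * exp (k * K * x)) (at x within {a..b})"
   if "x : {a..b}" for x
  proof -
   have "((%x. k * D x * exp (k * K * x)) has_real_derivative
     k * D x * (exp (k * K * x) * (k * K)) + k * D' x * exp (k * K * x)) (at x within {a..b})"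
    using DERIV_subset[OF d sub] sub that by (auto intro!: derivative_eq_intros)
   thus ?thesis using k by (elim disjE) (simp_all add: algebra_simps)
  qed
  thus "continuous_on {a..b} (%x. k * D x * exp (k * K * x))"
   by (rule DERIV_continuous_on)
  fix x assume x: "x : {a<..<b} - {}"
  show "((%x. k * D x * exp (k * K * x)) has_real_derivative (k * D' x + K * D x) * exp (k * K * x)) (at x)"
   using der[of x] x by (simp add: at_within_Icc_at)
  have "abs(D' x) <= K * D x" using x by (intro K subsetD[OF sub]) auto
  thus "0 <= (k * D' x + K * D x) * exp (k * K * x)" using k by (auto simp: abs_le_iff)
 qed (use ab in auto)
 show ?thesis
  using mono[of s t "-1"] mono[of t s 1] I assms(6) by (cases "s <= t") (auto simp: mult_le_0_iff zero_le_mult_iff)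
qed

section \<open>Solutions of the geodesic equation in a chart\<close>

context finsler_dom begin

text \<open>The geodesic equation as a first order system with the velocity as a second unknown.
  Derivatives are taken within \<open>I\<close>, hence one-sided at end points.\<close>

definition sol :: "real set => (real => real ^ 'n) => (real => real ^ 'n) => bool" where
 "sol I u v \<longleftrightarrow> (ALL t:I. u t : U & (u hvd v t) (at t within I) &
   (v hvd - Q (u t) (v t)) (at t within I))"

lemma solD: "sol I u v ==> t : I ==> u t : U" "sol I u v ==> t : I ==> (u hvd v t) (at t within I)"
 "sol I u v ==> t : I ==> (v hvd - Q (u t) (v t)) (at t within I)"
 unfolding sol_def by auto

lemma sol_subset: "sol I u v ==> J <= I ==> sol J u v"
 unfolding sol_def using has_vector_derivative_within_subset by blast

lemma sol_continuous: assumes "sol I u v" shows "continuous_on I u" "continuous_on I v"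
 using solD[OF assms] has_vector_derivative_continuous continuous_on_eq_continuous_within by blast+

lemma sol_energy_derivative:
 assumes s: "sol I u v" and t: "t : I"
 shows "((%s. E (u s, v s)) has_real_derivative 0) (at t within I)"
proof (cases "v t = 0")
 case False
 hence z: "(u t, v t) : Z" using solD(1)[OF s t] by (simp add: Z_iff)
 have "((%s. E (u s, v s)) hvd dird (v t, - Q (u t) (v t)) E (u t, v t)) (at t within I)"
  using chain_vec[OF has_vector_derivative_Pair'[OF solD(2,3)[OF s t]], of E] smooth_on_has_derivative[OF smooth_E z] by fast
 moreover have "dird (v t, - Q (u t) (v t)) E (u t, v t) = 0"
 proof -
  have "(v t, - Q (u t) (v t)) = (v t, 0) - (0, Q (u t) (v t))" by simp
  hence "dird (v t, - Q (u t) (v t)) E (u t, v t) = dird (v t, 0) E (u t, v t) - dird (0, Q (u t) (v t)) E (u t, v t)"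
   using dird_simps(4)[OF smooth_E z] by metis
  thus ?thesis using dird_x_E[OF z, of "v t"] by (simp add: Q_def)
 qed
 ultimately show ?thesis by (simp add: has_real_derivative_iff_has_vector_derivative)
next
 \<comment> \<open>At zero velocity \<open>E\<close> is not known to be differentiable by smoothness
   on \<open>Z\<close>; there it is squeezed between 0 and a multiple of |v|^2, which has derivative
   0.\<close>
 case True
 obtain r where r: "r > 0" "cball (u t) r <= U" using open_U solD(1)[OF s t] open_contains_cball by metis
 obtain c C where C: "!!x y. x : cball (u t) r ==> E (x, y) <= C / 2 * (norm y)\<^sup>2"
  using energy_bounds[OF compact_cball convex_cball r(2)] by metis
 have "(u \<longlongrightarrow> u t) (at t within I)"
  using sol_continuous(1)[OF s] t by (simp add: continuous_on)
 hence ev: "eventually (%s. u s : cball (u t) r) (at t within I)"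
  using r(1) unfolding tendsto_iff by (force simp: dist_commute elim: eventually_mono)
 show ?thesis
 proof (rule has_derivative_sandwich_zero[of "%s. C / 2 * (v s \<bullet> v s)"])
  have "((%s. C / 2 * (v s \<bullet> v s)) has_derivative (%h. C / 2 * (v t \<bullet> (h *r - Q (u t) (v t)) + (h *r - Q (u t) (v t)) \<bullet> v t))) (at t within I)"
   using solD(3)[OF s t] unfolding has_vector_derivative_def by (auto intro!: derivative_eq_intros)
  thus "((%s. C / 2 * (v s \<bullet> v s)) has_real_derivative 0) (at t within I)"
   by (simp add: True Q_zero has_field_derivative_def lambda_zero)
  show "eventually (%s. 0 <= E (u s, v s) & E (u s, v s) <= C / 2 * (v s \<bullet> v s)) (at t within I)"
   using ev C by (auto elim!: eventually_mono simp: E_def power2_norm_eq_inner)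
 qed (use t True E_zero solD(1)[OF s t] in auto)
qed

lemma sol_energy_constant:
 assumes "sol I u v" "convex I" "s : I" "t : I"
 shows "E (u s, v s) = E (u t, v t)"
 using has_field_derivative_zero_constant[OF assms(2) sol_energy_derivative[OF assms(1)]] assms(3,4) by metis

lemma E_eq_0: "x : U ==> E (x, y) = 0 \<longleftrightarrow> y = 0"
 using E_zero[of x] F_pos[of x y] by (cases "y = 0") (auto simp: Z_iff E_def)

text \<open>For zero initial velocity, conservation of energy makes both solutions constant.
  Otherwise both velocities stay near \<open>e\<close> for a short time, where \<open>Q\<close> is
  Lipschitz, and Gronwall applies to the squared difference of positions and velocities.\<close>

lemma sol_unique_local:
 assumes s1: "sol I u1 v1" and s2: "sol I u2 v2" and I: "convex I" "t0 : I"
  and eq: "u1 t0 = u2 t0" "v1 t0 = v2 t0"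
 obtains de where "de > 0" "!!t. t : I ==> abs(t - t0) < de ==> u1 t = u2 t & v1 t = v2 t"
proof (cases "v1 t0 = 0")
 case True
 have c: "u t = u t0 & v t = 0" if s: "sol I u v" "v t0 = 0" "t : I" for u v t
 proof -
  have v: "v t = 0" if "t : I" for t
   using sol_energy_constant[OF s(1) I(1) that I(2)] E_zero E_eq_0 solD(1)[OF s(1)] that I s by metis
  have "(u hvd 0) (at t within I)" if "t : I" for t
   using solD(2)[OF s(1) that] v[OF that] by simp
  from has_vector_derivative_zero_constant[OF I(1) this] show ?thesis using v s(3) I by metis
 qed
 show thesis
  by (rule that[of 1]) (use c[OF s1] c[OF s2] True eq in auto)
next
 case False
 define e where "e = v1 t0"
 have e: "e ~= 0" using False e_def by simp
 obtain r where r: "r > 0" "cball (u1 t0) r <= U" using open_U solD(1)[OF s1 I(2)] open_contains_cball by metis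
 obtain C where C: "C > 0" "!!x x' e v v'. x : cball (u1 t0) r ==> x' : cball (u1 t0) r ==> e ~= 0 ==>
   v : cball e (norm e / 2) ==> v' : cball e (norm e / 2) ==>
   norm (Q x v - Q x' v') <= C * ((norm e)\<^sup>2 * norm (x - x') + norm e * norm (v - v'))"
  using Q_bounds[OF compact_cball convex_cball r(2)] by metis
 have near: "EX de>0. ALL t:I. abs(t - t0) < de --> u t : cball (u1 t0) r & v t : cball e (norm e / 2)"
  if thats: "sol I u v" "u t0 = u1 t0" "v t0 = e" for u v
 proof -
  obtain d1 where "d1 > 0" "ALL t:I. dist t t0 < d1 --> dist (u t) (u t0) < r"
   using sol_continuous(1)[OF thats(1)] I(2) r(1) unfolding continuous_on_iff by blast
  moreover obtain d2 where "d2 > 0" "ALL t:I. dist t t0 < d2 --> dist (v t) (v t0) < norm e / 2"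
   using sol_continuous(2)[OF thats(1)] I(2) e unfolding continuous_on_iff by (metis half_gt_zero zero_less_norm_iff)
  ultimately show ?thesis using that
   by (intro exI[of _ "min d1 d2"]) (force simp: dist_real_def dist_commute)
 qed
 obtain d1 where d1: "d1 > 0" "ALL t:I. abs(t - t0) < d1 --> u1 t : cball (u1 t0) r & v1 t : cball e (norm e / 2)"
  using near[OF s1] e_def by auto
 obtain d2 where d2: "d2 > 0" "ALL t:I. abs(t - t0) < d2 --> u2 t : cball (u1 t0) r & v2 t : cball e (norm e / 2)"
  using near[OF s2] e_def eq by auto
 define J where "J = I Int ball t0 (min d1 d2)"
 have J: "convex J" "t0 : J" "J <= I" using I d1 d2 unfolding J_def by (auto intro: convex_Int)
 define a b where "a t = u1 t - u2 t" and "b t = v1 t - v2 t" for t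
 define q where "q t = - Q (u1 t) (v1 t) - - Q (u2 t) (v2 t)" for t
 let ?K = "1 + C * (norm e)\<^sup>2 + 2 * C * norm e"
 have D: "a t \<bullet> a t + b t \<bullet> b t <= 0" if t: "t : J" for t
 proof (rule gronwall_zero[OF J(1,2) t, where K="?K" and D'="%t. 2 * (a t \<bullet> b t + b t \<bullet> q t)"])
  fix x assume x: "x : J"
  have "(a hvd b x) (at x within J)" "(b hvd q x) (at x within J)"
   using has_vector_derivative_diff[OF solD(2)[OF sol_subset[OF s1 J(3)] x] solD(2)[OF sol_subset[OF s2 J(3)] x]]
    has_vector_derivative_diff[OF solD(3)[OF sol_subset[OF s1 J(3)] x] solD(3)[OF sol_subset[OF s2 J(3)] x]]
   by (simp_all add: a_def[abs_def] b_def[abs_def] q_def)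
  thus "((%t. a t \<bullet> a t + b t \<bullet> b t) has_real_derivative 2 * (a x \<bullet> b x + b x \<bullet> q x)) (at x within J)"
   unfolding has_vector_derivative_def has_field_derivative_def
   by (auto intro!: derivative_eq_intros simp: inner_commute algebra_simps)
  have "norm (q x) <= C * ((norm e)\<^sup>2 * norm (a x) + norm e * norm (b x))"
   using C(2)[of "u1 x" "u2 x" e "v1 x" "v2 x"] d1(2) d2(2) x e
   unfolding J_def q_def a_def b_def by (auto simp: norm_minus_commute dist_real_def abs_minus_commute)
  hence "norm (b x) * norm (q x) <= C * (norm e)\<^sup>2 * (norm (a x) * norm (b x)) + C * norm e * (norm (b x))\<^sup>2"
   using mult_left_mono[of "norm (q x)" _ "norm (b x)"] by (fastforce simp: algebra_simps power2_eq_square)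
  hence "\<bar>a x \<bullet> b x + b x \<bullet> q x\<bar> <= (1 + C * (norm e)\<^sup>2) * (norm (a x) * norm (b x)) + C * norm e * (norm (b x))\<^sup>2"
   using Cauchy_Schwarz_ineq2[of "a x" "b x"] Cauchy_Schwarz_ineq2[of "b x" "q x"] by (simp add: algebra_simps abs_le_iff)
  moreover have "(1 + C * (norm e)\<^sup>2) * (2 * norm (a x) * norm (b x)) <= (1 + C * (norm e)\<^sup>2) * ((norm (a x))\<^sup>2 + (norm (b x))\<^sup>2)"
   using C(1) by (intro mult_left_mono sum_squares_bound) auto
  moreover have "0 <= C * norm e * (norm (a x))\<^sup>2" using C(1) by simp
  ultimately show "\<bar>2 * (a x \<bullet> b x + b x \<bullet> q x)\<bar> <= ?K * (a x \<bullet> a x + b x \<bullet> b x)"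
   unfolding power2_norm_eq_inner[symmetric] abs_mult by (simp add: algebra_simps)
 qed (simp add: a_def b_def eq)
 have "u1 t = u2 t & v1 t = v2 t" if "t : J" for t
  using D[OF that] inner_ge_zero[of "a t"] inner_ge_zero[of "b t"] inner_eq_zero_iff[of "a t"] inner_eq_zero_iff[of "b t"]
  unfolding a_def b_def by (smt (verit) right_minus_eq)
 thus thesis using d1(1) d2(1) by (intro that[of "min d1 d2"]) (auto simp: J_def dist_real_def abs_minus_commute)
qed

text \<open>The velocity of the solution is the fixed point of a contraction on bounded continuous functions.\<close>

lemma bvp:
 assumes K: "compact K" "convex K" "K <= U"
 obtains de where "de > 0"
  "!!p q. norm (q - p) <= de ==> cball p (2 * norm (q - p)) <= K ==>
    EX u v. sol {0..1} u v & u 0 = p & u 1 = q &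
     (ALL t:{0..1}. u t : cball p (2 * norm (q - p)) & norm (v t - (q - p)) <= norm (q - p) / 2)"
proof -
 obtain C where C: "C > 0" "!!x v. x : K ==> norm (Q x v) <= C * (norm v)\<^sup>2"
  "!!x x' e v v'. x : K ==> x' : K ==> e ~= 0 ==> v : cball e (norm e / 2) ==> v' : cball e (norm e / 2) ==>
   norm (Q x v - Q x' v') <= C * ((norm e)\<^sup>2 * norm (x - x') + norm e * norm (v - v'))"
  using Q_bounds[OF K] by metis
 \<comment> \<open>The bound 9 C |e| <= 1 serves twice. The correction of the velocity is at most 2
   (9/4) C |e|^2 <= |e|/2, so the iteration preserves \<open>S\<close>; and its Lipschitz constant
   is at most 4 C |e| <= 1/2.\<close>
 define de where "de = min 1 (1 / (9 * C))"
 have de: "de > 0" "de <= 1" "9 * C * de <= 1"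
  using C(1) unfolding de_def by (auto simp: min_def field_simps)
 show thesis
 proof (rule that[OF de(1)])
  fix p q assume pq: "norm (q - p) <= de" "cball p (2 * norm (q - p)) <= K"
  define e where "e = q - p"
  show "EX u v. sol {0..1} u v & u 0 = p & u 1 = q &
     (ALL t:{0..1}. u t : cball p (2 * norm (q - p)) & norm (v t - (q - p)) <= norm (q - p) / 2)"
  proof (cases "e = 0")
   case True
   hence "p : U" "q = p" using pq K(3) unfolding e_def by auto
   thus ?thesis
    by (intro exI[of _ "%_. p"] exI[of _ "%_. 0"]) (auto simp: sol_def Q_zero)
  next
   case False
   have ed: "norm e <= de" "norm e > 0" using pq False unfolding e_def by auto
   have e9: "9 * C * norm e <= 1"
    using ed(1) de(3) C(1) by (intro order_trans[OF mult_left_mono[of "norm e" de "9 * C"]]) auto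
   define S where "S = PiC UNIV (%_::real. cball e (norm e / 2))"
   define u where "u w t = p + integral {0..t} (apply_bcontfun w)" for w :: "real \<Rightarrow>\<^sub>C (real ^ 'n)" and t :: real
   define f where "f w t = - Q (u w t) (apply_bcontfun w t)" for w :: "real \<Rightarrow>\<^sub>C (real ^ 'n)" and t :: real
   define H where "H w t = integral {0..t} (f w)" for w t
   \<comment> \<open>Subtracting the mean of \<open>H\<close> makes the mean velocity equal to
     \<open>e\<close> = q - p. The end condition u(1) = q is thus built into the map.\<close>
   define h where "h w t = e + H w t - integral {0..1} (H w)" for w t
   \<comment> \<open>The complete space consists of bounded continuous functions on the whole line,
     so the new velocity is continued constantly outside [0,1] by \<open>clamp\<close>.\<close>
   define Ph where "Ph w = (SOME k :: real \<Rightarrow>\<^sub>C (real ^ 'n). ALL t. apply_bcontfun k t = h w (clamp 0 1 t))" for w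
   have wS: "apply_bcontfun w t : cball e (norm e / 2)" if "w : S" for w t
    using that unfolding S_def mem_PiC_iff by auto
   have wn: "norm (apply_bcontfun w t) <= 3/2 * norm e" "apply_bcontfun w t ~= 0" if "w : S" for w t
    using wS[OF that, of t] ed(2) norm_triangle_ineq2[of "apply_bcontfun w t" e]
    by (auto simp: dist_norm norm_minus_commute)
   have wc: "continuous_on T (apply_bcontfun w)" for w :: "real \<Rightarrow>\<^sub>C (real ^ 'n)" and T by (rule continuous_on_apply_bcontfun)
   have wi: "apply_bcontfun w integrable_on {a..b}" for w :: "real \<Rightarrow>\<^sub>C (real ^ 'n)" and a b :: real by (rule integrable_continuous_real[OF wc])
   have ub: "norm (u w t - p) <= 3/2 * norm e" if "w : S" "t : {0..1}" for w t
   proof -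
    have "norm (integral {0..t} (apply_bcontfun w)) <= (3/2 * norm e) * (t - 0)"
     using that wn by (intro integral_bound wc) auto
    also have "... <= 3/2 * norm e" using that(2) ed(2) by (simp add: mult_left_le)
    finally show ?thesis by (simp add: u_def)
   qed
   have uK: "u w t : cball p (2 * norm e)" "u w t : K" "u w t : U" if "w : S" "t : {0..1}" for w t
   proof -
    show 1: "u w t : cball p (2 * norm e)" using ub[OF that] norm_ge_zero[of e] unfolding mem_cball dist_norm norm_minus_commute[of p] by linarith
    show "u w t : K" using 1 pq(2) unfolding e_def by blast
    thus "u w t : U" using K(3) by blast
   qed
   have ud: "(u w hvd apply_bcontfun w t) (at t within {0..1})" if "t : {0..1}" for w t
   proof -
    have "((%t. p + integral {0..t} (apply_bcontfun w)) hvd 0 + apply_bcontfun w t) (at t within {0..1})"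
     by (intro derivative_intros integral_has_vector_derivative wc that)
    thus ?thesis by (simp add: u_def[abs_def])
   qed
   have uc: "continuous_on {0..1} (u w)" for w
    using ud has_vector_derivative_continuous continuous_on_eq_continuous_within by blast
   have fc: "continuous_on {0..1} (f w)" if "w : S" for w
   proof -
    have "continuous_on {0..1} (%t. (%z. Q (fst z) (snd z)) (u w t, apply_bcontfun w t))"
     by (rule continuous_on_compose2[OF smooth_on_continuous[OF smooth_Q]])
      (use uK[OF that] wn[OF that] in "auto simp: Z_iff intro!: continuous_intros uc")
    thus ?thesis unfolding f_def[abs_def] by (simp add: continuous_on_minus)
   qed
   have fb: "norm (f w t) <= C * (9/4) * (norm e)\<^sup>2" if "w : S" "t : {0..1}" for w t
   proof -
    have "norm (f w t) <= C * (norm (apply_bcontfun w t))\<^sup>2" unfolding f_def using C(2)[OF uK(2)[OF that]] by simp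
    also have "... <= C * (3/2 * norm e)\<^sup>2" using wn[OF that(1)] C(1) by (intro mult_left_mono power_mono) auto
    finally show ?thesis by (simp add: power2_eq_square)
   qed
   have Hd: "(H w hvd f w t) (at t within {0..1})" if "w : S" "t : {0..1}" for w t
    unfolding H_def[abs_def] by (intro integral_has_vector_derivative fc that)
   have Hc: "continuous_on {0..1} (H w)" if "w : S" for w
    using Hd[OF that] has_vector_derivative_continuous continuous_on_eq_continuous_within by blast
   have Hb: "norm (H w t - H w' t) <= B" if "w : S" "w' : S" "t : {0..1}" "!!s. s : {0..1} ==> norm (f w s - f w' s) <= B" for w w' t B
   proof -
    have c: "continuous_on {0..t} (f w)" "continuous_on {0..t} (f w')"
     by (rule continuous_on_subset[OF fc]; use that in auto)+
    hence "H w t - H w' t = integral {0..t} (%s. f w s - f w' s)"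
     unfolding H_def by (intro integral_diff[symmetric] integrable_continuous_real)
    moreover have "norm ... <= B * (t - 0)"
     using that by (intro integral_bound continuous_intros c) auto
    moreover have "B * (t - 0) <= B" using that(3) order_trans[OF norm_ge_zero that(4)[of 0]] by (simp add: mult_left_le)
    ultimately show ?thesis by simp
   qed
   have Hb0: "norm (H w t) <= C * (9/4) * (norm e)\<^sup>2" if "w : S" "t : {0..1}" for w t
   proof -
    have "norm (integral {0..t} (f w)) <= (C * (9/4) * (norm e)\<^sup>2) * (t - 0)"
     using that fb by (intro integral_bound continuous_on_subset[OF fc]) auto
    also have "... <= C * (9/4) * (norm e)\<^sup>2" using that(2) C(1) by (intro mult_left_le) auto
    finally show ?thesis by (simp add: H_def)
   qed
   have hc: "continuous_on {0..1} (h w)" if "w : S" for w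
    unfolding h_def[abs_def] by (intro continuous_intros Hc that)
   have Ph: "apply_bcontfun (Ph w) t = h w (clamp 0 1 t)" if wS': "w : S" for w t
   proof -
    obtain k :: "real \<Rightarrow>\<^sub>C (real ^ 'n)" where "!!t. apply_bcontfun k t = h w (clamp 0 1 t)"
     using continuous_on_cbox_bcontfunE[of 0 1 "h w"] hc[OF wS'] by (metis cbox_interval)
    from this show ?thesis unfolding Ph_def using someI[of "%k. ALL t. apply_bcontfun k t = h w (clamp 0 1 t)" k] by blast
   qed
   have cl: "clamp 0 1 t : {0..1}" for t :: real using clamp_in_interval[of 0 1 t] by simp
   have PhS: "Ph w : S" if "w : S" for w
    unfolding S_def mem_PiC_iff
   proof (intro Pi_I)
    fix t
    have "norm (H w (clamp 0 1 t)) <= C * (9/4) * (norm e)\<^sup>2" by (rule Hb0[OF that cl])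
    moreover have "norm (integral {0..1} (H w)) <= (C * (9/4) * (norm e)\<^sup>2) * (1 - 0)"
     by (intro integral_bound Hc that) (use Hb0[OF that] in auto)
    moreover have "C * (9/4) * (norm e)\<^sup>2 * 2 <= norm e / 2"
     using mult_right_mono[OF e9, of "norm e"] by (simp add: power2_eq_square algebra_simps)
    ultimately have "norm (H w (clamp 0 1 t) - integral {0..1} (H w)) <= norm e / 2"
     using norm_triangle_ineq4[of "H w (clamp 0 1 t)" "integral {0..1} (H w)"] by simp
    thus "apply_bcontfun (Ph w) t : cball e (norm e / 2)"
     unfolding Ph[OF that] h_def by (simp add: dist_norm norm_minus_commute algebra_simps)
   qed
   have lip: "dist (Ph w) (Ph w') <= 1/2 * dist w w'" if w: "w : S" "w' : S" for w w'
   proof (rule dist_bound)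
    fix t
    have wd: "norm (apply_bcontfun w s - apply_bcontfun w' s) <= dist w w'" for s
     using dist_bounded[of w s w'] by (simp add: dist_norm)
    have uu: "norm (u w s - u w' s) <= dist w w'" if "s : {0..1}" for s
    proof -
     have "u w s - u w' s = integral {0..s} (%r. apply_bcontfun w r - apply_bcontfun w' r)"
      unfolding u_def by (subst integral_diff[OF wi wi]) simp
     moreover have "norm ... <= dist w w' * (s - 0)"
      using that wd by (intro integral_bound continuous_intros) auto
     moreover have "dist w w' * (s - 0) <= dist w w'" using that by (simp add: mult_left_le)
     ultimately show ?thesis by simp
    qed
    have B: "norm (f w s - f w' s) <= 2 * C * norm e * dist w w'" if "s : {0..1}" for s
    proof -
     have "norm (f w s - f w' s) = norm (Q (u w s) (apply_bcontfun w s) - Q (u w' s) (apply_bcontfun w' s))"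
      unfolding f_def by (simp add: norm_minus_commute)
     also have "... <= C * ((norm e)\<^sup>2 * norm (u w s - u w' s) + norm e * norm (apply_bcontfun w s - apply_bcontfun w' s))"
      by (intro C(3) uK w wS that False)
     also have "... <= C * ((norm e) * dist w w' + norm e * dist w w')"
     proof (intro mult_left_mono add_mono mult_mono wd uu that)
      show "(norm e)\<^sup>2 <= norm e" using ed de(2) by (simp add: power2_eq_square mult_left_le)
     qed (use C in auto)
     finally show ?thesis by (simp add: algebra_simps)
    qed
    have "norm (H w (clamp 0 1 t) - H w' (clamp 0 1 t)) <= 2 * C * norm e * dist w w'"
     by (rule Hb[OF w cl B])
    moreover have "norm (integral {0..1} (H w) - integral {0..1} (H w')) <= (2 * C * norm e * dist w w') * (1 - 0)"
     unfolding integral_diff[OF integrable_continuous_real[OF Hc[OF w(1)]] integrable_continuous_real[OF Hc[OF w(2)]], symmetric]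
     by (intro integral_bound continuous_intros Hc w) (use Hb[OF w _ B] in auto)
    ultimately have "norm (h w (clamp 0 1 t) - h w' (clamp 0 1 t)) <= 4 * C * norm e * dist w w'"
     using norm_triangle_ineq4[of "H w (clamp 0 1 t) - H w' (clamp 0 1 t)" "integral {0..1} (H w) - integral {0..1} (H w')"]
     unfolding h_def by (simp add: algebra_simps)
    also have "... <= 1/2 * dist w w'" using e9 by (intro mult_right_mono) auto
    finally show "dist (apply_bcontfun (Ph w) t) (apply_bcontfun (Ph w') t) <= 1/2 * dist w w'"
     unfolding Ph[OF w(1)] Ph[OF w(2)] by (simp add: dist_norm)
   qed
   have "complete S" unfolding S_def by (auto intro!: closed_PiC simp: complete_eq_closed)
   moreover have "const_bcontfun e : S" unfolding S_def mem_PiC_iff by auto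
   hence "S ~= {}" by blast
   ultimately have "EX! w:S. Ph w = w"
    by (intro Banach_fix[of S "1/2" Ph] lip) (use PhS in auto)
   then obtain w where w: "w : S" "Ph w = w" by blast
   have wh: "apply_bcontfun w t = h w t" if "t : {0..1}" for t
    using Ph[OF w(1), of t] w(2) clamp_cancel_cbox[of t 0 1] that by simp
   have vd: "(apply_bcontfun w hvd - Q (u w t) (apply_bcontfun w t)) (at t within {0..1})" if "t : {0..1}" for t
   proof -
    have "(h w hvd 0 + f w t - 0) (at t within {0..1})"
     unfolding h_def[abs_def] by (intro derivative_intros Hd w that)
    hence "(apply_bcontfun w hvd f w t) (at t within {0..1})"
     using has_vector_derivative_transform[OF that wh] by simp
    thus ?thesis by (simp add: f_def)
   qed
   have "u w 1 = p + integral {0..1} (h w)"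
    unfolding u_def using integral_cong[of "{0..1}" "apply_bcontfun w" "h w"] wh by simp
   also have "integral {0..1} (h w) = e"
   proof -
    have "integral {0..1} (h w) = integral {0..1} (%t. (e - integral {0..1} (H w)) + H w t)"
     unfolding h_def[abs_def] by (simp add: algebra_simps)
    also have "... = integral {0..1} (%t::real. e - integral {0..1} (H w)) + integral {0..1} (H w)"
     by (intro integral_add integrable_continuous_real continuous_intros Hc w)
    finally show ?thesis by simp
   qed
   finally have "u w 1 = q" by (simp add: e_def)
   moreover have "u w 0 = p" by (simp add: u_def)
   moreover have "sol {0..1} (u w) (apply_bcontfun w)"
    unfolding sol_def using ud vd uK[OF w(1)] by blast
   moreover have "norm (apply_bcontfun w t - (q - p)) <= norm (q - p) / 2" for t
    using wS[OF w(1), of t] unfolding e_def by (simp add: dist_norm norm_minus_commute)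
   ultimately show ?thesis
    using uK(1)[OF w(1)] unfolding e_def by blast
  qed
 qed
qed

end

section \<open>Local minimality of short geodesics\<close>

lemma deriv_nonneg_finite_const:
 fixes f :: "real => real"
 assumes "finite S" "continuous_on {a..b} f"
  and d: "!!x. x : {a<..<b} - S ==> (f has_real_derivative f' x) (at x)"
  and nn: "!!x. x : {a<..<b} - S ==> 0 <= f' x" and eq: "f b <= f a" and x: "x : {a<..<b} - S"
 shows "f' x = 0"
proof -
 have mono: "f s <= f t" if "a <= s" "s <= t" "t <= b" for s t
  by (rule deriv_nonneg_finite_mono[OF assms(1) that(2) continuous_on_subset[OF assms(2)] d nn]) (use that in auto)
 have fa: "f y = f a" if "y : {a<..<b}" for y
  using mono[of a y] mono[of y b] that eq by auto
 have "(f has_real_derivative 0) (at x)"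
 proof (rule has_field_derivative_transform_within_open[of "%_. f a" 0 x "{a<..<b}"])
  show "x : {a<..<b}" using x by blast
  show "f a = f y" if "y : {a<..<b}" for y using fa[OF that] by simp
 qed auto
 thus ?thesis using d[OF x] DERIV_unique by blast
qed

text \<open>Product rule for a derivative whose direction and base point both move with
  \<open>t\<close>.\<close>

lemma dird_var_derivative:
 fixes f :: "'a::euclidean_space => real"
 assumes f: "smooth_on S f" "open S" "z t : S"
  and z: "(z hvd z') (at t within I)" and h: "(h hvd h') (at t within I)"
  and zS: "!!s. s : I ==> z s : S"  "t : I"
 shows "((%s. dird (h s) f (z s)) hvd dird h' f (z t) + dird z' (dird (h t) f) (z t)) (at t within I)"
proof -
 have 1: "((%s. SUM b:Basis. (h s \<bullet> b) * dird b f (z s)) has_vector_derivative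
   (SUM b:Basis. (h t \<bullet> b) * dird z' (dird b f) (z t) + (h' \<bullet> b) * dird b f (z t))) (at t within I)"
 proof (rule has_vector_derivative_sum)
  fix b :: 'a assume "b : Basis"
  have "((%s. h s \<bullet> b) hvd h' \<bullet> b) (at t within I)"
   using bounded_linear.has_vector_derivative[OF bounded_linear_inner_left h] .
  moreover have "((%s. dird b f (z s)) hvd dird z' (dird b f) (z t)) (at t within I)"
   by (rule chain_vec[OF z smooth_on_has_derivative[OF smooth_on_dird[OF f(1)] f(3)]])
  ultimately show "((%s. (h s \<bullet> b) * dird b f (z s)) has_vector_derivative
    (h t \<bullet> b) * dird z' (dird b f) (z t) + (h' \<bullet> b) * dird b f (z t)) (at t within I)"
   by (rule has_vector_derivative_mult)
 qed
 have 2: "dird z' (dird (h t) f) (z t) = (SUM b:Basis. (h t \<bullet> b) * dird z' (dird b f) (z t))"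
  using linear_sum[OF dird_linear2[OF f(2,1,3)], of z' "%b. (h t \<bullet> b) *r b" Basis] linear_cmul[OF dird_linear2[OF f(2,1,3)]]
  by (simp add: euclidean_representation)
 have 3: "dird k f (z s) = (SUM b:Basis. (k \<bullet> b) * dird b f (z s))" if "s : I" for k s
  using dird_basis[OF f(1) zS(1)[OF that], of k] by simp
 have 4: "dird h' f (z t) + dird z' (dird (h t) f) (z t) = (SUM b:Basis. (h t \<bullet> b) * dird z' (dird b f) (z t) + (h' \<bullet> b) * dird b f (z t))"
  unfolding 2 using 3[OF zS(2), of h'] by (simp add: sum.distrib)
 show ?thesis unfolding 4 by (rule has_vector_derivative_transform[OF zS(2) 3 1])
qed

context finsler_dom begin

lemma E_nonneg: "0 <= E z" by (simp add: E_def)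

text \<open>The Euler-Lagrange equation along a geodesic, tested against a moving vector: the
  momentum p satisfies p' = dE/dx.\<close>

lemma sol_momentum_derivative:
 assumes s: "sol I u v" and t: "t : I" and v: "!!s. s : I ==> v s ~= 0"
  and h: "(h hvd h') (at t within I)"
 shows "((%s. dird (0, h s) E (u s, v s)) has_vector_derivative
   dird (0, h') E (u t, v t) + dird (h t, 0) E (u t, v t)) (at t within I)"
proof -
 have z: "(u s, v s) : Z" if "s : I" for s using solD(1)[OF s that] v[OF that] by (simp add: Z_iff)
 have "((%s. dird (0, h s) E (u s, v s)) has_vector_derivative
   dird (0, h') E (u t, v t) + dird (v t, - Q (u t) (v t)) (dird (0, h t) E) (u t, v t)) (at t within I)"
  by (rule dird_var_derivative[OF smooth_E open_Z])
   (use z t in "auto intro!: has_vector_derivative_Pair' solD(2,3)[OF s] h")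
 moreover have "dird (v t, - Q (u t) (v t)) (dird (0, h t) E) (u t, v t) = dird (h t, 0) E (u t, v t)"
 proof -
  have "(v t, - Q (u t) (v t)) = (v t, 0) - (0, Q (u t) (v t))" by simp
  hence "dird (v t, - Q (u t) (v t)) (dird (0, h t) E) (u t, v t) = dird (v t, 0) (dird (0, h t) E) (u t, v t) - g (u t, v t) (Q (u t) (v t)) (h t)"
   unfolding g_def using dird_simps(4)[OF smooth_E1 z[OF t]] by metis
  thus ?thesis using g_Q[OF z[OF t]] by simp
 qed
 ultimately show ?thesis by simp
qed

text \<open>A calibration argument. The term \<open>c (t - 1/2) |w - u|\<^sup>2\<close> in \<open>\<Psi>\<close> vanishes at both ends, while its derivative
  supplies the \<open>c |w - u|\<^sup>2\<close> that absorbs the second order errors.\<close>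

lemma locmin:
 assumes K: "compact K" "convex K" "K <= U"
 obtains ep where "ep > 0"
  "!!u v w w' S m. sol {0..1} u v ==> (!!t. t : {0..1} ==> u t : K & norm (v t) <= ep) ==>
   continuous_on {0..1} w ==> w ` {0..1} <= K ==> w 0 = u 0 ==> w 1 = u 1 ==> finite S ==>
   (!!t. t : {0<..<1} - S ==> (w hvd w' t) (at t) & E (w t, w' t) <= m) ==>
   E (u 0, v 0) <= m & (v 0 ~= 0 --> E (u 0, v 0) = m --> (ALL t:{0..1}. w t = u t))"
proof -
 obtain c C where c: "c > 0" "C > 0"
  and E0: "!!x y. x : K ==> c / 2 * (norm y)\<^sup>2 <= E (x, y)"
  and E1: "!!x y. x : K ==> E (x, y) <= C / 2 * (norm y)\<^sup>2"
  and E2: "!!x v w. x : K ==> v ~= 0 ==> E (x, v) + dird (0, w - v) E (x, v) + c / 2 * (norm (w - v))\<^sup>2 <= E (x, w)"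
  and E3: "!!a u v. a : K ==> u : K ==> v ~= 0 ==>
    E (u, v) + dird (a - u, 0) E (u, v) - C * (norm v)\<^sup>2 * (norm (a - u))\<^sup>2 <= E (a, v)"
  and E4: "!!a u v ze. a : K ==> u : K ==> v ~= 0 ==>
    abs(dird (0, ze) E (a, v) - dird (0, ze) E (u, v)) <= C * norm v * norm ze * norm (a - u)"
  by (rule energy_bounds[OF K]) (rule that, assumption+)
 \<comment> \<open>C ep <= c/8 bounds the two errors caused by evaluating the energy at
   \<open>w t\<close> instead of \<open>u t\<close>: the second order term and the change of the
   momentum.\<close>
 define ep where "ep = min 1 (c / (8 * C))"
 have ep: "ep > 0" "ep <= 1" "C * ep <= c / 8"
  using c unfolding ep_def by (auto simp: min_def field_simps)
 show thesis
 proof (rule that[OF ep(1)])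
  fix u v w w' S m
  assume s: "sol {0..1} u v" and uK: "!!t. t : {0..1} ==> u t : K & norm (v t) <= ep"
   and w: "continuous_on {0..1} w" "w ` {0..1} <= K" "w 0 = u 0" "w 1 = u 1" and S: "finite S"
   and wd: "!!t. t : {0<..<1::real} - S ==> (w hvd w' t) (at t) & E (w t, w' t) <= m"
  have wK: "w t : K" if "t : {0..1}" for t using w(2) that by blast
  have e: "E (u t, v t) = E (u 0, v 0)" if "t : {0..1}" for t
   using sol_energy_constant[OF s _ that, of 0] by simp
  \<comment> \<open>The equality case is obtained off the finite set \<open>S\<close> and extends by
    continuity.\<close>
  have dense: "w t = u t" if t: "t : {0..1}" and eq: "!!t. t : {0<..<1} - S ==> w t = u t" for t
  proof -
   have "t islimpt {0<..<1}" using t islimpt_greaterThanLessThan1[of 0 "1::real"] islimpt_greaterThanLessThan2[of 0 "1::real"]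
     interior_limit_point[of t "{0<..<1}"]
    by (cases "t = 0"; cases "t = 1") (simp_all add: interior_open less_le)
   hence "t islimpt S Un ({0<..<1} - S)" by (rule islimpt_subset) auto
   hence "t : closure ({0<..<1} - S)" using islimpt_Un_finite[OF S] unfolding closure_def by blast
   moreover have "closure ({0<..<1} - S) <= {0..1}" by (rule closure_minimal) auto
   hence "continuous_on (closure ({0<..<1} - S)) (%t. w t - u t)"
    by (intro continuous_intros continuous_on_subset[OF w(1)] continuous_on_subset[OF sol_continuous(1)[OF s]])
   ultimately show ?thesis using continuous_constant_on_closure[of "{0<..<1} - S" "%t. w t - u t" 0 t] eq by simp
  qed
  show "E (u 0, v 0) <= m & (v 0 ~= 0 --> E (u 0, v 0) = m --> (ALL t:{0..1}. w t = u t))"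
  proof (cases "v 0 = 0")
   case True
   have "infinite ({0<..<1::real} - S)" using S by (simp add: infinite_Ioo)
   then obtain t where "t : {0<..<1} - S" by (metis finite.emptyI ex_in_conv)
   hence "0 <= m" using wd[of t] order_trans[OF E_nonneg] by blast
   thus ?thesis using True E_zero solD(1)[OF s, of 0] by simp
  next
   case False
   hence vn: "v t ~= 0" if "t : {0..1}" for t
    using e[OF that] E_eq_0 solD(1)[OF s] that by (metis atLeastAtMost_iff order_refl zero_le_one)
   define h where "h t = w t - u t" for t
   define Sf where "Sf t = dird (0, h t) E (u t, v t) - c * (t - 1/2) * (h t \<bullet> h t)" for t
   \<comment> \<open>\<open>\<Psi>\<close> vanishes at 0 and equals m - E(u 0, v 0) at 1, so the
     claim is its monotonicity, and equality forces its derivative \<open>D\<close> to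
     vanish.\<close>
   define \<Psi> where "\<Psi> t = t * (m - E (u 0, v 0)) - Sf t" for t
   define D where "D t = (m - E (u 0, v 0)) - (dird (0, w' t - v t) E (u t, v t) + dird (h t, 0) E (u t, v t)
     - (c * (h t \<bullet> h t) + c * (t - 1/2) * (2 * (h t \<bullet> (w' t - v t)))))" for t
   have hd: "(h hvd w' t - v t) (at t)" if "t : {0<..<1} - S" for t
   proof -
    have "(u hvd v t) (at t)"
     using solD(2)[OF s, of t] that by (simp add: at_within_Icc_at)
    thus ?thesis unfolding h_def[abs_def] using wd[OF that] by (auto intro: has_vector_derivative_diff)
   qed
   have \<Psi>d: "(\<Psi> has_real_derivative D t) (at t)" if t: "t : {0<..<1} - S" for t
   proof -
    have ti: "t : {0..1}" "at t within {0..1} = at t" using t by (auto simp: at_within_Icc_at)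
    have 1: "((%t. dird (0, h t) E (u t, v t)) has_real_derivative
      dird (0, w' t - v t) E (u t, v t) + dird (h t, 0) E (u t, v t)) (at t)"
     using sol_momentum_derivative[OF s ti(1) vn, of h "w' t - v t"] hd[OF t]
     unfolding ti(2) by (simp add: has_real_derivative_iff_has_vector_derivative)
    have 2: "((%t. h t \<bullet> h t) has_real_derivative 2 * (h t \<bullet> (w' t - v t))) (at t)"
    proof -
     have "((%t. h t \<bullet> h t) has_derivative (%x. h t \<bullet> (x *r (w' t - v t)) + (x *r (w' t - v t)) \<bullet> h t)) (at t)"
      using hd[OF t] unfolding has_vector_derivative_def by (intro has_derivative_inner)
     thus ?thesis unfolding has_field_derivative_def
      by (rule has_derivative_eq_rhs) (auto simp: inner_commute algebra_simps)
    qed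
    have 3: "((%t. c * (t - 1/2) * (h t \<bullet> h t)) has_real_derivative c * (h t \<bullet> h t) + c * (t - 1/2) * (2 * (h t \<bullet> (w' t - v t)))) (at t)"
     by (rule derivative_eq_intros 2 refl)+ (simp add: algebra_simps)
    have 4: "((%t. t * (m - E (u 0, v 0))) has_real_derivative (m - E (u 0, v 0))) (at t)"
     by (auto intro!: derivative_eq_intros)
    show ?thesis
     using DERIV_diff[OF 4 DERIV_diff[OF 1 3]] unfolding \<Psi>_def[abs_def] Sf_def[abs_def] D_def by simp
   qed
   have Dge: "c / 10 * (norm (h t))\<^sup>2 <= D t" if t: "t : {0<..<1} - S" for t
   proof -
    have ti: "t : {0..1}" using t by auto
    note k = uK[OF ti] and wk = wK[OF ti] and vt = vn[OF ti]
    define ze where "ze = w' t - v t"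
    define H where "H = norm (h t)"
    define N where "N = norm ze"
    have HN: "H >= 0" "N >= 0" unfolding H_def N_def by auto
    have i1: "E (w t, v t) + dird (0, ze) E (w t, v t) + c / 2 * N\<^sup>2 <= m"
     using E2[OF wk vt, of "w' t"] wd[OF t] unfolding ze_def N_def by simp
    have i2: "E (u t, v t) + dird (h t, 0) E (u t, v t) - c / 8 * H\<^sup>2 <= E (w t, v t)"
    proof -
     have "C * (norm (v t))\<^sup>2 <= C * ep"
     proof (intro mult_left_mono)
      have "(norm (v t))\<^sup>2 <= norm (v t) * 1"
       unfolding power2_eq_square using k ep(2) by (intro mult_left_mono) auto
      thus "(norm (v t))\<^sup>2 <= ep" using k by simp
     qed (use c in auto)
     hence "C * (norm (v t))\<^sup>2 * H\<^sup>2 <= c / 8 * H\<^sup>2" using ep(3) by (intro mult_right_mono) auto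
     thus ?thesis using E3[OF wk conjunct1[OF k] vt] unfolding H_def h_def by simp
    qed
    have i3: "dird (0, ze) E (u t, v t) - c / 8 * N * H <= dird (0, ze) E (w t, v t)"
    proof -
     have "C * norm (v t) <= c / 8" using k ep(3) c by (smt (verit) mult_left_mono)
     hence "C * norm (v t) * N * H <= c / 8 * N * H" using HN by (intro mult_right_mono)
     thus ?thesis using E4[OF wk conjunct1[OF k] vt, of ze] unfolding H_def h_def N_def by linarith
    qed
    have i4: "- (c * (N * H)) <= c * (t - 1/2) * (2 * (h t \<bullet> ze))"
    proof -
     have "\<bar>(2 * t - 1) * (h t \<bullet> ze)\<bar> <= 1 * (H * N)"
      unfolding abs_mult H_def N_def using ti Cauchy_Schwarz_ineq2[of "h t" ze] by (intro mult_mono) auto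
     hence "- (N * H) <= (2 * t - 1) * (h t \<bullet> ze)" by (simp add: mult.commute)
     hence "c * (- (N * H)) <= c * ((2 * t - 1) * (h t \<bullet> ze))" using c by (intro mult_left_mono) auto
     thus ?thesis by (simp add: algebra_simps)
    qed
    have "D t = m - E (u 0, v 0) - dird (0, ze) E (u t, v t) - dird (h t, 0) E (u t, v t) + c * H\<^sup>2 + c * (t - 1/2) * (2 * (h t \<bullet> ze))"
     unfolding D_def ze_def H_def by (simp add: power2_norm_eq_inner)
    hence "c / 2 * N\<^sup>2 - c / 8 * H\<^sup>2 - c / 8 * N * H + c * H\<^sup>2 - c * (N * H) <= D t"
     using i1 i2 i3 i4 e[OF ti] by linarith
    moreover have "c / 10 * H\<^sup>2 <= c / 2 * N\<^sup>2 - c / 8 * H\<^sup>2 - c / 8 * N * H + c * H\<^sup>2 - c * (N * H)"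
    proof -
     \<comment> \<open>Completing the square in N^2/2 - (9/8) N H + (7/8 - 1/10) H^2: twice 7/8 -
       1/10 is 31/20, which exceeds (9/8)^2 = 81/64.\<close>
     have "0 <= c / 2 * ((N - 9/8 * H)\<^sup>2 + (31/20 - 81/64) * H\<^sup>2)" using c by (intro mult_nonneg_nonneg add_nonneg_nonneg) auto
     thus ?thesis by (simp add: power2_eq_square algebra_simps)
    qed
    ultimately show ?thesis unfolding H_def by linarith
   qed
   have Dnn: "0 <= D t" if "t : {0<..<1} - S" for t
    using Dge[OF that] c by (smt (verit) divide_nonneg_nonneg mult_nonneg_nonneg zero_le_power2)
   have \<Psi>c: "continuous_on {0..1} \<Psi>"
   proof -
    have hc: "continuous_on {0..1} h" unfolding h_def[abs_def] by (intro continuous_intros w(1) sol_continuous(1)[OF s])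
    show ?thesis unfolding \<Psi>_def[abs_def] Sf_def[abs_def]
     by (intro continuous_intros continuous_on_dird[OF smooth_E] hc sol_continuous[OF s])
      (use solD(1)[OF s] vn in "auto simp: Z_iff")
   qed
   have \<Psi>0: "\<Psi> 0 = 0" "\<Psi> 1 = m - E (u 0, v 0)"
    using dird_simps(5)[OF smooth_E, of "(u 0, v 0)"] dird_simps(5)[OF smooth_E, of "(u 1, v 1)"] solD(1)[OF s] vn w(3,4)
    unfolding \<Psi>_def Sf_def h_def by (auto simp: Z_iff zero_prod_def)
   have "\<Psi> 0 <= \<Psi> 1" by (rule deriv_nonneg_finite_mono[OF S _ \<Psi>c \<Psi>d Dnn]) auto
   hence "E (u 0, v 0) <= m" using \<Psi>0 by simp
   moreover have "w t = u t" if "E (u 0, v 0) = m" "t : {0..1}" for t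
   proof (rule dense[OF that(2)])
    fix t assume t: "t : {0<..<1} - S"
    have "D t = 0" by (rule deriv_nonneg_finite_const[OF S \<Psi>c \<Psi>d Dnn _ t]) (use \<Psi>0 that in auto)
    hence "(norm (h t))\<^sup>2 <= 0" using Dge[OF t] c by (smt (verit) divide_pos_pos mult_pos_pos)
    thus "w t = u t" by (simp add: h_def)
   qed
   ultimately show ?thesis by blast
  qed
 qed
qed

lemma sol_speed_constant:
 assumes "sol I u v" "convex I" "s : I" "t : I"
 shows "F (u s) (v s) = F (u t) (v t)"
 using sol_energy_constant[OF assms] solD(1)[OF assms(1)] assms(3,4) by (simp add: F_eq_sqrt)

end

text \<open>In a neighbourhood \<open>ball x0 r\<close> the function \<open>rh\<close>, the length of the unique short geodesic inside \<open>cball x0 R\<close>, will turn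
  out to be the Finsler distance.\<close>

locale locd = finsler_dom U F for U :: "(real ^ 'n::finite) set" and F +
 fixes x0 :: "real ^ 'n" and r R ep c :: real and rh :: "real ^ 'n => real ^ 'n => real"
 assumes pars: "0 < r" "r < R" "cball x0 R <= U" "0 < ep" "0 < c"
  and ex: "p : ball x0 r ==> q : ball x0 r ==> EX u v. sol {0..1} u v & u 0 = p & u 1 = q &
    (ALL t:{0..1}. u t : cball x0 R & F (u t) (v t) = rh p q)"
  and rho: "p : ball x0 r ==> q : ball x0 r ==> rh p q <= ep"
   "p : ball x0 r ==> q : ball x0 r ==> c * norm (p - q) <= rh p q"
   "p : ball x0 r ==> q : ball x0 r ==> rh p q <= norm (p - q) / c"
  and F_lower: "x : cball x0 R ==> c * norm y <= F x y"
  and competitor: "[|sol {0..1} u v; !!t. t : {0..1} ==> u t : cball x0 R; F (u 0) (v 0) <= ep;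
    a < b; continuous_on {a..b} w; w ` {a..b} <= cball x0 R; w a = u 0; w b = u 1; finite S;
    !!t. t : {a<..<b} - S ==> (w hvd w' t) (at t) & F (w t) (w' t) <= m|] ==>
    F (u 0) (v 0) <= m * (b - a) &
    (0 < F (u 0) (v 0) --> F (u 0) (v 0) = m * (b - a) --> t : {a..b} --> w t = u ((t - a) / (b - a)))"

context finsler_dom begin

lemma affine_has_vector_derivative:
 assumes "(u hvd u') (at ((t - a) / b))" "b ~= 0"
 shows "((%t. u ((t - a) / b)) hvd u' /\<^sub>R b) (at t)"
proof -
 have "((%t. (t - a) / b) hvd 1 / b) (at t)"
  using assms(2) by (auto intro!: derivative_eq_intros)
 from vector_diff_chain_at[OF this assms(1)] show ?thesis by (simp add: o_def divide_inverse)
qed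

lemma locd_exists:
 assumes x0: "x0 : U"
 shows "EX r R ep c rh. locd U F x0 r R ep c rh"
proof -
 obtain R where R: "R > 0" "cball x0 R <= U" using open_U x0 open_contains_cball by metis
 let ?K = "cball x0 R"
 have K: "compact ?K" "convex ?K" "?K <= U" using R by auto
 have "EX c C. c > 0 & C > 0 & (ALL x:?K. ALL y. c / 2 * (norm y)\<^sup>2 <= E (x, y) & E (x, y) <= C / 2 * (norm y)\<^sup>2)"
  by (rule energy_bounds[OF K]) blast
 then obtain c' C where c: "c' > 0" "C > 0" and eb: "!!x y. x : ?K ==> c' / 2 * (norm y)\<^sup>2 <= E (x, y)"
   "!!x y. x : ?K ==> E (x, y) <= C / 2 * (norm y)\<^sup>2" by blast
 have fb1: "sqrt c' * norm y <= F x y" if "x : ?K" for x y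
 proof -
  have "sqrt (c' * (norm y)\<^sup>2) <= sqrt (2 * E (x, y))" using eb(1)[OF that, of y] by (intro real_sqrt_le_mono) simp
  thus ?thesis using F_eq_sqrt[of x y] that R by (auto simp: real_sqrt_mult)
 qed
 have fb2: "F x y <= sqrt C * norm y" if "x : ?K" for x y
 proof -
  have "sqrt (2 * E (x, y)) <= sqrt (C * (norm y)\<^sup>2)" using eb(2)[OF that, of y] by (intro real_sqrt_le_mono) simp
  thus ?thesis using F_eq_sqrt[of x y] that R by (auto simp: real_sqrt_mult)
 qed
 obtain ep0 where ep0: "ep0 > 0"
  "!!u v w w' S m. sol {0..1} u v ==> (!!t. t : {0..1} ==> u t : ?K & norm (v t) <= ep0) ==>
   continuous_on {0..1} w ==> w ` {0..1} <= ?K ==> w 0 = u 0 ==> w 1 = u 1 ==> finite S ==>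
   (!!t. t : {0<..<1} - S ==> (w hvd w' t) (at t) & E (w t, w' t) <= m) ==>
   E (u 0, v 0) <= m & (v 0 ~= 0 --> E (u 0, v 0) = m --> (ALL t:{0..1}. w t = u t))"
  using locmin[OF K] by blast
 obtain de where de: "de > 0"
  "!!p q. norm (q - p) <= de ==> cball p (2 * norm (q - p)) <= ?K ==>
    EX u v. sol {0..1} u v & u 0 = p & u 1 = q &
     (ALL t:{0..1}. u t : cball p (2 * norm (q - p)) & norm (v t - (q - p)) <= norm (q - p) / 2)"
  using bvp[OF K] by blast
 define ep where "ep = sqrt c' * ep0"
 have ep: "ep > 0" using c ep0 unfolding ep_def by simp
 \<comment> \<open>One constant for both comparisons: \<open>sqrt c'\<close> is the lower bound for
   F, and 2 sqrt C bounds the length of the short geodesic in terms of |p - q|, its velocity being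
   at most 2 |q - p|.\<close>
 define c0 where "c0 = min (sqrt c') (1 / (2 * sqrt C))"
 have c0: "c0 > 0" "c0 <= sqrt c'" "c0 * (2 * sqrt C) <= 1"
  using c unfolding c0_def by (auto simp: min_def field_simps)
 \<comment> \<open>Two points of the ball are at most 2 r apart. Hence 2 r <= de allows
   \<open>bvp\<close>, r + 4 r <= R keeps its solution in the larger ball, and 4 sqrt C r <= ep
   keeps the speed small enough for \<open>locmin\<close>.\<close>
 define r where "r = min (R / 5) (min (de / 2) (ep / (4 * sqrt C)))"
 have r: "r > 0" "5 * r <= R" "2 * r <= de" "4 * sqrt C * r <= ep"
 proof -
  have "r <= R / 5" "r <= de / 2" "r <= ep / (4 * sqrt C)" unfolding r_def by auto
  thus "5 * r <= R" "2 * r <= de" "4 * sqrt C * r <= ep" using c by (auto simp: field_simps)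
  show "r > 0" using R de ep c unfolding r_def by simp
 qed
 \<comment> \<open>\<open>locmin\<close> in terms of speeds and on an arbitrary interval: the affine
   change of parameter turns the speed bound m into the energy bound (m (b - a))^2 / 2 on
   [0,1].\<close>
 have comp: "F (u 0) (v 0) <= m * (b - a) &
   (0 < F (u 0) (v 0) --> F (u 0) (v 0) = m * (b - a) --> t : {a..b} --> w t = u ((t - a) / (b - a)))"
  if s: "sol {0..1} u v" and uK: "!!t. t : {0..1} ==> u t : ?K" and uep: "F (u 0) (v 0) <= ep" and ab: "a < b"
   and w: "continuous_on {a..b} w" "w ` {a..b} <= ?K" "w a = u 0" "w b = u 1" and S: "finite S"
   and wd: "!!t. t : {a<..<b} - S ==> (w hvd w' t) (at t) & F (w t) (w' t) <= m" for u v w w' a b S m t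
 proof -
  let ?g = "%s. a + s * (b - a)"
  have gi: "?g s : {a..b}" if "s : {0..1}" for s
  proof -
   have "0 <= s * (b - a)" "s * (b - a) <= 1 * (b - a)" using that ab by (intro mult_nonneg_nonneg mult_right_mono; auto)+
   thus ?thesis by simp
  qed
  have S': "finite (?g -` S)" using S ab by (intro finite_vimageI) (auto intro!: injI)
  have der: "((%s. w (?g s)) hvd (b - a) *r w' (?g t)) (at t) &
    0 <= F (w (?g t)) ((b - a) *r w' (?g t)) & F (w (?g t)) ((b - a) *r w' (?g t)) <= m * (b - a)"
   if t: "t : {0<..<1} - ?g -` S" for t
  proof -
   have "0 < t * (b - a)" "t * (b - a) < 1 * (b - a)" using t ab by (intro mult_strict_right_mono mult_pos_pos; auto)+
   hence gt: "?g t : {a<..<b} - S" using t by auto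
   have gd: "(?g hvd (b - a)) (at t)" by (auto intro!: derivative_eq_intros)
   have wU: "w (?g t) : U" using w(2) gt R by force
   show ?thesis
    using vector_diff_chain_at[OF gd conjunct1[OF wd[OF gt]]] F_hom[OF wU, of "b - a"] F_nonneg[OF wU] ab wd[OF gt]
    by (auto simp: o_def mult.commute mult_left_mono)
  qed
  have main: "E (u 0, v 0) <= (m * (b - a))\<^sup>2 / 2 &
    (v 0 ~= 0 --> E (u 0, v 0) = (m * (b - a))\<^sup>2 / 2 --> (ALL s:{0..1}. w (?g s) = u s))"
  proof (rule ep0(2)[of u v "%s. w (?g s)" "?g -` S" "%s. (b - a) *r w' (?g s)", OF s])
   fix t :: real assume t: "t : {0..1}"
   have "sqrt c' * norm (v t) <= F (u t) (v t)" using fb1 uK t by blast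
   also have "... <= sqrt c' * ep0" using sol_speed_constant[OF s _ t, of 0] uep unfolding ep_def by simp
   finally show "u t : ?K & norm (v t) <= ep0" using uK t c by simp
  next
   show "continuous_on {0..1} (%s. w (?g s))"
    by (rule continuous_on_compose2[OF w(1)]) (use gi in "auto intro!: continuous_intros")
   show "(%s. w (?g s)) ` {0..1} <= ?K" using w(2) gi by blast
   show "w (a + 0 * (b - a)) = u 0" "w (a + 1 * (b - a)) = u 1" using w by auto
   show "((%s. w (?g s)) hvd (b - a) *r w' (?g t)) (at t) &
     E (w (?g t), (b - a) *r w' (?g t)) <= (m * (b - a))\<^sup>2 / 2" if "t : {0<..<1} - ?g -` S" for t
    using der[OF that] by (simp add: E_def power_mono)
  qed (rule S')
  have "infinite ({0<..<1} - ?g -` S)" using S' by (simp add: infinite_Ioo)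
  then obtain t0 where "t0 : {0<..<1} - ?g -` S" by (metis finite.emptyI ex_in_conv)
  from der[OF this] have nn: "m * (b - a) >= 0" by linarith
  have "w t = u ((t - a) / (b - a))" if "ALL s:{0..1}. w (?g s) = u s" "t : {a..b}"
   using bspec[OF that(1), of "(t - a) / (b - a)"] that(2) ab by (simp add: divide_le_eq)
  moreover have "F (u 0) (v 0) <= m * (b - a)" using main nn by (auto simp: E_def intro: power2_le_imp_le)
  moreover have "v 0 ~= 0" if "0 < F (u 0) (v 0)" using that F_zero[of "u 0"] solD(1)[OF s, of 0] by auto
  ultimately show ?thesis using main by (auto simp: E_def)
 qed
 have ex: "EX u v. sol {0..1} u v & u 0 = p & u 1 = q & (ALL t:{0..1}. u t : ?K) & F (u 0) (v 0) <= ep &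
   F (u 0) (v 0) <= 2 * sqrt C * norm (p - q)"
  if p: "p : ball x0 r" "q : ball x0 r" for p q
 proof -
  have n: "norm (q - p) <= 2 * r" using p dist_triangle2[of q p x0] by (simp add: dist_norm norm_minus_commute)
  have sub: "cball p (2 * norm (q - p)) <= ?K"
  proof
   fix z assume "z : cball p (2 * norm (q - p))"
   hence "dist x0 z <= r + 4 * r" using p n by (intro order_trans[OF dist_triangle[of x0 z p]] add_mono) auto
   thus "z : ?K" using r by simp
  qed
  obtain u v where uv: "sol {0..1} u v" "u 0 = p" "u 1 = q"
   "ALL t:{0..1}. u t : cball p (2 * norm (q - p)) & norm (v t - (q - p)) <= norm (q - p) / 2"
   using de(2)[OF order_trans[OF n r(3)] sub] by blast
  have uK: "ALL t:{0..1}. u t : ?K" using uv(4) sub by blast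
  have "norm (v 0) <= norm (q - p) + norm (q - p) / 2"
   using uv(4) norm_triangle_ineq2[of "v 0" "q - p"] by force
  also have "... <= 2 * norm (q - p)" by simp
  finally have "sqrt C * norm (v 0) <= sqrt C * (2 * norm (q - p))" using c by (intro mult_left_mono) auto
  hence 1: "F (u 0) (v 0) <= 2 * sqrt C * norm (p - q)"
   using fb2[of "u 0" "v 0"] uK by (force simp: norm_minus_commute)
  also have "... <= 2 * sqrt C * (2 * r)" using n c by (intro mult_left_mono) (auto simp: norm_minus_commute)
  also have "... <= ep" using r by simp
  finally show ?thesis using uv uK 1 by blast
 qed
 define P where "P p q m \<longleftrightarrow> (EX u v. sol {0..1} u v & u 0 = p & u 1 = q & (ALL t:{0..1}. u t : ?K) & F (u 0) (v 0) = m & m <= ep &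
   m <= 2 * sqrt C * norm (p - q))" for p q m
 define rh where "rh p q = (SOME m. P p q m)" for p q
 have P: "P p q (rh p q)" if "p : ball x0 r" "q : ball x0 r" for p q
  unfolding rh_def by (rule someI_ex) (use ex[OF that] in "unfold P_def, blast")
 have "locd U F x0 r R ep c0 rh"
 proof (rule locd.intro[OF finsler_dom_axioms], rule locd_axioms.intro)
  fix p q assume pq: "p : ball x0 r" "q : ball x0 r"
  from P[OF this] obtain u v where uv: "sol {0..1} u v" "u 0 = p" "u 1 = q" "ALL t:{0..1}. u t : ?K"
   "F (u 0) (v 0) = rh p q" and m: "rh p q <= ep" "rh p q <= 2 * sqrt C * norm (p - q)" unfolding P_def by blast
  have sp: "F (u t) (v t) = rh p q" if "t : {0..1}" for t
   using sol_speed_constant[OF uv(1) _ that, of 0] uv(5) by simp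
  thus "EX u v. sol {0..1} u v & u 0 = p & u 1 = q & (ALL t:{0..1}. u t : ?K & F (u t) (v t) = rh p q)"
   using uv by blast
  show "rh p q <= ep" by (rule m)
  have vb: "norm (v t) <= rh p q / sqrt c'" if "t : {0..1}" for t
   using fb1[of "u t" "v t"] uv(4) that sp[OF that] c by (simp add: field_simps)
  have "norm (u 1 - u 0) <= rh p q / sqrt c' * norm (1 - 0 :: real)"
   by (rule differentiable_bound[of "{0..1}" u "%t h. h *r v t"])
    (use solD(2)[OF uv(1)] vb in "auto simp: has_vector_derivative_def intro!: onorm_scaleR_vec_le")
  hence "sqrt c' * norm (p - q) <= rh p q" using uv c by (simp add: field_simps norm_minus_commute)
  thus "c0 * norm (p - q) <= rh p q" using c0(2) by (smt (verit) mult_right_mono norm_ge_zero)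
  have "rh p q * c0 <= (2 * sqrt C * norm (p - q)) * c0" using m(2) c0 by (intro mult_right_mono) auto
  also have "... <= norm (p - q)" using c0(3) mult_right_mono[OF c0(3), of "norm (p - q)"] by (simp add: mult_ac)
  finally show "rh p q <= norm (p - q) / c0" using c0 by (simp add: field_simps)
 next
  fix x y :: "real ^ 'n" assume "x : ?K"
  thus "c0 * norm y <= F x y" using fb1 c0(2) by (smt (verit) mult_right_mono norm_ge_zero)
 qed (fact comp | use r R ep c0 in simp)+
 thus ?thesis by blast
qed

end

section \<open>The local distance function of a chart\<close>

context locd begin

lemma rho_nonneg: "p : ball x0 r ==> q : ball x0 r ==> 0 <= rh p q"
 using order_trans[OF mult_nonneg_nonneg[of c "norm (p - q)"] rho(2)] pars(5) by simp

lemma rho_eq_0: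
 assumes "p : ball x0 r" "q : ball x0 r"
 shows "rh p q = 0 \<longleftrightarrow> p = q"
proof
 assume "rh p q = 0"
 hence "c * norm (p - q) <= 0" using rho(2)[OF assms] by simp
 thus "p = q" using pars(5) by (simp add: mult_le_0_iff)
qed (use rho(3)[OF assms] rho_nonneg[OF assms] in auto)

lemmas lD = pars ex rho rho_nonneg rho_eq_0 F_lower

text \<open>The geodesics from \<open>p\<close> to \<open>e\<close> and from \<open>e\<close> to
  \<open>q\<close>, run at unit speed one after the other, form an admissible competitor on
  [0, rh p e + rh e q]. Equality puts its corner on the geodesic from \<open>p\<close> to
  \<open>q\<close>.\<close>

lemma locd_concat:
 assumes pqe: "p : ball x0 r" "q : ball x0 r" "e : ball x0 r"
  and uv: "sol {0..1} u v" "!!t. t : {0..1} ==> u t : cball x0 R" "F (u 0) (v 0) <= ep" "u 0 = p" "u 1 = q"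
  and pos: "rh p e > 0" "rh e q > 0"
 shows "F (u 0) (v 0) <= rh p e + rh e q" "F (u 0) (v 0) = rh p e + rh e q ==> e = u (rh p e / (rh p e + rh e q))"
proof -
 obtain u1 v1 where u1: "sol {0..1} u1 v1" "u1 0 = p" "u1 1 = e" "!!t. t : {0..1} ==> u1 t : cball x0 R & F (u1 t) (v1 t) = rh p e"
  using lD(6)[OF pqe(1,3)] by blast
 obtain u2 v2 where u2: "sol {0..1} u2 v2" "u2 0 = e" "u2 1 = q" "!!t. t : {0..1} ==> u2 t : cball x0 R & F (u2 t) (v2 t) = rh e q"
  using lD(6)[OF pqe(3,2)] by blast
 define a1 where "a1 = rh p e"
 define a2 where "a2 = rh e q"
 have a: "a1 > 0" "a2 > 0" using pos unfolding a1_def a2_def by auto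
 define w where "w t = (if t <= a1 then u1 ((t - 0) / a1) else u2 ((t - a1) / a2))" for t
 define w' where "w' t = (if t <= a1 then v1 ((t - 0) / a1) /\<^sub>R a1 else v2 ((t - a1) / a2) /\<^sub>R a2)" for t
 have i1: "(t - 0) / a1 : {0..1}" if "t : {0..a1}" for t using that a by (auto simp: field_simps)
 have i2: "(t - a1) / a2 : {0..1}" if "t : {a1..a1 + a2}" for t using that a by (auto simp: field_simps)
 have eq: "{0..a1 + a2} = {0..a1} Un {a1..a1 + a2}" using a by auto
 have wc: "continuous_on {0..a1 + a2} w"
  unfolding eq w_def
 proof (rule continuous_on_cases)
  show "continuous_on {0..a1} (%t. u1 ((t - 0) / a1))"
   by (rule continuous_on_compose2[OF sol_continuous(1)[OF u1(1)]]) (use i1 a in "auto intro!: continuous_intros")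
  show "continuous_on {a1..a1 + a2} (%t. u2 ((t - a1) / a2))"
   by (rule continuous_on_compose2[OF sol_continuous(1)[OF u2(1)]]) (use i2 a in "auto intro!: continuous_intros")
 qed (use a u1 u2 in auto)
 have wK: "w ` {0..a1 + a2} <= cball x0 R"
 proof
  fix z assume "z : w ` {0..a1 + a2}"
  then obtain t where t: "z = w t" "t : {0..a1 + a2}" by blast
  show "z : cball x0 R"
  proof (cases "t <= a1")
   case True
   thus ?thesis using u1(4)[OF i1, of t] t by (simp add: w_def)
  next
   case False
   thus ?thesis using u2(4)[OF i2, of t] t by (simp add: w_def)
  qed
 qed
 have wd: "(w hvd w' t) (at t) & F (w t) (w' t) <= 1" if t: "t : {0<..<a1 + a2} - {a1}" for t
 proof (cases "t < a1")
  case True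
  have i: "(t - 0) / a1 : {0<..<1}" using True t a by auto
  have "((%t. u1 ((t - 0) / a1)) hvd w' t) (at t)"
   using affine_has_vector_derivative[of u1 "v1 ((t - 0) / a1)" t 0 a1] solD(2)[OF u1(1), of "(t - 0) / a1"] i a True
   by (auto simp: w'_def at_within_Icc_at)
  hence "(w hvd w' t) (at t)"
   by (rule has_vector_derivative_transform_within_open[of _ _ _ "{..<a1}"]) (use True in "auto simp: w_def")
  moreover have "F (w t) (w' t) = 1"
  proof -
   have "(t - 0) / a1 : {0..1}" using i by auto
   thus ?thesis using F_hom[of "u1 ((t - 0) / a1)" "inverse a1"] u1(4)[of "(t - 0) / a1"] lD(3) a True
    by (auto simp: w_def w'_def a1_def)
  qed
  ultimately show ?thesis by simp
 next
  case False
  hence ta: "t > a1" using t by auto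
  have i: "(t - a1) / a2 : {0<..<1}" using ta t a by auto
  have "((%t. u2 ((t - a1) / a2)) hvd w' t) (at t)"
   using affine_has_vector_derivative[of u2 "v2 ((t - a1) / a2)" t a1 a2] solD(2)[OF u2(1), of "(t - a1) / a2"] i a ta
   by (auto simp: w'_def at_within_Icc_at)
  hence "(w hvd w' t) (at t)"
   by (rule has_vector_derivative_transform_within_open[of _ _ _ "{a1<..}"]) (use ta in "auto simp: w_def")
  moreover have "F (w t) (w' t) = 1"
  proof -
   have "(t - a1) / a2 : {0..1}" using i by auto
   thus ?thesis using F_hom[of "u2 ((t - a1) / a2)" "inverse a2"] u2(4)[of "(t - a1) / a2"] lD(3) a ta
    by (auto simp: w_def w'_def a2_def)
  qed
  ultimately show ?thesis by simp
 qed
 have w0: "w 0 = u 0" "w (a1 + a2) = u 1" using a u1 u2 uv by (auto simp: w_def)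
 note comp = competitor[OF uv(1,2,3) _ wc wK w0 finite.insertI[OF finite.emptyI] wd]
 have "F (u 0) (v 0) <= 1 * (a1 + a2 - 0)" using comp a add_pos_pos by blast
 thus "F (u 0) (v 0) <= rh p e + rh e q" by (simp add: a1_def a2_def)
 assume eqF: "F (u 0) (v 0) = rh p e + rh e q"
 have "w a1 = u ((a1 - 0) / (a1 + a2 - 0))"
  using comp[of a1] a eqF[folded a1_def a2_def] by simp
 thus "e = u (rh p e / (rh p e + rh e q))" using u1 a by (simp add: w_def a1_def a2_def)
qed

lemma locd_triangle:
 assumes pqe: "p : ball x0 r" "q : ball x0 r" "e : ball x0 r"
 shows "rh p q <= rh p e + rh e q"
proof (cases "rh p e = 0 | rh e q = 0")
 case True
 thus ?thesis using lD(10,11) pqe by auto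
next
 case False
 hence "rh p e > 0" "rh e q > 0" using lD(10) pqe by (auto simp: less_le)
 moreover obtain u v where uv: "sol {0..1} u v" "u 0 = p" "u 1 = q" "!!t. t : {0..1} ==> u t : cball x0 R & F (u t) (v t) = rh p q"
  using lD(6)[OF pqe(1,2)] by blast
 moreover have "F (u 0) (v 0) = rh p q" "!!t. t : {0..1} ==> u t : cball x0 R" using uv(4) by auto
 ultimately show ?thesis using locd_concat(1)[OF pqe uv(1), OF _ _ uv(2,3)] lD(7)[OF pqe(1,2)] by simp
qed

text \<open>Equality in the triangle inequality locates the middle point. This is the source of all
  later statements that metric minimizers are geodesics.\<close>

lemma locd_between:
 assumes pqe: "p : ball x0 r" "q : ball x0 r" "e : ball x0 r"
  and uv: "sol {0..1} u v" "!!t. t : {0..1} ==> u t : cball x0 R & F (u t) (v t) = rh p q" "u 0 = p" "u 1 = q"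
  and eq: "rh p q = rh p e + rh e q" "p ~= q"
 shows "e = u (rh p e / rh p q)"
proof (cases "rh p e = 0 | rh e q = 0")
 case True
 thus ?thesis
 proof
  assume "rh p e = 0"
  thus ?thesis using lD(11)[OF pqe(1,3)] uv(3) by simp
 next
  assume "rh e q = 0"
  hence "e = q" using lD(11)[OF pqe(3,2)] by simp
  thus ?thesis using lD(11)[OF pqe(1,2)] eq(2) uv(4) by simp
 qed
next
 case False
 hence "rh p e > 0" "rh e q > 0" using lD(10) pqe by (auto simp: less_le)
 moreover have "F (u 0) (v 0) = rh p q" "!!t. t : {0..1} ==> u t : cball x0 R" using uv(2) by auto
 ultimately show ?thesis using locd_concat(2)[OF pqe uv(1), OF _ _ uv(3,4)] lD(7)[OF pqe(1,2)] eq(1) by simp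
qed

text \<open>\<open>competitor\<close> needs a constant speed bound. On short intervals the speed is
  almost constant, and the triangle inequality adds the estimates; the bisection of [a,b] replaces a
  choice of partition.\<close>

lemma locd_curve_length:
 assumes ab: "a <= b" and w: "continuous_on {a..b} w" "w ` {a..b} <= ball x0 r" and f: "continuous_on {a..b} f"
  and d: "!!t. t : {a<..<b} ==> (w hvd w' t) (at t) & F (w t) (w' t) = f t"
 shows "rh (w a) (w b) <= integral {a..b} f"
proof (rule field_le_epsilon)
 fix et :: real assume et: "et > 0"
 define et' where "et' = et / (b - a + 1)"
 have et': "et' > 0" "et' * (b - a) <= et" using et ab unfolding et'_def by (auto simp: field_simps)
 have fi: "f integrable_on {s..t}" if "a <= s" "t <= b" for s t
  by (rule integrable_continuous_real[OF continuous_on_subset[OF f]]) (use that in auto)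
 have wB: "w s : ball x0 r" if "s : {a..b}" for s using w(2) that by blast
 have "a <= a & b <= b --> rh (w a) (w b) <= integral {a..b} f + et' * (b - a)"
  using ab
 proof (induction rule: Bolzano[where P="%s t. a <= s & t <= b --> rh (w s) (w t) <= integral {s..t} f + et' * (t - s)"])
  case (trans s t t')
  show ?case
  proof
   assume st: "a <= s & t' <= b"
   have "integral {s..t} f + integral {t..t'} f = integral {s..t'} f"
    using trans fi st by (intro Henstock_Kurzweil_Integration.integral_combine) auto
   moreover have "rh (w s) (w t') <= rh (w s) (w t) + rh (w t) (w t')"
    using trans st by (intro locd_triangle wB) auto
   ultimately show "rh (w s) (w t') <= integral {s..t'} f + et' * (t' - s)" using trans st by (simp add: algebra_simps)
  qed
 next
  case (local x)
  then obtain e where e: "e > 0" "!!t. t : {a..b} ==> abs(t - x) < e ==> abs(f t - f x) < et' / 2"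
   using f et'(1) half_gt_zero unfolding continuous_on_iff dist_real_def by (metis atLeastAtMost_iff)
  show ?case
  proof (intro exI[of _ e] conjI allI impI)
   fix s t assume *: "s <= x & x <= t & t - s < e" "a <= s & t <= b"
   hence st: "s : {a..b}" "t : {a..b}" "s <= t" using local by auto
   have fl: "f x - et' / 2 <= f y" "f y <= f x + et' / 2" if "y : {s..t}" for y
   proof -
    have "abs(f y - f x) < et' / 2" by (rule e(2)) (use * that in "auto simp: abs_less_iff")
    thus "f x - et' / 2 <= f y" "f y <= f x + et' / 2" by linarith+
   qed
   obtain u v where uv: "sol {0..1} u v" "u 0 = w s" "u 1 = w t" "!!t'. t' : {0..1} ==> u t' : cball x0 R & F (u t') (v t') = rh (w s) (w t)"
    using lD(6)[OF wB[OF st(1)] wB[OF st(2)]] by blast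
   have 1: "rh (w s) (w t) <= (f x + et' / 2) * (t - s)"
   proof (cases "s = t")
    case False
    have "F (u 0) (v 0) <= (f x + et' / 2) * (t - s)"
    proof (rule conjunct1[OF competitor[OF uv(1), where S="{}" and w=w and w'=w']])
     show "continuous_on {s..t} w" using continuous_on_subset[OF w(1)] st by auto
     have "w ` {s..t} <= w ` {a..b}" using st by (intro image_mono) auto
     thus "w ` {s..t} <= cball x0 R" using w(2) subset_ball[of r R x0] pars(2) ball_subset_cball by (meson order_trans less_imp_le)
     show "(w hvd w' y) (at y) & F (w y) (w' y) <= f x + et' / 2" if "y : {s<..<t} - {}" for y
      using d[of y] fl(2)[of y] that st by auto
     show "F (u 0) (v 0) <= ep" using uv(4)[of 0] lD(7) wB st by simp
    qed (use uv st False in auto)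
    thus ?thesis using uv(4)[of 0] by simp
   qed (use rho_eq_0[OF wB[OF st(2)] wB[OF st(2)]] in simp)
   have "integral {s..t} (%_. f x - et' / 2) <= integral {s..t} f"
    by (rule integral_le) (use fl(1) fi st in auto)
   thus "rh (w s) (w t) <= integral {s..t} f + et' * (t - s)" using 1 st by (simp add: field_simps)
  qed (use e in auto)
 qed
 thus "rh (w a) (w b) <= integral {a..b} f + et" using et'(2) by simp
qed

end

section \<open>Change of charts\<close>

lemma dird_component:
 fixes f :: "'a::real_normed_vector => real ^ 'n::finite"
 assumes "smooth_on S f" "x : S"
 shows "dird u (%x. f x $ i) x = dird u f x $ i"
 by (rule dird_eqI[OF bounded_linear.has_derivative[OF bounded_linear_vec_nth smooth_on_has_derivative[OF assms]]])

lemma dird_dird_component: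
 fixes f :: "'a::real_normed_vector => real ^ 'n::finite"
 assumes "open S" "smooth_on S f" "x : S"
 shows "dird u (dird v (%x. f x $ i)) x = dird u (dird v f) x $ i"
proof -
 have "dird u (dird v (%x. f x $ i)) x = dird u (%x. dird v f x $ i) x"
  by (rule dird_cong[OF assms(1,3) smooth_on_dird[OF smooth_on_component[OF assms(1,2)]]]) (rule dird_component[OF assms(2)])
 thus ?thesis using dird_component[OF smooth_on_dird[OF assms(2)] assms(3)] by simp
qed

lemma dird_commute_vec:
 fixes f :: "'a::real_normed_vector => real ^ 'n::finite"
 assumes "open S" "smooth_on S f" "x : S"
 shows "dird u (dird v f) x = dird v (dird u f) x"
 using dird_commute[OF smooth_on_component[OF assms(1,2)] assms(1,3)] dird_dird_component[OF assms]
 by (simp add: vec_eq_iff)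

lemma has_vector_derivative_vecI:
 fixes f :: "real => real ^ 'n::finite"
 assumes "!!i. ((%t. f t $ i) hvd f' $ i) (at t within I)"
 shows "(f hvd f') (at t within I)"
proof -
 have "((%t. SUM i:UNIV. f t $ i *r axis i (1::real)) hvd (SUM i:UNIV. f' $ i *r axis i 1)) (at t within I)"
  by (intro has_vector_derivative_sum bounded_linear.has_vector_derivative[OF bounded_linear_scaleR_left] assms)
 thus ?thesis by (simp add: basis_expansion flip: scalar_mult_eq_scaleR)
qed

lemma dird_var_derivative_vec:
 fixes f :: "'a::euclidean_space => real ^ 'n::finite"
 assumes f: "smooth_on S f" "open S"
  and z: "(z hvd z') (at t within I)" and h: "(h hvd h') (at t within I)"
  and zS: "!!s. s : I ==> z s : S" "t : I"
 shows "((%s. dird (h s) f (z s)) hvd dird h' f (z t) + dird z' (dird (h t) f) (z t)) (at t within I)"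
proof (rule has_vector_derivative_vecI)
 fix i
 have "((%s. dird (h s) (%x. f x $ i) (z s)) has_vector_derivative
   dird h' (%x. f x $ i) (z t) + dird z' (dird (h t) (%x. f x $ i)) (z t)) (at t within I)"
  by (rule dird_var_derivative[OF smooth_on_component[OF f(2,1)] f(2) zS(1)[OF zS(2)] z h zS])
 hence "((%s. dird (h s) (%x. f x $ i) (z s)) has_vector_derivative
   (dird h' f (z t) + dird z' (dird (h t) f) (z t)) $ i) (at t within I)"
  using dird_component[OF f(1)] dird_dird_component[OF f(2,1)] zS by simp
 thus "((%s. dird (h s) f (z s) $ i) hvd (dird h' f (z t) + dird z' (dird (h t) f) (z t)) $ i) (at t within I)"
  by (rule has_vector_derivative_transform[OF zS(2), rotated]) (use dird_component[OF f(1)] zS in simp)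
qed

text \<open>A local isometry of two coordinate Finsler structures. Injectivity of the differential
  gives surjectivity, as the dimensions agree.\<close>

locale finsler_transition = D1: finsler_dom U1 F1 + D2: finsler_dom U2 F2
 for U1 U2 :: "(real ^ 'n::finite) set" and F1 F2 +
 fixes V :: "(real ^ 'n) set" and ph :: "real ^ 'n => real ^ 'n"
 assumes open_V: "open V" and V_sub: "V <= U1" and phi_smooth: "smooth_on V ph" and phi_image: "ph ` V <= U2"
  and F_phi: "!!x y. x : V ==> F2 (ph x) (dird y ph x) = F1 x y"
  and phi_inj: "!!x y. x : V ==> dird y ph x = 0 ==> y = 0"
begin

lemma phi_surj:
 assumes "x : V"
 obtains y where "dird y ph x = w"
proof -
 have l: "linear (%y. dird y ph x)" by (rule dird_linear[OF phi_smooth assms])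
 have "inj (%y. dird y ph x)" using phi_inj[OF assms] linear_injective_0[OF l] by blast
 hence "surj (%y. dird y ph x)" using linear_inj_imp_surj[OF l] by blast
 thus thesis using that by (metis surjD)
qed

lemma Z_phi: "x : V ==> y ~= 0 ==> (x, y) : D1.Z & (ph x, dird y ph x) : D2.Z"
 using V_sub phi_image phi_inj unfolding D1.Z_iff D2.Z_iff by blast

lemma E_phi: "x : V ==> D2.E (ph x, dird y ph x) = D1.E (x, y)"
 by (simp add: D1.E_def D2.E_def F_phi)

text \<open>The tangent map of \<open>ph\<close> along a line in the tangent bundle. The second
  derivative of \<open>ph\<close> appears because the differential is taken at a moving
  point.\<close>

lemma line_nbhd:
 assumes x: "x : V" and y: "y ~= 0"
 obtains I where "open I" "0 : I" "!!t. t : I ==> x + t *r xi : V & y + t *r et ~= 0"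
  "((%t. (ph (x + t *r xi), dird (y + t *r et) ph (x + t *r xi))) has_vector_derivative
   (dird xi ph x, dird et ph x + dird xi (dird y ph) x)) (at 0 within I)"
proof -
 define X where "X t = x + t *r xi" for t
 define Y where "Y t = y + t *r et" for t
 define I where "I = X -` V Int Y -` (- {0})"
 have 1: "open (X -` V)" "open (Y -` (- {0}))"
  unfolding X_def[abs_def] Y_def[abs_def] by (intro continuous_open_vimage continuous_intros open_V open_Compl closed_singleton)+
 have I: "open I" unfolding I_def by (rule open_Int[OF 1])
 have 0: "0 : I" using x y by (simp add: I_def X_def Y_def)
 have IV: "X t : V" "Y t ~= 0" if "t : I" for t using that by (auto simp: I_def)
 have d: "(X hvd xi) (at 0 within I)" "(Y hvd et) (at 0 within I)"
  unfolding X_def[abs_def] Y_def[abs_def] by (auto intro!: derivative_eq_intros)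
 have x0: "X 0 = x" "Y 0 = y" by (simp_all add: X_def Y_def)
 have z: "((%t. (ph (X t), dird (Y t) ph (X t))) has_vector_derivative
   (dird xi ph (X 0), dird et ph (X 0) + dird xi (dird (Y 0) ph) (X 0))) (at 0 within I)"
  by (rule has_vector_derivative_Pair'[OF chain_vec[OF d(1) smooth_on_has_derivative[OF phi_smooth IV(1)[OF 0]]]
    dird_var_derivative_vec[OF phi_smooth open_V d IV(1) 0]])
 show thesis
  by (rule that[OF I 0 _ z[unfolded x0, unfolded X_def Y_def]]) (use IV in "simp add: X_def Y_def")
qed

text \<open>Both sides are the derivative of \<open>E_phi\<close> along such a line. Differentiating
  once more gives the transformation of \<open>g\<close> and of the Euler-Lagrange
  expression.\<close>

lemma dird_E_phi:
 assumes x: "x : V" and y: "y ~= 0"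
 shows "dird (xi, et) D1.E (x, y) = dird (dird xi ph x, dird xi (dird y ph) x + dird et ph x) D2.E (ph x, dird y ph x)"
proof -
 let ?x = "%t. x + t *r xi" and ?y = "%t. y + t *r et"
 obtain I where I: "open I" "0 : I" "!!t. t : I ==> ?x t : V & ?y t ~= 0"
  and z: "((%t. (ph (?x t), dird (?y t) ph (?x t))) has_vector_derivative
   (dird xi ph x, dird et ph x + dird xi (dird y ph) x)) (at 0 within I)"
  using line_nbhd[OF x y] by blast
 have at: "at 0 within I = at 0" by (rule at_within_open[OF I(2,1)])
 have dx: "(?x hvd xi) (at 0 within I)" by (auto intro!: derivative_eq_intros)
 have "((%t. D2.E (ph (?x t), dird (?y t) ph (?x t))) has_vector_derivative
   dird (dird xi ph x, dird et ph x + dird xi (dird y ph) x) D2.E (ph x, dird y ph x)) (at 0 within I)"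
  using chain_vec[OF z, of D2.E "%v. dird v D2.E (ph x, dird y ph x)"]
   smooth_on_has_derivative[OF D2.smooth_E conjunct2[OF Z_phi[OF x y]]] by simp
 hence "((%t. D1.E ((x, y) + t *r (xi, et))) has_vector_derivative
   dird (dird xi ph x, dird et ph x + dird xi (dird y ph) x) D2.E (ph x, dird y ph x)) (at 0 within I)"
  by (rule has_vector_derivative_transform[OF I(2), rotated]) (use E_phi I(3) in simp)
 moreover have "((%t. D1.E ((x, y) + t *r (xi, et))) hvd dird (xi, et) D1.E (x, y)) (at 0)"
  using dird_line[OF D1.smooth_E, of "(x, y)" 0 "(xi, et)"] Z_phi[OF x y] by (simp add: has_real_derivative_iff_has_vector_derivative)
 ultimately show ?thesis unfolding at using vector_derivative_unique_at by (simp add: add.commute) blast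
qed

lemma dird_Ey_phi:
 assumes x: "x : V" and y: "y ~= 0"
 shows "dird (0, ze) D1.E (x, y) = dird (0, dird ze ph x) D2.E (ph x, dird y ph x)"
 using dird_E_phi[OF x y, of 0 ze] dird_simps(5)[OF phi_smooth x] dird_simps(5)[OF smooth_on_dird[OF phi_smooth] x] by simp

lemma dird_dird_Ey_phi:
 assumes x: "x : V" and y: "y ~= 0"
 shows "dird (xi, et) (dird (0, ze) D1.E) (x, y) = dird (0, dird xi (dird ze ph) x) D2.E (ph x, dird y ph x)
   + dird (dird xi ph x, dird xi (dird y ph) x + dird et ph x) (dird (0, dird ze ph x) D2.E) (ph x, dird y ph x)"
proof -
 let ?x = "%t. x + t *r xi" and ?y = "%t. y + t *r et"
 obtain I where I: "open I" "0 : I" "!!t. t : I ==> ?x t : V & ?y t ~= 0"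
  and z: "((%t. (ph (?x t), dird (?y t) ph (?x t))) has_vector_derivative
   (dird xi ph x, dird et ph x + dird xi (dird y ph) x)) (at 0 within I)"
  using line_nbhd[OF x y] by blast
 have at: "at 0 within I = at 0" by (rule at_within_open[OF I(2,1)])
 have dx: "(?x hvd xi) (at 0 within I)" by (auto intro!: derivative_eq_intros)
 have h: "((%t. (0 :: real ^ 'n, dird ze ph (?x t))) hvd (0, dird xi (dird ze ph) x)) (at 0 within I)"
  using chain_vec[OF dx, of "dird ze ph" "%v. dird v (dird ze ph) x"] smooth_on_has_derivative[OF smooth_on_dird[OF phi_smooth] x]
  by (intro has_vector_derivative_Pair' has_vector_derivative_const) simp
 have "((%t. dird (0, dird ze ph (?x t)) D2.E (ph (?x t), dird (?y t) ph (?x t))) has_vector_derivative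
   dird (0, dird xi (dird ze ph) x) D2.E (ph (?x 0), dird (?y 0) ph (?x 0)) +
   dird (dird xi ph x, dird et ph x + dird xi (dird y ph) x) (dird (0, dird ze ph (?x 0)) D2.E) (ph (?x 0), dird (?y 0) ph (?x 0))) (at 0 within I)"
  by (rule dird_var_derivative[OF D2.smooth_E D2.open_Z _ z h]) (use Z_phi x y I(2,3) in auto)
 hence "((%t. dird (0, ze) D1.E ((x, y) + t *r (xi, et))) has_vector_derivative
   dird (0, dird xi (dird ze ph) x) D2.E (ph (?x 0), dird (?y 0) ph (?x 0)) +
   dird (dird xi ph x, dird et ph x + dird xi (dird y ph) x) (dird (0, dird ze ph (?x 0)) D2.E) (ph (?x 0), dird (?y 0) ph (?x 0))) (at 0 within I)"
  by (rule has_vector_derivative_transform[OF I(2), rotated]) (use dird_Ey_phi I(3) in simp)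
 moreover have "((%t. dird (0, ze) D1.E ((x, y) + t *r (xi, et))) hvd dird (xi, et) (dird (0, ze) D1.E) (x, y)) (at 0)"
  using dird_line[OF D1.smooth_E1, of "(x, y)" 0 "(xi, et)"] Z_phi[OF x y] by (simp add: has_real_derivative_iff_has_vector_derivative)
 ultimately show ?thesis unfolding at using vector_derivative_unique_at by (simp add: add.commute) blast
qed

lemma g_phi:
 assumes x: "x : V" and y: "y ~= 0"
 shows "D1.g (x, y) et ze = D2.g (ph x, dird y ph x) (dird et ph x) (dird ze ph x)"
 using dird_dird_Ey_phi[OF x y, of 0 et ze] dird_simps(5)[OF phi_smooth x] dird_simps(5)[OF smooth_on_dird[OF phi_smooth] x]
  dird_simps(5)[OF D2.smooth_E, of "(ph x, dird y ph x)"] Z_phi[OF x y]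
 by (simp add: D1.g_def D2.g_def zero_prod_def)

text \<open>The transformation law of a spray. It suffices to test against all images of the
  differential, and there both sides are Euler-Lagrange expressions by \<open>g_Q\<close>.\<close>

lemma Q_phi:
 assumes x: "x : V"
 shows "dird (D1.Q x y) ph x = D2.Q (ph x) (dird y ph x) + dird y (dird y ph) x"
proof (cases "y = 0")
 case True
 have "dird 0 (dird 0 ph) x = 0" by (rule dird_simps(5)[OF smooth_on_dird[OF phi_smooth] x])
 thus ?thesis using True dird_simps(5)[OF phi_smooth x] by (simp add: D1.Q_zero D2.Q_zero)
next
 case y: False
 note z = Z_phi[OF x y]
 let ?z = "(ph x, dird y ph x)"
 show ?thesis
 proof (rule D2.g_eqI[OF conjunct2[OF z]])
  fix w
  obtain ze where w: "dird ze ph x = w" using phi_surj[OF x] .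
  have "D2.g ?z (dird (D1.Q x y) ph x) w = dird (y, 0) (dird (0, ze) D1.E) (x, y) - dird (ze, 0) D1.E (x, y)"
   using g_phi[OF x y, of "D1.Q x y" ze] D1.g_Q[of x y ze] z w by simp
  also have "... = dird (dird y ph x, dird y (dird y ph) x) (dird (0, w) D2.E) ?z - dird (w, 0) D2.E ?z"
  proof -
   have 1: "dird (w, dird ze (dird y ph) x) D2.E ?z = dird (w, 0) D2.E ?z + dird (0, dird ze (dird y ph) x) D2.E ?z"
    using dird_simps(1)[OF D2.smooth_E conjunct2[OF z], of "(w, 0)" "(0, dird ze (dird y ph) x)"] by simp
   show ?thesis
    using dird_dird_Ey_phi[OF x y, of y 0 ze] dird_E_phi[OF x y, of ze 0] dird_simps(5)[OF phi_smooth x]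
     dird_commute_vec[OF open_V phi_smooth x, of y ze] 1 w by simp
  qed
  also have "dird (dird y ph x, dird y (dird y ph) x) (dird (0, w) D2.E) ?z
    = dird (dird y ph x, 0) (dird (0, w) D2.E) ?z + D2.g ?z (dird y (dird y ph) x) w"
   using dird_simps(1)[OF D2.smooth_E1 conjunct2[OF z], of "(dird y ph x, 0)" "(0, dird y (dird y ph) x)"] by (simp add: D2.g_def)
  finally show "D2.g ?z (dird (D1.Q x y) ph x) w = D2.g ?z (D2.Q (ph x) (dird y ph x) + dird y (dird y ph) x) w"
   using D2.g_Q[OF conjunct2[OF z], of w] linear_add[OF D2.g_linear1[OF conjunct2[OF z]]] by simp
 qed
qed

lemma sol_phi:
 assumes s: "D1.sol I u v" and V: "!!t. t : I ==> u t : V"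
 shows "D2.sol I (%t. ph (u t)) (%t. dird (v t) ph (u t))"
 unfolding D2.sol_def
proof (intro ballI conjI)
 fix t assume t: "t : I"
 show "ph (u t) : U2" using V[OF t] phi_image by blast
 show "((%t. ph (u t)) hvd dird (v t) ph (u t)) (at t within I)"
  using chain_vec[OF D1.solD(2)[OF s t]] smooth_on_has_derivative[OF phi_smooth V[OF t]] by fast
 have "((%t. dird (v t) ph (u t)) hvd dird (- D1.Q (u t) (v t)) ph (u t) + dird (v t) (dird (v t) ph) (u t)) (at t within I)"
  by (rule dird_var_derivative_vec[OF phi_smooth open_V D1.solD(2,3)[OF s t] V t])
 thus "((%t. dird (v t) ph (u t)) hvd - D2.Q (ph (u t)) (dird (v t) ph (u t))) (at t within I)"
  using Q_phi[OF V[OF t], of "v t"] dird_simps(3)[OF phi_smooth V[OF t]] by simp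
qed

end

section \<open>Charts, velocities and geodesics on the manifold\<close>

locale finsler_mfd =
 fixes A :: "('m::{t2_space, second_countable_topology}, 'n::finite) chart set" and F :: "('m, 'n) finsler_fun"
 assumes mfd: "finsler_manifold A F"
begin

lemma atlas: "smooth_atlas A" and metric: "finsler_metric A F" and conn: "connected (UNIV :: 'm set)"
 using mfd unfolding finsler_manifold_def by auto

lemma chartD:
 assumes "c : A"
 shows "open (cdom c)" "open (cimg c)" "homeomorphism (cdom c) (cimg c) (cmap c) (cinv c)"
 using atlas assms unfolding smooth_atlas_def by auto

lemma chart_cover: obtains c where "c : A" "p : cdom c"
 using atlas unfolding smooth_atlas_def by blast

lemma chart_simps:
 assumes "c : A"
 shows "p : cdom c ==> cinv c (cmap c p) = p" "x : cimg c ==> cmap c (cinv c x) = x"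
  "p : cdom c ==> cmap c p : cimg c" "x : cimg c ==> cinv c x : cdom c"
  "continuous_on (cdom c) (cmap c)" "continuous_on (cimg c) (cinv c)"
 using chartD(3)[OF assms] unfolding homeomorphism_def by auto

definition ov where "ov c d = cmap c ` (cdom c Int cdom d)"
definition tr where "tr c d = cmap d \<circ> cinv c"

lemma ov_iff:
 assumes c: "c : A"
 shows "x : ov c d \<longleftrightarrow> x : cimg c & cinv c x : cdom d"
proof
 show "x : ov c d ==> x : cimg c & cinv c x : cdom d"
  unfolding ov_def using chart_simps(1,3)[OF c] by fastforce
 assume "x : cimg c & cinv c x : cdom d"
 thus "x : ov c d"
  unfolding ov_def using chart_simps(2,4)[OF c, of x] by (intro image_eqI[of _ _ "cinv c x"]) auto
qed

lemma ov_open: assumes "c : A" "d : A" shows "open (ov c d)"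
proof -
 have "ov c d = cimg c Int cinv c -` cdom d" by (rule set_eqI) (simp add: ov_iff[OF assms(1)])
 thus ?thesis
  using continuous_on_open_vimage[OF chartD(2)[OF assms(1)], THEN iffD1, OF chart_simps(6)[OF assms(1)]] chartD(1)[OF assms(2)]
  by (simp add: Int_commute)
qed

lemma tr_smooth: "c : A ==> d : A ==> smooth_on (ov c d) (tr c d)"
 using atlas unfolding smooth_atlas_def ov_def tr_def by blast

lemma tr_eq: "c : A ==> p : cdom c ==> tr c d (cmap c p) = cmap d p"
 by (simp add: tr_def chart_simps)

lemma tr_chain:
 assumes "c : A" "d : A" "e : A" "p : cdom c" "p : cdom d" "p : cdom e"
 shows "dird (dird v (tr c d) (cmap c p)) (tr d e) (cmap d p) = dird v (tr c e) (cmap c p)"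
proof -
 have x: "cmap c p : ov c d" "cmap d p : ov d e" "cmap c p : ov c e" using assms unfolding ov_def by auto
 have "((%x. tr d e (tr c d x)) has_derivative (%v. dird (dird v (tr c d) (cmap c p)) (tr d e) (cmap d p))) (at (cmap c p))"
  using has_derivative_compose[OF smooth_on_has_derivative[OF tr_smooth[OF assms(1,2)] x(1)], of "tr d e"]
   smooth_on_has_derivative[OF tr_smooth[OF assms(2,3)] x(2)] tr_eq[OF assms(1,4), of d] by simp
 hence "(tr c e has_derivative (%v. dird (dird v (tr c d) (cmap c p)) (tr d e) (cmap d p))) (at (cmap c p))"
  by (rule has_derivative_transform_within_open[OF _ open_Int[OF ov_open[OF assms(1,2)] ov_open[OF assms(1,3)]]])
   (rule IntI[OF x(1,3)], simp add: ov_iff[OF assms(1)] tr_def chart_simps(1)[OF assms(2)])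
 thus ?thesis by (rule dird_eqI[symmetric])
qed

lemma tr_refl:
 assumes "c : A" "p : cdom c"
 shows "dird v (tr c c) (cmap c p) = v"
proof -
 have "(tr c c has_derivative (%v. v)) (at (cmap c p))"
  by (rule has_derivative_transform_within_open[OF has_derivative_ident chartD(2)[OF assms(1)] chart_simps(3)[OF assms]])
   (simp add: tr_def chart_simps[OF assms(1)])
 thus ?thesis by (rule dird_eqI)
qed

lemma tvec_of_eq: "d : A ==> p : cdom d ==> tvec_of A c p y d = dird y (tr c d) (cmap c p)"
 by (simp add: tvec_of_def dird_def tr_def)

lemma tvec_of_in: "c : A ==> p : cdom c ==> tvec_of A c p y : tangent_space A p"
 unfolding tangent_space_def using tr_chain[of c]
 by (auto simp: tvec_of_def dird_def tr_def)

lemma tvec_of_self: "c : A ==> p : cdom c ==> tvec_of A c p y c = y"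
 by (simp add: tvec_of_eq tr_refl)

lemma tangent_eq:
 assumes "X : tangent_space A p" "c : A" "p : cdom c"
 shows "tvec_of A c p (X c) = X"
proof
 fix d
 show "tvec_of A c p (X c) d = X d"
 proof (cases "d : A & p : cdom d")
  case True
  hence "X d = frechet_derivative (cmap d \<circ> cinv c) (at (cmap c p)) (X c)"
   using assms unfolding tangent_space_def by blast
  thus ?thesis using True by (simp add: tvec_of_def)
 next
  case False
  hence "X d = 0" using assms(1) unfolding tangent_space_def by blast
  thus ?thesis unfolding tvec_of_def using False by (simp only: if_False)
 qed
qed

lemma tvec_of_scale:
 assumes "c : A" "p : cdom c"
 shows "tvec_of A c p (a *r y) = (%d. a *r tvec_of A c p y d)"
proof
 fix d
 show "tvec_of A c p (a *r y) d = a *r tvec_of A c p y d"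
 proof (cases "d : A & p : cdom d")
  case True
  hence "cmap c p : ov c d" using assms by (auto simp: ov_def)
  thus ?thesis using True dird_simps(2)[OF tr_smooth[of c d]] assms by (simp add: tvec_of_eq)
 next
  case False
  thus ?thesis by (simp add: tvec_of_def del: de_Morgan_conj)
 qed
qed

abbreviation L where "L c == local_F A F c"

lemma L_eq: "c : A ==> p : cdom c ==> L c (cmap c p) y = F p (tvec_of A c p y)"
 by (simp add: local_F_def chart_simps)

lemma F_tangent: "c : A ==> p : cdom c ==> X : tangent_space A p ==> F p X = L c (cmap c p) (X c)"
 using L_eq tangent_eq by metis

lemma finsler_dom: 
 assumes c: "c : A"
 shows "finsler_dom (cimg c) (L c)"
proof
 show "open (cimg c)" by (rule chartD(2)[OF c])
 show "smooth_on (cimg c \<times> - {0}) (%(x, y). L c x y)" using metric c unfolding finsler_metric_def by blast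
 fix x y assume x: "x : cimg c"
 hence p: "cinv c x : cdom c" by (rule chart_simps(4)[OF c])
 show "0 <= L c x y" using metric tvec_of_in[OF c p] unfolding finsler_metric_def local_F_def by blast
 show "L c x (a *r y) = a * L c x y" if "0 < a" for a
  using metric tvec_of_in[OF c p] that unfolding finsler_metric_def local_F_def tvec_of_scale[OF c p] by blast
 show "fund_form (L c) x y u u > 0" if "y ~= 0" "u ~= 0" for u
  using metric c x that unfolding finsler_metric_def by blast
qed

lemma transition:
 assumes "c : A" "d : A"
 shows "finsler_transition (cimg c) (cimg d) (L c) (L d) (ov c d) (tr c d)"
proof -
 interpret D1: finsler_dom "cimg c" "L c" by (rule finsler_dom[OF assms(1)])
 interpret D2: finsler_dom "cimg d" "L d" by (rule finsler_dom[OF assms(2)])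
 show ?thesis
 proof
  show "open (ov c d)" by (rule ov_open[OF assms])
  show "ov c d <= cimg c" using ov_iff[OF assms(1)] by blast
  show "smooth_on (ov c d) (tr c d)" by (rule tr_smooth[OF assms])
  show "tr c d ` ov c d <= cimg d"
   by (rule image_subsetI) (simp add: ov_iff[OF assms(1)] chart_simps(3)[OF assms(2)] tr_def)
  fix x y assume x: "x : ov c d"
  then obtain p where p: "p : cdom c" "p : cdom d" "x = cmap c p" unfolding ov_def by blast
  show "L d (tr c d x) (dird y (tr c d) x) = L c x y"
  proof -
   have "tvec_of A d p (tvec_of A c p y d) = tvec_of A c p y"
    by (rule tangent_eq[OF tvec_of_in[OF assms(1) p(1)] assms(2) p(2)])
   thus ?thesis
    using L_eq[OF assms(1) p(1), of y] L_eq[OF assms(2) p(2), of "dird y (tr c d) x"] tvec_of_eq[OF assms(2) p(2), of c y] p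
    by (simp add: tr_eq[OF assms(1)])
  qed
  assume "dird y (tr c d) x = 0"
  hence "dird 0 (tr d c) (cmap d p) = dird y (tr c c) (cmap c p)"
   using tr_chain[OF assms(1,2,1) p(1,2,1), of y] p by simp
  moreover have "dird 0 (tr d c) (cmap d p) = 0"
   by (rule dird_simps(5)[OF tr_smooth[OF assms(2,1)]]) (use p in "auto simp: ov_def")
  ultimately show "y = 0" using tr_refl[OF assms(1) p(1)] by simp
 qed
qed

definition Sol where "Sol c = finsler_dom.sol (cimg c) (L c)"

lemma Sol_def': "c : A ==> Sol c I u v \<longleftrightarrow> (ALL t:I. u t : cimg c & (u hvd v t) (at t within I) &
   (v hvd - finsler_dom.Q (L c) (u t) (v t)) (at t within I))"
 unfolding Sol_def by (rule finsler_dom.sol_def[OF finsler_dom])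

lemma Q_eq: "c : A ==> - finsler_dom.Q (L c) x v = (\<chi> i. - (SUM j:UNIV. SUM k:UNIV. chern (L c) i j k x v * v $ j * v $ k))"
 by (simp add: finsler_dom.Q_def[OF finsler_dom] finsler_dom.Gam_def[OF finsler_dom] vec_eq_iff)

lemma Sol_transition:
 assumes "c : A" "d : A" "Sol c I (%t. cmap c (ga t)) v" "!!t. t : I ==> ga t : cdom c Int cdom d"
 shows "Sol d I (%t. cmap d (ga t)) (%t. dird (v t) (tr c d) (cmap c (ga t)))"
proof -
 interpret T: finsler_transition "cimg c" "cimg d" "L c" "L d" "ov c d" "tr c d" by (rule transition[OF assms(1,2)])
 have "Sol d I (%t. tr c d (cmap c (ga t))) (%t. dird (v t) (tr c d) (cmap c (ga t)))"
  unfolding Sol_def by (rule T.sol_phi[OF assms(3)[unfolded Sol_def]]) (use assms(4) in "auto simp: ov_def")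
 moreover have "tr c d (cmap c (ga t)) = cmap d (ga t)" if "t : I" for t using tr_eq[OF assms(1), of "ga t" d] assms(4)[OF that] by simp
 ultimately show ?thesis unfolding Sol_def'[OF assms(2)]
  using has_vector_derivative_transform[of _ I "%t. cmap d (ga t)" "%t. tr c d (cmap c (ga t))"] by simp
qed

text \<open>An interval without isolated points, so that one-sided derivatives and hence velocities
  are unique.\<close>

definition good :: "real set => bool" where "good I \<longleftrightarrow> convex I & (ALL t:I. at t within I ~= bot)"

lemma good_Icc: "a < b ==> good {a..b}"
 unfolding good_def by (auto simp: trivial_limit_within islimpt_Icc)

lemma good_Ici: "good {a::real..}"
proof -
 have "at t within {a..} ~= bot" if "t : {a..}" for t
  using that islimpt_subset[of t "{t..t + 1}" "{a..}"] islimpt_Icc[of t "t + 1" t] by (auto simp: trivial_limit_within)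
 thus ?thesis unfolding good_def by (auto simp: convex_real_interval)
qed

lemma good_Ico: "a < b ==> good {a::real..<b}"
proof -
 assume ab: "a < b"
 have "at t within {a..<b} ~= bot" if "t : {a..<b}" for t
  using that islimpt_subset[of t "{t..(t + b) / 2}" "{a..<b}"] islimpt_Icc[of t "(t + b) / 2" t] by (auto simp: trivial_limit_within)
 thus ?thesis unfolding good_def by (auto simp: convex_real_interval)
qed

lemma velocity_eq:
 assumes "good I" "t : I" "c : A" "ga t : cdom c" "((%t. cmap c (ga t)) hvd v) (at t within I)"
 shows "velocity A I ga t c = v"
 using assms vector_derivative_within[of t I] unfolding good_def by (auto simp: velocity_def o_def)

lemma geodesic_Sol:
 assumes I: "good I" and g: "geodesic A F I ga" and c: "c : A" and J: "J <= I" "!!t. t : J ==> ga t : cdom c"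
 shows "Sol c J (%t. cmap c (ga t)) (%t. velocity A I ga t c)"
 unfolding Sol_def'[OF c]
proof (intro ballI conjI)
 fix t assume t: "t : J"
 hence tI: "t : I" "ga t : cdom c" using J by auto
 show "cmap c (ga t) : cimg c" by (rule chart_simps(3)[OF c tI(2)])
 have "(cmap c \<circ> ga) differentiable (at t within I)" using g c tI unfolding geodesic_def C1_curve_def by blast
 hence "((cmap c \<circ> ga) hvd velocity A I ga t c) (at t within I)"
  using c tI unfolding velocity_def by (simp add: vector_derivative_works)
 thus "((%t. cmap c (ga t)) hvd velocity A I ga t c) (at t within J)"
  using has_vector_derivative_within_subset[OF _ J(1)] by (simp add: o_def)
 have "((%s. velocity A I ga s c) hvd - finsler_dom.Q (L c) (cmap c (ga t)) (velocity A I ga t c)) (at t within I)"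
  using g c tI unfolding geodesic_def Q_eq[OF c] Let_def by blast
 thus "((%s. velocity A I ga s c) hvd - finsler_dom.Q (L c) (cmap c (ga t)) (velocity A I ga t c)) (at t within J)"
  by (rule has_vector_derivative_within_subset[OF _ J(1)])
qed

lemma within_ball: "t : ball t0 de ==> at t within (I Int ball t0 de) = at (t::real) within I"
 by (rule at_within_nhd[of t "ball t0 de"]) auto

text \<open>A geodesic has to satisfy its equation in every chart, but one chart around each time is
  enough: \<open>Sol_transition\<close> moves the solution to any other chart, and uniqueness of
  derivatives identifies its velocity.\<close>

lemma geodesicI:
 assumes I: "good I" and cont: "continuous_on I ga"
  and loc: "!!t. t : I ==> EX c:A. EX v. EX de>0. (ALL s:I Int ball t de. ga s : cdom c) & Sol c (I Int ball t de) (%t. cmap c (ga t)) v"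
 shows "geodesic A F I ga"
proof -
 have key: "(cmap d \<circ> ga) differentiable (at t within I) &
   ((%s. velocity A I ga s d) hvd - finsler_dom.Q (L d) (cmap d (ga t)) (velocity A I ga t d)) (at t within I)"
  if t: "t : I" and d: "d : A" "ga t : cdom d" for t d
 proof -
  obtain c v de where c: "c : A" "de > 0" "ALL s:I Int ball t de. ga s : cdom c" "Sol c (I Int ball t de) (%t. cmap c (ga t)) v"
   using loc[OF t] by blast
  obtain T where T: "open T" "t : T" "ALL s:I Int T. ga s : cdom d"
   using cont t d chartD(1)[OF d(1)] unfolding continuous_on_topological by (metis IntD1 IntD2)
  obtain e where e: "e > 0" "ball t e <= T" using T openE by metis
  define k where "k = min e de"
  define J where "J = I Int ball t k"
  have k: "k > 0" "J <= I Int ball t de" using e c unfolding k_def J_def by auto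
  have Jd: "ga s : cdom c Int cdom d" if "s : J" for s
  proof -
   have "s : I" "s : ball t e" "s : ball t de" using that unfolding J_def k_def by auto
   thus ?thesis using c(3) T(3) e(2) by blast
  qed
  have "Sol c J (%t. cmap c (ga t)) v"
   using c(4) k(2) finsler_dom.sol_subset[OF finsler_dom[OF c(1)]] unfolding Sol_def by blast
  from Sol_transition[OF c(1) d(1) this Jd]
  obtain w where w: "Sol d J (%t. cmap d (ga t)) w" by blast
  have wd: "((%t. cmap d (ga t)) hvd w s) (at s within I)"
   "(w hvd - finsler_dom.Q (L d) (cmap d (ga s)) (w s)) (at s within I)" if "s : J" for s
  proof -
   have "at s within J = at s within I" unfolding J_def by (rule within_ball) (use that in "simp add: J_def")
   thus "((%t. cmap d (ga t)) hvd w s) (at s within I)"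
    "(w hvd - finsler_dom.Q (L d) (cmap d (ga s)) (w s)) (at s within I)"
    using w that unfolding Sol_def'[OF d(1)] by metis+
  qed
  have vel: "velocity A I ga s d = w s" if "s : J" for s
   by (rule velocity_eq[OF I _ d(1) _ wd(1)[OF that]]) (use that Jd in "auto simp: J_def")
  have tJ: "t : J" using t k unfolding J_def by simp
  have "((%s. velocity A I ga s d) hvd - finsler_dom.Q (L d) (cmap d (ga t)) (w t)) (at t within I)"
  proof (rule has_vector_derivative_transform_within[OF wd(2)[OF tJ] k(1) t])
   fix s assume "s : I" "dist s t < k"
   thus "w s = velocity A I ga s d" using vel[of s] by (simp add: J_def dist_commute)
  qed
  thus ?thesis using wd(1)[OF tJ] vel[OF tJ] by (auto simp: o_def intro: differentiableI_vector)
 qed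
 show ?thesis
  unfolding geodesic_def C1_curve_def Let_def
 proof (intro conjI ballI impI cont)
  fix d t assume *: "d : A" "t : I" "ga t : cdom d"
  note k = key[OF *(2,1,3)]
  show "(cmap d \<circ> ga) differentiable (at t within I)" by (rule conjunct1[OF k])
  show "continuous (at t within I) (%s. velocity A I ga s d)"
   by (rule has_vector_derivative_continuous[OF conjunct2[OF k]])
  show "((%s. velocity A I ga s d) has_vector_derivative
    (\<chi> i. - (SUM j:UNIV. SUM k:UNIV. chern (L d) i j k (cmap d (ga t)) (velocity A I ga t d) *
      velocity A I ga t d $ j * velocity A I ga t d $ k))) (at t within I)"
   using conjunct2[OF k] unfolding Q_eq[OF *(1)] .
 qed
qed

end

section \<open>Curves and the Finsler distance\<close>

text \<open>Off the zero section this is smoothness; at y = 0 it follows from 0 <= F <= sqrt C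
  |y|.\<close>

lemma (in finsler_dom) continuous_F: "continuous_on (U \<times> UNIV) (%z. F (fst z) (snd z))"
 unfolding continuous_on_eq_continuous_within
proof
 fix z assume "z : U \<times> (UNIV :: (real ^ 'n) set)"
 then obtain x y where z: "z = (x, y)" "x : U" by auto
 show "continuous (at z within U \<times> UNIV) (%z. F (fst z) (snd z))"
 proof (cases "y = 0")
  case False
  have "isCont (%z. F (fst z) (snd z)) z"
  proof -
   have "continuous_on Z (%z. F (fst z) (snd z))"
    using smooth_on_continuous[OF smooth_F] by (simp add: Z_def case_prod_beta')
   thus ?thesis using open_Z z False by (simp add: continuous_on_eq_continuous_at Z_iff)
  qed
  thus ?thesis by (rule continuous_at_imp_continuous_at_within)
 next
  case True
  obtain R where R: "R > 0" "cball x R <= U" using open_U z(2) open_contains_cball by metis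
  have "EX C>0. ALL a:cball x R. ALL y. E (a, y) <= C / 2 * (norm y)\<^sup>2"
   by (rule energy_bounds[OF compact_cball convex_cball R(2)]) blast
  then obtain C where C: "C > 0" "!!a y. a : cball x R ==> E (a, y) <= C / 2 * (norm y)\<^sup>2" by blast
  have bound: "F a y <= sqrt C * norm y" if "a : cball x R" for a y
  proof -
   have "sqrt (2 * E (a, y)) <= sqrt (C * (norm y)\<^sup>2)" using C(2)[OF that, of y] by (intro real_sqrt_le_mono) simp
   thus ?thesis using F_eq_sqrt[of a y] that R by (auto simp: real_sqrt_mult)
  qed
  have ev: "eventually (%w. w : ball x R \<times> UNIV) (at z within U \<times> UNIV)"
   by (rule eventually_at_topological[THEN iffD2], rule exI[of _ "ball x R \<times> UNIV"]) (use z R in "auto intro: open_Times")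
  have "((%w. F (fst w) (snd w)) \<longlongrightarrow> 0) (at z within U \<times> UNIV)"
  proof (rule tendsto_sandwich[of "%_. 0" _ _ "%w. sqrt C * norm (snd w)"])
   show "eventually (%w. 0 <= F (fst w) (snd w)) (at z within U \<times> UNIV)"
    using ev by eventually_elim (use F_nonneg R in "auto simp: subset_iff")
   show "eventually (%w. F (fst w) (snd w) <= sqrt C * norm (snd w)) (at z within U \<times> UNIV)"
    using ev by eventually_elim (use bound in auto)
   have "((%w. sqrt C * norm (snd w)) \<longlongrightarrow> sqrt C * norm (snd z)) (at z within U \<times> UNIV)"
    by (intro tendsto_intros)
   thus "((%w. sqrt C * norm (snd w)) \<longlongrightarrow> 0) (at z within U \<times> UNIV)" using True z by simp
  qed simp
  thus ?thesis using True z F_zero by (simp add: continuous_within)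
 qed
qed

context finsler_mfd begin

text \<open>The components of the velocity in different charts are related by the chain rule, so
  they form a tangent vector.\<close>

lemma velocity_tangent:
 assumes I: "good I" and t: "t : I" and c: "c : A" "ga t : cdom c" and cont: "continuous_on I ga"
  and d: "((%t. cmap c (ga t)) hvd v) (at t within I)"
 shows "velocity A I ga t = tvec_of A c (ga t) v"
proof
 fix e
 show "velocity A I ga t e = tvec_of A c (ga t) v e"
 proof (cases "e : A & ga t : cdom e")
  case True
  have x: "cmap c (ga t) : ov c e" using True c by (auto simp: ov_def)
  have 1: "((%t. tr c e (cmap c (ga t))) hvd dird v (tr c e) (cmap c (ga t))) (at t within I)"
   using chain_vec[OF d smooth_on_has_derivative[OF tr_smooth[OF c(1) conjunct1[OF True]] x]] .
  obtain T where T: "open T" "t : T" "ALL s:I. s : T --> ga s : cdom c"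
   using cont t c(2) chartD(1)[OF c(1)] unfolding continuous_on_topological by metis
  obtain k where k: "k > 0" "ball t k <= T" using T openE by metis
  have "((%t. cmap e (ga t)) hvd dird v (tr c e) (cmap c (ga t))) (at t within I)"
  proof (rule has_vector_derivative_transform_within[OF 1 k(1) t])
   fix s assume "s : I" "dist s t < k"
   hence "ga s : cdom c" using T(3) k(2) by (auto simp: dist_commute subset_iff)
   thus "tr c e (cmap c (ga s)) = cmap e (ga s)" by (rule tr_eq[OF c(1)])
  qed
  thus ?thesis
   using velocity_eq[OF I t] True tvec_of_eq[of e "ga t" c v] by simp
 next
  case False
  thus ?thesis unfolding velocity_def tvec_of_def by (simp only: if_False)
 qed
qed

lemma C1_curve_derivative:
 assumes "C1_curve A I ga" "t : I" "c : A" "ga t : cdom c"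
 shows "((%t. cmap c (ga t)) hvd velocity A I ga t c) (at t within I)"
 using assms unfolding C1_curve_def velocity_def by (simp add: vector_derivative_works o_def)

definition spd :: "real set => (real => 'm) => real => real" where "spd I ga t = F (ga t) (velocity A I ga t)"

lemma spd_chart:
 assumes "good I" "C1_curve A I ga" "t : I" "c : A" "ga t : cdom c"
 shows "spd I ga t = L c (cmap c (ga t)) (velocity A I ga t c)"
proof -
 have "continuous_on I ga" using assms(2) unfolding C1_curve_def by blast
 from velocity_tangent[OF assms(1,3,4,5) this C1_curve_derivative[OF assms(2-5)]]
 show ?thesis unfolding spd_def using L_eq[OF assms(4,5)] by metis
qed

lemma chart_nbhd:
 fixes t :: real
 assumes "continuous_on I ga" "t : I" "c : A" "ga t : cdom c"
 obtains k where "k > 0" "!!s. s : I ==> abs(s - t) < k ==> ga s : cdom c"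
proof -
 obtain T where T: "open T" "t : T" "ALL s:I. s : T --> ga s : cdom c"
  using assms chartD(1)[OF assms(3)] unfolding continuous_on_topological by metis
 obtain k where k: "k > 0" "ball t k <= T" using T openE by metis
 show thesis by (rule that[OF k(1)]) (use T k in "auto simp: dist_real_def subset_iff abs_minus_commute")
qed

lemma spd_continuous:
 assumes I: "good I" and C: "C1_curve A I ga"
 shows "continuous_on I (spd I ga)"
 unfolding continuous_on_eq_continuous_within
proof
 fix t assume t: "t : I"
 obtain c where c: "c : A" "ga t : cdom c" using chart_cover[of "ga t"] by blast
 interpret D: finsler_dom "cimg c" "L c" by (rule finsler_dom[OF c(1)])
 have cont: "continuous_on I ga" using C unfolding C1_curve_def by blast
 obtain k where k: "k > 0" "!!s. s : I ==> abs(s - t) < k ==> ga s : cdom c" using chart_nbhd[OF cont t c] by blast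
 define J where "J = I Int ball t k"
 have J: "ga s : cdom c" "s : I" if "s : J" for s using that k(2) unfolding J_def by (auto simp: dist_real_def abs_minus_commute)
 have tJ: "t : J" using t k(1) by (simp add: J_def)
 have "continuous_on J (%s. (cmap c (ga s), velocity A I ga s c))"
 proof (rule continuous_on_Pair)
  show "continuous_on J (%s. cmap c (ga s))"
   by (rule continuous_on_compose2[OF chart_simps(5)[OF c(1)] continuous_on_subset[OF cont]]) (use J in auto)
  show "continuous_on J (%s. velocity A I ga s c)"
   unfolding continuous_on_eq_continuous_within
  proof
   fix s assume s: "s : J"
   have "continuous (at s within I) (%s. velocity A I ga s c)"
    using C c(1) J[OF s] unfolding C1_curve_def by blast
   thus "continuous (at s within J) (%s. velocity A I ga s c)"
    by (rule continuous_within_subset) (use J(2) in blast)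
  qed
 qed
 hence "continuous_on J (%s. L c (cmap c (ga s)) (velocity A I ga s c))"
  using continuous_on_compose2[OF D.continuous_F, of J "%s. (cmap c (ga s), velocity A I ga s c)"] chart_simps(3)[OF c(1) J(1)] by force
 hence "continuous_on J (spd I ga)"
  by (rule continuous_on_eq) (use spd_chart[OF I C J(2) c(1) J(1)] in simp)
 hence "continuous (at t within J) (spd I ga)" using tJ by (simp add: continuous_on_eq_continuous_within)
 moreover have "at t within J = at t within I" unfolding J_def by (rule within_ball) (use k in simp)
 ultimately show "continuous (at t within I) (spd I ga)" by simp
qed

lemma spd_nonneg: "good I ==> C1_curve A I ga ==> t : I ==> 0 <= spd I ga t"
 using spd_chart chart_cover[of "ga t"] finsler_dom.F_nonneg[OF finsler_dom] chart_simps(3) by metis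

lemma C1_curve_subset:
 assumes C: "C1_curve A I ga" and I: "good I" and J: "good J" "J <= I"
 shows "C1_curve A J ga" "t : J ==> velocity A J ga t = velocity A I ga t"
proof -
 have cont: "continuous_on J ga" using C J continuous_on_subset unfolding C1_curve_def by blast
 have d: "((%t. cmap c (ga t)) hvd velocity A I ga t c) (at t within J)"
  if "t : J" "c : A" "ga t : cdom c" for t c
  using has_vector_derivative_within_subset[OF C1_curve_derivative[OF C _ that(2,3)] J(2)] that J by blast
 have v: "velocity A J ga t = velocity A I ga t" if t: "t : J" for t
 proof
  fix c
  show "velocity A J ga t c = velocity A I ga t c"
  proof (cases "c : A & ga t : cdom c")
   case True
   thus ?thesis using velocity_eq[OF J(1) t _ _ d[OF t]] by blast
  next
   case False
   thus ?thesis unfolding velocity_def by (simp only: if_False)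
  qed
 qed
 thus "t : J ==> velocity A J ga t = velocity A I ga t" .
 show "C1_curve A J ga"
  unfolding C1_curve_def
 proof (intro conjI ballI impI cont)
  fix c t assume *: "c : A" "t : J" "ga t : cdom c"
  show "(cmap c \<circ> ga) differentiable (at t within J)"
   using d[OF *(2,1,3)] unfolding o_def by (rule differentiableI_vector)
  have "continuous (at t within I) (%s. velocity A I ga s c)" using C * J(2) unfolding C1_curve_def by blast
  hence "continuous (at t within J) (%s. velocity A I ga s c)" by (rule continuous_within_subset[OF _ J(2)])
  thus "continuous (at t within J) (%s. velocity A J ga s c)"
   using *(2) v by (simp add: continuous_within v cong: Lim_cong_within)
 qed
qed

lemma C1_curve_affine:
 assumes C: "C1_curve A I ga" and I: "good I" and J: "good J" "(%t. al * t + be) ` J <= I"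
 shows "C1_curve A J (%t. ga (al * t + be))"
  "t : J ==> velocity A J (%t. ga (al * t + be)) t = (%c. al *r velocity A I ga (al * t + be) c)"
proof -
 let ?h = "%t. al * t + be"
 have hI: "?h t : I" if "t : J" for t using J(2) that by blast
 have cg: "continuous_on I ga" using C unfolding C1_curve_def by blast
 have cont: "continuous_on J (%t. ga (?h t))"
  by (rule continuous_on_compose2[OF cg _ J(2)]) (intro continuous_intros)
 have d: "((%t. cmap c (ga (?h t))) hvd al *r velocity A I ga (?h t) c) (at t within J)"
  if "t : J" "c : A" "ga (?h t) : cdom c" for t c
 proof -
  have "(?h hvd al) (at t within J)" by (auto intro!: derivative_eq_intros)
  moreover have "((%t. cmap c (ga t)) hvd velocity A I ga (?h t) c) (at (?h t) within ?h ` J)"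
   using has_vector_derivative_within_subset[OF C1_curve_derivative[OF C hI[OF that(1)] that(2,3)] J(2)] .
  ultimately show ?thesis using vector_diff_chain_within by (fastforce simp: o_def)
 qed
 have v: "velocity A J (%t. ga (?h t)) t = (%c. al *r velocity A I ga (?h t) c)" if t: "t : J" for t
 proof
  fix c
  show "velocity A J (%t. ga (?h t)) t c = al *r velocity A I ga (?h t) c"
  proof (cases "c : A & ga (?h t) : cdom c")
   case True
   thus ?thesis using velocity_eq[OF J(1) t, of c "%t. ga (?h t)"] d[OF t] by blast
  next
   case False
   thus ?thesis unfolding velocity_def by (simp only: if_False scaleR_zero_right)
  qed
 qed
 thus "t : J ==> velocity A J (%t. ga (?h t)) t = (%c. al *r velocity A I ga (?h t) c)" .
 show "C1_curve A J (%t. ga (?h t))"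
  unfolding C1_curve_def
 proof (intro conjI ballI impI cont)
  fix c t assume *: "c : A" "t : J" "ga (?h t) : cdom c"
  show "(cmap c \<circ> (%t. ga (?h t))) differentiable (at t within J)"
   using d[OF *(2,1,3)] unfolding o_def by (rule differentiableI_vector)
  have "continuous (at (?h t) within I) (%s. velocity A I ga s c)" using C * hI unfolding C1_curve_def by blast
  hence 1: "continuous (at (?h t) within ?h ` J) (%s. velocity A I ga s c)" by (rule continuous_within_subset[OF _ J(2)])
  have 2: "continuous (at t within J) ?h" by (intro continuous_intros)
  have "continuous (at t within J) (%s. velocity A I ga (?h s) c)"
   by (rule continuous_within_compose2[OF 2 1])
  hence "continuous (at t within J) (%s. al *r velocity A I ga (?h s) c)" by (intro continuous_intros)
  thus "continuous (at t within J) (%s. velocity A J (%t. ga (?h t)) s c)"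
   using *(2) by (simp add: continuous_within v cong: Lim_cong_within)
 qed
qed

section \<open>Piecewise differentiable curves and their lengths\<close>

definition pwc :: "real => real => (real => 'm) => bool" where
 "pwc a b ga \<longleftrightarrow> continuous_on {a..b} ga &
   (EX S. finite S & (ALL a' b'. a <= a' & a' < b' & b' <= b & {a'<..<b'} Int S = {} --> C1_curve A {a'..b'} ga))"

text \<open>The speed from two-sided derivatives. It does not depend on a parameter interval and
  agrees with \<open>spd\<close> in the interior, so lengths over adjacent intervals are integrals
  of a single function.\<close>

definition sp :: "(real => 'm) => real => real" where "sp ga t = F (ga t) (velocity A UNIV ga t)"

abbreviation len where "len == curve_length A F"
abbreviation dst where "dst == fdist A F"

lemma pw_C1_curve_iff: "pw_C1_curve A ga \<longleftrightarrow> pwc 0 1 ga"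
 unfolding pw_C1_curve_def pwc_def by simp

lemma velocity_interior: "a < t ==> t < b ==> velocity A {a..b} ga t = velocity A UNIV ga t"
 unfolding velocity_def by (simp add: at_within_Icc_at cong: if_cong)

lemma spd_interior: "a < t ==> t < b ==> spd {a..b} ga t = sp ga t"
 unfolding spd_def sp_def by (simp add: velocity_interior)

lemma len_sp: "len a b ga = integral {a..b} (sp ga)"
 unfolding curve_length_def
 by (rule integral_spike[of "{a, b}"]) (auto simp: sp_def velocity_interior)

text \<open>Induction over the differentiable pieces by bisection: to the left and to the right of
  any time a short interval contains no break point.\<close>

lemma pwc_induct:
 assumes ga: "pwc a b ga" and ab: "a <= b" and refl: "!!s. s : {a..b} ==> P s s"
  and C1: "!!s t. a <= s ==> s < t ==> t <= b ==> C1_curve A {s..t} ga ==> P s t"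
  and trans: "!!s t u. a <= s ==> s <= t ==> t <= u ==> u <= b ==> P s t ==> P t u ==> P s u"
 shows "P a b"
proof -
 obtain S where S: "finite S" "!!a' b'. a <= a' ==> a' < b' ==> b' <= b ==> {a'<..<b'} Int S = {} ==> C1_curve A {a'..b'} ga"
  using ga unfolding pwc_def by blast
 have "a <= a & b <= b --> P a b"
  using ab
 proof (induction rule: Bolzano[where P="%s t. a <= s & t <= b --> P s t"])
  case (trans s t u)
  thus ?case using assms(5)[of s t u] by auto
 next
  case (local x)
  obtain d where d: "d > 0" "!!y. y : S ==> y ~= x ==> d <= dist x y" using finite_set_avoid[OF S(1)] by metis
  have P: "P s t" if "a <= s" "s <= t" "t <= b" "x ~: {s<..<t}" "x - d < s" "t < x + d" for s t
  proof (cases "s = t")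
   case False
   have "{s<..<t} Int S = {}"
    using d(2) that by (fastforce simp: dist_real_def)
   thus ?thesis using False that by (intro C1 S(2)) auto
  qed (use refl that in auto)
  show ?case
  proof (intro exI[of _ d] conjI allI impI d)
   fix s t assume *: "s <= x & x <= t & t - s < d" "a <= s & t <= b"
   show "P s t" by (rule assms(5)[of s x t]) (use * in "auto intro!: P")
  qed
 qed
 thus ?thesis by simp
qed

lemma C1_integrable:
 assumes "C1_curve A {a..b} ga" "a < b" "a <= u" "u <= v" "v <= b"
 shows "sp ga integrable_on {u..v}"
proof -
 have "spd {a..b} ga integrable_on {a..b}"
  by (rule integrable_continuous_real[OF spd_continuous[OF good_Icc[OF assms(2)] assms(1)]])
 hence "sp ga integrable_on {a..b}"
  by (rule integrable_spike_finite[of "{a, b}", rotated 2]) (auto simp: spd_interior)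
 thus ?thesis using integrable_subinterval_real assms by fastforce
qed

lemma pwc_integrable:
 assumes "pwc a b ga"
 shows "sp ga integrable_on {a..b}"
proof (cases "a <= b")
 case True
 show ?thesis
  by (rule pwc_induct[OF assms True])
   (auto intro: C1_integrable Henstock_Kurzweil_Integration.integrable_combine simp: integrable_on_refl[where 'a=real, simplified])
qed (simp add: integrable_on_empty)

lemma pwc_sub:
 assumes "pwc a b ga" "a <= a'" "b' <= b"
 shows "pwc a' b' ga"
proof -
 obtain S where S: "finite S" "!!a' b'. a <= a' ==> a' < b' ==> b' <= b ==> {a'<..<b'} Int S = {} ==> C1_curve A {a'..b'} ga"
  using assms(1) unfolding pwc_def by blast
 have "continuous_on {a'..b'} ga" using assms continuous_on_subset unfolding pwc_def by fastforce
 thus ?thesis unfolding pwc_def using S assms(2,3) by (intro conjI exI[of _ S]) auto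
qed

lemma pwc_split:
 assumes "pwc a b ga" "pwc b c ga" "a <= b" "b <= c"
 shows "pwc a c ga"
proof -
 obtain S where S: "finite S" "!!a' b'. a <= a' ==> a' < b' ==> b' <= b ==> {a'<..<b'} Int S = {} ==> C1_curve A {a'..b'} ga"
  using assms(1) unfolding pwc_def by blast
 obtain S' where S': "finite S'" "!!a' b'. b <= a' ==> a' < b' ==> b' <= c ==> {a'<..<b'} Int S' = {} ==> C1_curve A {a'..b'} ga"
  using assms(2) unfolding pwc_def by blast
 have "continuous_on ({a..b} Un {b..c}) ga"
  using assms(1,2) unfolding pwc_def by (intro continuous_on_closed_Un) auto
 moreover have "{a..b} Un {b..c} = {a..c}" using assms by auto
 moreover have "C1_curve A {a'..b'} ga" if "a <= a'" "a' < b'" "b' <= c" "{a'<..<b'} Int (S Un S' Un {b}) = {}" for a' b'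
 proof (cases "b' <= b")
  case True
  thus ?thesis using S(2)[of a' b'] that by auto
 next
  case False
  hence "b <= a'" using that by (force simp: disjoint_iff)
  thus ?thesis using S'(2)[of a' b'] that by auto
 qed
 ultimately show ?thesis unfolding pwc_def using S(1) S'(1) by (intro conjI exI[of _ "S Un S' Un {b}"]) auto
qed

lemma C1_curve_cong:
 assumes "C1_curve A {a..b} ga" "a < b" "!!t. t : {a..b} ==> ga t = sg t"
 shows "C1_curve A {a..b} sg"
proof -
 have e: "vector_derivative (cmap c \<circ> sg) (at t within {a..b}) = vector_derivative (cmap c \<circ> ga) (at t within {a..b})" if "t : {a..b}" for t c
 proof -
  have "((cmap c \<circ> sg) hvd f) (at t within {a..b}) \<longleftrightarrow> ((cmap c \<circ> ga) hvd f) (at t within {a..b})" for f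
   using has_vector_derivative_transform[OF that, of "cmap c \<circ> sg" "cmap c \<circ> ga"] has_vector_derivative_transform[OF that, of "cmap c \<circ> ga" "cmap c \<circ> sg"] assms(3) by auto
  thus ?thesis unfolding vector_derivative_def by simp
 qed
 have v: "velocity A {a..b} sg t = velocity A {a..b} ga t" if "t : {a..b}" for t
  unfolding velocity_def e[OF that] using assms(3)[OF that] by simp
 show ?thesis unfolding C1_curve_def
 proof (intro conjI ballI impI)
  show "continuous_on {a..b} sg" using assms unfolding C1_curve_def by (metis continuous_on_eq)
  fix c t assume *: "c : A" "t : {a..b}" "sg t : cdom c"
  hence g: "ga t : cdom c" using assms(3) by simp
  have "(cmap c \<circ> ga) differentiable (at t within {a..b})" using assms(1) * g unfolding C1_curve_def by blast
  thus "(cmap c \<circ> sg) differentiable (at t within {a..b})"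
   by (rule differentiable_transform_within[of _ _ _ 1]) (use * assms(3) in auto)
  have "continuous (at t within {a..b}) (%s. velocity A {a..b} ga s c)" using assms(1) * g unfolding C1_curve_def by blast
  thus "continuous (at t within {a..b}) (%s. velocity A {a..b} sg s c)"
   by (rule continuous_transform_within[of _ _ _ 1]) (use *(2) v in simp_all)
 qed
qed

lemma pwc_cong:
 assumes "pwc a b ga" "!!t. t : {a..b} ==> ga t = sg t"
 shows "pwc a b sg"
proof -
 obtain S where S: "finite S" "!!a' b'. a <= a' ==> a' < b' ==> b' <= b ==> {a'<..<b'} Int S = {} ==> C1_curve A {a'..b'} ga"
  using assms(1) unfolding pwc_def by blast
 have "C1_curve A {a'..b'} sg" if "a <= a'" "a' < b'" "b' <= b" "{a'<..<b'} Int S = {}" for a' b'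
  by (rule C1_curve_cong[OF S(2)[OF that]]) (use that assms(2) in auto)
 moreover have "continuous_on {a..b} sg" using assms unfolding pwc_def by (metis continuous_on_eq)
 ultimately show ?thesis unfolding pwc_def using S(1) by blast
qed

lemma len_combine: "pwc a c ga ==> a <= b ==> b <= c ==> len a b ga + len b c ga = len a c ga"
 unfolding len_sp by (intro Henstock_Kurzweil_Integration.integral_combine pwc_integrable)

lemma len_cong:
 assumes "!!t. t : {a..b} ==> ga t = sg t"
 shows "len a b ga = len a b sg"
 unfolding curve_length_def
proof (rule integral_cong)
 fix t assume t: "t : {a..b}"
 have "vector_derivative (cmap c \<circ> sg) (at t within {a..b}) = vector_derivative (cmap c \<circ> ga) (at t within {a..b})" for c :: "('m, 'n) chart"
 proof -
  have "((cmap c \<circ> sg) hvd f) (at t within {a..b}) \<longleftrightarrow> ((cmap c \<circ> ga) hvd f) (at t within {a..b})" for f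
   using has_vector_derivative_transform[OF t, of "cmap c \<circ> sg" "cmap c \<circ> ga"] has_vector_derivative_transform[OF t, of "cmap c \<circ> ga" "cmap c \<circ> sg"] assms by auto
  thus ?thesis unfolding vector_derivative_def by simp
 qed
 thus "F (ga t) (velocity A {a..b} ga t) = F (sg t) (velocity A {a..b} sg t)"
  unfolding velocity_def using assms[OF t] by (simp cong: if_cong)
qed

lemma F_zero_tvec: "F p (%c. 0) = 0" and F_scale: "X : tangent_space A p ==> a > 0 ==> F p (%c. a *r X c) = a * F p X"
 and F_nonneg: "X : tangent_space A p ==> 0 <= F p X"
proof -
 show "F p (%c. a *r X c) = a * F p X" if "X : tangent_space A p" "a > 0"
  using metric that unfolding finsler_metric_def by blast
 show "X : tangent_space A p ==> 0 <= F p X" using metric unfolding finsler_metric_def by blast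
 obtain c where c: "c : A" "p : cdom c" using chart_cover by blast
 have "tvec_of A c p (0 *r 0) = (%d. 0 *r tvec_of A c p 0 d)" by (rule tvec_of_scale[OF c])
 hence "tvec_of A c p 0 = (%d. 0)" by simp
 thus "F p (%c. 0) = 0"
  using L_eq[OF c, of 0] finsler_dom.F_zero[OF finsler_dom[OF c(1)] chart_simps(3)[OF c]] by simp
qed

lemma pwc_interior:
 assumes "pwc a b ga"
 obtains S where "finite S" "!!t. t : {a..b} - S ==> a < t & t < b & (EX e>0. C1_curve A {t - e..t + e} ga)"
proof -
 obtain S where S: "finite S" "!!a' b'. a <= a' ==> a' < b' ==> b' <= b ==> {a'<..<b'} Int S = {} ==> C1_curve A {a'..b'} ga"
  using assms unfolding pwc_def by blast
 show thesis
 proof (rule that[of "S Un {a, b}"])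
  fix t assume t: "t : {a..b} - (S Un {a, b})"
  have "open ({a<..<b} - S)" using S(1) by (simp add: open_Diff finite_imp_closed)
  moreover have "t : {a<..<b} - S" using t by auto
  ultimately obtain e where e: "e > 0" "cball t e <= {a<..<b} - S" using open_contains_cball by metis
  have "{t - e..t + e} = cball t e" by (simp add: cball_eq_atLeastAtMost)
  hence i: "{t - e..t + e} <= {a<..<b} - S" using e by simp
  have "t - e : {a<..<b} - S" "t + e : {a<..<b} - S" by (rule subsetD[OF i], use e(1) in simp)+
  moreover have "{t - e<..<t + e} Int S = {}" using i greaterThanLessThan_subseteq_atLeastAtMost_iff by fastforce
  ultimately have "C1_curve A {t - e..t + e} ga" using e(1) by (intro S(2)) auto
  thus "a < t & t < b & (EX e>0. C1_curve A {t - e..t + e} ga)" using e(1) t by auto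
 qed (use S in simp)
qed

lemma C1_interior:
 assumes "C1_curve A {t - e..t + e} ga" "e > 0"
 shows "0 <= sp ga t" "velocity A UNIV ga t : tangent_space A (ga t)"
proof -
 have g: "good {t - e..t + e}" by (rule good_Icc) (use assms in simp)
 have tt: "t : {t - e..t + e}" using assms by simp
 show "0 <= sp ga t" using spd_nonneg[OF g assms(1) tt] spd_interior[of "t - e" t "t + e" ga] assms(2) by simp
 obtain c where c: "c : A" "ga t : cdom c" using chart_cover by blast
 have "velocity A {t - e..t + e} ga t : tangent_space A (ga t)"
  using velocity_tangent[OF g tt c _ C1_curve_derivative[OF assms(1) tt c]] assms(1) tvec_of_in[OF c] unfolding C1_curve_def by metis
 thus "velocity A UNIV ga t : tangent_space A (ga t)" using velocity_interior[of "t - e" t "t + e" ga] assms(2) by simp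
qed

lemma len_nonneg: assumes "pwc a b ga" shows "0 <= len a b ga"
proof -
 obtain S where S: "finite S" "!!t. t : {a..b} - S ==> 0 <= sp ga t" using pwc_interior[OF assms] C1_interior(1) by metis
 have "len a b ga = integral {a..b} (%t. if t : S then 0 else sp ga t)"
  unfolding len_sp by (rule integral_spike[of S]) (use S(1) in "auto simp: negligible_finite")
 also have "... >= 0"
 proof (rule integral_nonneg)
  show "(%t. if t : S then 0 else sp ga t) integrable_on {a..b}"
   by (rule integrable_spike_finite[OF S(1) _ pwc_integrable[OF assms]]) auto
 qed (use S(2) in auto)
 finally show ?thesis .
qed

end

lemma (in finsler_dom) sol_affine:
 assumes s: "sol I u v" and J: "(%t. al * t + be) ` J <= I" and al: "al >= 0"
 shows "sol J (%t. u (al * t + be)) (%t. al *r v (al * t + be))"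
 unfolding sol_def
proof (intro ballI conjI)
 fix t assume t: "t : J"
 hence tI: "al * t + be : I" using J by blast
 show "u (al * t + be) : U" by (rule solD(1)[OF s tI])
 have h: "((%t. al * t + be) hvd al) (at t within J)" by (auto intro!: derivative_eq_intros)
 show "((%t. u (al * t + be)) hvd al *r v (al * t + be)) (at t within J)"
  using vector_diff_chain_within[OF h has_vector_derivative_within_subset[OF solD(2)[OF s tI] J]] by (simp add: o_def)
 have "((%t. v (al * t + be)) hvd al *r - Q (u (al * t + be)) (v (al * t + be))) (at t within J)"
  using vector_diff_chain_within[OF h has_vector_derivative_within_subset[OF solD(3)[OF s tI] J]] by (simp add: o_def)
 hence "((%t. al *r v (al * t + be)) hvd al *r (al *r - Q (u (al * t + be)) (v (al * t + be)))) (at t within J)"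
  by (rule bounded_linear.has_vector_derivative[OF bounded_linear_scaleR_right])
 moreover have "al *r (al *r - Q (u (al * t + be)) (v (al * t + be))) = - Q (u (al * t + be)) (al *r v (al * t + be))"
  using Q_hom[OF solD(1)[OF s tI], of al] Q_zero al by (cases "al = 0") (auto simp: power2_eq_square)
 ultimately show "((%t. al *r v (al * t + be)) hvd - Q (u (al * t + be)) (al *r v (al * t + be))) (at t within J)"
  by simp
qed

context finsler_mfd begin

lemma pwc_affine:
 assumes p: "pwc a b ga" and al: "al ~= 0" and im: "(%t. al * t + be) ` {a'..b'} <= {a..b}"
 shows "pwc a' b' (%t. ga (al * t + be))"
proof -
 obtain S where S: "finite S" "!!a' b'. a <= a' ==> a' < b' ==> b' <= b ==> {a'<..<b'} Int S = {} ==> C1_curve A {a'..b'} ga"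
  using p unfolding pwc_def by blast
 let ?h = "%t. al * t + be"
 have "C1_curve A {x..y} (%t. ga (?h t))" if xy: "a' <= x" "x < y" "y <= b'" "{x<..<y} Int ?h -` S = {}" for x y
 proof -
  define lo where "lo = min (?h x) (?h y)"
  define hi where "hi = max (?h x) (?h y)"
  have in_ab: "?h t : {a..b}" if "t : {x, y}" for t
  proof -
   have "t : {a'..b'}" using that xy by auto
   thus ?thesis using im by blast
  qed
  have "al * x ~= al * y" using al xy(2) by simp
  hence "al * x < al * y | al * y < al * x" by linarith
  hence lt: "lo < hi" unfolding lo_def hi_def min_def max_def by argo
  have ints: "?h t : {lo..hi}" if "t : {x..y}" for t
  proof (cases "al > 0")
   case True
   hence "al * x <= al * t" "al * t <= al * y" using that by (auto intro: mult_left_mono)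
   thus ?thesis unfolding lo_def hi_def by (auto simp: min_def max_def)
  next
   case False
   hence "al * y <= al * t" "al * t <= al * x" using that by (auto intro: mult_left_mono_neg)
   thus ?thesis unfolding lo_def hi_def by (auto simp: min_def max_def)
  qed
  have "{lo<..<hi} Int S = {}"
  proof (rule ccontr)
   assume "{lo<..<hi} Int S ~= {}"
   then obtain s where s: "s : S" "lo < s" "s < hi" by auto
   define t where "t = (s - be) / al"
   have ht: "?h t = s" using al by (simp add: t_def)
   have "x < t" "t < y"
   proof -
    have "~ t <= x" "~ y <= t"
    proof -
     show "~ t <= x"
     proof
      assume "t <= x"
      hence "(al > 0 & ?h t <= ?h x & ?h x <= ?h y) | (al < 0 & ?h x <= ?h t & ?h y <= ?h x)"
       using al xy(2) by (cases "al > 0") (auto intro: mult_left_mono mult_left_mono_neg)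
      thus False using s ht unfolding lo_def hi_def by auto
     qed
     show "~ y <= t"
     proof
      assume "y <= t"
      hence "(al > 0 & ?h y <= ?h t & ?h x <= ?h y) | (al < 0 & ?h t <= ?h y & ?h y <= ?h x)"
       using al xy(2) by (cases "al > 0") (auto intro: mult_left_mono mult_left_mono_neg)
      thus False using s ht unfolding lo_def hi_def by auto
     qed
    qed
    thus "x < t" "t < y" by auto
   qed
   hence "t : {x<..<y} Int ?h -` S" using ht s(1) by auto
   thus False using xy(4) by blast
  qed
  hence "C1_curve A {lo..hi} ga" using lt in_ab[of x] in_ab[of y] by (intro S(2)) (auto simp: lo_def hi_def min_def max_def)
  thus ?thesis by (rule C1_curve_affine(1)[OF _ good_Icc[OF lt] good_Icc[OF xy(2)]]) (use ints in auto)
 qed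
 moreover have "finite (?h -` S)" using S(1) al by (intro finite_vimageI) (auto intro!: injI)
 moreover have "continuous_on {a'..b'} (%t. ga (?h t))"
  by (rule continuous_on_compose2[OF _ _ im]) (use p in "auto simp: pwc_def intro!: continuous_intros")
 ultimately show ?thesis unfolding pwc_def by (intro conjI exI[of _ "?h -` S"]) auto
qed

lemma sp_affine:
 assumes "C1_curve A {al * t + be - e..al * t + be + e} ga" "e > 0" "al ~= 0"
 shows "velocity A UNIV (%t. ga (al * t + be)) t = (%c. al *r velocity A UNIV ga (al * t + be) c)"
proof -
 define k where "k = e / abs(al)"
 have k: "k > 0" using assms by (simp add: k_def)
 have "velocity A {t - k..t + k} (%t. ga (al * t + be)) t = (%c. al *r velocity A {al * t + be - e..al * t + be + e} ga (al * t + be) c)"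
 proof (rule C1_curve_affine(2)[OF assms(1) good_Icc good_Icc])
  show "(%t. al * t + be) ` {t - k..t + k} <= {al * t + be - e..al * t + be + e}"
  proof (rule image_subsetI)
   fix s assume "s : {t - k..t + k}"
   hence "abs(s - t) <= k" by (auto simp: abs_le_iff)
   hence "abs(al) * abs(s - t) <= abs(al) * k" by (intro mult_left_mono) auto
   also have "... = e" using assms(3) by (simp add: k_def)
   finally have "abs(al * s - al * t) <= e" by (simp add: abs_mult[symmetric] right_diff_distrib)
   thus "al * s + be : {al * t + be - e..al * t + be + e}" by (auto simp: abs_le_iff)
  qed
 qed (use k assms in auto)
 thus ?thesis
  using velocity_interior[of "t - k" t "t + k"] velocity_interior[of "al * t + be - e" "al * t + be" "al * t + be + e"] k assms(2) by simp
qed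

text \<open>One statement for both orientations. For positive \<open>al\<close> the factor is
  \<open>m = 1\<close>; for negative \<open>al\<close> the factor \<open>m\<close> is a bound for
  F(-X)/F(X).\<close>

lemma len_affine_le:
 assumes p: "pwc a b ga" and al: "al ~= 0" and h: "(%t. al * t + be) ` {a'..b'} = {a..b}" and m: "m >= 0"
  and le: "!!q X. X : tangent_space A q ==> F q (%c. sgn al *r X c) <= m * F q X"
 shows "len a' b' (%t. ga (al * t + be)) <= m * len a b ga"
proof -
 let ?h = "%t. al * t + be"
 obtain S where S: "finite S" "!!t. t : {a..b} - S ==> a < t & t < b & (EX e>0. C1_curve A {t - e..t + e} ga)"
  using pwc_interior[OF p] by metis
 have fS: "finite (?h -` S)" using S(1) al by (intro finite_vimageI) (auto intro!: injI)
 have i: "(sp ga has_integral len a b ga) (cbox a b)"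
  using pwc_integrable[OF p] unfolding len_sp by (simp add: integrable_integral)
 have "((%t. sp ga (al *r t + be)) has_integral (1 / abs(al) ^ DIM(real)) *r len a b ga) ((%x. (1 / al) *r x + - ((1 / al) *r be)) ` cbox a b)"
  by (rule has_integral_affinity[OF i al])
 moreover have "(%x. (1 / al) *r x + - ((1 / al) *r be)) ` cbox a b = {a'..b'}"
 proof -
  have "(%x. (1 / al) *r x + - ((1 / al) *r be)) ` (?h ` {a'..b'}) = {a'..b'}"
   using al by (auto simp: image_image field_simps)
  thus ?thesis unfolding h by simp
 qed
 ultimately have "((%t. sp ga (?h t)) has_integral len a b ga / abs(al)) {a'..b'}" by (simp add: mult.commute)
 hence k: "((%t. m * abs(al) * sp ga (?h t)) has_integral m * abs(al) * (len a b ga / abs(al))) {a'..b'}"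
  by (rule has_integral_mult_right)
 \<comment> \<open>The comparison of integrands is known off a finite set only; on this set the
   integrand is replaced without changing the integral.\<close>
 define k2 where "k2 t = (if t : ?h -` S then sp (%t. ga (?h t)) t else m * abs(al) * sp ga (?h t))" for t
 have k2: "(k2 has_integral m * abs(al) * (len a b ga / abs(al))) {a'..b'}"
  by (rule has_integral_spike_finite[OF fS _ k]) (simp add: k2_def)
 have "pwc a' b' (%t. ga (?h t))" by (rule pwc_affine[OF p al]) (simp add: h)
 hence k1: "(sp (%t. ga (?h t)) has_integral len a' b' (%t. ga (?h t))) {a'..b'}"
  unfolding len_sp by (intro integrable_integral pwc_integrable)
 have "len a' b' (%t. ga (?h t)) <= m * abs(al) * (len a b ga / abs(al))"
 proof (rule has_integral_le[OF k1 k2])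
  fix t assume t: "t : {a'..b'}"
  show "sp (%t. ga (?h t)) t <= k2 t"
  proof (cases "?h t : S")
   case False
   have "?h t : {a..b}" using t h by blast
   then obtain e where e: "e > 0" "C1_curve A {?h t - e..?h t + e} ga" using S(2) False by blast
   let ?X = "velocity A UNIV ga (?h t)"
   have X: "?X : tangent_space A (ga (?h t))" by (rule C1_interior(2)[OF e(2,1)])
   have sX: "(%c. sgn al *r ?X c) : tangent_space A (ga (?h t))"
   proof -
    obtain c where c: "c : A" "ga (?h t) : cdom c" using chart_cover by blast
    have "tvec_of A c (ga (?h t)) (sgn al *r ?X c) = (%d. sgn al *r ?X d)"
     unfolding tvec_of_scale[OF c] tangent_eq[OF X c] ..
    thus ?thesis using tvec_of_in[OF c] by metis
   qed
   have "sp (%t. ga (?h t)) t = F (ga (?h t)) (%c. abs(al) *r (sgn al *r ?X c))"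
    unfolding sp_def sp_affine[OF e(2,1) al] by (simp add: mult.commute[of "abs(al)"] sgn_mult_abs)
   also have "... = abs(al) * F (ga (?h t)) (%c. sgn al *r ?X c)" by (rule F_scale[OF sX]) (use al in simp)
   also have "... <= abs(al) * (m * F (ga (?h t)) ?X)" by (intro mult_left_mono le X) simp
   finally show ?thesis using False by (simp add: k2_def sp_def mult_ac)
  qed (simp add: k2_def)
 qed
 thus ?thesis using al by simp
qed

lemma affine_image: "al > 0 ==> (%t. al * t + be) ` {a..b} = {al * a + be..al * b + be :: real}"
 using image_affinity_atLeastAtMost[of al be a b] by (auto split: if_splits)

lemma dst_le:
 assumes "pwc a b ga" "a < b"
 shows "dst (ga a) (ga b) <= len a b ga"
proof -
 let ?sg = "%t. ga ((b - a) * t + a)"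
 have im: "(%t. (b - a) * t + a) ` {0..1} = {a..b}" using affine_image[of "b - a" a 0 1] assms(2) by simp
 have p: "pw_C1_curve A ?sg" unfolding pw_C1_curve_iff by (rule pwc_affine[OF assms(1)]) (use assms(2) im in auto)
 have "len 0 1 ?sg <= 1 * len a b ga"
  by (rule len_affine_le[OF assms(1) _ im]) (use assms(2) in "auto simp: sgn_if")
 moreover have "dst (ga a) (ga b) <= len 0 1 ?sg"
  unfolding fdist_def
 proof (rule cInf_lower)
  show "len 0 1 ?sg : {len 0 1 ga' |ga'. pw_C1_curve A ga' & ga' 0 = ga a & ga' 1 = ga b}"
   using p by (intro CollectI exI[of _ ?sg]) simp
  show "bdd_below {len 0 1 ga' |ga'. pw_C1_curve A ga' & ga' 0 = ga a & ga' 1 = ga b}"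
   unfolding pw_C1_curve_iff by (rule bdd_belowI[of _ 0]) (use len_nonneg in auto)
 qed
 ultimately show ?thesis by simp
qed

text \<open>\<open>fdist\<close> is an infimum of reals, which says nothing if no curve exists.
  Connectedness will exclude this.\<close>

definition joinable where "joinable p q \<longleftrightarrow> (EX ga. pwc 0 1 ga & ga 0 = p & ga 1 = q)"

lemma pwc_const: "pwc a b (%_. p)"
proof -
 have "C1_curve A {a'..b'} (%_. p)" if "a' < b'" for a' b'
  unfolding C1_curve_def
 proof (intro conjI ballI impI)
  fix c t assume c: "c : A" "t : {a'..b'}" "p : cdom c"
  show "(cmap c \<circ> (%_. p)) differentiable (at t within {a'..b'})" unfolding o_def by (rule differentiable_const)
  have v: "velocity A {a'..b'} (%_. p) s c = 0" if "s : {a'..b'}" for s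
   by (rule velocity_eq[OF good_Icc[OF `a' < b'`] that c(1,3)]) (rule has_vector_derivative_const)
  have "continuous (at t within {a'..b'}) (%_. 0 :: real ^ 'n)" by simp
  thus "continuous (at t within {a'..b'}) (%s. velocity A {a'..b'} (%_. p) s c)"
   by (rule continuous_transform_within[OF _ zero_less_one c(2)]) (simp only: v)
 qed simp
 thus ?thesis unfolding pwc_def by (intro conjI exI[of _ "{}"]) auto
qed

lemma pwc_concat:
 assumes "pwc 0 1 ga1" "pwc 0 1 ga2" "ga1 1 = ga2 0"
 obtains ga where "pwc 0 2 ga" "ga 0 = ga1 0" "ga 2 = ga2 1" "len 0 2 ga <= len 0 1 ga1 + len 0 1 ga2"
proof -
 define ga where "ga t = (if t <= 1 then ga1 t else ga2 (1 * t + (- 1)))" for t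
 have im: "(%t. 1 * t + (- 1)) ` {1..2} = {0..1::real}" using affine_image[of 1 "- 1" 1 2] by simp
 have p2: "pwc 1 2 (%t. ga2 (1 * t + (- 1)))" by (rule pwc_affine[OF assms(2)]) (use im in simp_all)
 have e1: "ga1 t = ga t" if "t : {0..1}" for t using that by (simp add: ga_def)
 have e2: "ga2 (1 * t + (- 1)) = ga t" if "t : {1..2}" for t using that assms(3) by (auto simp: ga_def)
 have p: "pwc 0 2 ga" by (rule pwc_split[OF pwc_cong[OF assms(1) e1] pwc_cong[OF p2 e2]]) auto
 have "len 0 2 ga = len 0 1 ga + len 1 2 ga" using len_combine[OF p, of 1] by simp
 also have "len 0 1 ga = len 0 1 ga1" using len_cong[OF e1] by simp
 also have "len 1 2 ga = len 1 2 (%t. ga2 (1 * t + (- 1)))" by (rule len_cong) (rule e2[symmetric])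
 also have "... <= 1 * len 0 1 ga2" by (rule len_affine_le[OF assms(2) _ im]) auto
 finally have l: "len 0 2 ga <= len 0 1 ga1 + len 0 1 ga2" by simp
 have "ga 0 = ga1 0" "ga 2 = ga2 1" using assms(3) by (auto simp: ga_def)
 thus thesis using that[OF p _ _ l] by blast
qed

lemma joinable_trans: assumes "joinable p q" "joinable q r" shows "joinable p r"
proof -
 obtain ga1 ga2 where 1: "pwc 0 1 ga1" "ga1 0 = p" "ga1 1 = q" and 2: "pwc 0 1 ga2" "ga2 0 = q" "ga2 1 = r"
  using assms unfolding joinable_def by blast
 then obtain ga where ga: "pwc 0 2 ga" "ga 0 = p" "ga 2 = r" using pwc_concat[OF 1(1) 2(1)] by metis
 have im: "(%t. 2 * t + 0) ` {0..1} = {0..2::real}" using affine_image[of 2 0 0 1] by simp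
 have "pwc 0 1 (%t. ga (2 * t + 0))" by (rule pwc_affine[OF ga(1)]) (use im in simp_all)
 thus ?thesis unfolding joinable_def using ga by (intro exI[of _ "%t. ga (2 * t + 0)"]) simp
qed

lemma joinable_sym: assumes "joinable p q" shows "joinable q p"
proof -
 obtain ga where ga: "pwc 0 1 ga" "ga 0 = p" "ga 1 = q" using assms unfolding joinable_def by blast
 have "pwc 0 1 (%t. ga (- 1 * t + 1))" by (rule pwc_affine[OF ga(1)]) auto
 thus ?thesis unfolding joinable_def using ga by (intro exI[of _ "%t. ga (- 1 * t + 1)"]) simp
qed

lemma geodesic_C1: "geodesic A F I ga ==> C1_curve A I ga" unfolding geodesic_def by simp

lemma geodesic_subset:
 assumes "geodesic A F I ga" "good I" "good J" "J <= I"
 shows "geodesic A F J ga"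
proof (rule geodesicI[OF assms(3)])
 show "continuous_on J ga" using geodesic_C1[OF assms(1)] assms(4) continuous_on_subset unfolding C1_curve_def by blast
 fix t assume t: "t : J"
 obtain c where c: "c : A" "ga t : cdom c" using chart_cover by blast
 obtain k where k: "k > 0" "!!s. s : I ==> abs(s - t) < k ==> ga s : cdom c"
  using chart_nbhd[of I ga t c] geodesic_C1[OF assms(1)] c t assms(4) unfolding C1_curve_def by blast
 have d: "ga s : cdom c" if "s : J Int ball t k" for s
  using k(2)[of s] that assms(4) by (auto simp: dist_real_def abs_minus_commute subset_iff)
 show "EX c:A. EX v. EX de>0. (ALL s:J Int ball t de. ga s : cdom c) & Sol c (J Int ball t de) (%t. cmap c (ga t)) v"
  using geodesic_Sol[OF assms(2,1) c(1), of "J Int ball t k"] d assms(4) c(1) k(1) by (intro bexI[of _ c] exI[of _ "%t. velocity A I ga t c"] exI[of _ k]) blast+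
qed

lemma geodesic_affine:
 assumes g: "geodesic A F I ga" and I: "good I" and J: "good J" "(%t. al * t + be) ` J <= I" and al: "al >= 0"
 shows "geodesic A F J (%t. ga (al * t + be))"
proof (rule geodesicI[OF J(1)])
 let ?h = "%t. al * t + be"
 have cg: "continuous_on I ga" using geodesic_C1[OF g] unfolding C1_curve_def by blast
 show cont: "continuous_on J (%t. ga (?h t))"
  by (rule continuous_on_compose2[OF cg _ J(2)]) (intro continuous_intros)
 fix t assume t: "t : J"
 obtain c where c: "c : A" "ga (?h t) : cdom c" using chart_cover by blast
 interpret D: finsler_dom "cimg c" "L c" by (rule finsler_dom[OF c(1)])
 obtain k where k: "k > 0" "!!s. s : J ==> abs(s - t) < k ==> ga (?h s) : cdom c"
  using chart_nbhd[OF cont t c(1)] c(2) by blast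
 have d: "ga (?h s) : cdom c" if "s : J Int ball t k" for s
  using k(2)[of s] that by (auto simp: dist_real_def abs_minus_commute)
 let ?J = "J Int ball t k"
 have "Sol c (?h ` ?J) (%t. cmap c (ga t)) (%t. velocity A I ga t c)"
  by (rule geodesic_Sol[OF I g c(1)]) (use J(2) d in auto)
 hence "Sol c ?J (%t. cmap c (ga (?h t))) (%t. al *r velocity A I ga (?h t) c)"
  unfolding Sol_def using D.sol_affine[OF _ subset_refl al] by blast
 thus "EX c:A. EX v. EX de>0. (ALL s:J Int ball t de. ga (?h s) : cdom c) & Sol c (J Int ball t de) (%t. cmap c (ga (?h t))) v"
  using d c(1) k(1) by blast
qed

text \<open>In a chart half the squared speed is the energy, which has derivative 0; the derivative
  is local, so the constant is global.\<close>

lemma geodesic_speed: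
 assumes g: "geodesic A F I ga" and I: "good I"
 obtains m where "m >= 0" "!!t. t : I ==> spd I ga t = m"
proof -
 note C = geodesic_C1[OF g]
 have cg: "continuous_on I ga" using C unfolding C1_curve_def by blast
 have "((%t. (spd I ga t)\<^sup>2 / 2) has_real_derivative 0) (at t within I)" if t: "t : I" for t
 proof -
  obtain c where c: "c : A" "ga t : cdom c" using chart_cover by blast
  interpret D: finsler_dom "cimg c" "L c" by (rule finsler_dom[OF c(1)])
  obtain k where k: "k > 0" "!!s. s : I ==> abs(s - t) < k ==> ga s : cdom c" using chart_nbhd[OF cg t c] by blast
  let ?J = "I Int ball t k"
  have J: "ga s : cdom c" "s : I" if "s : ?J" for s using that k(2) by (auto simp: dist_real_def abs_minus_commute)
  have "D.sol ?J (%t. cmap c (ga t)) (%t. velocity A I ga t c)"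
   using geodesic_Sol[OF I g c(1), of ?J] J unfolding Sol_def by blast
  from D.sol_energy_derivative[OF this, of t] t k(1)
  have "((%s. D.E (cmap c (ga s), velocity A I ga s c)) has_real_derivative 0) (at t within I)"
   using within_ball[of t t k I] by simp
  thus ?thesis
   by (rule has_field_derivative_transform_within[OF _ k(1) t])
    (use spd_chart[OF I C _ c(1)] k(2) in "simp add: D.E_def dist_real_def")
 qed
 then obtain e where e: "!!t. t : I ==> (spd I ga t)\<^sup>2 / 2 = e"
  using has_field_derivative_zero_constant[of I "%t. (spd I ga t)\<^sup>2 / 2"] I unfolding good_def by blast
 have "spd I ga t = sqrt (2 * e)" if "t : I" for t
  using e[OF that] spd_nonneg[OF I C that] by (metis real_sqrt_unique nonzero_mult_div_cancel_left times_divide_eq_right zero_neq_numeral)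
 moreover have "sqrt (2 * e) >= 0 | I = {}" using e by (metis ex_in_conv calculation spd_nonneg[OF I C])
 ultimately show thesis using that by (metis order_refl empty_iff)
qed

lemma geodesic_pwc:
 assumes "geodesic A F {a..b} ga" "a < b"
 shows "pwc a b ga"
 unfolding pwc_def using assms geodesic_C1[OF assms(1)] C1_curve_subset(1)[OF geodesic_C1[OF assms(1)] good_Icc[OF assms(2)] good_Icc]
 by (intro conjI exI[of _ "{}"]) (auto simp: C1_curve_def)

lemma geodesic_len:
 assumes g: "geodesic A F I ga" and I: "good I" and m: "!!t. t : I ==> spd I ga t = m" and ab: "a <= b" "{a..b} <= I"
 shows "len a b ga = m * (b - a)" "dst (ga a) (ga b) <= m * (b - a)"
proof -
 show "len a b ga = m * (b - a)"
 proof (cases "a < b")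
  case True
  have "len a b ga = integral {a..b} (%t. m)"
   unfolding curve_length_def
  proof (rule integral_cong)
   fix t assume t: "t : {a..b}"
   have "velocity A {a..b} ga t = velocity A I ga t" by (rule C1_curve_subset(2)[OF geodesic_C1[OF g] I good_Icc[OF True] ab(2) t])
   thus "F (ga t) (velocity A {a..b} ga t) = m" using m t ab(2) unfolding spd_def by auto
  qed
  thus ?thesis using ab by (simp add: mult.commute)
 qed (use ab in "simp add: curve_length_def")
 show "dst (ga a) (ga b) <= m * (b - a)"
 proof (cases "a < b")
  case True
  have "geodesic A F {a..b} ga" by (rule geodesic_subset[OF g I good_Icc[OF True] ab(2)])
  from dst_le[OF geodesic_pwc[OF this True] True] show ?thesis using `len a b ga = m * (b - a)` by simp
 next
  case False
  hence e: "a = b" using ab by simp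
  have "len 0 1 (%_. ga a) = 0"
  proof -
   have "velocity A UNIV (%_. ga a) t = (%c. 0)" for t
    unfolding velocity_def by (auto simp: o_def)
   thus ?thesis unfolding len_sp sp_def by (simp add: F_zero_tvec)
  qed
  thus ?thesis using dst_le[OF pwc_const[of 0 1 "ga a"]] e by simp
 qed
qed

lemma Sol_geodesic:
 assumes c: "c : A" and s: "Sol c {a..b} u v" and ab: "a < b"
 shows "geodesic A F {a..b} (%t. cinv c (u t))" "t : {a..b} ==> spd {a..b} (%t. cinv c (u t)) t = L c (u t) (v t)"
proof -
 interpret D: finsler_dom "cimg c" "L c" by (rule finsler_dom[OF c])
 have s': "D.sol {a..b} u v" using s unfolding Sol_def .
 have uc: "u t : cimg c" if "t : {a..b}" for t using D.solD(1)[OF s' that] .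
 have cm: "cmap c (cinv c (u t)) = u t" if "t : {a..b}" for t using chart_simps(2)[OF c uc[OF that]] .
 have dm: "cinv c (u t) : cdom c" if "t : {a..b}" for t using chart_simps(4)[OF c uc[OF that]] .
 have S2: "Sol c {a..b} (%t. cmap c (cinv c (u t))) v"
  unfolding Sol_def'[OF c]
 proof (intro ballI conjI)
  fix t assume t: "t : {a..b}"
  show "cmap c (cinv c (u t)) : cimg c" using cm[OF t] uc[OF t] by simp
  show "((%t. cmap c (cinv c (u t))) hvd v t) (at t within {a..b})"
   by (rule has_vector_derivative_transform[OF t cm D.solD(2)[OF s' t]])
  show "(v hvd - D.Q (cmap c (cinv c (u t))) (v t)) (at t within {a..b})"
   using D.solD(3)[OF s' t] cm[OF t] by simp
 qed
 have cont: "continuous_on {a..b} (%t. cinv c (u t))"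
  by (rule continuous_on_compose2[OF chart_simps(6)[OF c] D.sol_continuous(1)[OF s']]) (use uc in blast)
 show g: "geodesic A F {a..b} (%t. cinv c (u t))"
 proof (rule geodesicI[OF good_Icc[OF ab] cont])
  fix t assume "t : {a..b}"
  have "Sol c ({a..b} Int ball t 1) (%t. cmap c (cinv c (u t))) v"
   using S2 D.sol_subset[of "{a..b}" _ v "{a..b} Int ball t 1"] unfolding Sol_def by blast
  thus "EX c':A. EX v. EX de>0. (ALL s:{a..b} Int ball t de. cinv c (u s) : cdom c') & Sol c' ({a..b} Int ball t de) (%t. cmap c' (cinv c (u t))) v"
   using c dm by (intro bexI[of _ c] exI[of _ v] exI[of _ 1]) auto
 qed
 show "spd {a..b} (%t. cinv c (u t)) t = L c (u t) (v t)" if t: "t : {a..b}"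
 proof -
  have "((%t. cmap c (cinv c (u t))) hvd v t) (at t within {a..b})"
   using S2 t unfolding Sol_def'[OF c] by blast
  hence "velocity A {a..b} (%t. cinv c (u t)) t c = v t"
   using velocity_eq[OF good_Icc[OF ab] t c, of "%t. cinv c (u t)"] dm[OF t] by blast
  thus ?thesis using spd_chart[OF good_Icc[OF ab] geodesic_C1[OF g] t c dm[OF t]] cm[OF t] by simp
 qed
qed

end

section \<open>The distance near a point in terms of one chart\<close>

locale finsler_nb = finsler_mfd A F for A :: "('m::{t2_space, second_countable_topology}, 'n::finite) chart set" and F +
 fixes c :: "('m, 'n) chart" and x0 :: "real ^ 'n" and r R ep ka :: real and rh
 assumes c: "c : A" and l: "locd (cimg c) (L c) x0 r R ep ka rh"
begin

sublocale D: locd "cimg c" "L c" x0 r R ep ka rh by (rule l)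

lemmas lD = D.lD

definition nb :: "real => 'm set" where "nb s = cinv c ` ball x0 s"

lemma ball_cimg: "s <= R ==> ball x0 s <= cimg c" "s <= R ==> cball x0 s <= cimg c"
 using lD(3) by (auto simp: subset_iff)

lemma nb_iff:
 assumes "s <= R"
 shows "p : nb s \<longleftrightarrow> p : cdom c & cmap c p : ball x0 s"
proof
 assume "p : nb s"
 then obtain x where x: "x : ball x0 s" "p = cinv c x" unfolding nb_def by blast
 hence "x : cimg c" using ball_cimg(1)[OF assms] by blast
 thus "p : cdom c & cmap c p : ball x0 s" using x chart_simps[OF c] by metis
next
 assume "p : cdom c & cmap c p : ball x0 s"
 thus "p : nb s" unfolding nb_def using chart_simps(1)[OF c] by (metis imageI)
qed

lemma nb_open: "s <= R ==> open (nb s)"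
proof -
 assume s: "s <= R"
 have "nb s = cdom c Int cmap c -` ball x0 s" using nb_iff[OF s] by blast
 thus ?thesis using continuous_open_preimage[OF chart_simps(5)[OF c] chartD(1)[OF c] open_ball] by simp
qed

lemma cinv_cball: "s <= R ==> compact (cinv c ` cball x0 s)"
 by (rule compact_continuous_image[OF continuous_on_subset[OF chart_simps(6)[OF c] ball_cimg(2)] compact_cball])

lemma geodesic_ex:
 assumes x: "x : ball x0 r" and y: "y : ball x0 r"
 obtains u v where "D.sol {0..1} u v" "u 0 = x" "u 1 = y" "!!t. t : {0..1} ==> u t : cball x0 R & L c (u t) (v t) = rh x y"
  "geodesic A F {0..1} (%t. cinv c (u t))"
  "!!t. t : {0..1} ==> spd {0..1} (%t. cinv c (u t)) t = rh x y"
proof -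
 obtain u v where uv: "D.sol {0..1} u v" "u 0 = x" "u 1 = y" "ALL t:{0..1}. u t : cball x0 R & L c (u t) (v t) = rh x y"
  using lD(6)[OF x y] by blast
 have S: "Sol c {0..1} u v" unfolding Sol_def by (rule uv(1))
 show thesis
  by (rule that[OF uv(1-3) _ Sol_geodesic(1)[OF c S zero_less_one]])
   (use uv(4) Sol_geodesic(2)[OF c S zero_less_one] in simp_all)
qed

lemma joinable_nb: "p : nb r ==> q : nb r ==> joinable p q"
proof -
 assume "p : nb r" "q : nb r"
 then obtain x y where x: "x : ball x0 r" "p = cinv c x" and y: "y : ball x0 r" "q = cinv c y" unfolding nb_def by blast
 show ?thesis
 proof (rule geodesic_ex[OF x(1) y(1)])
  fix u v assume "u 0 = x" "u 1 = y" "geodesic A F {0..1} (%t. cinv c (u t))"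
  thus ?thesis unfolding joinable_def using x y geodesic_pwc[OF _ zero_less_one]
   by (intro exI[of _ "%t. cinv c (u t)"]) simp
 qed
qed

end

context finsler_mfd begin

lemma nb_exists:
 obtains c r R ep ka rh where "finsler_nb A F c (cmap c p) r R ep ka rh" "cinv c (cmap c p) = p"
proof -
 obtain c :: "('m,'n) chart" where c: "c : A" "p : cdom c" using chart_cover by blast
 interpret D: finsler_dom "cimg c" "L c" by (rule finsler_dom[OF c(1)])
 obtain r R ep ka rh where "locd (cimg c) (L c) (cmap c p) r R ep ka rh" using D.locd_exists[OF chart_simps(3)[OF c]] by blast
 hence "finsler_nb A F c (cmap c p) r R ep ka rh"
  unfolding finsler_nb_def finsler_nb_axioms_def using c(1) finsler_mfd_axioms by blast
 thus thesis using that chart_simps(1)[OF c] by blast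
qed

text \<open>Joinability is an equivalence relation with open classes, by short geodesics in
  charts.\<close>

lemma joinable_all: "joinable p q"
proof (rule connected_equivalence_relation[OF conn])
 fix a :: 'm
 show "EX T. openin (top_of_set UNIV) T & a : T & (ALL x:T. joinable a x)"
 proof (rule nb_exists[of a])
  fix c :: "('m,'n) chart" and r R ep ka rh assume n: "finsler_nb A F c (cmap c a) r R ep ka rh" and a: "cinv c (cmap c a) = a"
  interpret finsler_nb A F c "cmap c a" r R ep ka rh by (rule n)
  have "a : nb r" unfolding nb_def using a lD(1) by (metis centre_in_ball imageI)
  thus ?thesis using nb_open[of r] lD(2) joinable_nb by (intro exI[of _ "nb r"]) (simp add: subtopology_UNIV)
 qed
qed (auto intro: joinable_trans joinable_sym)

lemma dst_nonneg: "0 <= dst p q"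
 and dst_approx: "ep > 0 ==> EX ga. pwc 0 1 ga & ga 0 = p & ga 1 = q & len 0 1 ga < dst p q + ep"
 and dst_greatest: "(!!ga. pwc 0 1 ga ==> ga 0 = p ==> ga 1 = q ==> m <= len 0 1 ga) ==> m <= dst p q"
proof -
 let ?X = "{len 0 1 ga' |ga'. pw_C1_curve A ga' & ga' 0 = p & ga' 1 = q}"
 have ne: "?X ~= {}" using joinable_all[of p q] unfolding joinable_def pw_C1_curve_iff by blast
 have bd: "bdd_below ?X" unfolding pw_C1_curve_iff by (rule bdd_belowI[of _ 0]) (use len_nonneg in auto)
 show "0 <= dst p q" unfolding fdist_def by (rule cInf_greatest[OF ne]) (use len_nonneg in "auto simp: pw_C1_curve_iff")
 show "m <= dst p q" if "!!ga. pwc 0 1 ga ==> ga 0 = p ==> ga 1 = q ==> m <= len 0 1 ga" for m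
  unfolding fdist_def by (rule cInf_greatest[OF ne]) (use that in "auto simp: pw_C1_curve_iff")
 show "EX ga. pwc 0 1 ga & ga 0 = p & ga 1 = q & len 0 1 ga < dst p q + ep" if "ep > 0"
 proof -
  have "Inf ?X < dst p q + ep" using that unfolding fdist_def by simp
  thus ?thesis using cInf_less_iff[OF ne bd] unfolding pw_C1_curve_iff by auto
 qed
qed

lemma dst_triangle: "dst p q <= dst p e + dst e q"
proof (rule field_le_epsilon)
 fix ep :: real assume e: "ep > 0"
 obtain ga1 where 1: "pwc 0 1 ga1" "ga1 0 = p" "ga1 1 = e" "len 0 1 ga1 < dst p e + ep / 2" using dst_approx[of "ep / 2" p e] e by auto
 obtain ga2 where 2: "pwc 0 1 ga2" "ga2 0 = e" "ga2 1 = q" "len 0 1 ga2 < dst e q + ep / 2" using dst_approx[of "ep / 2" e q] e by auto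
 have "ga1 1 = ga2 0" using 1 2 by simp
 then obtain ga where g: "pwc 0 2 ga" "ga 0 = ga1 0" "ga 2 = ga2 1" "len 0 2 ga <= len 0 1 ga1 + len 0 1 ga2" by (rule pwc_concat[OF 1(1) 2(1)])
 have "dst (ga 0) (ga 2) <= len 0 2 ga" by (rule dst_le[OF g(1)]) simp
 thus "dst p q <= dst p e + dst e q + ep" using g 1 2 by simp
qed

lemma dst_self[simp]: "dst p p = 0"
proof -
 have "velocity A UNIV (%_. p) t = (%c. 0)" for t unfolding velocity_def by (auto simp: o_def)
 hence "len 0 1 (%_. p) = 0" unfolding len_sp sp_def by (simp add: F_zero_tvec)
 thus ?thesis using dst_le[OF pwc_const[of 0 1 p]] dst_nonneg[of p p] by simp
qed

lemma interior_deriv: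
 assumes C: "C1_curve A {u..v} ga" and t: "u < t" "t < v" and c: "c : A" "ga t : cdom c"
 shows "((%t. cmap c (ga t)) hvd velocity A UNIV ga t c) (at t)"
  "L c (cmap c (ga t)) (velocity A UNIV ga t c) = spd {u..v} ga t"
proof -
 have uv: "u < v" "t : {u..v}" using t by auto
 show "((%t. cmap c (ga t)) hvd velocity A UNIV ga t c) (at t)"
  using C1_curve_derivative[OF C uv(2) c] unfolding velocity_interior[OF t] at_within_Icc_at[OF t] .
 show "L c (cmap c (ga t)) (velocity A UNIV ga t c) = spd {u..v} ga t"
  using spd_chart[OF good_Icc[OF uv(1)] C uv(2) c] unfolding velocity_interior[OF t] by simp
qed

end

context finsler_nb begin

lemma curve_length_lower:
 assumes p: "pwc a b ga" "a <= b" and N: "!!t. t : {a..b} ==> ga t : nb r"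
 shows "rh (cmap c (ga a)) (cmap c (ga b)) <= len a b ga"
proof (rule pwc_induct[OF p])
 have N': "ga t : cdom c" "cmap c (ga t) : ball x0 r" if "t : {a..b}" for t
  using N[OF that] nb_iff[of r] lD(2) by simp_all
 show "rh (cmap c (ga s)) (cmap c (ga s)) <= len s s ga" if "s : {a..b}" for s using lD(11)[OF N'(2)[OF that] N'(2)[OF that]] by (simp add: len_sp)
 show "rh (cmap c (ga s)) (cmap c (ga u)) <= len s u ga" if "a <= s" "s <= t" "t <= u" "u <= b"
  "rh (cmap c (ga s)) (cmap c (ga t)) <= len s t ga" "rh (cmap c (ga t)) (cmap c (ga u)) <= len t u ga" for s t u
  using D.locd_triangle[of "cmap c (ga s)" "cmap c (ga u)" "cmap c (ga t)"] N' that
   len_combine[OF pwc_sub[OF p(1) that(1,4)] that(2,3)] by simp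
 fix s t assume st: "a <= s" "s < t" "t <= b" and C: "C1_curve A {s..t} ga"
 have N'': "ga x : cdom c" "cmap c (ga x) : ball x0 r" if "x : {s..t}" for x using N'[of x] that st by auto
 have "rh (cmap c (ga s)) (cmap c (ga t)) <= integral {s..t} (spd {s..t} ga)"
 proof (rule D.locd_curve_length[where w = "%t. cmap c (ga t)"])
  show "continuous_on {s..t} (%t. cmap c (ga t))"
   by (rule continuous_on_compose2[OF chart_simps(5)[OF c]]) (use C N'' in "auto simp: C1_curve_def")
  show "continuous_on {s..t} (spd {s..t} ga)" by (rule spd_continuous[OF good_Icc[OF st(2)] C])
  show "((%t. cmap c (ga t)) hvd velocity A UNIV ga x c) (at x) & L c (cmap c (ga x)) (velocity A UNIV ga x c) = spd {s..t} ga x"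
   if "x : {s<..<t}" for x
   using interior_deriv[OF C _ _ c, of x] N''(1)[of x] that by simp
 qed (use st N''(2) in auto)
 thus "rh (cmap c (ga s)) (cmap c (ga t)) <= len s t ga" unfolding curve_length_def spd_def .
qed

text \<open>Up to its first exit from the ball of radius \<open>s\<close> the curve is seen by the
  chart, where \<open>ka\<close> compares Euclidean distance and length.\<close>

lemma exit_length:
 assumes p: "pwc a b ga" and a: "ga a : nb s" and s: "s < r" and e: "EX t:{a..b}. ga t ~: nb s"
 shows "ka * (s - norm (cmap c (ga a) - x0)) <= len a b ga"
proof -
 have sR: "s <= R" using s lD(2) by simp
 have cont: "continuous_on {a..b} ga" using p unfolding pwc_def by blast
 define X where "X = {a..b} Int ga -` (- nb s)"
 have cX: "closed X" unfolding X_def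
  by (rule continuous_closed_preimage[OF cont closed_atLeastAtMost]) (use nb_open[OF sR] in auto)
 have neX: "X ~= {}" "bdd_below X" using e unfolding X_def by auto
 define T where "T = Inf X"
 have TX: "T : X" unfolding T_def by (rule closed_contains_Inf[OF neX cX])
 have Tab: "T : {a..b}" "ga T ~: nb s" using TX unfolding X_def by auto
 have aT: "a < T" using Tab a by (cases "a = T") auto
 have before: "ga t : nb s" if "a <= t" "t < T" for t
 proof (rule ccontr)
  assume "ga t ~: nb s"
  hence "t : X" using that Tab unfolding X_def by auto
  hence "T <= t" unfolding T_def by (rule cInf_lower[OF _ neX(2)])
  thus False using that by simp
 qed
 have cl: "closed (cinv c ` cball x0 s)" by (rule compact_imp_closed[OF cinv_cball[OF sR]])
 \<comment> \<open>At the exit time the curve is a limit of points of the ball, and the image of the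
   closed ball is compact, hence closed.\<close>
 have "ga T : cinv c ` cball x0 s"
 proof -
  have "closure {a..<T} <= {a..T}" "T : closure {a..<T}" using aT by simp_all
  moreover have "ga ` closure {a..<T} <= closure (ga ` {a..<T})"
   by (rule image_closure_subset[OF continuous_on_subset[OF cont] closed_closure closure_subset]) (use aT Tab in simp)
  moreover have "closure (ga ` {a..<T}) <= cinv c ` cball x0 s"
  proof (rule closure_minimal[OF _ cl])
   show "ga ` {a..<T} <= cinv c ` cball x0 s" using before ball_subset_cball unfolding nb_def by fastforce
  qed
  ultimately show ?thesis by blast
 qed
 then obtain y where y: "y : cball x0 s" "ga T = cinv c y" by blast
 have yc: "y : cimg c" using y(1) ball_cimg(2)[OF sR] by blast
 have cy: "cmap c (ga T) = y" using chart_simps(2)[OF c yc] y(2) by simp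
 have "y ~: ball x0 s" using y(2) Tab(2) unfolding nb_def by blast
 hence ny: "norm (y - x0) = s" using y(1) by (simp add: dist_norm norm_minus_commute)
 have N: "ga t : nb r" if "t : {a..T}" for t
 proof (cases "t = T")
  case True
  have "y : ball x0 r" using ny s by (simp add: dist_norm norm_minus_commute)
  thus ?thesis using True y(2) unfolding nb_def by blast
 next
  case False
  hence "ga t : nb s" using before that by simp
  thus ?thesis using s subset_ball[of s r x0] unfolding nb_def by auto
 qed
 have sub: "pwc a T ga" "pwc T b ga" using pwc_sub[OF p, of a T] pwc_sub[OF p, of T b] Tab by auto
 have r1: "cmap c (ga a) : ball x0 r" "y : ball x0 r" using N[of a] N[of T] aT nb_iff[of r] lD(2) cy by simp_all
 have "s - norm (cmap c (ga a) - x0) <= norm (cmap c (ga a) - y)"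
  using norm_triangle_ineq2[of "y - x0" "cmap c (ga a) - x0"] ny by (simp add: norm_minus_commute)
 hence "ka * (s - norm (cmap c (ga a) - x0)) <= ka * norm (cmap c (ga a) - y)" using lD(5) by simp
 also have "... <= rh (cmap c (ga a)) y" by (rule lD(8)[OF r1])
 also have "... <= len a T ga" using curve_length_lower[OF sub(1) _ N] aT cy by simp
 also have "... <= len a b ga" using len_combine[OF p, of T] len_nonneg[OF sub(2)] Tab by simp
 finally show ?thesis .
qed

text \<open>Points within \<open>r0\<close> of the centre are joined by geodesics of length at most
  2 r0 / ka <= ka r / 4, while a curve from there that leaves the ball of radius r/2 has length at
  least ka (r/2 - r0) >= ka r / 4.\<close>

definition r0 where "r0 = min (r / 4) (ka\<^sup>2 * r / 8)"

lemma r0: "0 < r0" "r0 <= r / 4" "r0 <= ka\<^sup>2 * r / 8"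
 unfolding r0_def using lD(1,5) by (auto simp: zero_less_power)

text \<open>Curves that stay in the ball of radius r/2 are measured by
  \<open>curve_length_lower\<close>, all others are too long by the choice of
  \<open>r0\<close>.\<close>

lemma dst_rho:
 assumes x: "x : ball x0 r0" and y: "y : ball x0 r0"
 shows "dst (cinv c x) (cinv c y) = rh x y"
proof (rule antisym)
 have sub: "ball x0 r0 <= ball x0 r" using r0 lD(1) by (intro subset_ball) simp
 have xr: "x : ball x0 r" and yr: "y : ball x0 r" using sub x y by blast+
 show "dst (cinv c x) (cinv c y) <= rh x y"
 proof (rule geodesic_ex[OF xr yr])
  fix u v assume u: "u 0 = x" "u 1 = y" "geodesic A F {0..1} (%t. cinv c (u t))"
   "!!t. t : {0..1} ==> spd {0..1} (%t. cinv c (u t)) t = rh x y"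
  show ?thesis using geodesic_len(2)[OF u(3) good_Icc[OF zero_less_one] u(4), of 0 1] u(1,2) by simp
 qed
 show "rh x y <= dst (cinv c x) (cinv c y)"
 proof (rule dst_greatest)
  fix ga assume ga: "pwc 0 1 ga" "ga 0 = cinv c x" "ga 1 = cinv c y"
  have cm: "cmap c (ga 0) = x" "cmap c (ga 1) = y"
   using ga chart_simps(2)[OF c] xr yr ball_cimg(1)[of r] lD(2) by (simp_all add: subset_iff)
  show "rh x y <= len 0 1 ga"
  proof (cases "ALL t:{0..1}. ga t : nb (r / 2)")
   case True
   have "nb (r / 2) <= nb r" unfolding nb_def using lD(1) by (intro image_mono subset_ball) simp
   thus ?thesis using curve_length_lower[OF ga(1)] True cm by (metis (no_types) subsetD zero_le_one)
  next
   case False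
   have nx: "norm (x - x0) < r0" "norm (y - x0) < r0" using x y by (simp_all add: dist_norm norm_minus_commute)
   have x2: "ga 0 : nb (r / 2)" unfolding ga(2) nb_def using nx(1) r0 lD(1) by (intro imageI) (simp add: dist_norm norm_minus_commute)
   have "rh x y <= norm (x - y) / ka" by (rule lD(9)[OF xr yr])
   also have "... <= (2 * r0) / ka"
   proof (rule divide_right_mono)
    have "norm (x - y) <= norm (x - x0) + norm (y - x0)" using norm_triangle_ineq4[of "x - x0" "y - x0"] by simp
    thus "norm (x - y) <= 2 * r0" using nx by simp
   qed (use lD(5) in simp)
   also have "... <= ka * (r / 4)" using r0(3) lD(5) by (simp add: divide_le_eq power2_eq_square mult_ac)
   also have "... <= ka * (r / 2 - norm (x - x0))" using r0(2) nx(1) lD(5) by (intro mult_left_mono) auto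
   also have "... <= len 0 1 ga" using exit_length[OF ga(1) x2 _ ] False lD(1) cm by simp
   finally show ?thesis .
  qed
 qed
qed

lemma dst_exit:
 assumes p: "p : nb (r0 / 2)" and q: "q ~: nb r0"
 shows "ka * (r0 / 2) <= dst p q"
proof (rule dst_greatest)
 fix ga assume ga: "pwc 0 1 ga" "ga 0 = p" "ga 1 = q"
 have "cmap c p : ball x0 (r0 / 2)" using p nb_iff[of "r0 / 2"] r0 lD(1,2) by simp
 hence n: "norm (cmap c p - x0) <= r0 / 2" by (simp add: dist_norm norm_minus_commute)
 have "nb (r0 / 2) <= nb r0" unfolding nb_def using r0 by (intro image_mono subset_ball) simp
 hence "ga 0 : nb r0" using p ga(2) by blast
 moreover have "EX t:{0..1}. ga t ~: nb r0" using q ga(3) by force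
 ultimately have "ka * (r0 - norm (cmap c (ga 0) - x0)) <= len 0 1 ga" using exit_length[OF ga(1)] r0 lD(1) by simp
 moreover have "ka * (r0 / 2) <= ka * (r0 - norm (cmap c (ga 0) - x0))" using n lD(5) ga(2) by (intro mult_left_mono) auto
 ultimately show "ka * (r0 / 2) <= len 0 1 ga" by simp
qed

text \<open>The geodesic is no longer than the distance of its ends, so the triangle inequality
  forces equality on every subinterval. The last but one clause is \<open>locd_between\<close> in
  metric terms.\<close>

lemma geodesic_minimizes:
 assumes x: "x : ball x0 r0" and y: "y : ball x0 r0"
 obtains ga where "geodesic A F {0..1} ga" "ga 0 = cinv c x" "ga 1 = cinv c y"
  "!!s t. 0 <= s ==> s <= t ==> t <= 1 ==> dst (ga s) (ga t) = (t - s) * dst (cinv c x) (cinv c y)"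
  "!!e. e : ball x0 r0 ==> x ~= y ==> dst (cinv c x) (cinv c e) + dst (cinv c e) (cinv c y) = dst (cinv c x) (cinv c y) ==>
    cinv c e = ga (dst (cinv c x) (cinv c e) / dst (cinv c x) (cinv c y))"
  "!!t. t : {0..1} ==> spd {0..1} ga t = dst (cinv c x) (cinv c y)"
proof -
 have sub: "ball x0 r0 <= ball x0 r" using r0 lD(1) by (intro subset_ball) simp
 have xr: "x : ball x0 r" and yr: "y : ball x0 r" using sub x y by blast+
 show thesis
 proof (rule geodesic_ex[OF xr yr])
  fix u v assume u: "D.sol {0..1} u v" "u 0 = x" "u 1 = y" "geodesic A F {0..1} (%t. cinv c (u t))"
   "!!t. t : {0..1} ==> spd {0..1} (%t. cinv c (u t)) t = rh x y"
   and u2: "!!t. t : {0..1} ==> u t : cball x0 R & L c (u t) (v t) = rh x y"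
  show thesis
  proof (rule that[OF u(4)])
   show "cinv c (u 0) = cinv c x" "cinv c (u 1) = cinv c y" using u(2,3) by simp_all
   let ?g = "%t. cinv c (u t)"
   have le: "dst (?g s) (?g t) <= (t - s) * rh x y" if "0 <= s" "s <= t" "t <= 1" for s t
    using geodesic_len(2)[OF u(4) good_Icc[OF zero_less_one] u(5), of s t] that by (simp add: mult.commute)
   show "dst (?g s) (?g t) = (t - s) * dst (cinv c x) (cinv c y)" if st: "0 <= s" "s <= t" "t <= 1" for s t
   proof -
    have "rh x y = dst (?g 0) (?g 1)" using dst_rho[OF x y] u(2,3) by simp
    hence "rh x y <= dst (?g 0) (?g s) + dst (?g s) (?g t) + dst (?g t) (?g 1)"
     using dst_triangle[of "?g 0" "?g 1" "?g s"] dst_triangle[of "?g s" "?g 1" "?g t"] by simp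
    hence "(t - s) * rh x y <= dst (?g s) (?g t)" using le[of 0 s] le[of t 1] st by (simp add: algebra_simps)
    thus ?thesis using le[OF st] dst_rho[OF x y] by simp
   qed
   show "spd {0..1} ?g t = dst (cinv c x) (cinv c y)" if "t : {0..1}" for t
    using u(5)[OF that] dst_rho[OF x y] by simp
   fix e assume e: "e : ball x0 r0" "x ~= y" and eq: "dst (cinv c x) (cinv c e) + dst (cinv c e) (cinv c y) = dst (cinv c x) (cinv c y)"
   show "cinv c e = cinv c (u (dst (cinv c x) (cinv c e) / dst (cinv c x) (cinv c y)))"
    unfolding dst_rho[OF x y] dst_rho[OF x e(1)]
    by (rule arg_cong[where f="cinv c"], rule D.locd_between[OF xr yr _ u(1) u2 u(2,3) _ e(2)])
     (use eq e(1) sub dst_rho[OF x y] dst_rho[OF x e(1)] dst_rho[OF e(1) y] in "simp_all add: subset_iff")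
  qed
 qed
qed

text \<open>Every unit speed geodesic that starts near the centre minimizes for a time that does not
  depend on its direction. This yields a local lower bound for the injectivity radius.\<close>

lemma short_geodesics:
 assumes g: "geodesic A F {0..b} ga" and b: "0 < b" "b < ka * (r0 / 2)" "b <= ep" and p: "ga 0 : nb (r0 / 2)"
  and s: "!!t. t : {0..b} ==> spd {0..b} ga t = 1"
 shows "dst (ga 0) (ga b) = b"
proof (rule antisym)
 have le: "dst (ga 0) (ga t) <= t" if "0 <= t" "t <= b" for t
  using geodesic_len(2)[OF g good_Icc[OF b(1)] s, of 0 t] that by simp
 show "dst (ga 0) (ga b) <= b" by (rule le) (use b in auto)
 have N: "ga t : nb r0" if "t : {0..b}" for t
  using dst_exit[OF p, of "ga t"] le[of t] that b(2) by force
 have N': "ga t : cdom c" "cmap c (ga t) : ball x0 r0" "cmap c (ga t) : cball x0 R" if "t : {0..b}" for t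
  using N[OF that] nb_iff[of r0] r0 lD(1,2) by (simp_all)
 let ?sg = "%t. ga (b * t + 0)"
 have im: "(%t. b * t + 0) ` {0..1} <= {0..b}" using affine_image[OF b(1), of 0 0 1] by simp
 have bt: "b * t + 0 : {0..b}" if "t : {0..1}" for t using im that by blast
 have g2: "geodesic A F {0..1} ?sg"
  by (rule geodesic_affine[OF g good_Icc[OF b(1)] good_Icc[OF zero_less_one] im]) (use b in simp)
 let ?v = "%t. velocity A {0..1} ?sg t c"
 have S: "D.sol {0..1} (%t. cmap c (?sg t)) ?v"
  using geodesic_Sol[OF good_Icc[OF zero_less_one] g2 c subset_refl] N'(1)[OF bt] unfolding Sol_def by blast
 have "velocity A {0..1} ?sg 0 = (%d. b *r velocity A {0..b} ga (b * 0 + 0) d)"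
  by (rule C1_curve_affine(2)[OF geodesic_C1[OF g] good_Icc[OF b(1)] good_Icc[OF zero_less_one] im]) simp
 hence v0: "?v 0 = b *r velocity A {0..b} ga 0 c" by simp
 have b0: "0 : {0..b}" using b by simp
 have "L c (cmap c (ga 0)) (velocity A {0..b} ga 0 c) = 1"
  using s[OF b0] spd_chart[OF good_Icc[OF b(1)] geodesic_C1[OF g] b0 c N'(1)[OF b0]] by simp
 hence F0: "L c (cmap c (?sg 0)) (?v 0) = b"
  using D.F_hom[OF chart_simps(3)[OF c N'(1)[OF b0]] b(1)] v0 by simp
 let ?x = "cmap c (ga 0)" and ?y = "cmap c (ga b)"
 have xy: "?x : ball x0 r0" "?y : ball x0 r0" using N'(2)[of 0] N'(2)[of b] b by auto
 have sub: "ball x0 r0 <= ball x0 r" using r0 lD(1) by (intro subset_ball) simp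
 have xyr: "?x : ball x0 r" "?y : ball x0 r" using sub xy by blast+
 show "b <= dst (ga 0) (ga b)"
 proof (rule geodesic_ex[OF xyr])
  fix u v assume u: "D.sol {0..1} u v" "u 0 = ?x" "u 1 = ?y"
   and u2: "!!t. t : {0..1} ==> u t : cball x0 R & L c (u t) (v t) = rh ?x ?y"
  \<comment> \<open>The given geodesic plays the minimizing solution in \<open>competitor\<close>,
    and the selected geodesic with the same ends is the competitor.\<close>
  have "L c (cmap c (?sg 0)) (?v 0) <= rh ?x ?y * (1 - 0)"
  proof (rule conjunct1[OF D.competitor[OF S]])
   show "cmap c (?sg t) : cball x0 R" if "t : {0..1}" for t by (rule N'(3)[OF bt[OF that]])
   show "continuous_on {0..1} u" by (rule D.sol_continuous(1)[OF u(1)])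
   show "u ` {0..1} <= cball x0 R" using u2 by blast
   show "(u hvd v t) (at t) & L c (u t) (v t) <= rh ?x ?y" if "t : {0<..<1} - {}" for t
    using D.solD(2)[OF u(1), of t] u2[of t] that at_within_Icc_at[of 0 t 1] by simp
  qed (use F0 b u in simp_all)
  hence "b <= rh ?x ?y" using F0 by simp
  moreover have "cinv c ?x = ga 0" "cinv c ?y = ga b" using chart_simps(1)[OF c] N'(1)[of 0] N'(1)[of b] b by auto
  ultimately show ?thesis using dst_rho[OF xy] by simp
 qed
qed

text \<open>Below this length a curve from the half ball cannot leave \<open>nb r0\<close>, and a
  geodesic is slow enough for \<open>competitor\<close>.\<close>

definition reach where "reach = min ep (ka * (r0 / 2))"

lemma nbD: "0 < reach" "nb (r0 / 2) <= nb r0" "open (nb r0)" "open (nb (r0 / 2))" "compact (cinv c ` cball x0 r0)"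
 "nb r0 <= cinv c ` cball x0 r0" "cinv c x0 : nb (r0 / 2)" "cinv c x0 : nb r0"
 "p : nb (r0 / 2) ==> dst p q < reach ==> q : nb r0"
 using lD(2,4,5) r0 dst_exit[of p q] by (auto simp: reach_def intro!: nb_open cinv_cball) (auto simp: nb_def)

lemma dst_bounds:
 assumes "x : ball x0 r0" "y : ball x0 r0"
 shows "ka * norm (x - y) <= dst (cinv c x) (cinv c y)" "dst (cinv c x) (cinv c y) <= norm (x - y) / ka"
 using lD(8)[of x y] lD(9)[of x y] dst_rho[OF assms] assms r0 lD(1) by (simp_all add: subset_iff)

end

section \<open>Unique continuation of geodesics; the topology of the distance\<close>

context finsler_mfd begin

text \<open>The times near which the two geodesics agree form an open set. It is closed as well:
  positions and velocities agree in the limit, and local uniqueness in a chart continues the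
  agreement.\<close>

lemma geodesic_unique:
 assumes g: "geodesic A F I ga1" "geodesic A F I ga2" and I: "good I" and uv: "u < v" "{u..v} <= I"
  and eq: "!!t. t : {u..v} ==> ga1 t = ga2 t" and t: "t : I"
 shows "ga1 t = ga2 t"
proof -
 define Y where "Y = {t : I. EX e>0. ALL s:I. abs(s - t) < e --> ga1 s = ga2 s}"
 have cont: "continuous_on I ga1" "continuous_on I ga2" using geodesic_C1[OF g(1)] geodesic_C1[OF g(2)] unfolding C1_curve_def by blast+
 have YI: "Y <= I" unfolding Y_def by blast
 have "openin (top_of_set I) Y"
  unfolding openin_euclidean_subtopology_iff
 proof (intro conjI ballI YI)
  fix y assume "y : Y"
  then obtain e where e: "y : I" "e > 0" "!!s. s : I ==> abs(s - y) < e ==> ga1 s = ga2 s" unfolding Y_def by blast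
  have "x : Y" if "x : I" "abs(x - y) < e" for x
   unfolding Y_def
  proof (intro CollectI conjI that(1) exI[of _ "e - abs(x - y)"] ballI impI)
   fix s assume "s : I" "abs(s - x) < e - abs(x - y)"
   thus "ga1 s = ga2 s" by (intro e(3)) auto
  qed (use that in simp)
  thus "EX e>0. ALL x':I. dist x' y < e --> x' : Y" using e(2) by (auto simp: dist_real_def)
 qed
 moreover have "closedin (top_of_set I) Y"
 proof -
  have lim: "l : Y" if y: "!!n. y n : Y" and yl: "y \<longlonglongrightarrow> l" and lI: "l : I" for y l
  proof -
   have yI: "y n : I" for n using y YI by blast
   have l12: "(%n. ga1 (y n)) \<longlonglongrightarrow> ga1 l" "(%n. ga2 (y n)) \<longlonglongrightarrow> ga2 l"
    using continuous_on_tendsto_compose[OF cont(1) yl lI] continuous_on_tendsto_compose[OF cont(2) yl lI] yI by simp_all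
   have "ga1 (y n) = ga2 (y n)" for n using y[of n] unfolding Y_def by force
   hence eql: "ga1 l = ga2 l" using LIMSEQ_unique[OF l12(1)] l12(2) by simp
   obtain c :: "('m, 'n) chart" where c: "c : A" "ga1 l : cdom c" using chart_cover by blast
   have c2: "ga2 l : cdom c" using c eql by simp
   interpret D: finsler_dom "cimg c" "L c" by (rule finsler_dom[OF c(1)])
   obtain k1 where k1: "k1 > 0" "!!s. s : I ==> abs(s - l) < k1 ==> ga1 s : cdom c" by (rule chart_nbhd[OF cont(1) lI c]) blast
   obtain k2 where k2: "k2 > 0" "!!s. s : I ==> abs(s - l) < k2 ==> ga2 s : cdom c" by (rule chart_nbhd[OF cont(2) lI c(1) c2]) blast
   define k where "k = min k1 k2"
   let ?J = "I Int ball l k"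
   have k: "k > 0" using k1 k2 by (simp add: k_def)
   have J: "s : I" "ga1 s : cdom c" "ga2 s : cdom c" if "s : ?J" for s
    using that k1(2)[of s] k2(2)[of s] by (auto simp: k_def dist_real_def)
   let ?v1 = "%t. velocity A I ga1 t c" and ?v2 = "%t. velocity A I ga2 t c"
   have S: "D.sol ?J (%t. cmap c (ga1 t)) ?v1" "D.sol ?J (%t. cmap c (ga2 t)) ?v2"
    using geodesic_Sol[OF I g(1) c(1), of ?J] geodesic_Sol[OF I g(2) c(1), of ?J] J unfolding Sol_def by blast+
   have lJ: "l : ?J" using lI k by simp
   have ev: "\<forall>\<^sub>F n in sequentially. y n : ?J" 
    using tendstoD[OF yl k] by eventually_elim (use yI in "simp add: dist_commute")
   have veq: "?v1 s = ?v2 s" if s: "s : Y" "s : ?J" for s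
   proof -
    obtain e where e: "e > 0" "!!s'. s' : I ==> abs(s' - s) < e ==> ga1 s' = ga2 s'" using s(1) unfolding Y_def by blast
    have "((%t. cmap c (ga1 t)) hvd ?v1 s) (at s within I)"
     by (rule C1_curve_derivative[OF geodesic_C1[OF g(1)] _ c(1)]) (use J[OF s(2)] in simp_all)
    hence "((%t. cmap c (ga2 t)) hvd ?v1 s) (at s within I)"
     by (rule has_vector_derivative_transform_within[OF _ e(1)]) (use e(2) J(1)[OF s(2)] in "simp_all add: dist_real_def")
    thus ?thesis using velocity_eq[where ga = ga2, OF I J(1)[OF s(2)] c(1) J(3)[OF s(2)]] by metis
   qed
   have vl12: "(%n. ?v1 (y n)) \<longlonglongrightarrow> ?v1 l" "(%n. ?v2 (y n)) \<longlonglongrightarrow> ?v2 l"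
    using continuous_on_tendsto_compose[OF D.sol_continuous(2)[OF S(1)] yl lJ ev] continuous_on_tendsto_compose[OF D.sol_continuous(2)[OF S(2)] yl lJ ev] by simp_all
   have "\<forall>\<^sub>F n in sequentially. ?v1 (y n) = ?v2 (y n)" using ev by eventually_elim (rule veq[OF y])
   from tendsto_cong[OF this] have vl: "?v1 l = ?v2 l" using LIMSEQ_unique[OF vl12(1)] vl12(2) by blast
   have cJ: "convex ?J" using I unfolding good_def by (intro convex_Int convex_ball) blast
   have ul: "cmap c (ga1 l) = cmap c (ga2 l)" using eql by simp
   obtain d where d: "d > 0" "!!t. t : ?J ==> abs(t - l) < d ==> cmap c (ga1 t) = cmap c (ga2 t) & ?v1 t = ?v2 t"
    by (rule D.sol_unique_local[OF S cJ lJ ul vl]) blast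
   show ?thesis unfolding Y_def
   proof (intro CollectI conjI lI exI[of _ "min d k"] ballI impI)
    fix s assume s: "s : I" "abs(s - l) < min d k"
    hence sJ: "s : ?J" by (simp add: dist_real_def abs_minus_commute)
    hence "cmap c (ga1 s) = cmap c (ga2 s)" using d(2) s by simp
    thus "ga1 s = ga2 s" using chart_simps(1)[OF c(1)] J[OF sJ] by metis
   qed (use d k in simp)
  qed
  show ?thesis
   unfolding closedin_limpt
  proof (intro conjI allI impI YI)
   fix x assume "x islimpt Y & x : I"
   thus "x : Y" using lim unfolding islimpt_sequential by blast
  qed
 qed
 moreover have "connected I" using I unfolding good_def by (simp add: convex_connected)
 moreover have "(u + v) / 2 : Y"
  unfolding Y_def
 proof (intro CollectI conjI exI[of _ "(v - u) / 2"] ballI impI)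
  show "(u + v) / 2 : I" using uv by auto
  fix s assume "abs(s - (u + v) / 2) < (v - u) / 2"
  hence "s : {u..v}" unfolding abs_less_iff by (auto simp: field_simps)
  thus "ga1 s = ga2 s" by (rule eq)
 qed (use uv in simp)
 ultimately have "Y = I" by (metis connected_clopen empty_iff)
 thus ?thesis using t unfolding Y_def by force
qed

lemma tangent_scale: "X : tangent_space A q ==> (%c. a *r X c) : tangent_space A q"
proof -
 assume X: "X : tangent_space A q"
 obtain c where c: "c : A" "q : cdom c" using chart_cover by blast
 have "tvec_of A c q (a *r X c) = (%d. a *r X d)" unfolding tvec_of_scale[OF c] tangent_eq[OF X c] ..
 thus ?thesis using tvec_of_in[OF c] by metis
qed

lemma F_pos: "X : tangent_space A q ==> X ~= zero_tvec ==> 0 < F q X"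
proof -
 assume X: "X : tangent_space A q" "X ~= zero_tvec"
 obtain c where c: "c : A" "q : cdom c" using chart_cover by blast
 interpret D: finsler_dom "cimg c" "L c" by (rule finsler_dom[OF c(1)])
 have "X c ~= 0"
 proof
  assume "X c = 0"
  hence "X = (%d. 0 *r tvec_of A c q 0 d)" using tangent_eq[OF X(1) c] tvec_of_scale[OF c, of 0 0] by simp
  thus False using X(2) by simp
 qed
 thus ?thesis using D.F_pos[of "cmap c q" "X c"] F_tangent[OF c X(1)] chart_simps(3)[OF c] D.Z_iff by simp
qed

text \<open>Together with \<open>dst_near\<close>: the asymmetric distance induces the topology of
  the manifold.\<close>

lemma dst_small:
 assumes "open U" "p : U"
 obtains e where "e > 0" "!!q. dst p q < e ==> q : U"
proof (rule nb_exists[of p])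
 fix c :: "('m,'n) chart" and r R ep ka rh assume n: "finsler_nb A F c (cmap c p) r R ep ka rh" and p: "cinv c (cmap c p) = p"
 interpret finsler_nb A F c "cmap c p" r R ep ka rh by (rule n)
 let ?x = "cmap c p"
 have "open (cimg c Int cinv c -` U)" by (rule continuous_open_preimage[OF chart_simps(6)[OF c] chartD(2)[OF c] assms(1)])
 moreover have "?x : cimg c Int cinv c -` U" using ball_cimg(1)[of R] lD(1,2) p assms by auto
 ultimately obtain d where d: "d > 0" "ball ?x d <= cimg c Int cinv c -` U" by (meson open_contains_ball)
 show thesis
 proof (rule that[of "min reach (ka * d)"])
  show "0 < min reach (ka * d)" using lD(5) nbD(1) d(1) by simp
  fix q assume q: "dst p q < min reach (ka * d)"
  then obtain y where y: "y : ball ?x r0" "q = cinv c y" using nbD(7,9) p unfolding nb_def by force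
  have "ka * norm (?x - y) < ka * d" using dst_bounds(1)[of ?x y] y q p r0 by simp
  hence "y : ball ?x d" using lD(5) by (simp add: dist_norm)
  thus "q : U" using d(2) y(2) by blast
 qed
qed

lemma dst_near:
 assumes "e > 0"
 obtains V where "open V" "p : V" "!!q. q : V ==> dst p q < e & dst q p < e"
proof (rule nb_exists[of p])
 fix c :: "('m,'n) chart" and r R ep ka rh assume n: "finsler_nb A F c (cmap c p) r R ep ka rh" and p: "cinv c (cmap c p) = p"
 interpret finsler_nb A F c "cmap c p" r R ep ka rh by (rule n)
 let ?x = "cmap c p"
 define s where "s = min r0 (ka * e)"
 have s: "s > 0" "s <= r0" "s <= ka * e" "s <= R" using r0 lD(1,2,5) assms by (auto simp: s_def)
 show thesis
 proof (rule that[OF nb_open[OF s(4)]])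
  show "p : nb s" unfolding nb_def by (rule image_eqI[of _ _ ?x]) (use p s(1) in simp_all)
  fix q assume "q : nb s"
  then obtain y where y: "y : ball ?x s" "q = cinv c y" unfolding nb_def by blast
  have "norm (?x - y) < ka * e" using y(1) s by (simp add: dist_norm)
  hence "norm (?x - y) / ka < e" using lD(5) by (simp add: divide_less_eq mult.commute)
  moreover have "y : ball ?x r0" "?x : ball ?x r0" using y(1) s by auto
  ultimately show "dst p q < e & dst q p < e" using dst_bounds(2)[of ?x y] dst_bounds(2)[of y ?x] y(2) p by (simp add: norm_minus_commute)
 qed
qed

lemma dst_eq_0: "dst p q = 0 \<longleftrightarrow> p = q"
proof
 assume d: "dst p q = 0"
 show "p = q"
 proof (rule ccontr)
  assume "p ~= q"
  then obtain U where "open U" "p : U" "q ~: U" using t1_space by blast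
  thus False using dst_small[of U p] d by metis
 qed
qed simp

lemma tendsto_dst:
 assumes f: "(f \<longlongrightarrow> p) G" and g: "(g \<longlongrightarrow> q) G"
 shows "((%x. dst (f x) (g x)) \<longlongrightarrow> dst p q) G"
proof (rule tendstoI)
 fix e :: real assume "e > 0"
 hence e: "e / 2 > 0" by simp
 obtain V where V: "open V" "p : V" "!!q. q : V ==> dst p q < e / 2 & dst q p < e / 2" by (rule dst_near[OF e]) blast
 obtain W where W: "open W" "q : W" "!!p. p : W ==> dst q p < e / 2 & dst p q < e / 2" by (rule dst_near[OF e]) blast
 have "\<forall>\<^sub>F x in G. f x : V" "\<forall>\<^sub>F x in G. g x : W" using topological_tendstoD f g V W by blast+
 thus "\<forall>\<^sub>F x in G. dist (dst (f x) (g x)) (dst p q) < e"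
 proof eventually_elim
  case (elim x)
  have "dst (f x) (g x) <= dst (f x) p + (dst p q + dst q (g x))" using dst_triangle[of "f x" "g x" p] dst_triangle[of p "g x" q] by simp
  moreover have "dst p q <= dst p (f x) + (dst (f x) (g x) + dst (g x) q)" using dst_triangle[of p q "f x"] dst_triangle[of "f x" q "g x"] by simp
  ultimately show ?case using V(3)[OF elim(1)] W(3)[OF elim(2)] by (auto simp: dist_real_def)
 qed
qed

lemma continuous_on_dst[continuous_intros]: "continuous_on S f ==> continuous_on S g ==> continuous_on S (%x. dst (f x) (g x))"
 unfolding continuous_on_def by (auto intro: tendsto_dst)

text \<open>Finitely many chart neighbourhoods cover the compact set, so some forward neighbourhood
  of it of positive width has compact closure in the weak sense of lying in a compact set.\<close>

lemma compact_near:
 assumes "compact C"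
 obtains e K where "e > 0" "compact K" "!!p q. p : C ==> dst p q < e ==> q : K"
proof -
 have "ALL p. EX V e K. open V & p : V & e > 0 & compact K & (ALL p':V. ALL q. dst p' q < e --> q : K)"
 proof
  fix p
  show "EX V e K. open V & p : V & e > 0 & compact K & (ALL p':V. ALL q. dst p' q < e --> q : K)"
  proof (rule nb_exists[of p])
   fix c :: "('m,'n) chart" and r R ep ka rh assume n: "finsler_nb A F c (cmap c p) r R ep ka rh" and p: "cinv c (cmap c p) = p"
   interpret finsler_nb A F c "cmap c p" r R ep ka rh by (rule n)
   show ?thesis
    by (intro exI[of _ "nb (r0 / 2)"] exI[of _ reach] exI[of _ "cinv c ` cball (cmap c p) r0"] conjI ballI allI impI)
     (use nbD p in auto)
  qed
 qed
 then obtain V e K where VK: "!!p. open (V p)" "!!p. p : V p" "!!p. e p > (0::real)" "!!p. compact (K p)" "!!p p' q. p' : V p ==> dst p' q < e p ==> q : K p"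
  by metis
 obtain C' where C': "C' <= C" "finite C'" "C <= (UN p:C'. V p)"
  by (rule compactE_image[OF assms, of C V]) (use VK in auto)
 \<comment> \<open>The element 1 keeps the minimum defined when the cover is empty.\<close>
 define d where "d = Min (insert 1 (e ` C'))"
 have d: "d > 0" "!!p. p : C' ==> d <= e p" unfolding d_def using C'(2) VK(3) by auto
 show thesis
 proof (rule that[OF d(1), of "UN p:C'. K p"])
  show "compact (UN p:C'. K p)" using C'(2) VK(4) by blast
  fix p q assume pq: "p : C" "dst p q < d"
  then obtain p' where "p' : C'" "p : V p'" using C'(3) by blast
  thus "q : (UN p:C'. K p)" using VK(5)[of p p' q] d(2)[of p'] pq(2) by force
 qed
qed

lemma geodesic_const: 
 assumes "good I"
 shows "geodesic A F I (%_. p)"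
proof (rule geodesicI[OF assms])
 fix t assume "t : I"
 obtain c :: "('m,'n) chart" where c: "c : A" "p : cdom c" using chart_cover by blast
 interpret D: finsler_dom "cimg c" "L c" by (rule finsler_dom[OF c(1)])
 have "Sol c (I Int ball t 1) (%t. cmap c p) (%_. 0)"
  unfolding Sol_def'[OF c(1)] using chart_simps(3)[OF c] D.Q_zero by (simp add: has_vector_derivative_const)
 thus "EX c:A. EX v. EX de>0. (ALL s:I Int ball t de. p : cdom c) & Sol c (I Int ball t de) (%t. cmap c p) v"
  using c zero_less_one by blast
qed (rule continuous_on_const)

lemma geodesic_localI:
 assumes I: "good I" and cont: "continuous_on I ga"
  and loc: "!!t. t : I ==> EX de>0. EX J sg. good J & geodesic A F J sg & I Int ball t de <= J & (ALL s:I Int ball t de. sg s = ga s)"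
 shows "geodesic A F I ga"
proof (rule geodesicI[OF I cont])
 fix t assume t: "t : I"
 obtain de J sg where de: "de > 0" and J: "good J" "geodesic A F J sg" "I Int ball t de <= J" and eq: "!!s. s : I Int ball t de ==> sg s = ga s"
  using loc[OF t] by blast
 obtain c :: "('m,'n) chart" where c: "c : A" "ga t : cdom c" using chart_cover by blast
 obtain k where k: "k > 0" "!!s. s : I ==> abs(s - t) < k ==> ga s : cdom c" using chart_nbhd[OF cont t c] by blast
 define d where "d = min de k"
 have d: "d > 0" "I Int ball t d <= I Int ball t de" using de k by (auto simp: d_def)
 have dom: "ga s : cdom c" if "s : I Int ball t d" for s using k(2)[of s] that by (auto simp: d_def dist_real_def abs_minus_commute)
 have S: "Sol c (I Int ball t d) (%t. cmap c (sg t)) (%t. velocity A J sg t c)"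
  by (rule geodesic_Sol[OF J(1,2) c(1)]) (use d(2) J(3) dom eq in "auto simp: subset_iff")
 have "Sol c (I Int ball t d) (%t. cmap c (ga t)) (%t. velocity A J sg t c)"
  unfolding Sol_def'[OF c(1)]
 proof (intro ballI conjI)
  fix s assume s: "s : I Int ball t d"
  have e: "cmap c (ga s') = cmap c (sg s')" if "s' : I Int ball t d" for s' using eq[of s'] d(2) that by (metis subsetD)
  note S' = S[unfolded Sol_def'[OF c(1)], rule_format, OF s]
  show "cmap c (ga s) : cimg c" using S' e[OF s] by simp
  show "((%t. cmap c (ga t)) hvd velocity A J sg s c) (at s within I Int ball t d)"
   by (rule has_vector_derivative_transform[OF s e]) (use S' in blast)+
  show "((%t. velocity A J sg t c) hvd - finsler_dom.Q (L c) (cmap c (ga s)) (velocity A J sg s c)) (at s within I Int ball t d)"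
   using S' e[OF s] by simp
 qed
 thus "EX c:A. EX v. EX de>0. (ALL s:I Int ball t de. ga s : cdom c) & Sol c (I Int ball t de) (%t. cmap c (ga t)) v"
  using c(1) d(1) dom by blast
qed

lemma geodesic_cong: "good I ==> geodesic A F I ga ==> (!!t. t : I ==> ga t = sg t) ==> geodesic A F I sg"
proof (rule geodesic_localI)
 assume g: "good I" "geodesic A F I ga" and eq: "!!t. t : I ==> ga t = sg t"
 have "continuous_on I ga" using geodesic_C1[OF g(2)] unfolding C1_curve_def by blast
 thus "continuous_on I sg" using continuous_on_cong[of I I ga sg] eq by blast
 show "EX de>0. EX J ga'. good J & geodesic A F J ga' & I Int ball t de <= J & (ALL s:I Int ball t de. ga' s = sg s)" for t
  using g eq by (intro exI[of _ 1] conjI exI[of _ I] exI[of _ ga]) auto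
qed

end

section \<open>Minimizers and the Hopf--Rinow theorem\<close>

locale finsler_rev = finsler_mfd A F for A :: "('m::{t2_space, second_countable_topology}, 'n::finite) chart set" and F +
 fixes lam :: real
 assumes rev: "reversibility A F <= ereal lam"
begin

lemma F_rev: 
 assumes X: "X : tangent_space A q"
 shows "F q (%c. - X c) <= lam * F q X"
proof (cases "X = zero_tvec")
 case False
 have "ereal (F q (%c. - X c) / F q X) <= reversibility A F"
  unfolding reversibility_def by (rule SUP_upper2[of "(q, X)"]) (use X False in auto)
 hence "F q (%c. - X c) / F q X <= lam" using rev by (metis ereal_less_eq(3) order_trans)
 thus ?thesis using F_pos[OF X False] by (simp add: divide_le_eq)
qed (simp add: F_zero_tvec)

text \<open>The reversibility bound applied to a vector and to its opposite.\<close>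

lemma lam_ge_1: "1 <= lam"
proof -
 obtain q :: 'm where True by blast
 obtain c :: "('m,'n) chart" where c: "c : A" "q : cdom c" using chart_cover by blast
 define X where "X = tvec_of A c q (axis undefined 1)"
 have X: "X : tangent_space A q" unfolding X_def by (rule tvec_of_in[OF c])
 have X0: "X ~= zero_tvec"
 proof
  assume "X = zero_tvec"
  hence "X c = 0" by simp
  thus False unfolding X_def tvec_of_self[OF c] by simp
 qed
 have mX: "(%c. - X c) : tangent_space A q" using tangent_scale[OF X, of "- 1"] by simp
 have mX0: "(%c. - X c) ~= zero_tvec" using X0 by (metis minus_equation_iff minus_zero)
 have p: "F q X > 0" "F q (%c. - X c) > 0" using F_pos[OF X X0] F_pos[OF mX mX0] .
 have 1: "F q (%c. - X c) <= lam * F q X" by (rule F_rev[OF X])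
 have 2: "F q X <= lam * F q (%c. - X c)" using F_rev[OF mX] by simp
 show ?thesis
 proof (rule ccontr)
  assume "~ 1 <= lam"
  hence "lam * F q X < F q X" "lam * F q (%c. - X c) < F q (%c. - X c)" using p by simp_all
  thus False using 1 2 by linarith
 qed
qed

lemma dst_rev: "dst q p <= lam * dst p q"
proof -
 have "dst q p / lam <= dst p q"
 proof (rule dst_greatest)
  fix ga assume ga: "pwc 0 1 ga" "ga 0 = p" "ga 1 = q"
  have im: "(%t. - 1 * t + 1) ` {0..1} = {0..1::real}" using image_affinity_atLeastAtMost[of "- 1" 1 0 "1::real"] by simp
  have p: "pwc 0 1 (%t. ga (- 1 * t + 1))" by (rule pwc_affine[OF ga(1)]) (use im in auto)
  have "len 0 1 (%t. ga (- 1 * t + 1)) <= lam * len 0 1 ga"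
   by (rule len_affine_le[OF ga(1) _ im]) (use F_rev lam_ge_1 in simp_all)
  hence "dst q p <= lam * len 0 1 ga" using dst_le[OF p] ga(2,3) by simp
  thus "dst q p / lam <= len 0 1 ga" using lam_ge_1 by (simp add: divide_le_eq mult.commute)
 qed
 thus ?thesis using lam_ge_1 by (simp add: divide_le_eq mult.commute)
qed

text \<open>A minimizing curve of constant speed \<open>m\<close> in purely metric terms. No
  derivative occurs, so such curves can be cut, joined and compared without regard to
  smoothness.\<close>

definition mg :: "real => real => (real => 'm) => real => bool" where
 "mg a b ga m \<longleftrightarrow> (ALL s t. a <= s --> s <= t --> t <= b --> dst (ga s) (ga t) = m * (t - s))"

lemma mgD: "mg a b ga m ==> a <= s ==> s <= t ==> t <= b ==> dst (ga s) (ga t) = m * (t - s)"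
 unfolding mg_def by blast

text \<open>If no subinterval is too long and the whole is long enough, then by the triangle
  inequality every subinterval has the exact length.\<close>

lemma mgI:
 assumes le: "!!s t. a <= s ==> s <= t ==> t <= b ==> dst (ga s) (ga t) <= m * (t - s)" and ab: "m * (b - a) <= dst (ga a) (ga b)"
 shows "mg a b ga m"
 unfolding mg_def
proof (intro allI impI)
 fix s t assume st: "a <= s" "s <= t" "t <= b"
 have "dst (ga a) (ga b) <= dst (ga a) (ga s) + dst (ga s) (ga t) + dst (ga t) (ga b)"
  using dst_triangle[of "ga a" "ga b" "ga s"] dst_triangle[of "ga s" "ga b" "ga t"] by simp
 hence "m * (b - a) <= m * (s - a) + dst (ga s) (ga t) + m * (b - t)" using le[of a s] le[of t b] ab st by simp
 hence "m * (t - s) <= dst (ga s) (ga t)" by (simp add: algebra_simps)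
 thus "dst (ga s) (ga t) = m * (t - s)" using le[OF st] by simp
qed

lemma mg_concat:
 assumes "mg a b ga m" "mg b c ga m" and abc: "a <= b" "b <= c" and d: "m * (c - a) <= dst (ga a) (ga c)"
 shows "mg a c ga m"
proof (rule mgI[OF _ d])
 fix s t assume st: "a <= s" "s <= t" "t <= c"
 consider "t <= b" | "b <= s" | "s <= b" "b <= t" by linarith
 thus "dst (ga s) (ga t) <= m * (t - s)"
 proof cases
  case 3
  thus ?thesis using dst_triangle[of "ga s" "ga t" "ga b"] mgD[OF assms(1), of s b] mgD[OF assms(2), of b t] st
   by (simp add: algebra_simps)
 qed (use mgD[OF assms(1)] mgD[OF assms(2)] st in auto)
qed

lemma mg_subset: "mg a b ga m ==> a <= a' ==> b' <= b ==> mg a' b' ga m"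
 unfolding mg_def by auto

lemma mg_cong: "mg a b ga m ==> (!!t. t : {a..b} ==> ga t = sg t) ==> mg a b sg m"
 unfolding mg_def by (metis atLeastAtMost_iff order_trans)

lemma mg_affine:
 assumes "mg a b ga m" "al >= 0" "a <= al * a' + be" "al * b' + be <= b"
 shows "mg a' b' (%t. ga (al * t + be)) (m * al)"
 unfolding mg_def
proof (intro allI impI)
 fix s t assume st: "a' <= s" "s <= t" "t <= b'"
 have "al * a' <= al * s" "al * s <= al * t" "al * t <= al * b'" using st assms(2) by (auto intro: mult_left_mono)
 thus "dst (ga (al * s + be)) (ga (al * t + be)) = m * al * (t - s)"
  using mgD[OF assms(1), of "al * s + be" "al * t + be"] assms(3,4) by (simp add: algebra_simps)
qed

lemma mg_nonneg: "mg a b ga m ==> a < b ==> 0 <= m"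
 using mgD[of a b ga m a b] dst_nonneg[of "ga a" "ga b"] by (simp add: zero_le_mult_iff)

lemma mg_continuous:
 assumes g: "mg a b ga m" and m: "m >= 0"
 shows "continuous_on {a..b} ga"
 unfolding continuous_on_def
proof (intro ballI topological_tendstoI)
 fix t0 U assume t0: "t0 : {a..b}" and U: "open U" "ga t0 : U"
 obtain e where e: "e > 0" "!!q. dst (ga t0) q < e ==> q : U" by (rule dst_small[OF U]) blast
 define d where "d = e / (lam * m + 1)"
 have lm: "0 <= lam * m" using lam_ge_1 m by simp
 have d: "d > 0" unfolding d_def using e(1) lm by simp
 have "ga s : U" if s: "s : {a..b}" "abs(s - t0) < d" for s
 proof (rule e(2))
  have mm: "m * abs(s - t0) <= lam * m * abs(s - t0)"
   using mult_right_mono[of 1 lam "m * abs(s - t0)"] lam_ge_1 m by (simp add: mult_ac)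
  have "dst (ga t0) (ga s) <= lam * m * abs(s - t0)"
  proof (cases "t0 <= s")
   case True
   thus ?thesis using mgD[OF g, of t0 s] s t0 mm by simp
  next
   case False
   thus ?thesis using mgD[OF g, of s t0] s t0 dst_rev[of "ga t0" "ga s"] by (simp add: mult.assoc)
  qed
  also have "... <= lam * m * d" using lm s by (intro mult_left_mono) auto
  also have "... < (lam * m + 1) * d" using d by (simp add: algebra_simps)
  also have "... = e" using lm by (simp add: d_def)
  finally show "dst (ga t0) (ga s) < e" .
 qed
 thus "\<forall>\<^sub>F s in at t0 within {a..b}. ga s : U"
  unfolding eventually_at using d by (intro exI[of _ d]) (simp add: dist_real_def)
qed

lemma mg_zero: "mg a b ga 0 ==> t : {a..b} ==> ga t = ga a"
 using mgD[of a b ga 0 a t] dst_eq_0 by force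

text \<open>Near any time a minimizing curve runs inside one chart neighbourhood. Each of its points
  lies metrically between the ends of a short piece, hence on the short geodesic that joins these
  ends.\<close>

lemma mg_rep:
 assumes g: "mg a b ga m" and m: "m > 0" and ab: "a < b" and t0: "t0 : {a..b}"
 obtains s1 s2 sg de where "s1 < s2" "a <= s1" "s2 <= b" "de > 0" "{a..b} Int ball t0 de <= {s1..s2}" "geodesic A F {0..1} sg"
  "!!t. t : {0..1} ==> spd {0..1} sg t = m * (s2 - s1)" "!!s. s : {s1..s2} ==> ga s = sg ((s - s1) / (s2 - s1))"
proof (rule nb_exists[of "ga t0"])
 fix c :: "('m,'n) chart" and r R ep ka rh assume n: "finsler_nb A F c (cmap c (ga t0)) r R ep ka rh" and p: "cinv c (cmap c (ga t0)) = ga t0"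
 interpret finsler_nb A F c "cmap c (ga t0)" r R ep ka rh by (rule n)
 let ?x0 = "cmap c (ga t0)"
 let ?N = "nb r0"
 have p0: "ga t0 : ?N" using nbD(8) p by simp
 have cont: "continuous_on {a..b} ga" by (rule mg_continuous[OF g]) (use m in simp)
 have "\<forall>\<^sub>F s in at t0 within {a..b}. ga s : ?N"
  by (rule topological_tendstoD[OF _ nbD(3) p0]) (use cont t0 in "auto simp: continuous_on_def")
 then obtain k where k: "k > 0" "!!s. s : {a..b} ==> abs(s - t0) < k ==> ga s : ?N"
  unfolding eventually_at dist_real_def using p0 by metis
 define s1 where "s1 = max a (t0 - k / 2)"
 define s2 where "s2 = min b (t0 + k / 2)"
 have s12: "s1 < s2" "a <= s1" "s2 <= b" "t0 - k < s1" "s2 < t0 + k" using ab t0 k(1) by (auto simp: s1_def s2_def)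
 have N: "ga s : ?N" if "s : {s1..s2}" for s using k(2)[of s] that s12 by (auto simp: abs_less_iff)
 obtain x where x: "x : ball ?x0 r0" "ga s1 = cinv c x" using N[of s1] s12 unfolding nb_def by auto
 obtain y where y: "y : ball ?x0 r0" "ga s2 = cinv c y" using N[of s2] s12 unfolding nb_def by auto
 have d: "dst (cinv c x) (cinv c y) = m * (s2 - s1)" using mgD[OF g, of s1 s2] s12 x y by simp
 obtain sg where sg: "geodesic A F {0..1} sg" "!!t. t : {0..1} ==> spd {0..1} sg t = dst (cinv c x) (cinv c y)"
  and bt: "!!e. e : ball ?x0 r0 ==> x ~= y ==> dst (cinv c x) (cinv c e) + dst (cinv c e) (cinv c y) = dst (cinv c x) (cinv c y) ==>
      cinv c e = sg (dst (cinv c x) (cinv c e) / dst (cinv c x) (cinv c y))"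
  by (rule geodesic_minimizes[OF x(1) y(1)]) (blast intro: that)
 show thesis
 proof (rule that[OF s12(1-3) _ _ sg(1)])
  show "0 < k / 2" using k by simp
  show "{a..b} Int ball t0 (k / 2) <= {s1..s2}"
  proof
   fix x assume "x : {a..b} Int ball t0 (k / 2)"
   hence "abs(t0 - x) < k / 2" "a <= x" "x <= b" by (auto simp: dist_real_def)
   hence "t0 - k / 2 <= x" "x <= t0 + k / 2" unfolding abs_less_iff by linarith+
   thus "x : {s1..s2}" using `a <= x` `x <= b` unfolding s1_def s2_def by simp
  qed
  show "spd {0..1} sg t = m * (s2 - s1)" if "t : {0..1}" for t using sg(2)[OF that] d by simp
  fix s assume s: "s : {s1..s2}"
  obtain e where e: "e : ball ?x0 r0" "ga s = cinv c e" using N[OF s] unfolding nb_def by auto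
  have 1: "dst (cinv c x) (cinv c e) = m * (s - s1)" using mgD[OF g, of s1 s] s12 s x e by simp
  have 2: "dst (cinv c e) (cinv c y) = m * (s2 - s)" using mgD[OF g, of s s2] s12 s y e by simp
  have "x ~= y" using d m s12(1) by auto
  moreover have "m * (s - s1) + m * (s2 - s) = m * (s2 - s1)" by (simp add: algebra_simps)
  ultimately show "ga s = sg ((s - s1) / (s2 - s1))" using bt[OF e(1), unfolded 1 2 d] e(2) m by simp
 qed
qed

lemma mg_geodesic:
 assumes g: "mg a b ga m" and ab: "a < b"
 shows "geodesic A F {a..b} ga"
proof (cases "m = 0")
 case True
 show ?thesis by (rule geodesic_cong[OF good_Icc[OF ab] geodesic_const[OF good_Icc[OF ab], of "ga a"]]) (use mg_zero g True in metis)
next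
 case False
 hence m: "m > 0" using mg_nonneg[OF g ab] by simp
 show ?thesis
 proof (rule geodesic_localI[OF good_Icc[OF ab]])
  show "continuous_on {a..b} ga" by (rule mg_continuous[OF g]) (use m in simp)
  fix t assume t: "t : {a..b}"
  obtain s1 s2 sg de where r: "s1 < s2" "a <= s1" "s2 <= b" "de > 0" "{a..b} Int ball t de <= {s1..s2}" "geodesic A F {0..1} sg"
   and eq: "!!s. s : {s1..s2} ==> ga s = sg ((s - s1) / (s2 - s1))" by (rule mg_rep[OF g m ab t]) blast
  define al where "al = 1 / (s2 - s1)"
  have h: "(s - s1) / (s2 - s1) = al * s + (- al * s1)" for s unfolding al_def by (simp add: field_simps diff_divide_distrib)
  have al: "al >= 0" using r(1) by (simp add: al_def)
  have im: "(%s. al * s + (- al * s1)) ` {s1..s2} <= {0..1}" unfolding h[symmetric] using r(1) by (auto simp: divide_simps)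
  have "geodesic A F {s1..s2} (%s. sg (al * s + (- al * s1)))"
   by (rule geodesic_affine[OF r(6) good_Icc[OF zero_less_one] good_Icc[OF r(1)] im al])
  thus "EX de>0. EX J sg. good J & geodesic A F J sg & {a..b} Int ball t de <= J & (ALL s:{a..b} Int ball t de. sg s = ga s)"
   using r(4,5) good_Icc[OF r(1)] eq unfolding h
   by (intro exI[of _ de] conjI exI[of _ "{s1..s2}"] exI[of _ "%s. sg (al * s + (- al * s1))"] ballI) auto
 qed
qed

lemma spd_affine:
 assumes g: "geodesic A F I ga" and I: "good I" and J: "good J" "(%t. al * t + be) ` J <= I" and al: "al > 0" and t: "t : J"
 shows "spd J (%t. ga (al * t + be)) t = al * spd I ga (al * t + be)"
proof -
 let ?s = "al * t + be"
 have s: "?s : I" using J t by blast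
 note C = geodesic_C1[OF g]
 obtain c :: "('m,'n) chart" where c: "c : A" "ga ?s : cdom c" using chart_cover by blast
 have cont: "continuous_on I ga" using C unfolding C1_curve_def by blast
 have X: "velocity A I ga ?s : tangent_space A (ga ?s)"
  using velocity_tangent[OF I s c cont C1_curve_derivative[OF C s c]] tvec_of_in[OF c] by metis
 show ?thesis
  unfolding spd_def C1_curve_affine(2)[OF C I J t] by (rule F_scale[OF X al])
qed

text \<open>The speed is constant since the curve is a geodesic; the constant is found by comparing
  lengths on one piece from \<open>mg_rep\<close>.\<close>

lemma mg_speed:
 assumes g: "mg a b ga m" and ab: "a < b" and t: "t : {a..b}"
 shows "spd {a..b} ga t = m"
proof -
 note geo = mg_geodesic[OF g ab]
 obtain m' where m': "m' >= 0" "!!t. t : {a..b} ==> spd {a..b} ga t = m'" by (rule geodesic_speed[OF geo good_Icc[OF ab]]) blast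
 have l: "len a b ga = m' * (b - a)" by (rule geodesic_len(1)[OF geo good_Icc[OF ab] m'(2)]) (use ab in auto)
 have "m' = m"
 proof (cases "m = 0")
  case True
  have "len a b ga = len a b (%_. ga a)" by (rule len_cong) (use mg_zero g True in metis)
  also have "... = 0"
  proof -
   have "velocity A UNIV (%_. ga a) t = (%c. 0)" for t unfolding velocity_def by (auto simp: o_def)
   thus ?thesis unfolding len_sp sp_def by (simp add: F_zero_tvec)
  qed
  finally show ?thesis using l True ab by simp
 next
  case False
  hence m: "m > 0" using mg_nonneg[OF g ab] by simp
  obtain s1 s2 sg where r: "s1 < s2" "a <= s1" "s2 <= b" "geodesic A F {0..1} sg"
    "!!t. t : {0..1} ==> spd {0..1} sg t = m * (s2 - s1)" "!!s. s : {s1..s2} ==> ga s = sg ((s - s1) / (s2 - s1))"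
   by (rule mg_rep[OF g m ab t], rule that)
  define al where "al = 1 / (s2 - s1)"
  have h: "(s - s1) / (s2 - s1) = al * s + (- al * s1)" for s unfolding al_def by (simp add: field_simps diff_divide_distrib)
  have al: "al > 0" using r(1) by (simp add: al_def)
  have im: "(%s. al * s + (- al * s1)) ` {s1..s2} <= {0..1}" unfolding h[symmetric] using r(1) by (auto simp: divide_simps)
  let ?sg = "%s. sg (al * s + (- al * s1))"
  have "spd {s1..s2} ?sg s = m" if s: "s : {s1..s2}" for s
  proof -
   have "spd {s1..s2} ?sg s = al * spd {0..1} sg (al * s + (- al * s1))"
    by (rule spd_affine[OF r(4) good_Icc[OF zero_less_one] good_Icc[OF r(1)] im al s])
   also have "spd {0..1} sg (al * s + (- al * s1)) = m * (s2 - s1)" using r(5) im s by blast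
   finally show ?thesis using r(1) by (simp add: al_def)
  qed
  moreover have "geodesic A F {s1..s2} ?sg"
   by (rule geodesic_affine[OF r(4) good_Icc[OF zero_less_one] good_Icc[OF r(1)] im]) (use al in simp)
  ultimately have "len s1 s2 ?sg = m * (s2 - s1)" using geodesic_len(1)[of "{s1..s2}" ?sg m s1 s2] good_Icc[OF r(1)] r(1) by simp
  moreover have "len s1 s2 ga = len s1 s2 ?sg" by (rule len_cong) (use r(6) h in simp)
  moreover have "len s1 s2 ga = m' * (s2 - s1)" by (rule geodesic_len(1)[OF geo good_Icc[OF ab] m'(2)]) (use r in auto)
  ultimately show ?thesis using r(1) by simp
 qed
 thus ?thesis using m'(2)[OF t] by simp
qed

lemma geodesic_mg:
 assumes g: "geodesic A F I ga" and I: "good I" and m: "!!t. t : I ==> spd I ga t = m" and ab: "a <= b" "{a..b} <= I"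
  and d: "m * (b - a) <= dst (ga a) (ga b)"
 shows "mg a b ga m"
 by (rule mgI[OF _ d], rule geodesic_len(2)[OF g I m]) (use ab in auto)

text \<open>Length bounds distance on each subinterval, so \<open>mgI\<close> applies to a length
  minimizer. Conversely a metric minimizer is a geodesic, whose length is its speed times its
  duration.\<close>

lemma minimizer_mg: "minimizer A F p q ga \<longleftrightarrow> mg 0 1 ga (dst p q) & ga 0 = p & ga 1 = q"
proof
 assume m: "minimizer A F p q ga"
 hence p: "pwc 0 1 ga" and e: "ga 0 = p" "ga 1 = q" and l: "!!t. t : {0..1} ==> len 0 t ga = t * dst p q"
  unfolding minimizer_def pw_C1_curve_iff by blast+
 have "mg 0 1 ga (dst p q)"
 proof (rule mgI)
  fix s t :: real assume st: "0 <= s" "s <= t" "t <= 1"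
  show "dst (ga s) (ga t) <= dst p q * (t - s)"
  proof (cases "s < t")
   case True
   have "dst (ga s) (ga t) <= len s t ga" by (rule dst_le[OF pwc_sub[OF p] True]) (use st in auto)
   also have "... = len 0 t ga - len 0 s ga" using len_combine[OF pwc_sub[OF p, of 0 t], of s] st by simp
   also have "... = dst p q * (t - s)" using l[of s] l[of t] st by (simp add: algebra_simps)
   finally show ?thesis .
  qed (use st in simp)
 qed (simp add: e)
 thus "mg 0 1 ga (dst p q) & ga 0 = p & ga 1 = q" using e by blast
next
 assume g: "mg 0 1 ga (dst p q) & ga 0 = p & ga 1 = q"
 hence geo: "geodesic A F {0..1} ga" using mg_geodesic zero_less_one by blast
 have "len 0 t ga = t * dst p q" if "t : {0..1}" for t
  using geodesic_len(1)[OF geo good_Icc[OF zero_less_one], of "dst p q" 0 t] mg_speed[of 0 1 ga "dst p q"] g that by (simp add: mult.commute)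
 thus "minimizer A F p q ga" unfolding minimizer_def pw_C1_curve_iff using geodesic_pwc[OF geo zero_less_one] g by blast
qed

end

section \<open>Existence, uniqueness and stability of minimizers\<close>

locale finsler_complete = finsler_rev A F lam
 for A :: "('m::{t2_space, second_countable_topology}, 'n::finite) chart set" and F and lam +
 assumes complete: "forward_complete A F"
begin

text \<open>Completeness speaks of half-open intervals; the value at the right end is recovered by
  continuity, and the speed by comparing lengths.\<close>

lemma geodesic_extend:
 assumes g: "geodesic A F {a..b} ga" and ab: "a < b" and m: "!!t. t : {a..b} ==> spd {a..b} ga t = m"
 obtains sg where "geodesic A F {a..} sg" "!!t. t : {a..b} ==> sg t = ga t" "!!t. t >= a ==> spd {a..} sg t = m"
proof -
 have "geodesic A F {a..<b} ga" by (rule geodesic_subset[OF g good_Icc[OF ab] good_Ico[OF ab]]) auto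
 then obtain sg where sg: "geodesic A F {a..} sg" "!!t. t : {a..<b} ==> sg t = ga t"
  using complete ab unfolding forward_complete_def by blast
 have cont: "continuous_on {a..b} ga" "continuous_on {a..} sg"
  using geodesic_C1[OF g] geodesic_C1[OF sg(1)] unfolding C1_curve_def by blast+
 have "(ga \<longlongrightarrow> ga b) (at b within {a..b})" "(sg \<longlongrightarrow> sg b) (at b within {a..})"
  using cont ab unfolding continuous_on_def by auto
 hence "(ga \<longlongrightarrow> ga b) (at b within {a..<b})" "(sg \<longlongrightarrow> sg b) (at b within {a..<b})"
  by (auto elim: tendsto_within_subset)
 moreover have "(sg \<longlongrightarrow> ga b) (at b within {a..<b}) \<longleftrightarrow> (ga \<longlongrightarrow> ga b) (at b within {a..<b})"
  by (rule Lim_cong_within) (use sg(2) in auto)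
 moreover have "at b within {a..<b} ~= bot"
  using ab by (simp add: at_within_eq_bot_iff)
 ultimately have "sg b = ga b" using tendsto_unique by blast
 hence eq: "sg t = ga t" if "t : {a..b}" for t using sg(2)[of t] that by (cases "t = b") auto
 obtain m' where m': "!!t. t : {a..} ==> spd {a..} sg t = m'" by (rule geodesic_speed[OF sg(1) good_Ici]) blast
 have "m * (b - a) = len a b ga" using geodesic_len(1)[OF g good_Icc[OF ab] m, of a b] ab by simp
 also have "... = len a b sg" by (rule len_cong) (use eq in simp)
 also have "... = m' * (b - a)" using geodesic_len(1)[OF sg(1) good_Ici m', of a b] ab by simp
 finally have "m' = m" using ab by simp
 thus thesis using that[OF sg(1) eq] m' by simp
qed

lemma mg_extend:
 assumes g: "mg a b ga m" and ab: "a < b"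
 obtains sg where "geodesic A F {a..} sg" "!!t. t : {a..b} ==> sg t = ga t" "!!t. t >= a ==> spd {a..} sg t = m"
 by (rule geodesic_extend[OF mg_geodesic[OF g ab] ab mg_speed[OF g ab]]) (blast intro: that)+

lemma ray_mg:
 assumes "geodesic A F {a..} sg" "!!t. t >= a ==> spd {a..} sg t = m" "a <= b" "m * (b - a) <= dst (sg a) (sg b)"
 shows "mg a b sg m"
 by (rule geodesic_mg[OF assms(1) good_Ici _ assms(3) _ assms(4)]) (use assms in auto)

text \<open>The first step towards \<open>q\<close>: small metric spheres around \<open>p\<close>
  are compact, and \<open>e\<close> is the point of the sphere with the least distance to
  \<open>q\<close>. All curves from \<open>p\<close> to \<open>q\<close> cross the sphere, so
  nothing is lost by passing through \<open>e\<close>.\<close>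

lemma sphere:
 obtains e0 where "e0 > 0" "!!q et. 0 < et ==> et < e0 ==> et < dst p q ==>
   EX e ga. dst p e = et & dst e q = dst p q - et & mg 0 1 ga et & ga 0 = p & ga 1 = e"
proof (rule nb_exists[of p])
 fix c :: "('m,'n) chart" and r R ep ka rh assume n: "finsler_nb A F c (cmap c p) r R ep ka rh" and p: "cinv c (cmap c p) = p"
 interpret finsler_nb A F c "cmap c p" r R ep ka rh by (rule n)
 let ?x0 = "cmap c p"
 show thesis
 proof (rule that[OF nbD(1)])
  fix q et assume et: "0 < et" "et < reach" "et < dst p q"
  define S where "S = {e. dst p e = et}"
  have "closed S" unfolding S_def using continuous_closed_preimage_constant[of UNIV "dst p" et]
   by (simp add: continuous_intros)
  moreover have SN: "e : nb r0" if "e : S" for e using nbD(9)[OF nbD(7), of e] p that et(2) unfolding S_def by simp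
  moreover have "S <= cinv c ` cball ?x0 r0" using SN nbD(6) by blast
  ultimately have cS: "compact S" using compact_Int_closed[OF nbD(5), of S] by (simp add: inf.absorb2)
  have cross: "EX e:S. et + dst e q <= len 0 1 ga" if ga: "pwc 0 1 ga" "ga 0 = p" "ga 1 = q" for ga
  proof -
   have "continuous_on {0..1} (%t. dst p (ga t))" using ga(1) unfolding pwc_def by (auto intro!: continuous_intros)
   then obtain t where t: "t >= 0" "t <= 1" "dst p (ga t) = et"
    using IVT'[of "%t. dst p (ga t)" 0 et 1] ga et by auto
   have t01: "0 < t" "t < 1" using t ga et by (auto simp: less_le)
   have "dst (ga 0) (ga t) <= len 0 t ga" "dst (ga t) (ga 1) <= len t 1 ga"
    using dst_le[OF pwc_sub[OF ga(1)]] t01 by auto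
   hence "et + dst (ga t) q <= len 0 1 ga" using len_combine[OF ga(1), of t] t ga by simp
   thus ?thesis using t(3) unfolding S_def by blast
  qed
  have neS: "S ~= {}" using joinable_all[of p q] cross unfolding joinable_def by blast
  then obtain e where e: "e : S" "!!e'. e' : S ==> dst e q <= dst e' q"
   using continuous_attains_inf[OF cS neS continuous_on_dst[OF continuous_on_id continuous_on_const], of q] by blast
  have "et + dst e q <= dst p q"
  proof (rule dst_greatest)
   fix ga assume "pwc 0 1 ga" "ga 0 = p" "ga 1 = q"
   from cross[OF this] obtain e' where "e' : S" "et + dst e' q <= len 0 1 ga" by blast
   thus "et + dst e q <= len 0 1 ga" using e(2)[of e'] by simp
  qed
  hence eq: "dst e q = dst p q - et" using dst_triangle[of p q e] e(1) unfolding S_def by simp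
  obtain y where y: "y : ball ?x0 r0" "e = cinv c y" using SN[OF e(1)] unfolding nb_def by blast
  have d: "dst (cinv c ?x0) (cinv c y) = et" using e(1) p y unfolding S_def by simp
  obtain ga where ga: "ga 0 = p" "ga 1 = e" "!!s t. 0 <= s ==> s <= t ==> t <= 1 ==> dst (ga s) (ga t) = (t - s) * et"
   by (rule geodesic_minimizes[of ?x0 y, unfolded d]) (use y r0(1) p that in auto)
  have "mg 0 1 ga et" unfolding mg_def using ga(3) by (simp add: mult.commute)
  thus "EX e ga. dst p e = et & dst e q = dst p q - et & mg 0 1 ga et & ga 0 = p & ga 1 = e"
   using ga(1,2) eq e(1) unfolding S_def by (intro exI[of _ e] exI[of _ ga]) simp
 qed
qed

lemma mg_join:
 assumes 1: "mg a b ga1 m" and 2: "mg b c ga2 m" and abc: "a <= b" "b <= c" "ga1 b = ga2 b" and d: "m * (c - a) <= dst (ga1 a) (ga2 c)"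
 shows "mg a c (%t. if t <= b then ga1 t else ga2 t) m"
proof (rule mg_concat[of a b])
 show "mg a b (%t. if t <= b then ga1 t else ga2 t) m" by (rule mg_cong[OF 1]) simp
 show "mg b c (%t. if t <= b then ga1 t else ga2 t) m" by (rule mg_cong[OF 2]) (use abc in auto)
 show "m * (c - a) <= dst (if a <= b then ga1 a else ga2 a) (if c <= b then ga1 c else ga2 c)"
  using d abc by (cases "c = b") auto
qed (use abc in auto)

lemma mg_stretch:
 assumes "mg 0 1 ga et" "et > 0"
 shows "mg T (T + et) (%t. ga (1 / et * t + (- T / et))) 1"
 using mg_affine[OF assms(1), of "1 / et" T "- T / et" "T + et"] assms(2) by (simp add: field_simps)

theorem mg_exists:
 obtains ga where "mg 0 1 ga (dst p q)" "ga 0 = p" "ga 1 = q"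
proof (cases "p = q")
 case True
 thus thesis using that[of "%_. p"] by (simp add: mg_def)
next
 case False
 define d where "d = dst p q"
 have d: "d > 0" using False dst_eq_0 dst_nonneg[of p q] unfolding d_def by (metis less_eq_real_def)
 obtain e0 where e0: "e0 > 0" "!!q et. 0 < et ==> et < e0 ==> et < dst p q ==>
   EX e ga. dst p e = et & dst e q = dst p q - et & mg 0 1 ga et & ga 0 = p & ga 1 = e" by (rule sphere[of p], rule that)
 define et where "et = min e0 d / 2"
 have et: "0 < et" "et < e0" "et < d" unfolding et_def using e0(1) d by auto
 obtain e ga where e: "dst p e = et" "dst e q = d - et" and ga: "mg 0 1 ga et" "ga 0 = p" "ga 1 = e"
  using e0(2)[of et q] et unfolding d_def by blast
 have g1: "mg 0 et (%t. ga (1 / et * t + (- 0 / et))) 1" using mg_stretch[OF ga(1) et(1), of 0] by simp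
 obtain sg where sg: "geodesic A F {0..} sg" "!!t. t : {0..et} ==> sg t = ga (1 / et * t + (- 0 / et))" "!!t. t >= 0 ==> spd {0..} sg t = 1"
  by (rule mg_extend[OF g1 et(1)], rule that)
 have s0: "sg 0 = p" "sg et = e" using sg(2)[of 0] sg(2)[of et] et ga by auto
 have cont: "continuous_on {0..d} sg" using geodesic_C1[OF sg(1)] unfolding C1_curve_def by (metis Icc_subset_Ici_iff continuous_on_subset order_refl)
 \<comment> \<open>The times at which the ray still heads for \<open>q\<close> without loss. The aim
   is that the last of them is \<open>d\<close>.\<close>
 define X where "X = {t : {0..d}. dst (sg t) q - (d - t) = 0}"
 have cX: "closed X" unfolding X_def by (intro continuous_closed_preimage_constant continuous_intros cont)
 have bX: "bdd_above X" unfolding X_def by auto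
 have etX: "et : X" unfolding X_def using e s0 et by simp
 define T where "T = Sup X"
 have TX: "T : X" unfolding T_def using closed_contains_Sup[OF _ bX cX] etX by blast
 have T: "et <= T" "T <= d" "dst (sg T) q = d - T" using TX cSup_upper[OF etX bX] unfolding X_def T_def by auto
 have mT: "mg 0 T sg 1"
  by (rule ray_mg[OF sg(1,3)]) (use T et s0 dst_triangle[of p q "sg T"] in "auto simp: d_def")
 have "T = d"
 proof (rule ccontr)
  assume "T ~= d"
  hence Td: "T < d" using T by simp
  obtain e1 where e1: "e1 > 0" "!!q et. 0 < et ==> et < e1 ==> et < dst (sg T) q ==>
   EX e ga. dst (sg T) e = et & dst e q = dst (sg T) q - et & mg 0 1 ga et & ga 0 = (sg T) & ga 1 = e" by (rule sphere[of "sg T"], rule that)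
  define th where "th = min e1 (d - T) / 2"
  have th: "0 < th" "th < e1" "th < d - T" unfolding th_def using e1(1) Td by auto
  obtain e' ga' where e': "dst (sg T) e' = th" "dst e' q = d - T - th" and ga': "mg 0 1 ga' th" "ga' 0 = sg T" "ga' 1 = e'"
   using e1(2)[of th q] th T(3) by auto
  note g2 = mg_stretch[OF ga'(1) th(1), of T]
  let ?ga2 = "%t. ga' (1 / th * t + (- T / th))"
  have g2e: "?ga2 T = sg T" "?ga2 (T + th) = e'" using ga' th(1) by (simp_all add: field_simps)
  define ta where "ta t = (if t <= T then sg t else ?ga2 t)" for t
  have "d <= dst p e' + dst e' q" unfolding d_def by (rule dst_triangle)
  hence "1 * (T + th - 0) <= dst (sg 0) (?ga2 (T + th))" using e'(2) g2e(2) s0 by simp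
  hence "mg 0 (T + th) ta 1"
   unfolding ta_def using T et th by (intro mg_join[OF mT g2 _ _ g2e(1)[symmetric]]) auto
  hence "geodesic A F {0..T + th} ta" by (rule mg_geodesic) (use T et th in auto)
  moreover have "geodesic A F {0..T + th} sg"
   by (rule geodesic_subset[OF sg(1) good_Ici good_Icc]) (use T et th in auto)
  \<comment> \<open>The ray followed by the next step towards \<open>q\<close> is minimizing, hence
    a geodesic without a corner, and therefore the ray itself. So \<open>T + th\<close> belongs to
    \<open>X\<close>, against the choice of \<open>T\<close>.\<close>
  ultimately have "ta (T + th) = sg (T + th)"
   by (rule geodesic_unique[OF _ _ good_Icc, of 0 "T + th" _ _ 0 T]) (use T et th in "auto simp: ta_def")
  hence "sg (T + th) = e'" using g2e(2) th(1) by (simp add: ta_def)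
  hence "T + th : X" unfolding X_def using e'(2) T et th by auto
  hence "T + th <= T" unfolding T_def by (rule cSup_upper[OF _ bX])
  thus False using th(1) by simp
 qed
 hence g: "mg 0 d sg 1" "sg d = q" using mT T(3) dst_eq_0 by auto
 show thesis
 proof (rule that[of "%t. sg (d * t + 0)"])
  show "mg 0 1 (%t. sg (d * t + 0)) (dst p q)" using mg_affine[OF g(1), of d 0 0 1] d unfolding d_def by simp
 qed (use g s0 in auto)
qed

text \<open>All unit speed geodesics from \<open>p\<close> minimize up to length \<open>R\<close>.
  This replaces the injectivity radius, because it can also be verified near a point without a
  global bound.\<close>

definition INJ :: "'m => real => bool" where
 "INJ p R \<longleftrightarrow> (ALL ga. geodesic A F {0..} ga --> ga 0 = p --> (ALL t>=0. spd {0..} ga t = 1) --> (ALL t. 0 <= t --> t < R --> dst p (ga t) = t))"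

text \<open>The minimizing times of a ray are closed and contain all smaller times. If they are
  bounded, their supremum gives a cut point whose distance from \<open>p\<close> is this
  supremum.\<close>

lemma INJ_injectivity_radius:
 assumes "ereal R <= injectivity_radius A F"
 shows "INJ p R"
 unfolding INJ_def
proof (intro allI impI)
 fix ga t0 assume g: "geodesic A F {0..} ga" "ga 0 = p" and s: "ALL t>=0. spd {0..} ga t = 1" and t0: "0 <= t0" "t0 < R"
 define T where "T = {t. 0 <= t & dst p (ga t) = t}"
 have "EX t:T. t0 <= t"
 proof (cases "bdd_above T")
  case True
  have T2: "T = {t : {0..}. dst p (ga t) - t = 0}" unfolding T_def by auto
  have "continuous_on {0..} ga" using geodesic_C1[OF g(1)] unfolding C1_curve_def by blast
  hence "closed T" unfolding T2 by (intro continuous_closed_preimage_constant continuous_intros) auto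
  moreover have "0 : T" unfolding T_def using g(2) by simp
  ultimately have ST: "Sup T : T" using closed_contains_Sup[OF _ True] by blast
  have "ga (Sup T) : cut_locus A F p"
   unfolding cut_locus_def using g s True unfolding spd_def T_def by blast
  hence "injectivity_radius A F <= ereal (dst p (ga (Sup T)))"
   unfolding injectivity_radius_def by (meson INF_lower INF_lower2 UNIV_I)
  hence "R <= dst p (ga (Sup T))" using assms by (meson ereal_less_eq(3) order_trans)
  moreover have "dst p (ga (Sup T)) = Sup T" using ST unfolding T_def by simp
  ultimately have "t0 <= Sup T" using t0 by linarith
  thus ?thesis using ST by blast
 next
  case False
  thus ?thesis unfolding bdd_above_def by (meson linear)
 qed
 then obtain t where t: "0 <= t" "dst p (ga t) = t" "t0 <= t" unfolding T_def by blast
 have "mg 0 t ga 1" by (rule ray_mg[OF g(1)]) (use s t g in auto)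
 from mgD[OF this, of 0 t0] show "dst p (ga t0) = t0" using t0 t g by simp
qed

text \<open>Supplies the positive convexity radius at every point, independently of the global
  injectivity radius.\<close>

lemma INJ_local:
 obtains V R where "open V" "x : V" "R > 0" "!!p. p : V ==> INJ p R"
proof (rule nb_exists[of x])
 fix c :: "('m,'n) chart" and r R ep ka rh assume n: "finsler_nb A F c (cmap c x) r R ep ka rh" and x: "cinv c (cmap c x) = x"
 interpret finsler_nb A F c "cmap c x" r R ep ka rh by (rule n)
 show thesis
 proof (rule that[OF nbD(4) _ nbD(1)])
  show "x : nb (r0 / 2)" using nbD(7) x by simp
  fix p assume p: "p : nb (r0 / 2)"
  show "INJ p reach"
   unfolding INJ_def
  proof (intro allI impI)
   fix ga t assume g: "geodesic A F {0..} ga" "ga 0 = p" "ALL t>=0. spd {0..} ga t = 1" and t: "0 <= t" "t < reach"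
   show "dst p (ga t) = t"
   proof (cases "t = 0")
    case False
    hence t0: "0 < t" using t by simp
    have g2: "geodesic A F {0..t} ga" by (rule geodesic_subset[OF g(1) good_Ici good_Icc[OF t0]]) auto
    have sp1: "spd {0..t} ga s = 1" if s: "s : {0..t}" for s
    proof -
     have "velocity A {0..t} ga s = velocity A {0..} ga s"
      by (rule C1_curve_subset(2)[OF geodesic_C1[OF g(1)] good_Ici good_Icc[OF t0] _ s]) auto
     thus ?thesis using g(3) s unfolding spd_def by simp
    qed
    have "dst (ga 0) (ga t) = t" by (rule short_geodesics[OF g2 t0]) (use t p g sp1 in "auto simp: reach_def")
    thus ?thesis using g(2) by simp
   qed (use g in simp)
  qed
 qed
qed

lemma INJ_mono:
 assumes "INJ p R" "R' <= R"
 shows "INJ p R'"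
 unfolding INJ_def
proof (intro allI impI)
 fix ga t assume g: "geodesic A F {0..} ga" "ga 0 = p" "ALL t>=0. spd {0..} ga t = 1" and t: "0 <= t" "t < R'"
 have "t < R" using t assms(2) by simp
 thus "dst p (ga t) = t" using assms(1) g t(1) unfolding INJ_def by blast
qed

lemma INJ_geodesic:
 assumes i: "INJ p R" and g: "geodesic A F {0..1} ga" "ga 0 = p" and m: "!!t. t : {0..1} ==> spd {0..1} ga t = m"
  and t: "t : {0..1}" "m * t < R"
 shows "dst p (ga t) = m * t"
proof (cases "m > 0")
 case False
 have "0 <= m" using m[of 0] spd_nonneg[OF good_Icc[OF zero_less_one] geodesic_C1[OF g(1)], of 0] by simp
 hence "m = 0" using False by simp
 thus ?thesis using geodesic_len(2)[OF g(1) good_Icc[OF zero_less_one] m, of 0 t] t(1) g(2) dst_nonneg[of p "ga t"] by simp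
next
 case True
 let ?c = "%s. ga (1 / m * s + 0)"
 have im: "(%s. 1 / m * s + 0) ` {0..m} <= {0..1}" using True by (auto simp: field_simps)
 have gc: "geodesic A F {0..m} ?c" by (rule geodesic_affine[OF g(1) good_Icc[OF zero_less_one] good_Icc[OF True] im]) (use True in simp)
 have sc: "spd {0..m} ?c s = 1" if "s : {0..m}" for s
 proof -
  have "spd {0..m} ?c s = 1 / m * spd {0..1} ga (1 / m * s + 0)"
   by (rule spd_affine[OF g(1) good_Icc[OF zero_less_one] good_Icc[OF True] im _ that]) (use True in simp)
  also have "spd {0..1} ga (1 / m * s + 0) = m" using m im that by blast
  finally show ?thesis using True by simp
 qed
 obtain sg where sg: "geodesic A F {0..} sg" "!!t. t : {0..m} ==> sg t = ?c t" "!!t. t >= 0 ==> spd {0..} sg t = 1"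
  using geodesic_extend[of 0 m ?c 1, OF gc True sc] by metis
 have mt: "m * t : {0..m}" using t(1) True by (simp add: mult_left_le)
 have "sg 0 = p" using sg(2)[of 0] True g(2) by simp
 hence "dst p (sg (m * t)) = m * t" using i sg(1,3) t mt unfolding INJ_def by simp
 thus ?thesis using sg(2)[OF mt] True by simp
qed

text \<open>Minimizers from \<open>p\<close> remain minimizing slightly beyond \<open>q\<close>. The
  second minimizer, followed by the continuation of the first, has the same length and is minimizing
  too; so it is a geodesic and agrees with the first by unique continuation.\<close>

lemma mg_unique:
 assumes i: "INJ p R" and d: "dst p q < R" and 1: "mg 0 1 ga1 (dst p q)" "ga1 0 = p" "ga1 1 = q"
  and 2: "mg 0 1 ga2 (dst p q)" "ga2 0 = p" "ga2 1 = q" and t: "t : {0..1}"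
 shows "ga1 t = ga2 t"
proof (cases "dst p q = 0")
 case True
 thus ?thesis using mg_zero[of 0 1 ga1 t] mg_zero[of 0 1 ga2 t] 1 2 t by simp
next
 case False
 define m where "m = dst p q"
 have m: "m > 0" using False dst_nonneg[of p q] unfolding m_def by simp
 note g1 = mg_stretch[OF 1(1)[folded m_def] m, of 0] and g2 = mg_stretch[OF 2(1)[folded m_def] m, of 0]
 let ?c1 = "%t. ga1 (1 / m * t + - 0 / m)" and ?c2 = "%t. ga2 (1 / m * t + - 0 / m)"
 obtain sg where sg: "geodesic A F {0..} sg" "!!t. t : {0..0 + m} ==> sg t = ?c1 t" "!!t. t >= 0 ==> spd {0..} sg t = 1"
  by (rule mg_extend[OF g1]) (use m in auto)
 define R' where "R' = (m + R) / 2"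
 have R': "m < R'" "R' < R" using d unfolding R'_def m_def by auto
 have s0: "sg 0 = p" "sg m = q" using sg(2)[of 0] sg(2)[of m] 1 m by auto
 have dR: "dst p (sg R') = R'" using i sg(1,3) s0(1) R' m unfolding INJ_def by simp
 have gR: "mg 0 R' sg 1" by (rule ray_mg[OF sg(1,3)]) (use dR s0 R' m in auto)
 have "mg 0 R' (%t. if t <= 0 + m then ?c2 t else sg t) 1"
  by (rule mg_join[OF g2 mg_subset[OF gR]]) (use R' m s0 2 dR in auto)
 hence gt: "geodesic A F {0..R'} (%t. if t <= 0 + m then ?c2 t else sg t)" by (rule mg_geodesic) (use R' m in simp)
 have mt: "m * t : {0..m}" using t m by (simp add: mult_left_le)
 have "m * t <= m" using mt by (metis atLeastAtMost_iff)
 hence mt2: "m * t : {0..R'}" using mt R'(1) by (metis atLeastAtMost_iff less_imp_le order_trans)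
 have "(if m * t <= 0 + m then ?c2 (m * t) else sg (m * t)) = sg (m * t)"
 proof (rule geodesic_unique[OF gt mg_geodesic[OF gR] good_Icc R'(1)])
  show "(if s <= 0 + m then ?c2 s else sg s) = sg s" if "s : {m..R'}" for s
   using that s0(2) 2 m by (cases "s = m") auto
  show "m * t : {0..R'}" by (rule mt2)
 qed (use R' m in auto)
 thus ?thesis using sg(2)[of "m * t"] mt m by simp
qed

text \<open>Compactness turns uniqueness into stability. A minimizer that strays from
  \<open>c0\<close> passes through the set \<open>KK\<close> of points at distance exactly
  \<open>ep'\<close>, and on \<open>KK\<close> the failure to lie on a minimizer to
  \<open>q0\<close> is bounded below.\<close>

lemma mg_stable:
 assumes c0: "mg 0 1 c0 (dst p q0)" "c0 0 = p" "c0 1 = q0"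
  and uniq: "!!c (t::real). mg 0 1 c (dst p q0) ==> c 0 = p ==> c 1 = q0 ==> t : {0..1} ==> c t = c0 t" and ep: "ep > 0"
 obtains V where "open V" "q0 : V" "!!q c (s::real). q : V ==> mg 0 1 c (dst p q) ==> c 0 = p ==> c 1 = q ==> s : {0..1} ==> dst (c0 s) (c s) < ep"
proof -
 define D where "D = dst p q0"
 have cont0: "continuous_on {0..1} c0" by (rule mg_continuous[OF c0(1) dst_nonneg])
 have "compact (c0 ` {0..1})" by (rule compact_continuous_image[OF cont0 compact_Icc])
 then obtain e K where eK: "e > 0" "compact K" "!!p q. p : c0 ` {0..1} ==> dst p q < e ==> q : K" by (rule compact_near) blast
 define ep' where "ep' = min ep (e / 2)"
 have ep': "0 < ep'" "ep' <= ep" "ep' < e" using ep eK(1) by (auto simp: ep'_def)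
 define KK where "KK = {z : {0..1} \<times> K. dst (c0 (fst z)) (snd z) = ep'}"
 have cpt: "compact ({0..1::real} \<times> K)" by (intro compact_Times compact_Icc eK(2))
 have contz: "continuous_on ({0..1} \<times> K) (%z. c0 (fst z))"
  by (rule continuous_on_compose2[OF cont0]) (auto intro: continuous_intros)
 have "closed KK" unfolding KK_def
  by (rule continuous_closed_preimage_constant) (intro continuous_intros contz compact_imp_closed[OF cpt])+
 hence cKK: "compact KK" using compact_Int_closed[OF cpt, of KK] unfolding KK_def by (simp add: inf.absorb2 Int_def) 
 \<comment> \<open>\<open>ph (s, y)\<close> measures how far \<open>y\<close> is from being the
   point at time \<open>s\<close> of a minimizer from \<open>p\<close> to \<open>q0\<close>. Where
   it vanishes, minimizers through \<open>y\<close> can be joined and uniqueness gives y =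
   c0(s).\<close>
 define ph where "ph z = abs(dst p (snd z) - fst z * D) + abs(dst (snd z) q0 - (1 - fst z) * D)" for z
 have cph: "continuous_on KK ph" unfolding ph_def by (intro continuous_intros)
 have pos: "ph z > 0" if z: "z : KK" for z
 proof (rule ccontr)
  assume "~ ph z > 0"
  obtain s y where sy: "z = (s, y)" by (cases z)
  have s: "0 <= s" "s <= 1" and ds: "dst (c0 s) y = ep'" using z unfolding KK_def sy by auto
  have dy: "dst p y = s * D" "dst y q0 = (1 - s) * D" using `~ ph z > 0` unfolding ph_def sy by auto
  have "y = c0 s"
  proof -
   consider "s = 0" | "s = 1" | "0 < s" "s < 1" using s by linarith
   thus ?thesis
   proof cases
    case 1 thus ?thesis using dy dst_eq_0 c0 by simp
   next
    case 2 thus ?thesis using dy dst_eq_0 c0 by simp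
   next
    case 3
    obtain a where a: "mg 0 1 a (dst p y)" "a 0 = p" "a 1 = y" by (rule mg_exists)
    obtain b where b: "mg 0 1 b (dst y q0)" "b 0 = y" "b 1 = q0" by (rule mg_exists)
    let ?a = "%t. a (1 / s * t + 0)" and ?b = "%t. b (1 / (1 - s) * t + (- s / (1 - s)))"
    have ga: "mg 0 s ?a D" using mg_affine[OF a(1), of "1 / s" 0 0 s] 3 dy by simp
    have "1 / (1 - s) * s + - s / (1 - s) = 0" "1 / (1 - s) * 1 + - s / (1 - s) = 1" "dst y q0 * (1 / (1 - s)) = D"
     using 3 dy by (simp_all add: diff_divide_distrib[symmetric])
    hence gb: "mg s 1 ?b D" using mg_affine[OF b(1), of "1 / (1 - s)" s "- s / (1 - s)" 1] 3 by simp
    have ends: "?a 0 = p" "?a s = y" "?b s = y" "?b 1 = q0" using a b 3 by (simp_all add: field_simps)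
    have j: "mg 0 1 (%t. if t <= s then ?a t else ?b t) D"
     by (rule mg_join[OF ga gb]) (use 3 ends in "simp_all add: D_def")
    have "(if s <= s then ?a s else ?b s) = c0 s"
     by (rule uniq[OF j[unfolded D_def], of s]) (use 3 ends in auto)
    thus ?thesis using ends by simp
   qed
  qed
  thus False using ds ep'(1) by simp
 qed
 have "EX et>0. ALL z:KK. et <= ph z"
 proof (cases "KK = {}")
  case False
  then obtain z0 where "z0 : KK" "!!z. z : KK ==> ph z0 <= ph z" using continuous_attains_inf[OF cKK _ cph] by blast
  thus ?thesis using pos by blast
 qed (auto intro: exI[of _ 1])
 then obtain et where et: "et > 0" "!!z. z : KK ==> et <= ph z" by blast
 \<comment> \<open>Moving the end point costs at most et/4 in each of three places: twice the change
   of the total distance and once the change of the remaining distance.\<close>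
 have "et / 4 > 0" using et by simp
 then obtain V where V: "open V" "q0 : V" "!!q. q : V ==> dst q0 q < et / 4 & dst q q0 < et / 4" by (rule dst_near) blast
 show thesis
 proof (rule that[OF V(1,2)])
  fix q c and s :: real assume q: "q : V" and c: "mg 0 1 c (dst p q)" "c 0 = p" "c 1 = q" and s: "s : {0..1}"
  show "dst (c0 s) (c s) < ep"
  proof (rule ccontr)
   assume "~ dst (c0 s) (c s) < ep"
   hence far: "ep' <= dst (c0 s) (c s)" using ep'(2) by simp
   have "continuous_on {0..1} c" by (rule mg_continuous[OF c(1) dst_nonneg])
   hence "continuous_on {0..s} (%s. dst (c0 s) (c s))"
    using s continuous_on_subset[of "{0..1}" _ "{0..s}"] cont0 by (intro continuous_intros) auto
   then obtain s' where s': "0 <= s'" "s' <= s" "dst (c0 s') (c s') = ep'"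
    using IVT'[of "%s. dst (c0 s) (c s)" 0 ep' s] far s c(2) c0(2) ep'(1) by auto
   have "c s' : K" using eK(3)[of "c0 s'" "c s'"] s' s ep'(3) by auto
   hence "(s', c s') : KK" unfolding KK_def using s' s by auto
   hence big: "et <= ph (s', c s')" by (rule et(2))
   define E where "E = dst p q - D"
   have E: "abs(E) < et / 4" using dst_triangle[of p q q0] dst_triangle[of p q0 q] V(3)[OF q] unfolding D_def E_def abs_less_iff by linarith
   have "dst p (c s') = dst p q * s'" "dst (c s') q = dst p q * (1 - s')"
    using mgD[OF c(1), of 0 s'] mgD[OF c(1), of s' 1] c(2,3) s' s by auto
   hence 1: "dst p (c s') - s' * D = s' * E" "dst (c s') q - (1 - s') * D = (1 - s') * E" unfolding E_def by (simp_all add: algebra_simps)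
   have s'1: "abs(s') <= 1" "abs(1 - s') <= 1" using s' s by auto
   have le: "abs(s' * E) <= abs(E)" "abs((1 - s') * E) <= abs(E)"
    using mult_right_mono[OF s'1(1), of "abs(E)"] mult_right_mono[OF s'1(2), of "abs(E)"] by (auto simp: abs_mult)
   have "abs(dst (c s') q0 - dst (c s') q) < et / 4"
    using dst_triangle[of "c s'" q0 q] dst_triangle[of "c s'" q q0] V(3)[OF q] unfolding abs_less_iff by linarith
   moreover have "abs(dst (c s') q0 - (1 - s') * D) <= abs(dst (c s') q0 - dst (c s') q) + abs(dst (c s') q - (1 - s') * D)"
    using abs_triangle_ineq[of "dst (c s') q0 - dst (c s') q" "dst (c s') q - (1 - s') * D"] by simp
   ultimately have "abs(s' * E) + abs(dst (c s') q0 - (1 - s') * D) < et" using le E unfolding 1(2) by linarith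
   hence "ph (s', c s') < et" unfolding ph_def using 1(1) by simp
   thus False using big by simp
  qed
 qed
qed

end

section \<open>Curvature and second variation on Berwald manifolds\<close>

lemma linear_zero_axis:
 fixes f :: "real ^ 'n::finite => 'b::real_vector"
 assumes "linear f" "!!i. f (axis i 1) = 0"
 shows "f v = 0"
 using linear_eq_axis[OF assms(1) linear_zero, of v] assms(2) by simp

lemma sum_swap4: "(SUM s:S. SUM a:A. SUM b:B. SUM c:C. f s a b c) = (SUM a:A. SUM b:B. SUM c:C. SUM s:S. f s a b c)"
 by (subst sum.swap, rule sum.cong[OF refl], subst sum.swap, rule sum.cong[OF refl], rule sum.swap)

context finsler_dom begin

text \<open>\<open>Gam\<close> with the point of the tangent bundle as last argument, in the form
  that \<open>dird\<close> expects; \<open>dG\<close> is its x-derivative.\<close>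

definition Gz :: "real ^ 'n => real ^ 'n => (real ^ 'n) \<times> (real ^ 'n) => real ^ 'n" where
 "Gz a b z = Gam (fst z) (snd z) a b"

definition dG :: "(real ^ 'n) \<times> (real ^ 'n) => real ^ 'n => real ^ 'n => real ^ 'n => real ^ 'n" where
 "dG z ze a b = dird (ze, 0) (Gz a b) z"

lemma smooth_Gz: "smooth_on Z (Gz a b)"
 using smooth_Gam[of a b] unfolding Gz_def .

lemma Gz_simps: "Gz a (b + b') z = Gz a b z + Gz a b' z" "Gz (a + a') b z = Gz a b z + Gz a' b z"
 "Gz a (s *r b) z = s *r Gz a b z" "Gz (s *r a) b z = s *r Gz a b z" "Gz 0 b z = 0" "Gz a 0 z = 0"
 unfolding Gz_def
 by (rule linear_add[OF Gam_linear2] linear_add[OF Gam_linear1] linear_scale[OF Gam_linear2] linear_scale[OF Gam_linear1]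
   linear_0[OF Gam_linear1] linear_0[OF Gam_linear2])+

lemma Gz_sym: "z : Z ==> Gz a b z = Gz b a z"
 unfolding Gz_def using Gam_sym[of "fst z" "snd z"] by simp

lemma dird_Gz_linear:
 assumes z: "z : Z"
 shows "linear (%a. dird u (Gz a b) z)" "linear (%b. dird u (Gz a b) z)"
proof -
 note d = smooth_on_has_derivative[OF smooth_Gz z]
 show "linear (%a. dird u (Gz a b) z)"
 proof (rule linearI)
  fix a a' s
  have "Gz (a + a') b = (%z. Gz a b z + Gz a' b z)" "Gz (s *r a) b = (%z. s *r Gz a b z)" by (auto simp: Gz_simps)
  thus "dird u (Gz (a + a') b) z = dird u (Gz a b) z + dird u (Gz a' b) z" "dird u (Gz (s *r a) b) z = s *r dird u (Gz a b) z"
   using dird_eqI[OF has_derivative_add[OF d[of a b] d[of a' b]]] dird_eqI[OF has_derivative_scaleR_right[OF d[of a b]]] by simp_all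
 qed
 show "linear (%b. dird u (Gz a b) z)"
 proof (rule linearI)
  fix b b' s
  have "Gz a (b + b') = (%z. Gz a b z + Gz a b' z)" "Gz a (s *r b) = (%z. s *r Gz a b z)" by (auto simp: Gz_simps)
  thus "dird u (Gz a (b + b')) z = dird u (Gz a b) z + dird u (Gz a b') z" "dird u (Gz a (s *r b)) z = s *r dird u (Gz a b) z"
   using dird_eqI[OF has_derivative_add[OF d[of a b] d[of a b']]] dird_eqI[OF has_derivative_scaleR_right[OF d[of a b]]] by simp_all
 qed
qed

lemma dG_linear:
 assumes z: "z : Z"
 shows "linear (%ze. dG z ze a b)" "linear (%a. dG z ze a b)" "linear (%b. dG z ze a b)"
 unfolding dG_def using dird_Gz_linear[OF z] linear_compose[OF lin_fst dird_linear[OF smooth_Gz z]] by (simp_all add: o_def)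

lemma dG_sym: "z : Z ==> dG z ze a b = dG z ze b a"
 unfolding dG_def by (rule dird_cong[OF open_Z _ smooth_Gz Gz_sym])

lemma line_in_Z:
 fixes u :: "(real ^ 'n) \<times> (real ^ 'n)"
 assumes z: "z : Z"
 defines "I == {t. z + t *r u : Z}"
 shows "0 : I" "at 0 within I = at (0::real)"
proof -
 show 0: "0 : I" unfolding I_def using z by simp
 have "open ((%t::real. z + t *r u) -` Z)" by (rule open_vimage[OF open_Z]) (intro continuous_intros)
 hence "open I" unfolding I_def vimage_def .
 from at_within_open[OF 0 this] show "at 0 within I = at (0::real)" .
qed

lemma dird_E_Gz_derivative:
 assumes z: "z : Z"
 shows "((%t. dird (0, Gz xi (snd (z + t *r u)) (z + t *r u)) E (z + t *r u)) has_vector_derivative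
   dird (0, dird u (Gz xi (snd z)) z + Gz xi (snd u) z) E z + dird u (dird (0, Gz xi (snd z) z) E) z) (at 0)"
proof -
 define I where "I = {t. z + t *r u : Z}"
 have I: "0 : I" "at 0 within I = at (0::real)" using line_in_Z[OF z, of u] unfolding I_def by auto
 have dz: "((%t. z + t *r u) hvd u) (at 0 within I)" by (auto intro!: derivative_eq_intros)
 have dl: "((%t. Gz xi a (z + t *r u)) hvd dird u (Gz xi a) z) (at 0)" for a
  by (rule line_derivative) (use smooth_on_has_derivative[OF smooth_Gz z] in simp)
 have id: "((%t. t) has_real_derivative 1) (at (0::real))" by (rule DERIV_ident)
 have "((%t. Gz xi (snd z) (z + t *r u) + t *r Gz xi (snd u) (z + t *r u)) has_vector_derivative
   dird u (Gz xi (snd z)) z + (0 *r dird u (Gz xi (snd u)) z + 1 *r Gz xi (snd u) (z + 0 *r u))) (at 0)"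
  by (rule has_vector_derivative_add[OF dl has_vector_derivative_scaleR[OF id dl]])
 hence "((%t. Gz xi (snd (z + t *r u)) (z + t *r u)) hvd dird u (Gz xi (snd z)) z + Gz xi (snd u) z) (at 0)"
  by (simp add: Gz_simps)
 hence h: "((%t. (0::real ^ 'n, Gz xi (snd (z + t *r u)) (z + t *r u))) hvd (0, dird u (Gz xi (snd z)) z + Gz xi (snd u) z)) (at 0 within I)"
  unfolding I(2) by (intro has_vector_derivative_Pair' has_vector_derivative_const)
 have zS: "z + s *r u : Z" if "s : I" for s using that by (simp add: I_def)
 from dird_var_derivative[OF smooth_E open_Z _ dz h zS I(1)]
 show ?thesis using z unfolding I(2) by simp
qed

text \<open>The identity \<open>dird_x_E\<close> holds on an open set and may be differentiated in
  any direction. This expresses all second derivatives of the energy through \<open>g\<close>, the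
  momentum and the connection.\<close>

lemma dird_dird_x_E:
 assumes z: "z : Z"
 shows "dird u (dird (xi, 0) E) z = dird (0, dird u (Gz xi (snd z)) z + Gz xi (snd u) z) E z + dird u (dird (0, Gz xi (snd z) z) E) z"
proof -
 define I where "I = {t. z + t *r u : Z}"
 have I: "0 : I" "at 0 within I = at (0::real)" using line_in_Z[OF z, of u] unfolding I_def by auto
 have "dird (xi, 0) E z' = dird (0, Gz xi (snd z') z') E z'" if "z' : Z" for z'
  using dird_x_E[of "fst z'" "snd z'" xi] that unfolding Gz_def by simp
 hence e: "dird (0, Gz xi (snd (z + t *r u)) (z + t *r u)) E (z + t *r u) = dird (xi, 0) E (z + t *r u)" if "t : I" for t
  using that unfolding I_def by simp
 have "((%t. dird (xi, 0) E (z + t *r u)) has_vector_derivative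
   dird (0, dird u (Gz xi (snd z)) z + Gz xi (snd u) z) E z + dird u (dird (0, Gz xi (snd z) z) E) z) (at 0 within I)"
  by (rule has_vector_derivative_transform[OF I(1) e[symmetric]]) (use dird_E_Gz_derivative[OF z, of xi u] I(2) in auto)
 moreover have "((%t. dird (xi, 0) E (z + t *r u)) hvd dird u (dird (xi, 0) E) z) (at 0 within I)"
  unfolding I(2) by (rule line_derivative) (use smooth_on_has_derivative[OF smooth_E1 z] in simp)
 ultimately show ?thesis unfolding I(2) by (rule vector_derivative_unique_at[symmetric])
qed

end

section \<open>Curvature in a Berwald chart\<close>

locale berwald_dom = finsler_dom U F for U :: "(real ^ 'n::finite) set" and F +
 fixes k :: real
 assumes berw: "x : U ==> y ~= 0 ==> pdy s (chern F i j l) x y = 0"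
  and curv: "x : U ==> y ~= 0 ==> V ~: span {y} ==> flag_curv F x y V <= k"
begin

lemma dird_y_Gz:
 assumes z: "z : Z"
 shows "dird (0, et) (Gz a b) z = 0"
proof -
 have 1: "dird (0, axis s 1) (Gz (axis j 1) (axis l 1)) z = 0" for s j l
 proof -
  have "dird (0, axis s 1) (Gz (axis j 1) (axis l 1)) z $ i = 0" for i
  proof -
   obtain x y where xy: "z = (x, y)" "(x, y) : Z" using z by (cases z) auto
   have "pdy s (chern F i j l) x y = dird (0, axis s 1) (%z. Gz (axis j 1) (axis l 1) z $ i) (x, y)"
    by (rule pdy_eq[OF xy(2) smooth_on_component[OF open_Z smooth_Gz]]) (simp add: Gz_def chern_Gv(2))
   thus ?thesis using berw[of x y s i j l] xy dird_component[OF smooth_Gz z, of "(0, axis s 1)"] unfolding Z_iff by simp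
  qed
  thus ?thesis by (simp add: vec_eq_iff)
 qed
 have "dird (0, et) (Gz (axis j 1) (axis l 1)) z = 0" for j l
  by (rule linear_zero_axis[OF linear_compose[OF lin_snd dird_linear[OF smooth_Gz z], unfolded o_def] 1])
 hence "dird (0, et) (Gz a (axis l 1)) z = 0" for l by (rule linear_zero_axis[OF dird_Gz_linear(1)[OF z]])
 thus ?thesis by (rule linear_zero_axis[OF dird_Gz_linear(2)[OF z]])
qed

lemma dird_Gz: "z : Z ==> dird (xi, et) (Gz a b) z = dG z xi a b"
 using dird_simps(1)[OF smooth_Gz, of z "(xi, 0)" "(0, et)"] dird_y_Gz unfolding dG_def by simp

text \<open>In dimension 1 the punctured fibre is disconnected, so independence of the velocity is
  claimed only along segments that avoid 0.\<close>

lemma Gz_segment: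
 assumes x: "x : U" and y: "!!t. t : {0..1} ==> y + t *r v ~= 0"
 shows "Gz a b (x, y + v) = Gz a b (x, y)"
proof -
 have "((%t. Gz a b ((x, y) + t *r (0, v))) hvd 0) (at t within {0..1})" if t: "t : {0..1}" for t
 proof -
  have zt: "(x, y) + t *r (0, v) : Z" using x y[OF t] by (simp add: Z_iff)
  show ?thesis
   by (rule has_vector_derivative_at_within) (use line_derivative[OF smooth_on_has_derivative[OF smooth_Gz zt]] dird_y_Gz[OF zt] in simp)
 qed
 then obtain c where "!!t. t : {0..1} ==> Gz a b ((x, y) + t *r (0, v)) = c"
  using has_vector_derivative_zero_constant[OF convex_real_interval(5)] by blast
 from this[of 0] this[of 1] show ?thesis by simp
qed

lemma dG_segment:
 assumes x: "x : U" and y: "!!t. t : {0..1} ==> y + t *r v ~= 0"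
 shows "dG (x, y + v) ze a b = dG (x, y) ze a b"
proof -
 have zy: "(x, y) : Z" "(x, y + v) : Z" using x y[of 0] y[of 1] by (simp_all add: Z_iff)
 define I where "I = {t. (x, y) + t *r (ze, 0) : Z}"
 have I: "0 : I" "at 0 within I = at (0::real)" using line_in_Z[OF zy(1), of "(ze, 0)"] unfolding I_def by auto
 have 1: "((%t. Gz a b ((x, y) + t *r (ze, 0))) hvd dG (x, y) ze a b) (at 0 within I)"
  unfolding I(2) dG_def by (rule line_derivative) (use smooth_on_has_derivative[OF smooth_Gz zy(1)] in simp)
 have "((%t. Gz a b ((x, y + v) + t *r (ze, 0))) hvd dG (x, y + v) ze a b) (at 0 within I)"
  unfolding I(2) dG_def by (rule line_derivative) (use smooth_on_has_derivative[OF smooth_Gz zy(2)] in simp)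
 hence "((%t. Gz a b ((x, y) + t *r (ze, 0))) hvd dG (x, y + v) ze a b) (at 0 within I)"
  by (rule has_vector_derivative_transform[OF I(1), rotated]) (use Gz_segment[OF _ y] in "simp add: I_def Z_iff")
 thus ?thesis using 1 unfolding I(2) by (rule vector_derivative_unique_at)
qed

lemma E_xy:
 assumes z: "(x, y) : Z"
 shows "dird (0, w) (dird (xi, 0) E) (x, y) = dird (0, Gz xi w (x, y)) E (x, y) + g (x, y) w (Gz xi y (x, y))"
 using dird_dird_x_E[OF z, of "(0, w)" xi] dird_y_Gz[OF z] unfolding g_def by simp

lemma E_xx:
 assumes z: "(x, y) : Z"
 shows "dird (et, 0) (dird (xi, 0) E) (x, y) = dird (0, dG (x, y) et xi y + Gz et (Gz xi y (x, y)) (x, y)) E (x, y)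
   + g (x, y) (Gz xi y (x, y)) (Gz et y (x, y))"
proof -
 have "dird (et, 0) (dird (xi, 0) E) (x, y) = dird (0, dG (x, y) et xi y) E (x, y) + dird (et, 0) (dird (0, Gz xi y (x, y)) E) (x, y)"
  using dird_dird_x_E[OF z, of "(et, 0)" xi] by (simp add: dG_def Gz_simps)
 also have "dird (et, 0) (dird (0, Gz xi y (x, y)) E) (x, y) = dird (0, Gz xi y (x, y)) (dird (et, 0) E) (x, y)"
  by (rule dird_commute[OF smooth_E open_Z z])
 also have "... = dird (0, Gz et (Gz xi y (x, y)) (x, y)) E (x, y) + g (x, y) (Gz xi y (x, y)) (Gz et y (x, y))" by (rule E_xy[OF z])
 finally show ?thesis
  using dird_simps(1)[OF smooth_E z, of "(0, dG (x, y) et xi y)" "(0, Gz et (Gz xi y (x, y)) (x, y))"] by simp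
qed

text \<open>The curvature R(a,b)v of the linear connection on the base.\<close>

definition Rc :: "(real ^ 'n) \<times> (real ^ 'n) => real ^ 'n => real ^ 'n => real ^ 'n => real ^ 'n" where
 "Rc z a b v = dG z a b v - dG z b a v + Gz a (Gz b v z) z - Gz b (Gz a v z) z"

lemma linear_Gz: "linear (%a. Gz a b z)" "linear (%b. Gz a b z)" by (rule linearI; simp add: Gz_simps)+

lemma Rc_linear:
 assumes z: "z : Z"
 shows "linear (%a. Rc z a b v)" "linear (%b. Rc z a b v)" "linear (%v. Rc z a b v)"
 unfolding Rc_def
 by (intro linear_compose_add linear_compose_sub dG_linear[OF z] linear_Gz
   linear_compose[OF linear_Gz(1) linear_Gz(2), unfolded o_def] linear_compose[OF linear_Gz(2) linear_Gz(2), unfolded o_def])+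

text \<open>Curvature annihilates the energy, because the x-derivatives of \<open>E\<close> commute
  in \<open>E_xx\<close>.\<close>

lemma p_Rc_y:
 assumes z: "(x, y) : Z"
 shows "dird (0, Rc (x, y) a b y) E (x, y) = 0"
proof -
 have "dird (a, 0) (dird (b, 0) E) (x, y) = dird (b, 0) (dird (a, 0) E) (x, y)"
  by (rule dird_commute[OF smooth_E open_Z z])
 hence "dird (0, dG (x, y) a b y + Gz a (Gz b y (x, y)) (x, y)) E (x, y) = dird (0, dG (x, y) b a y + Gz b (Gz a y (x, y)) (x, y)) E (x, y)"
  unfolding E_xx[OF z] using g_symm[OF z] by simp
 hence "dird ((0, dG (x, y) a b y + Gz a (Gz b y (x, y)) (x, y)) - (0, dG (x, y) b a y + Gz b (Gz a y (x, y)) (x, y))) E (x, y) = 0"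
  unfolding dird_simps(4)[OF smooth_E z] by simp
 thus ?thesis unfolding Rc_def by (simp add: algebra_simps)
qed

text \<open>The y-derivative of \<open>p_Rc_y\<close> in direction \<open>v\<close>. It replaces the
  skew symmetry of the Riemannian curvature tensor.\<close>

lemma p_Rc:
 assumes z: "(x, y) : Z"
 shows "dird (0, Rc (x, y) a b v) E (x, y) = - g (x, y) v (Rc (x, y) a b y)"
proof -
 let ?z = "(x, y)"
 have xy: "x : U" "y ~= 0" using z by (auto simp: Z_iff)
 define m where "m = norm v + 1"
 have nv: "m > 0" using norm_ge_zero[of v] unfolding m_def by linarith
 define d where "d = norm y / (2 * m)"
 have d: "d > 0" unfolding d_def using xy nv by simp
 have dv: "d * norm v < norm y"
 proof -
  have "d * norm v <= d * m" using d by (simp add: m_def)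
  also have "... = norm y / 2" using nv unfolding d_def by simp
  also have "... < norm y" using xy by simp
  finally show ?thesis .
 qed
 have seg: "y + t *r (s *r v) ~= 0" if "t : {0..1}" "abs(s) < d" for t s
 proof
  assume "y + t *r (s *r v) = 0"
  hence "norm y = abs(t) * (abs(s) * norm v)" by (metis add_eq_0_iff norm_minus_cancel norm_scaleR)
  also have "... <= 1 * (d * norm v)" using that by (intro mult_mono) auto
  finally show False using dv by simp
 qed
 define I where "I = ball (0::real) d"
 have I: "0 : I" "at 0 within I = at (0::real)" using d at_within_open[of 0 "ball (0::real) d"] by (simp_all add: I_def)
 have zI: "?z + s *r (0, v) : Z" if "s : I" for s using seg[of 1 s] that xy by (simp add: I_def Z_iff)
 \<comment> \<open>For |s| < d the segment from \<open>y\<close> to y + s v avoids 0, so the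
   curvature at the moved velocity is that at \<open>y\<close> and only the argument of the momentum
   moves.\<close>
 have "Rc ?z a b (y + s *r v) = Rc (x, y + s *r v) a b (y + s *r v)" if "s : I" for s
  unfolding Rc_def using Gz_segment[OF xy(1), of y "s *r v"] dG_segment[OF xy(1), of y "s *r v"] seg that by (simp add: I_def)
 hence zero: "dird (0, Rc ?z a b (y + s *r v)) E (?z + s *r (0, v)) = 0" if "s : I" for s
  using p_Rc_y[of x "y + s *r v" a b] zI[OF that] that by simp
 have dz: "((%s. ?z + s *r (0, v)) hvd (0, v)) (at 0 within I)" by (auto intro!: derivative_eq_intros)
 have "((%s. Rc ?z a b (y + s *r v)) hvd Rc ?z a b v) (at 0 within I)"
  using linear_add[OF Rc_linear(3)[OF z]] linear_scale[OF Rc_linear(3)[OF z]] by (auto intro!: derivative_eq_intros)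
 hence dh: "((%s. (0::real ^ 'n, Rc ?z a b (y + s *r v))) hvd (0, Rc ?z a b v)) (at 0 within I)"
  by (intro has_vector_derivative_Pair' has_vector_derivative_const)
 have "((%s. dird (0, Rc ?z a b (y + s *r v)) E (?z + s *r (0, v))) has_vector_derivative
   dird (0, Rc ?z a b v) E ?z + dird (0, v) (dird (0, Rc ?z a b y) E) ?z) (at 0 within I)"
  using dird_var_derivative[OF smooth_E open_Z _ dz dh zI I(1)] z by simp
 hence "((%s. 0) hvd dird (0, Rc ?z a b v) E ?z + dird (0, v) (dird (0, Rc ?z a b y) E) ?z) (at 0 within I)"
  by (rule has_vector_derivative_transform[OF I(1), rotated]) (use zero in simp)
 hence "dird (0, Rc ?z a b v) E ?z + dird (0, v) (dird (0, Rc ?z a b y) E) ?z = 0"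
  unfolding I(2) using vector_derivative_unique_at[OF has_vector_derivative_const] by metis
 thus ?thesis unfolding g_def by simp
qed

text \<open>In the horizontal derivative the vertical part vanishes by the Berwald
  condition.\<close>

lemma hh_curv_Rc:
 assumes z: "(x, y) : Z"
 shows "hh_curv F i j p q x y = Rc (x, y) (axis p 1) (axis q 1) (axis j 1) $ i"
proof -
 let ?z = "(x, y)"
 have ch: "chern F i j l x y = Gz (axis j 1) (axis l 1) ?z $ i" for i j l using chern_Gv(2)[OF z] by (simp add: Gz_def)
 have hd: "hder F p (chern F i j l) x y = dG ?z (axis p 1) (axis j 1) (axis l 1) $ i" for p l
 proof -
  have "pdx p (chern F i j l) x y = dird (axis p 1, 0) (%z. Gz (axis j 1) (axis l 1) z $ i) (x, y)"
   by (rule pdx_eq[OF z smooth_on_component[OF open_Z smooth_Gz]]) (simp add: Gz_def chern_Gv(2))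
  also have "... = dG ?z (axis p 1) (axis j 1) (axis l 1) $ i" unfolding dG_def by (rule dird_component[OF smooth_Gz z])
  finally show ?thesis unfolding hder_def using berw[of x y] z by (simp add: Z_iff)
 qed
 have "(SUM h:UNIV. chern F i h p x y * chern F h j q x y) = Gz (axis p 1) (Gz (axis q 1) (axis j 1) ?z) ?z $ i" for p q
 proof -
  have l: "linear (%v. Gz v (axis p 1) ?z $ i)"
   using linear_compose[OF linear_Gz(1) bounded_linear.linear[OF bounded_linear_vec_nth]] by (simp add: o_def)
  have "Gz (Gz (axis j 1) (axis q 1) ?z) (axis p 1) ?z $ i = (SUM h:UNIV. Gz (axis j 1) (axis q 1) ?z $ h * Gz (axis h 1) (axis p 1) ?z $ i)"
   by (rule linear_axis_sum[OF l])
  thus ?thesis unfolding ch using Gz_sym[OF z] by (simp add: mult.commute)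
 qed
 thus ?thesis unfolding hh_curv_def hd Rc_def sum_subtractf
  using dG_sym[OF z, of _ "axis j 1"] by simp
qed

lemma g_axis_sum:
 assumes z: "z : Z"
 shows "g z a b = (SUM i:UNIV. SUM j:UNIV. a $ i * b $ j * g z (axis i 1) (axis j 1))"
 by (subst linear_axis_sum[OF g_linear1[OF z]], subst linear_axis_sum[OF g_linear2[OF z]]) (simp add: sum_distrib_left mult_ac)

lemma flag_curv_Rc:
 assumes z: "(x, y) : Z"
 shows "flag_curv F x y V = g (x, y) V (Rc (x, y) V y y) / (g (x, y) y y * g (x, y) V V - (g (x, y) y V)\<^sup>2)"
proof -
 let ?z = "(x, y)"
 have l: "linear (%v. Rc ?z v b c $ s)" "linear (%v. Rc ?z b v c $ s)" "linear (%v. Rc ?z b c v $ s)" for b c s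
  using linear_compose[OF Rc_linear(1)[OF z] bounded_linear.linear[OF bounded_linear_vec_nth]]
   linear_compose[OF Rc_linear(2)[OF z] bounded_linear.linear[OF bounded_linear_vec_nth]]
   linear_compose[OF Rc_linear(3)[OF z] bounded_linear.linear[OF bounded_linear_vec_nth]] by (simp_all add: o_def)
 have R: "Rc ?z V y y $ s = (SUM j:UNIV. SUM p:UNIV. SUM q:UNIV. y $ j * (V $ p * (y $ q * Rc ?z (axis p 1) (axis q 1) (axis j 1) $ s)))" for s
  by (subst linear_axis_sum[OF l(3)], subst linear_axis_sum[OF l(1)], subst linear_axis_sum[OF l(2)]) (simp add: sum_distrib_left)
 have "g ?z V (Rc ?z V y y) = (SUM i:UNIV. SUM s:UNIV. V $ i * Rc ?z V y y $ s * g ?z (axis i 1) (axis s 1))" by (rule g_axis_sum[OF z])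
 also have "... = (SUM i:UNIV. SUM s:UNIV. SUM j:UNIV. SUM p:UNIV. SUM q:UNIV. V $ i * y $ j * (g ?z (axis i 1) (axis s 1) * Rc ?z (axis p 1) (axis q 1) (axis j 1) $ s) * y $ q * V $ p)"
  unfolding R sum_distrib_left sum_distrib_right by (simp only: mult_ac)
 also have "... = (SUM i:UNIV. SUM j:UNIV. SUM p:UNIV. SUM q:UNIV. SUM s:UNIV. V $ i * y $ j * (g ?z (axis i 1) (axis s 1) * Rc ?z (axis p 1) (axis q 1) (axis j 1) $ s) * y $ q * V $ p)"
  by (rule sum.cong[OF refl], rule sum_swap4)
 also have "... = (SUM i:UNIV. SUM j:UNIV. SUM p:UNIV. SUM q:UNIV. V $ i * y $ j * hh_curv_low F j i p q x y * y $ q * V $ p)"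
  unfolding hh_curv_low_def hh_curv_Rc[OF z] fund_tensor_eq[OF z] sum_distrib_left sum_distrib_right ..
 finally show ?thesis unfolding flag_curv_def fund_form_eq[OF z] by simp
qed

lemma g_cauchy_schwarz:
 assumes z: "z : Z" and a: "a ~= 0"
 shows "(g z a b)\<^sup>2 <= g z a a * g z b b" "b ~: span {a} ==> (g z a b)\<^sup>2 < g z a a * g z b b"
proof -
 have p: "g z a a > 0" using g_posdef[of "fst z" "snd z"] z a by simp
 define s where "s = g z a b / g z a a"
 have "g z (b - s *r a) (b - s *r a) = g z b b - s * g z a b - s * (g z a b - s * g z a a)"
  using g_symm[OF z, of b a]
  by (simp add: linear_diff[OF g_linear1[OF z]] linear_scale[OF g_linear1[OF z]] linear_diff[OF g_linear2[OF z]] linear_scale[OF g_linear2[OF z]])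
 also have "g z a b - s * g z a a = 0" using p by (simp add: s_def)
 finally have e: "g z a a * g z (b - s *r a) (b - s *r a) = g z a a * g z b b - (g z a b)\<^sup>2"
  using p by (simp add: s_def field_simps power2_eq_square)
 have pos: "v ~= 0 ==> g z v v > 0" for v using g_posdef[of "fst z" "snd z"] z by simp
 have nn: "0 <= g z v v" for v using pos[of v] linear_0[OF g_linear1[OF z]] by (cases "v = 0") auto
 thus "(g z a b)\<^sup>2 <= g z a a * g z b b" using e p mult_nonneg_nonneg[of "g z a a" "g z (b - s *r a) (b - s *r a)"] by simp
 assume "b ~: span {a}"
 hence "b - s *r a ~= 0" by (metis eq_iff_diff_eq_0 insertI1 span_base span_scale)
 from mult_pos_pos[OF p pos[OF this]] show "(g z a b)\<^sup>2 < g z a a * g z b b" unfolding e by simp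
qed

text \<open>For V parallel to y the curvature term is 0. Otherwise the flag curvature bound applies;
  \<open>max k 0\<close> permits dropping g(y,V)^2 from the area factor.\<close>

lemma Rc_bound:
 assumes z: "(x, y) : Z"
 shows "g (x, y) V (Rc (x, y) V y y) <= max k 0 * (2 * E (x, y)) * g (x, y) V V"
proof -
 let ?z = "(x, y)"
 have y: "y ~= 0" and xU: "x : U" using z by (auto simp: Z_iff)
 have gnn: "0 <= g ?z V V" using g_posdef[OF z, of V] linear_0[OF g_linear1[OF z]] by (cases "V = 0") auto
 have nn: "0 <= max k 0 * (2 * E ?z) * g ?z V V" using gnn E_nonneg[of ?z] by simp
 show ?thesis
 proof (cases "V : span {y}")
  case True
  then obtain s where V: "V = s *r y" by (auto simp: span_singleton)
  have "Rc ?z V y y = 0"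
   using linear_scale[OF Rc_linear(1)[OF z], of s y y y] unfolding V by (simp add: Rc_def)
  thus ?thesis using nn linear_0[OF g_linear2[OF z]] by simp
 next
  case False
  define D where "D = g ?z y y * g ?z V V - (g ?z y V)\<^sup>2"
  have D: "0 < D" using g_cauchy_schwarz(2)[OF z y False] by (simp add: D_def)
  have "flag_curv F x y V <= k" by (rule curv[OF xU y False])
  hence "g ?z V (Rc ?z V y y) <= k * D" unfolding flag_curv_Rc[OF z] D_def[symmetric] using D by (simp add: divide_le_eq)
  also have "... <= max k 0 * D" using D by (intro mult_right_mono) auto
  also have "... <= max k 0 * (g ?z y y * g ?z V V)" unfolding D_def by (intro mult_left_mono) auto
  finally show ?thesis using g_yy[OF z] by (simp add: mult.assoc)
 qed
qed

end

section \<open>The index form along a geodesic\<close>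

lemma bilinear_axis_sum:
 fixes be :: "real ^ 'n::finite => real ^ 'n => 'b::real_vector"
 assumes "!!b. linear (%a. be a b)" "!!a. linear (be a)"
 shows "be a b = (SUM i:UNIV. SUM j:UNIV. (a $ i * b $ j) *r be (axis i 1) (axis j 1))"
proof -
 have e: "x = (SUM i:UNIV. x $ i *r axis i 1)" for x :: "real ^ 'n"
  using basis_expansion[of x] by (simp add: scalar_mult_eq_scaleR)
 have "be a b = (SUM i:UNIV. a $ i *r be (axis i 1) b)"
  by (subst e[of a]) (simp add: linear_sum[OF assms(1)] linear_scale[OF assms(1)])
 also have "... = (SUM i:UNIV. a $ i *r (SUM j:UNIV. b $ j *r be (axis i 1) (axis j 1)))"
  by (subst e[of b]) (simp add: linear_sum[OF assms(2)] linear_scale[OF assms(2)])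
 finally show ?thesis by (simp add: scaleR_sum_right)
qed

lemma bilinear_var_derivative:
 fixes be :: "real => real ^ 'n::finite => real ^ 'n => 'b::real_normed_vector"
 assumes lin: "!!s b. s : I ==> linear (%a. be s a b)" "!!s a. s : I ==> linear (be s a)"
  and lin': "!!b. linear (%a. be' a b)" "!!a. linear (be' a)"
  and d: "!!a b. ((%s. be s a b) hvd be' a b) (at t within I)"
  and z: "(z hvd w) (at t within I)" and t: "t : I"
 shows "((%s. be s (z s) (z s)) hvd be' (z t) (z t) + be t (z t) w + be t w (z t)) (at t within I)"
proof -
 have zi: "((%s. z s $ i) has_real_derivative w $ i) (at t within I)" for i
  using bounded_linear.has_vector_derivative[OF bounded_linear_vec_nth z]
  unfolding has_real_derivative_iff_has_vector_derivative .
 have "((%s. SUM i:UNIV. SUM j:UNIV. (z s $ i * z s $ j) *r be s (axis i 1) (axis j 1)) has_vector_derivative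
  (SUM i:UNIV. SUM j:UNIV. (z t $ i * z t $ j) *r be' (axis i 1) (axis j 1) + (w $ i * z t $ j + w $ j * z t $ i) *r be t (axis i 1) (axis j 1))) (at t within I)"
  by (intro has_vector_derivative_sum has_vector_derivative_scaleR DERIV_mult zi d)
 moreover have "(SUM i:UNIV. SUM j:UNIV. (z t $ i * z t $ j) *r be' (axis i 1) (axis j 1) + (w $ i * z t $ j + w $ j * z t $ i) *r be t (axis i 1) (axis j 1))
  = be' (z t) (z t) + be t (z t) w + be t w (z t)"
  unfolding bilinear_axis_sum[OF lin', of "z t" "z t"] bilinear_axis_sum[OF lin[OF t], of "z t" w] bilinear_axis_sum[OF lin[OF t], of w "z t"]
  by (simp add: sum.distrib scaleR_left_distrib mult.commute algebra_simps)
 ultimately show ?thesis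
  by (intro has_vector_derivative_transform[OF t bilinear_axis_sum[OF lin]]) simp_all
qed

context berwald_dom begin

text \<open>The correction \<open>\<Gamma>(z,z)/2\<close> makes \<open>Bf\<close> independent of the chart up to \<open>o(|z|\<^sup>2)\<close>.\<close>

definition Bf :: "real => real ^ 'n => real ^ 'n => real ^ 'n => real" where
 "Bf h x y z = dird (0, z + (1 / 2) *r Gz z z (x, y)) E (x, y) + h / 2 * g (x, y) z z"

lemma p_linear:
 assumes z: "z : Z"
 shows "linear (%a. dird (0, a) E z)" "linear (%a. dird (a, 0) E z)"
 using linear_compose[OF lin_snd dird_linear[OF smooth_E z]] linear_compose[OF lin_fst dird_linear[OF smooth_E z]] by (simp_all add: o_def)

text \<open>The second derivative of the energy in direction (ze, w). Here \<open>D\<close> is the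
  covariant derivative of the variation field when w = ze', so g(D,D) minus the curvature term is
  the integrand of the index form. The momentum terms are the derivative of p(Gam(ze,ze)) along the
  geodesic, which explains the correction by half of it in \<open>Bf\<close>.\<close>

lemma index_form:
 fixes ze w :: "real ^ 'n"
 assumes z: "(x, y) : Z"
 defines "p == %a. dird (0, a) E (x, y)" and "D == w + Gz ze y (x, y)"
 shows "dird (ze, w) (dird (ze, w) E) (x, y) = g (x, y) D D + 2 * p (Gz ze w (x, y)) + p (dG (x, y) y ze ze + Gz y (Gz ze ze (x, y)) (x, y)) - g (x, y) ze (Rc (x, y) ze y y)"
proof -
 let ?z = "(x, y)"
 have lp: "linear p" unfolding p_def by (rule p_linear[OF z])
 have e: "(ze, w) = (ze, 0) + (0, w)" by simp
 have l2: "linear (%v. dird u (dird v E) ?z)" for u by (rule dird_linear2[OF open_Z smooth_E z])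
 have l1: "dird (a + b) (dird v E) ?z = dird a (dird v E) ?z + dird b (dird v E) ?z" for a b v
  by (rule dird_simps(1)[OF smooth_on_dird[OF smooth_E] z])
 have "dird (ze, w) (dird (ze, w) E) ?z = dird (ze, 0) (dird (ze, 0) E) ?z + dird (ze, 0) (dird (0, w) E) ?z
   + (dird (0, w) (dird (ze, 0) E) ?z + dird (0, w) (dird (0, w) E) ?z)"
  unfolding e l1 linear_add[OF l2] by simp
 also have "dird (ze, 0) (dird (0, w) E) ?z = dird (0, w) (dird (ze, 0) E) ?z" by (rule dird_commute[OF smooth_E open_Z z])
 also have "dird (0, w) (dird (ze, 0) E) ?z = p (Gz ze w ?z) + g ?z w (Gz ze y ?z)" unfolding p_def by (rule E_xy[OF z])
 also have "dird (ze, 0) (dird (ze, 0) E) ?z = p (dG ?z ze ze y + Gz ze (Gz ze y ?z) ?z) + g ?z (Gz ze y ?z) (Gz ze y ?z)"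
  unfolding p_def by (rule E_xx[OF z])
 also have "dird (0, w) (dird (0, w) E) ?z = g ?z w w" by (simp add: g_def)
 finally have 1: "dird (ze, w) (dird (ze, w) E) ?z = p (dG ?z ze ze y + Gz ze (Gz ze y ?z) ?z) + 2 * p (Gz ze w ?z)
   + (g ?z (Gz ze y ?z) (Gz ze y ?z) + 2 * g ?z w (Gz ze y ?z) + g ?z w w)" by simp
 have 2: "g ?z D D = g ?z (Gz ze y ?z) (Gz ze y ?z) + 2 * g ?z w (Gz ze y ?z) + g ?z w w"
  unfolding D_def linear_add[OF g_linear1[OF z]] linear_add[OF g_linear2[OF z]] using g_symm[OF z, of w "Gz ze y ?z"] by simp
 have "p (Rc ?z ze y ze) = - g ?z ze (Rc ?z ze y y)" unfolding p_def by (rule p_Rc[OF z])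
 moreover have "Rc ?z ze y ze = (dG ?z ze ze y + Gz ze (Gz ze y ?z) ?z) - (dG ?z y ze ze + Gz y (Gz ze ze ?z) ?z)"
  unfolding Rc_def using dG_sym[OF z, of ze y ze] Gz_sym[OF z, of y ze] by simp
 ultimately have "p (dG ?z ze ze y + Gz ze (Gz ze y ?z) ?z) = p (dG ?z y ze ze + Gz y (Gz ze ze ?z) ?z) - g ?z ze (Rc ?z ze y y)"
  using linear_diff[OF lp] by simp
 thus ?thesis using 1 2 by simp
qed

text \<open>Half the index form minus the derivative of (h/2) g(ze,ze) under the Riccati equation is
  the square of D - h ze plus a curvature defect; the latter is positive for k' > max k 0.\<close>

lemma index_form_lower:
 fixes ze w :: "real ^ 'n"
 assumes z: "(x, y) : Z"
 defines "p == %a. dird (0, a) E (x, y)" and "D == w + Gz ze y (x, y)"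
 shows "g (x, y) (D - h *r ze) (D - h *r ze) / 2 + (k' - max k 0) * E (x, y) * g (x, y) ze ze
   <= dird (ze, w) (dird (ze, w) E) (x, y) / 2 - p (dG (x, y) y ze ze + Gz y (Gz ze ze (x, y)) (x, y)) / 2 - p (Gz ze w (x, y))
    + (k' * (2 * E (x, y)) + h\<^sup>2) / 2 * g (x, y) ze ze - h * g (x, y) ze D"
proof -
 let ?z = "(x, y)"
 have 1: "g ?z (D - h *r ze) (D - h *r ze) = g ?z D D - 2 * h * g ?z ze D + h\<^sup>2 * g ?z ze ze"
  unfolding linear_diff[OF g_linear1[OF z]] linear_diff[OF g_linear2[OF z]] linear_scale[OF g_linear1[OF z]] linear_scale[OF g_linear2[OF z]]
  using g_symm[OF z, of D ze] by (simp add: algebra_simps power2_eq_square)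
 show ?thesis
  unfolding 1 index_form[OF z, of ze w, folded D_def] p_def using Rc_bound[OF z, of ze]
  by (simp add: algebra_simps add_divide_distrib diff_divide_distrib)
qed

text \<open>The second formula is compatibility along the geodesic: the reference velocity changes
  by - Q, and this cancels the Cartan term of \<open>compat\<close>.\<close>

lemma sol_Gz_derivative:
 assumes s: "sol I u T" and T: "!!s. s : I ==> T s ~= 0" and t: "t : I" and z: "(z hvd w) (at t within I)"
 shows "((%s. Gz (z s) (z s) (u s, T s)) hvd dG (u t, T t) (T t) (z t) (z t) + 2 *r Gz (z t) w (u t, T t)) (at t within I)"
  "((%s. g (u s, T s) (z s) (z s)) hvd 2 * g (u t, T t) (z t) (w + Gz (z t) (T t) (u t, T t))) (at t within I)"
proof -
 have zI: "(u s, T s) : Z" if "s : I" for s using solD(1)[OF s that] T[OF that] by (simp add: Z_iff)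
 have duT: "((%s. (u s, T s)) hvd (T t, - Q (u t) (T t))) (at t within I)"
  by (rule has_vector_derivative_Pair'[OF solD(2,3)[OF s t]])
 have "((%s. Gz a b (u s, T s)) hvd dG (u t, T t) (T t) a b) (at t within I)" for a b
  using chain_vec[OF duT smooth_on_has_derivative[OF smooth_Gz zI[OF t]]] dird_Gz[OF zI[OF t]] by simp
 from bilinear_var_derivative[OF linear_Gz dG_linear(2,3)[OF zI[OF t]] this z t]
 show "((%s. Gz (z s) (z s) (u s, T s)) hvd dG (u t, T t) (T t) (z t) (z t) + 2 *r Gz (z t) w (u t, T t)) (at t within I)"
  using Gz_sym[OF zI[OF t], of w "z t"] by (simp add: scaleR_2 add.assoc)
 let ?z = "(u t, T t)"
 define be' where "be' a b = g ?z (Gz a (T t) ?z) b + g ?z a (Gz b (T t) ?z)" for a b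
 have "((%s. g (u s, T s) a b) hvd be' a b) (at t within I)" for a b
 proof -
  have "dird (T t, - Q (u t) (T t)) (%z. g z a b) ?z = dird (T t, 0) (%z. g z a b) ?z + dird (0, - Q (u t) (T t)) (%z. g z a b) ?z"
   using dird_simps(1)[OF smooth_g zI[OF t], of "(T t, 0)" "(0, - Q (u t) (T t))"] by simp
  also have "dird (0, - Q (u t) (T t)) (%z. g z a b) ?z = - dird (0, Q (u t) (T t)) (%z. g z a b) ?z"
   using dird_simps(3)[OF smooth_g zI[OF t], of "(0, Q (u t) (T t))"] by simp
  also have "dird (T t, 0) (%z. g z a b) ?z = B ?z (T t) a b" unfolding B_def g_def ..
  also have "dird (0, Q (u t) (T t)) (%z. g z a b) ?z = C ?z (Q (u t) (T t)) a b" unfolding C_def g_def ..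
  finally have "dird (T t, - Q (u t) (T t)) (%z. g z a b) ?z = be' a b"
   using compat[OF zI[OF t], of "T t" a b] unfolding be'_def Gz_def Q_def by simp
  with chain_vec[OF duT smooth_on_has_derivative[OF smooth_g[of a b] zI[OF t]]] show ?thesis by simp
 qed
 moreover have "linear (%a. be' a b)" "linear (be' a)" for a b
  unfolding be'_def by (intro linear_compose_add g_linear1[OF zI[OF t]] g_linear2[OF zI[OF t]]
   linear_compose[OF linear_Gz(1) g_linear1[OF zI[OF t]], unfolded o_def] linear_compose[OF linear_Gz(1) g_linear2[OF zI[OF t]], unfolded o_def])+
 ultimately have "((%s. g (u s, T s) (z s) (z s)) hvd be' (z t) (z t) + g ?z (z t) w + g ?z w (z t)) (at t within I)"
  by (intro bilinear_var_derivative[OF _ _ _ _ _ z t] g_linear1 g_linear2 zI)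
 moreover have "be' (z t) (z t) + g ?z (z t) w + g ?z w (z t) = 2 * g ?z (z t) (w + Gz (z t) (T t) ?z)"
  unfolding be'_def linear_add[OF g_linear2[OF zI[OF t]]]
  using g_symm[OF zI[OF t], of w "z t"] g_symm[OF zI[OF t], of "Gz (z t) (T t) ?z" "z t"] by simp
 ultimately show "((%s. g (u s, T s) (z s) (z s)) hvd 2 * g ?z (z t) (w + Gz (z t) (T t) ?z)) (at t within I)"
  by simp
qed

text \<open>\<open>ba\<close> and \<open>bb\<close> collect the parts of the derivative of
  \<open>Bf\<close> that are bilinear in (z,z) and in (z,w), after the Riccati equation for
  \<open>h\<close> has been inserted.\<close>

definition ba :: "real => real => (real ^ 'n) \<times> (real ^ 'n) => real ^ 'n => real ^ 'n => real" where
 "ba k' h z a b = dird (0, dG z (snd z) a b + Gz (snd z) (Gz a b z) z) E z / 2 - (k' * (2 * E z) + h\<^sup>2) / 2 * g z a b + h * g z a (Gz b (snd z) z)"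
definition bb :: "real => (real ^ 'n) \<times> (real ^ 'n) => real ^ 'n => real ^ 'n => real" where
 "bb h z a b = dird (0, Gz a b z) E z + h * g z a b"

lemma Bf_derivative:
 assumes s: "sol I u T" and T: "!!s. s : I ==> T s ~= 0" and t: "t : I" and z: "(z hvd w) (at t within I)"
  and h: "(h has_real_derivative - (k' * (2 * E (u t, T t)) + (h t)\<^sup>2)) (at t within I)"
 shows "((%s. Bf (h s) (u s) (T s) (z s)) has_real_derivative
   dird (z t, w) E (u t, T t) + ba k' (h t) (u t, T t) (z t) (z t) + bb (h t) (u t, T t) (z t) w) (at t within I)"
proof -
 let ?z = "(u t, T t)"
 have zt: "?z : Z" using solD(1)[OF s t] T[OF t] by (simp add: Z_iff)
 let ?G = "Gz (z t) (z t) ?z"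
 note p = p_linear[OF zt]
 have dh: "((%s. z s + (1 / 2) *r Gz (z s) (z s) (u s, T s)) has_vector_derivative
   w + (1 / 2) *r (dG ?z (T t) (z t) (z t) + 2 *r Gz (z t) w ?z)) (at t within I)"
  by (intro has_vector_derivative_add z bounded_linear.has_vector_derivative[OF bounded_linear_scaleR_right] sol_Gz_derivative(1)[OF s T t])
 have 1: "((%s. dird (0, z s + (1 / 2) *r Gz (z s) (z s) (u s, T s)) E (u s, T s)) has_vector_derivative
   dird (0, w + (1 / 2) *r (dG ?z (T t) (z t) (z t) + 2 *r Gz (z t) w ?z)) E ?z + dird (z t + (1 / 2) *r ?G, 0) E ?z) (at t within I)"
  by (rule sol_momentum_derivative[OF s t T dh])
 have hh: "((%s. h s / 2) has_real_derivative - (k' * (2 * E ?z) + (h t)\<^sup>2) / 2) (at t within I)"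
  using DERIV_cdivide[OF h, of 2] by simp
 have 2: "((%s. h s / 2 * g (u s, T s) (z s) (z s)) has_vector_derivative
   h t / 2 * (2 * g ?z (z t) (w + Gz (z t) (T t) ?z)) + - (k' * (2 * E ?z) + (h t)\<^sup>2) / 2 * g ?z (z t) (z t)) (at t within I)"
  using has_vector_derivative_scaleR[OF hh sol_Gz_derivative(2)[OF s T t z]] by simp
 have e1: "dird (z t, w) E ?z = dird (0, w) E ?z + dird (z t, 0) E ?z"
  using dird_simps(1)[OF smooth_E zt, of "(z t, 0)" "(0, w)"] by simp
 have e2: "dird (?G, 0) E ?z = dird (0, Gz (T t) ?G ?z) E ?z"
  using dird_x_E[OF zt, of ?G] Gz_sym[OF zt, of ?G "T t"] unfolding Gz_def by simp
 have "dird (0, w + (1 / 2) *r (dG ?z (T t) (z t) (z t) + 2 *r Gz (z t) w ?z)) E ?z + dird (z t + (1 / 2) *r ?G, 0) E ?z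
   + (h t / 2 * (2 * g ?z (z t) (w + Gz (z t) (T t) ?z)) + - (k' * (2 * E ?z) + (h t)\<^sup>2) / 2 * g ?z (z t) (z t))
   = dird (z t, w) E ?z + ba k' (h t) ?z (z t) (z t) + bb (h t) ?z (z t) w"
  unfolding e1 ba_def bb_def linear_add[OF p(1)] linear_scale[OF p(1)] linear_add[OF p(2)] linear_scale[OF p(2)] e2 snd_conv linear_add[OF g_linear2[OF zt]]
  by (simp add: field_simps)
 with has_vector_derivative_add[OF 1 2] show ?thesis
  unfolding Bf_def has_real_derivative_iff_has_vector_derivative by simp
qed

lemma ba_linear: "z : Z ==> linear (%a. ba k' h z a b)" "z : Z ==> linear (ba k' h z a)"
 and bb_linear: "z : Z ==> linear (%a. bb h z a b)" "z : Z ==> linear (bb h z a)"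
proof -
 assume z: "z : Z"
 note ls = linear_add[OF p_linear(1)[OF z]] linear_scale[OF p_linear(1)[OF z]] linear_add[OF g_linear1[OF z]] linear_scale[OF g_linear1[OF z]]
  linear_add[OF g_linear2[OF z]] linear_scale[OF g_linear2[OF z]] linear_add[OF dG_linear(2)[OF z]] linear_scale[OF dG_linear(2)[OF z]]
  linear_add[OF dG_linear(3)[OF z]] linear_scale[OF dG_linear(3)[OF z]] Gz_simps
 show "linear (%a. ba k' h z a b)" "linear (ba k' h z a)" "linear (%a. bb h z a b)" "linear (bb h z a)"
  by (rule linearI; simp add: ba_def bb_def ls algebra_simps add_divide_distrib diff_divide_distrib)+
qed

lemma curve_bilinear_bound:
 fixes a b' :: real and be :: "real => real ^ 'n => real ^ 'n => real"
 assumes lin: "!!s b. s : {a..b'} ==> linear (%a. be s a b)" "!!s a'. s : {a..b'} ==> linear (be s a')"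
  and c: "!!i j. continuous_on {a..b'} (%s. be s (axis i 1) (axis j 1 :: real ^ 'n) :: real)"
 obtains M where "M >= 0" "!!s x y. s : {a..b'} ==> abs(be s x (y :: real ^ 'n)) <= M * norm (x :: real ^ 'n) * norm y"
proof (rule bilinear_bound[of "{a..b'}" be "%_. 1"])
 show "EX M>=0. ALL s:{a..b'}. abs(be s (axis i 1) (axis j 1)) <= M * 1" for i j
 proof (rule compact_image_bound[OF c[of i j] compact_Icc])
  fix M assume "M > 0" "!!x. x : {a..b'} ==> norm (be x (axis i 1) (axis j 1)) <= M"
  thus ?thesis by (intro exI[of _ M]) auto
 qed
 fix M assume "0 <= M" "!!z x y. z : {a..b'} ==> abs(be z x y) <= M * 1 * norm x * norm y"
 thus thesis by (intro that[of M]) simp_all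
qed (use lin in simp_all)

lemma g_lower:
 assumes "compact K" "K <= Z"
 obtains mu where "mu > 0" "!!z xi. z : K ==> mu * (norm xi)\<^sup>2 <= g z xi xi"
proof -
 define S where "S = K \<times> sphere (0 :: real ^ 'n) 1"
 have cS: "compact S" unfolding S_def by (intro compact_Times assms compact_sphere)
 have cont: "continuous_on S (%p. g (fst p) (snd p) (snd p))"
  unfolding g_def by (rule continuous_on_dird2[OF smooth_E open_Z]) (use assms in "auto simp: S_def intro!: continuous_intros")
 have pos: "0 < g z xi xi" if "z : K" "xi ~= 0" for z xi using g_posdef[of "fst z" "snd z" xi] that assms(2) by auto
 have "EX mu>0. ALL p:S. mu <= g (fst p) (snd p) (snd p)"
 proof (cases "S = {}")
  case False
  then obtain p where p: "p : S" "ALL q:S. g (fst p) (snd p) (snd p) <= g (fst q) (snd q) (snd q)"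
   using continuous_attains_inf[OF cS _ cont] by blast
  have "snd p ~= 0" "fst p : K" using p(1) by (auto simp: S_def)
  thus ?thesis using p(2) pos by blast
 qed (auto intro: exI[of _ 1])
 then obtain mu where mu: "mu > 0" "!!p. p : S ==> mu <= g (fst p) (snd p) (snd p)" by blast
 show thesis
 proof (rule that[OF mu(1)])
  fix z xi assume z: "z : K"
  hence zZ: "z : Z" using assms(2) by blast
  show "mu * (norm xi)\<^sup>2 <= g z xi xi"
  proof (cases "xi = 0")
   case False
   let ?e = "xi /\<^sub>R norm xi"
   have "mu <= g z ?e ?e" using mu(2)[of "(z, ?e)"] z False by (simp add: S_def)
   also have "g z ?e ?e = g z xi xi / (norm xi)\<^sup>2"
    by (simp add: linear_scale[OF g_linear1[OF zZ]] linear_scale[OF g_linear2[OF zZ]] power2_eq_square divide_inverse mult_ac)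
   finally show ?thesis using False by (simp add: le_divide_eq)
  qed (simp add: linear_0[OF g_linear1[OF zZ]])
 qed
qed

text \<open>For small \<open>(z,w)\<close> this is the strict index form inequality; for large \<open>w\<close> it follows from the convexity of \<open>E(x,-)\<close>.\<close>

lemma excess_nonneg:
 assumes K: "compact K" "convex K" "K <= U" and u: "sol {a..b} u T" "!!s. s : {a..b} ==> u s : K" "!!s. s : {a..b} ==> T s ~= 0"
  and h: "continuous_on {a..b} h" and k': "k' > max k 0"
 obtains ep where "ep > 0" "!!s z w. s : {a..b} ==> u s + z : K ==> norm z <= ep ==>
   E (u s, T s) + dird (z, w) E (u s, T s) + ba k' (h s) (u s, T s) z z + bb (h s) (u s, T s) z w <= E (u s + z, T s + w)"
proof (cases "a <= b")
 case False
 thus thesis by (intro that[of 1]) auto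
next
 case ab: True
 have zI: "(u s, T s) : Z" if "s : {a..b}" for s using solD(1)[OF u(1) that] u(3)[OF that] by (simp add: Z_iff)
 have cu: "continuous_on {a..b} u" "continuous_on {a..b} T" using sol_continuous[OF u(1)] .
 have cuT: "continuous_on {a..b} (%s. (u s, T s))" by (intro continuous_intros cu)
 have imZ: "(%s. (u s, T s)) ` {a..b} <= Z" using zI by blast
 define KK where "KK = (%s. (u s, T s)) ` {a..b}"
 have KK: "compact KK" "KK <= Z" unfolding KK_def by (rule compact_continuous_image[OF cuT compact_Icc]) (rule imZ)
 obtain mu where mu: "mu > 0" "!!z xi. z : KK ==> mu * (norm xi)\<^sup>2 <= g z xi xi" using g_lower[OF KK] by blast
 obtain MT where MT: "MT > 0" "!!s. s : {a..b} ==> norm (T s) <= MT" using compact_image_bound[OF cu(2) compact_Icc] by blast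
 obtain H where H: "H > 0" "!!s. s : {a..b} ==> norm (h s) <= H" using compact_image_bound[OF h compact_Icc] by blast
 have cG: "continuous_on {a..b} (%s. Gz x y (u s, T s))" for x y
  by (rule continuous_on_compose2[OF smooth_on_continuous[OF smooth_Gz] cuT imZ])
 have cE: "continuous_on {a..b} (%s. E (u s, T s))"
  by (rule continuous_on_compose2[OF smooth_on_continuous[OF smooth_E] cuT imZ])
 have cg: "continuous_on {a..b} (%s. g (u s, T s) (f1 s) (f2 s))" if "continuous_on {a..b} f1" "continuous_on {a..b} f2" for f1 f2
  unfolding g_def by (rule continuous_on_dird2[OF smooth_E open_Z _ _ cuT imZ]) (intro continuous_intros that)+
 have cp: "continuous_on {a..b} (%s. dird (0, f s) E (u s, T s))" if "continuous_on {a..b} f" for f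
  by (rule continuous_on_dird[OF smooth_E _ cuT imZ]) (intro continuous_intros that)
 have cdG: "continuous_on {a..b} (%s. dG (u s, T s) (T s) x y)" for x y
  unfolding dG_def by (rule continuous_on_dird[OF smooth_Gz _ cuT imZ]) (intro continuous_intros cu)
 have GT: "Gz x y z = (SUM i:UNIV. x $ i *r Gz (axis i 1) y z)" for x y z
 proof -
  have "Gz x y z = Gz (SUM i:UNIV. x $ i *r axis i 1) y z" using basis_expansion[of x] by (simp add: scalar_mult_eq_scaleR)
  thus ?thesis by (simp add: linear_sum[OF linear_Gz(1)] linear_scale[OF linear_Gz(1)])
 qed
 have GT2: "Gz x y z = (SUM i:UNIV. y $ i *r Gz x (axis i 1) z)" for x y z
 proof -
  have "Gz x y z = Gz x (SUM i:UNIV. y $ i *r axis i 1) z" using basis_expansion[of y] by (simp add: scalar_mult_eq_scaleR)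
  thus ?thesis by (simp add: linear_sum[OF linear_Gz(2)] linear_scale[OF linear_Gz(2)])
 qed
 have cGG: "continuous_on {a..b} (%s. Gz (f1 s) (f2 s) (u s, T s))" if "continuous_on {a..b} f1" "continuous_on {a..b} f2" for f1 f2
  by (subst GT, subst GT2) (intro continuous_intros cG that)
 obtain Ma where Ma: "Ma >= 0" "!!s x y. s : {a..b} ==> abs(ba k' (h s) (u s, T s) x y) <= Ma * norm x * norm y"
 proof (rule curve_bilinear_bound[of a b "%s. ba k' (h s) (u s, T s)"])
  show "continuous_on {a..b} (%s. ba k' (h s) (u s, T s) (axis i 1) (axis j 1))" for i j
   unfolding ba_def snd_conv by (intro continuous_intros cp cdG cGG cg cE h cu) simp_all
 qed (use ba_linear[OF zI] in simp_all)
 obtain Mb where Mb: "Mb >= 0" "!!s x y. s : {a..b} ==> abs(bb (h s) (u s, T s) x y) <= Mb * norm x * norm y"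
 proof (rule curve_bilinear_bound[of a b "%s. bb (h s) (u s, T s)"])
  show "continuous_on {a..b} (%s. bb (h s) (u s, T s) (axis i 1) (axis j 1))" for i j
   unfolding bb_def by (intro continuous_intros cp cGG cg h)
 qed (use bb_linear[OF zI] in simp_all)
 obtain MG where MG: "MG >= 0" "!!s x y. s : {a..b} ==> \<bar>Gz x (T s) (u s, T s) \<bullet> y\<bar> <= MG * norm x * norm y"
 proof (rule curve_bilinear_bound[of a b "%s x y. Gz x (T s) (u s, T s) \<bullet> y"])
  show "linear (%x. Gz x (T s) (u s, T s) \<bullet> y)" for s y by (rule linearI) (simp_all add: Gz_simps inner_left_distrib)
  show "linear (%y. Gz x (T s) (u s, T s) \<bullet> y)" for s x by (rule linearI) (simp_all add: inner_right_distrib)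
  show "continuous_on {a..b} (%s. Gz (axis i 1) (T s) (u s, T s) \<bullet> axis j 1)" for i j
   by (intro continuous_intros cGG cu)
 qed (rule that)
 have nG: "norm (Gz x (T s) (u s, T s)) <= MG * norm x" if "s : {a..b}" for s x
 proof (cases "Gz x (T s) (u s, T s) = 0")
  case False
  thus ?thesis using MG(2)[OF that, of x "Gz x (T s) (u s, T s)"] by (simp add: dot_square_norm power2_eq_square)
 qed (use MG(1) in simp)
 define e0 where "e0 = E (u a, T a)"
 have e0: "E (u s, T s) = e0" if "s : {a..b}" for s
  unfolding e0_def by (rule sol_energy_constant[OF u(1) convex_real_interval(5) that]) (use ab in simp)
 have e0p: "e0 > 0" unfolding e0_def using g_yy[OF zI[of a]] g_posdef[OF zI[of a], of "T a"] u(3)[of a] ab by simp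
 \<comment> \<open>Coercivity of the second order part: it dominates (mu/2) |D - h z|^2 + rh |z|^2,
   with \<open>D\<close> the covariant derivative of the displacement.\<close>
 define rh where "rh = (k' - max k 0) * e0 * mu"
 have rh: "rh > 0" unfolding rh_def using k' e0p mu(1) by simp
 define N where "N = MG + H"
 have N: "N >= 0" unfolding N_def using MG(1) H(1) by simp
 \<comment> \<open>Since |w| <= |D - h z| + N |z|, a Taylor error et |(z,w)|^2 is absorbed if 2 et
   <= mu/2 and et (1 + 2 N^2) <= rh.\<close>
 define et where "et = min (mu / 4) (rh / (1 + 2 * N\<^sup>2))"
 have N2: "1 + 2 * N\<^sup>2 > 0" using zero_le_power2[of N] by linarith
 have et: "et > 0" "et <= mu / 4" "et * (1 + 2 * N\<^sup>2) <= rh"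
 proof -
  show "et > 0" unfolding et_def using mu(1) rh N2 by simp
  show "et <= mu / 4" unfolding et_def by (rule min.cobounded1)
  have "et <= rh / (1 + 2 * N\<^sup>2)" unfolding et_def by (rule min.cobounded2)
  thus "et * (1 + 2 * N\<^sup>2) <= rh" unfolding le_divide_eq using N2 by simp
 qed
 obtain de where de: "de > 0" "!!x v. x : KK ==> norm v <= de ==> x + v : Z &
   abs(E (x + v) - E x - dird v E x - dird v (dird v E) x / 2) <= et * (norm v)\<^sup>2"
  using taylor2_uniform[OF smooth_E open_Z KK et(1)] by blast
 obtain c C where cC: "c > 0" "C > 0"
  and eb1: "!!x v w. x : K ==> v ~= 0 ==> E (x, v) + dird (0, w - v) E (x, v) + c / 2 * (norm (w - v))\<^sup>2 <= E (x, w)"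
  and eb2: "!!a u v. a : K ==> u : K ==> v ~= 0 ==> E (u, v) + dird (a - u, 0) E (u, v) - C * (norm v)\<^sup>2 * (norm (a - u))\<^sup>2 <= E (a, v)"
  and eb3: "!!a u v ze. a : K ==> u : K ==> v ~= 0 ==> abs(dird (0, ze) E (a, v) - dird (0, ze) E (u, v)) <= C * norm v * norm ze * norm (a - u)"
  by (rule energy_bounds[OF K], rule that)
 define M where "M = Ma + Mb + C * MT\<^sup>2 + C * MT + 1"
 have M: "M > 0" "Ma + C * MT\<^sup>2 <= M" "Mb + C * MT <= M" 
  unfolding M_def using Ma(1) Mb(1) cC(2) MT(1) mult_pos_pos[OF cC(2) MT(1)] by (auto intro: add_nonneg_pos)
 \<comment> \<open>When |z| <= th |w|, all errors together are at most 2 M th |w|^2, and uniform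
   convexity supplies c/2 |w|^2.\<close>
 define th where "th = min 1 (c / (4 * M))"
 have th: "th > 0" "th <= 1" "2 * M * th <= c / 2"
 proof -
  show "th > 0" "th <= 1" unfolding th_def using cC(1) M(1) by auto
  have "th <= c / (4 * M)" unfolding th_def by (rule min.cobounded2)
  thus "2 * M * th <= c / 2" using M(1) by (simp add: le_divide_eq mult_ac)
 qed
 \<comment> \<open>If (z,w) is too large for Taylor's formula, then |w| >= de/2 and hence |z| <= ep
   <= th |w|.\<close>
 define ep where "ep = th * de / 2"
 have ep: "ep > 0" "ep <= de / 2"
 proof -
  show "ep > 0" unfolding ep_def using th de(1) by simp
  have "th * de <= 1 * de" by (rule mult_right_mono[OF th(2)]) (use de(1) in simp)
  thus "ep <= de / 2" unfolding ep_def by simp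
 qed
 show thesis
 proof (rule that[OF ep(1)])
  fix s z w assume s: "s : {a..b}" and zK: "u s + z : K" and z: "norm z <= ep"
  let ?z = "(u s, T s)"
  have zKK: "?z : KK" unfolding KK_def using s by blast
  note zZ = zI[OF s]
  show "E ?z + dird (z, w) E ?z + ba k' (h s) ?z z z + bb (h s) ?z z w <= E (u s + z, T s + w)"
  proof (cases "norm (z, w) <= de")
   case True
   define D where "D = w + Gz z (T s) ?z"
   define A where "A = norm (D - h s *r z)"
   define X where "X = norm z"
   have il: "g ?z (D - h s *r z) (D - h s *r z) / 2 + (k' - max k 0) * E ?z * g ?z z z
    <= dird (z, w) (dird (z, w) E) ?z / 2 - ba k' (h s) ?z z z - bb (h s) ?z z w"
    using index_form_lower[OF zZ, of w z "h s" k', folded D_def]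
    unfolding ba_def bb_def snd_conv D_def linear_add[OF g_linear2[OF zZ]] by (simp add: algebra_simps)
   have g1: "mu * A\<^sup>2 <= g ?z (D - h s *r z) (D - h s *r z)" unfolding A_def by (rule mu(2)[OF zKK])
   have g2: "rh * X\<^sup>2 <= (k' - max k 0) * E ?z * g ?z z z"
   proof -
    have "(k' - max k 0) * e0 * (mu * X\<^sup>2) <= (k' - max k 0) * e0 * g ?z z z"
     unfolding X_def by (rule mult_left_mono[OF mu(2)[OF zKK]]) (use k' e0p in simp)
    thus ?thesis unfolding rh_def e0[OF s] by (simp add: mult_ac)
   qed
   have nw: "norm w <= A + N * X"
   proof -
    have "w = (D - h s *r z) - (Gz z (T s) ?z - h s *r z)" by (simp add: D_def)
    hence "norm w <= A + norm (Gz z (T s) ?z - h s *r z)" unfolding A_def by (metis norm_triangle_ineq4)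
    also have "norm (Gz z (T s) ?z - h s *r z) <= norm (Gz z (T s) ?z) + norm (h s *r z)" by (rule norm_triangle_ineq4)
    also have "... <= MG * X + H * X"
     unfolding X_def norm_scaleR using nG[OF s, of z] mult_right_mono[OF H(2)[OF s], of "norm z"] by simp
    finally show ?thesis unfolding N_def by (simp add: algebra_simps)
   qed
   have A0: "A >= 0" "X >= 0" unfolding A_def X_def by auto
   have "(norm w)\<^sup>2 <= (A + N * X)\<^sup>2" by (rule power_mono[OF nw]) simp
   also have "... <= 2 * A\<^sup>2 + 2 * (N * X)\<^sup>2" using sum_squares_bound[of A "N * X"] by (simp add: power2_sum)
   finally have w2: "(norm w)\<^sup>2 <= 2 * A\<^sup>2 + 2 * N\<^sup>2 * X\<^sup>2" by (simp add: power_mult_distrib)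
   have nv: "(norm (z, w))\<^sup>2 = X\<^sup>2 + (norm w)\<^sup>2" unfolding X_def by (simp add: norm_Pair)
   have "et * (norm (z, w))\<^sup>2 <= et * (X\<^sup>2 + (2 * A\<^sup>2 + 2 * N\<^sup>2 * X\<^sup>2))"
    unfolding nv using et(1) w2 by (intro mult_left_mono) auto
   also have "... = et * (1 + 2 * N\<^sup>2) * X\<^sup>2 + 2 * et * A\<^sup>2" by (simp add: algebra_simps)
   also have "... <= rh * X\<^sup>2 + mu / 2 * A\<^sup>2"
    using et by (intro add_mono mult_right_mono) auto
   also have "... <= dird (z, w) (dird (z, w) E) ?z / 2 - ba k' (h s) ?z z z - bb (h s) ?z z w"
    using il g1 g2 by simp
   finally have 1: "et * (norm (z, w))\<^sup>2 <= dird (z, w) (dird (z, w) E) ?z / 2 - ba k' (h s) ?z z z - bb (h s) ?z z w" .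
   have "abs(E (?z + (z, w)) - E ?z - dird (z, w) E ?z - dird (z, w) (dird (z, w) E) ?z / 2) <= et * (norm (z, w))\<^sup>2"
    using de(2)[OF zKK True] by blast
   thus ?thesis using 1 unfolding abs_le_iff by simp
  next
   case False
   have "norm (z, w) <= norm z + norm w" by (rule norm_Pair_le)
   hence w: "de / 2 <= norm w" using False z ep(2) by simp
   have zw: "norm z <= th * norm w"
   proof -
    have "th * (de / 2) <= th * norm w" by (rule mult_left_mono[OF w]) (use th(1) in simp)
    thus ?thesis using z unfolding ep_def by simp
   qed
   define X W where "X = norm z" and "W = norm w"
   have XW: "0 <= X" "0 <= W" "X <= th * W" using zw unfolding X_def W_def by auto
   have uK: "u s : K" by (rule u(2)[OF s])
   have T0: "T s ~= 0" by (rule u(3)[OF s])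
   have 1: "E (u s + z, T s) + dird (0, w) E (u s + z, T s) + c / 2 * W\<^sup>2 <= E (u s + z, T s + w)"
    using eb1[OF zK T0, of "T s + w"] by (simp add: W_def)
   have 2: "E ?z + dird (z, 0) E ?z - C * (norm (T s))\<^sup>2 * X\<^sup>2 <= E (u s + z, T s)"
    using eb2[OF zK uK T0] by (simp add: X_def)
   have 3: "dird (0, w) E ?z - C * norm (T s) * W * X <= dird (0, w) E (u s + z, T s)"
    using eb3[OF zK uK T0, of w] by (simp add: X_def W_def abs_le_iff)
   have 4: "C * (norm (T s))\<^sup>2 * X\<^sup>2 <= C * MT\<^sup>2 * X\<^sup>2" "C * norm (T s) * W * X <= C * MT * W * X"
    using MT(2)[OF s] cC(2) XW by (auto intro!: mult_right_mono mult_left_mono power_mono)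
   have 5: "ba k' (h s) ?z z z <= Ma * X\<^sup>2" "bb (h s) ?z z w <= Mb * X * W"
    using Ma(2)[OF s, of z z] Mb(2)[OF s, of z w] unfolding X_def W_def by (auto simp: power2_eq_square mult_ac abs_le_iff)
   have 6: "dird (z, w) E ?z = dird (z, 0) E ?z + dird (0, w) E ?z"
    using dird_simps(1)[OF smooth_E zZ, of "(z, 0)" "(0, w)"] by simp
   have XX: "X * X <= th * W * W" "X * W <= th * W * W"
   proof -
    show 1: "X * W <= th * W * W" using XW by (intro mult_right_mono) auto
    have "th * W <= W" using th(1,2) XW(2) by (simp add: mult_left_le_one_le)
    hence "X <= W" using XW(3) by simp
    hence "X * X <= X * W" using XW by (intro mult_left_mono) auto
    thus "X * X <= th * W * W" using 1 by simp
   qed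
   have "(Ma + C * MT\<^sup>2) * (X * X) + (Mb + C * MT) * (X * W) <= M * (th * W * W) + M * (th * W * W)"
    by (rule add_mono[OF mult_mono[OF M(2) XX(1)] mult_mono[OF M(3) XX(2)]]) (use M(1) XW in simp_all)
   also have "... = (2 * M * th) * W\<^sup>2" by (simp add: power2_eq_square)
   also have "... <= c / 2 * W\<^sup>2" by (intro mult_right_mono[OF th(3)]) simp
   finally have "Ma * X\<^sup>2 + C * MT\<^sup>2 * X\<^sup>2 + (Mb * X * W + C * MT * W * X) <= c / 2 * W\<^sup>2"
    by (simp add: algebra_simps power2_eq_square)
   thus ?thesis using 1 2 3 4 5 unfolding 6 by linarith
  qed
 qed
qed

text \<open>The excess inequality along two solutions, with z the difference of positions and w that
  of velocities, says that \<open>G\<close> has nonnegative derivative. Both energies are constant,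
  which gives the linear right-hand side.\<close>

lemma compare:
 assumes K: "compact K" "convex K" "K <= U" and ab: "a <= b"
  and u: "sol {a..b} u T" "!!s. s : {a..b} ==> u s : K" "!!s. s : {a..b} ==> T s ~= 0"
  and h: "!!s. s : {a..b} ==> (h has_real_derivative - (k' * (2 * E (u s, T s)) + (h s)\<^sup>2)) (at s within {a..b})"
  and k': "k' > max k 0"
 obtains ep where "ep > 0" "!!c v. sol {a..b} c v ==> (!!s. s : {a..b} ==> c s : K & norm (c s - u s) <= ep) ==>
   Bf (h b) (u b) (T b) (c b - u b) - Bf (h a) (u a) (T a) (c a - u a) <= (b - a) * (E (c a, v a) - E (u a, T a))"
proof -
 have ch: "continuous_on {a..b} h" using h by (meson DERIV_continuous continuous_on_eq_continuous_within)
 obtain ep where ep: "ep > 0" "!!s z w. s : {a..b} ==> u s + z : K ==> norm z <= ep ==>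
   E (u s, T s) + dird (z, w) E (u s, T s) + ba k' (h s) (u s, T s) z z + bb (h s) (u s, T s) z w <= E (u s + z, T s + w)"
  using excess_nonneg[OF K u ch k'] by blast
 show thesis
 proof (rule that[OF ep(1)])
  fix c v assume c: "sol {a..b} c v" and cK: "!!s. s : {a..b} ==> c s : K & norm (c s - u s) <= ep"
  define e0 e1 where "e0 = E (u a, T a)" and "e1 = E (c a, v a)"
  have aab: "a : {a..b}" using ab by simp
  have e: "E (u s, T s) = e0" "E (c s, v s) = e1" if "s : {a..b}" for s
   unfolding e0_def e1_def by (rule sol_energy_constant[OF _ convex_real_interval(5) that aab], rule u c)+
  define G where "G s = s * (e1 - e0) - Bf (h s) (u s) (T s) (c s - u s)" for s
  define G' where "G' s = (e1 - e0) - (dird (c s - u s, v s - T s) E (u s, T s) + ba k' (h s) (u s, T s) (c s - u s) (c s - u s)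
    + bb (h s) (u s, T s) (c s - u s) (v s - T s))" for s
  have dG: "(G has_real_derivative G' s) (at s within {a..b})" if s: "s : {a..b}" for s
  proof -
   have "((%s. c s - u s) hvd (v s - T s)) (at s within {a..b})"
    by (rule has_vector_derivative_diff[OF solD(2)[OF c s] solD(2)[OF u(1) s]])
   from Bf_derivative[OF u(1,3) s this h[OF s]]
   have B: "((%s. Bf (h s) (u s) (T s) (c s - u s)) has_real_derivative
    dird (c s - u s, v s - T s) E (u s, T s) + ba k' (h s) (u s, T s) (c s - u s) (c s - u s)
    + bb (h s) (u s, T s) (c s - u s) (v s - T s)) (at s within {a..b})" .
   have "((%s. s * (e1 - e0)) has_real_derivative (e1 - e0)) (at s within {a..b})"
    by (auto intro!: derivative_eq_intros)
   from DERIV_diff[OF this B] show ?thesis unfolding G_def G'_def .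
  qed
  have "G a <= G b"
  proof (rule deriv_nonneg_finite_mono[of "{}" a b G G'])
   show "continuous_on {a..b} G" using dG by (meson DERIV_continuous continuous_on_eq_continuous_within)
   fix s assume "s : {a<..<b} - {}"
   hence s: "s : {a..b}" "a < s" "s < b" by auto
   show "(G has_real_derivative G' s) (at s)" using dG[OF s(1)] at_within_Icc_at[OF s(2,3)] by simp
   have uz: "u s + (c s - u s) : K" using cK[OF s(1)] by simp
   show "0 <= G' s" unfolding G'_def
    using ep(2)[OF s(1) uz, of "v s - T s"] cK[OF s(1)] e[OF s(1)] by simp
  qed (use ab in simp_all)
  thus "Bf (h b) (u b) (T b) (c b - u b) - Bf (h a) (u a) (T a) (c a - u a) <= (b - a) * (E (c a, v a) - E (u a, T a))"
   unfolding G_def e0_def[symmetric] e1_def[symmetric] by (simp add: algebra_simps)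
 qed
qed

lemma Bf_expand:
 assumes "(x, y) : Z"
 shows "Bf h x y z = dird (0, z) E (x, y) + dird (0, Gz z z (x, y)) E (x, y) / 2 + h / 2 * g (x, y) z z"
 unfolding Bf_def by (simp add: linear_add[OF p_linear(1)[OF assms]] linear_scale[OF p_linear(1)[OF assms]])

lemma Bf_zero: "(x, y) : Z ==> Bf h x y 0 = 0"
 using Bf_expand[of x y h 0] by (simp add: Gz_simps linear_0[OF p_linear(1), unfolded zero_prod_def] linear_0[OF g_linear1])

text \<open>A maximum at \<open>t0\<close> forces p(v) = 0. In the second derivative the
  acceleration - Q cancels against the correction term of \<open>Bf\<close>, and h g(v,v) > 0
  remains.\<close>

lemma Bf_not_max:
 assumes s: "sol J u v" and J: "open J" "t0 : J" and v: "v t0 ~= 0" and T: "T ~= 0" and h: "h > 0"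
  and le: "!!t. t : J ==> Bf h (u t0) T (u t - u t0) <= 0"
 shows False
proof -
 let ?x = "u t0"
 let ?z = "(?x, T)"
 have xU: "?x : U" by (rule solD(1)[OF s J(2)])
 have z: "?z : Z" using xU T by (simp add: Z_iff)
 note lp = p_linear(1)[OF z]
 define p where "p a = dird (0, a) E ?z" for a
 have lp: "linear p" unfolding p_def by (rule p_linear(1)[OF z])
 define be where "be a b = p (Gz a b ?z) / 2 + h / 2 * g ?z a b" for a b
 have lbe: "linear (%a. be a b)" "linear (be a)" for a b
  by (rule linearI; simp add: be_def Gz_simps linear_add[OF lp] linear_scale[OF lp] linear_add[OF g_linear1[OF z]] linear_scale[OF g_linear1[OF z]]
    linear_add[OF g_linear2[OF z]] linear_scale[OF g_linear2[OF z]] add_divide_distrib algebra_simps)+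
 have be_sym: "be a b = be b a" for a b unfolding be_def using Gz_sym[OF z, of a b] g_symm[OF z, of a b] by simp
 define B where "B t = p (u t - ?x) + be (u t - ?x) (u t - ?x)" for t
 define B' where "B' t = p (v t) + 2 * be (u t - ?x) (v t)" for t
 have BB: "Bf h ?x T (u t - ?x) = B t" for t unfolding Bf_expand[OF z] B_def be_def p_def by simp
 have at: "at t within J = at t" if "t : J" for t using at_within_open[OF that J(1)] .
 have blp: "bounded_linear p" using lp by (simp add: linear_conv_bounded_linear)
 have du: "((%t. u t - ?x) hvd v t) (at t)" if "t : J" for t
  using has_vector_derivative_diff[OF solD(2)[OF s that] has_vector_derivative_const[of ?x]] unfolding at[OF that] by simp
 have dv: "(v hvd - Q (u t) (v t)) (at t)" if "t : J" for t
  using solD(3)[OF s that] unfolding at[OF that] .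
 have dB: "(B has_real_derivative B' t) (at t)" if t: "t : J" for t
 proof -
  have "((%t. be (u t - ?x) (u t - ?x)) hvd 0 + be (u t - ?x) (v t) + be (v t) (u t - ?x)) (at t within UNIV)"
   by (rule bilinear_var_derivative[of UNIV "%_. be" "%_ _. 0"]) (use lbe du[OF t] in "auto intro: linear_zero has_vector_derivative_const")
  from has_vector_derivative_add[OF bounded_linear.has_vector_derivative[OF blp du[OF t]] this]
  show ?thesis unfolding B_def B'_def has_real_derivative_iff_has_vector_derivative using be_sym by simp
 qed
 have B0: "B t0 = 0" unfolding B_def using linear_0[OF lp] linear_0[OF lbe(1)] by simp
 have B'0: "B' t0 = 0"
 proof -
  obtain e where e: "e > 0" "ball t0 e <= J" using J openE by blast
  have "ALL y. abs(t0 - y) < e --> B y <= B t0" using le e(2) unfolding BB B0 by (auto simp: dist_real_def subset_iff)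
  thus ?thesis by (rule DERIV_local_max[OF dB[OF J(2)] e(1)])
 qed
 hence py: "p (v t0) = 0" unfolding B'_def using linear_0[OF lbe(1)] by simp
 \<comment> \<open>Along the segment from \<open>T\<close> to \<open>v t0\<close> the momentum of
   \<open>T\<close> is positive until the end, so the segment avoids 0 and the Christoffel symbols
   at \<open>T\<close> are those of the geodesic.\<close>
 have seg: "T + ta *r (v t0 - T) ~= 0" for ta
 proof
  assume eq: "T + ta *r (v t0 - T) = 0"
  have "p (T + ta *r (v t0 - T)) = (1 - ta) * p T" using py by (simp add: linear_add[OF lp] linear_scale[OF lp] linear_diff[OF lp] algebra_simps)
  moreover have "p T > 0" using euler_E[OF z] g_yy[OF z] g_posdef[OF z T] unfolding p_def by simp
  ultimately have "ta = 1" using eq linear_0[OF lp] by simp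
  thus False using eq v by simp
 qed
 have QG: "Q ?x (v t0) = Gz (v t0) (v t0) ?z"
  using Gz_segment[OF xU, of T "v t0 - T" "v t0" "v t0"] seg unfolding Q_def Gz_def by simp
 have "((%t. be (u t - ?x) (v t)) hvd be (v t0) (v t0)) (at t0)"
 proof -
  have bb: "bounded_bilinear be" using lbe by (simp add: bilinear_conv_bounded_bilinear[symmetric] bilinear_def)
  show ?thesis
   using bounded_bilinear.has_vector_derivative[OF bb du[OF J(2)] dv[OF J(2)]] linear_0[OF lbe(1)] by simp
 qed
 hence "((%t. p (v t) + 2 *r be (u t - ?x) (v t)) hvd p (- Q ?x (v t0)) + 2 *r be (v t0) (v t0)) (at t0)"
  by (intro has_vector_derivative_add bounded_linear.has_vector_derivative[OF blp dv[OF J(2)]] bounded_linear.has_vector_derivative[OF bounded_linear_scaleR_right])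
 moreover have "p (- Q ?x (v t0)) + 2 *r be (v t0) (v t0) = h * g ?z (v t0) (v t0)"
  unfolding QG be_def by (simp add: linear_neg[OF lp] algebra_simps)
 ultimately have dB': "(B' has_real_derivative h * g ?z (v t0) (v t0)) (at t0)"
  unfolding B'_def has_real_derivative_iff_has_vector_derivative by simp
 have "h * g ?z (v t0) (v t0) > 0" using h g_posdef[OF z v] by simp
 from DERIV_pos_inc_right[OF dB' this] obtain d where d: "d > 0" "!!s. s > 0 ==> s < d ==> B' t0 < B' (t0 + s)" by blast
 obtain e where e: "e > 0" "ball t0 e <= J" using J openE by blast
 define s where "s = min d e / 2"
 have s: "0 < s" "s < d" "s < e" unfolding s_def using d e by auto
 have in_J: "t : J" if "t0 <= t" "t <= t0 + s" for t using e(2) that s(3) by (auto simp: dist_real_def subset_iff)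
 have "EX xi. t0 < xi & xi < t0 + s & B (t0 + s) - B t0 = (t0 + s - t0) * B' xi"
  by (rule MVT2) (use s dB in_J in auto)
 then obtain xi where xi: "t0 < xi" "xi < t0 + s" "B (t0 + s) - B t0 = s * B' xi" by auto
 have "B' xi > 0" using d(2)[of "xi - t0"] xi s B'0 by simp
 hence "B (t0 + s) > 0" using xi(3) s(1) B0 by simp
 thus False using le[OF in_J, of "t0 + s"] s BB by simp
qed

end

section \<open>Change of charts for \<open>Bf\<close>\<close>

locale berwald_transition = finsler_transition U1 U2 F1 F2 V ph + B1: berwald_dom U1 F1 k + B2: berwald_dom U2 F2 k
 for U1 U2 :: "(real ^ 'n::finite) set" and F1 F2 V ph k
begin

lemma dphi_linear: "x : V ==> linear (%z. dird z ph x)"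
 by (rule dird_linear[OF phi_smooth])

lemma ddphi_linear:
 assumes x: "x : V"
 shows "linear (%a. dird a (dird b ph) x)" "linear (%b. dird a (dird b ph) x)"
proof -
 show 1: "linear (%a. dird a (dird b ph) x)" for b by (rule dird_linear[OF smooth_on_dird[OF phi_smooth] x])
 show "linear (%b. dird a (dird b ph) x)"
  using 1[of a] dird_commute_vec[OF open_V phi_smooth x, of a] by simp
qed

text \<open>The transformation law of the Christoffel symbols, by polarization of
  \<open>Q_phi\<close> at y + t z for small t; there all velocities avoid 0 and share the symbols at
  \<open>y\<close>.\<close>

lemma Gz_phi:
 assumes x: "x : V" and y: "y ~= 0"
 shows "dird (D1.Gz z z (x, y)) ph x = D2.Gz (dird z ph x) (dird z ph x) (ph x, dird y ph x) + dird z (dird z ph) x"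
proof -
 let ?d = "%z. dird z ph x"
 note ld = dphi_linear[OF x] and ldd = ddphi_linear[OF x]
 have xU: "x : U1" "ph x : U2" using x V_sub phi_image by auto
 define m where "m = norm z + 1"
 have m: "m > 0" using norm_ge_zero[of z] unfolding m_def by linarith
 define s where "s = norm y / (2 * m)"
 have s: "s > 0" unfolding s_def using y m by simp
 have sz: "s * norm z < norm y"
 proof -
  have "s * norm z <= s * m" using s by (simp add: m_def)
  also have "... = norm y / 2" using m unfolding s_def by simp
  also have "... < norm y" using y by simp
  finally show ?thesis .
 qed
 have seg: "y + ta *r (t *r z) ~= 0" if "ta : {0..1}" "abs(t) <= s" for ta t
 proof
  assume "y + ta *r (t *r z) = 0"
  hence "norm y = abs(ta) * (abs(t) * norm z)" by (metis add_eq_0_iff norm_minus_cancel norm_scaleR)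
  also have "... <= 1 * (s * norm z)" using that by (intro mult_mono) auto
  finally show False using sz by simp
 qed
 have seg2: "?d y + ta *r (t *r ?d z) ~= 0" if "ta : {0..1}" "abs(t) <= s" for ta t
  using phi_inj[OF x, of "y + ta *r (t *r z)"] seg[OF that] by (auto simp: linear_add[OF ld] linear_scale[OF ld])
 define P where "P a b = ?d (D1.Gz a b (x, y)) - D2.Gz (?d a) (?d b) (ph x, ?d y) - dird a (dird b ph) x" for a b
 have P0: "P (y + t *r z) (y + t *r z) = 0" if t: "abs(t) <= s" for t
 proof -
  let ?y = "y + t *r z"
  have "D1.Q x ?y = D1.Gz ?y ?y (x, y)"
   using B1.Gz_segment[OF xU(1), of y "t *r z" ?y ?y] seg[OF _ t] unfolding D1.Q_def D1.Gz_def by simp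
  moreover have "D2.Q (ph x) (?d ?y) = D2.Gz (?d ?y) (?d ?y) (ph x, ?d y)"
   using B2.Gz_segment[OF xU(2), of "?d y" "t *r ?d z" "?d ?y" "?d ?y"] seg2[OF _ t]
   unfolding D2.Q_def D2.Gz_def by (simp add: linear_add[OF ld] linear_scale[OF ld])
  ultimately show ?thesis using Q_phi[OF x, of ?y] unfolding P_def by simp
 qed
 have lP: "linear (%a. P a b)" "linear (P a)" for a b
  unfolding P_def by (rule linearI; simp add: D1.Gz_simps D2.Gz_simps linear_add[OF ld] linear_scale[OF ld] linear_add[OF ldd(1)] linear_scale[OF ldd(1)]
    linear_add[OF ldd(2)] linear_scale[OF ldd(2)] algebra_simps)+
 have ex: "P (y + t *r z) (y + t *r z) = P y y + t *r (P y z + P z y) + (t * t) *r P z z" for t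
  by (simp add: linear_add[OF lP(1)] linear_add[OF lP(2)] linear_scale[OF lP(1)] linear_scale[OF lP(2)] algebra_simps)
 \<comment> \<open>A quadratic polynomial in t that vanishes at s, - s and 0 has leading coefficient
   0.\<close>
 have "P y y + s *r (P y z + P z y) + (s * s) *r P z z = 0" "P y y + (- s) *r (P y z + P z y) + (- s * - s) *r P z z = 0" "P y y = 0"
  using P0[of s] P0[of "- s"] P0[of 0] s unfolding ex by simp_all
 hence "(s * s) *r P z z = s *r (P y z + P z y)" "(s * s) *r P z z = - (s *r (P y z + P z y))"
  by (simp_all add: add_eq_0_iff) (metis minus_equation_iff)
 hence "(2 * (s * s)) *r P z z = 0" by (metis add.right_inverse scaleR_scaleR scaleR_2)
 hence "P z z = 0" using s by simp
 thus ?thesis unfolding P_def by (simp add: algebra_simps)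
qed

lemma phi_taylor:
 assumes x: "x : V" and et: "et > 0"
 obtains de where "de > 0" "!!z. norm z <= de ==> x + z : V & norm (ph (x + z) - ph x - dird z ph x - (1 / 2) *r dird z (dird z ph) x) <= et * (norm z)\<^sup>2"
proof -
 have "EX de>0. ALL z. norm z <= de --> x + z : V & abs(ph (x + z) $ i - ph x $ i - dird z ph x $ i - dird z (dird z ph) x $ i / 2) <= et / CARD('n) * (norm z)\<^sup>2" for i
 proof -
  have e: "et / CARD('n) > 0" using et by simp
  show ?thesis
  proof (rule taylor2_uniform[OF smooth_on_component[OF open_V phi_smooth, of i] open_V, of "{x}", OF _ _ e])
   fix de assume de: "de > 0" "!!xa v. xa : {x} ==> norm v <= de ==> xa + v : V &
     abs(ph (xa + v) $ i - ph xa $ i - dird v (%z. ph z $ i) xa - dird v (dird v (%z. ph z $ i)) xa / 2) <= et / CARD('n) * (norm v)\<^sup>2"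
   show ?thesis
    using de(1) de(2)[of x] unfolding dird_component[OF phi_smooth x] dird_dird_component[OF open_V phi_smooth x] by blast
  qed (use x in auto)
 qed
 then obtain de where de: "!!i. de i > 0" "!!i z. norm z <= de i ==> x + z : V &
   abs(ph (x + z) $ i - ph x $ i - dird z ph x $ i - dird z (dird z ph) x $ i / 2) <= et / CARD('n) * (norm z)\<^sup>2"
  by metis
 define d where "d = Min (range de)"
 have d: "d > 0" "!!i. d <= de i" unfolding d_def using de(1) by auto
 show thesis
 proof (rule that[OF d(1)], rule conjI)
  fix z :: "real ^ 'n" assume z: "norm z <= d"
  hence zi: "norm z <= de i" for i using d(2)[of i] by simp
  show "x + z : V" using de(2)[OF zi] by blast
  let ?r = "ph (x + z) - ph x - dird z ph x - (1 / 2) *r dird z (dird z ph) x"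
  have "norm ?r <= (SUM i:UNIV. abs(?r $ i))" by (rule norm_le_l1_cart)
  also have "... <= (SUM i:(UNIV::'n set). et / CARD('n) * (norm z)\<^sup>2)"
   by (rule sum_mono) (use de(2)[OF zi] in simp)
  also have "... = et * (norm z)\<^sup>2" by simp
  finally show "norm ?r <= et * (norm z)\<^sup>2" .
 qed
qed

lemma linear_norm_bound:
 fixes f :: "real ^ 'n => 'b::real_normed_vector"
 assumes "linear f"
 obtains M where "M > 0" "!!z. norm (f z) <= M * norm z"
 using bounded_linear.pos_bounded[of f] assms by (auto simp: linear_conv_bounded_linear mult.commute)

lemma bilinear_norm_bound:
 fixes f :: "real ^ 'n => real ^ 'n => 'b::real_normed_vector"
 assumes "!!b. linear (%a. f a b)" "!!a. linear (f a)"
 obtains M where "M > 0" "!!a b. norm (f a b) <= M * norm a * norm b"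
proof -
 have "bounded_bilinear f" using assms by (simp add: bilinear_conv_bounded_bilinear[symmetric] bilinear_def)
 from bounded_bilinear.pos_bounded[OF this] obtain K where "K > 0" "!!a b. norm (f a b) <= norm a * norm b * K" by blast
 thus thesis by (intro that[of K]) (simp_all add: mult_ac)
qed

text \<open>To second order the displacement in the new chart is dph(z) + ddph(z,z)/2, and the
  quadratic term is what \<open>Gz_phi\<close> contributes to the correction. The error is o(|z|^2)
  and is paid for by lowering \<open>h\<close>.\<close>

lemma Bf_phi:
 assumes x: "x : V" and y: "y ~= 0" and h: "h2 < h1"
 obtains ep where "ep > 0" "!!z. norm z <= ep ==> B2.Bf h2 (ph x) (dird y ph x) (ph (x + z) - ph x) <= B1.Bf h1 x y z"
proof -
 have z1: "(x, y) : D1.Z" and z2: "(ph x, dird y ph x) : D2.Z" using Z_phi[OF x y] by auto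
 let ?z1 = "(x, y)" and ?z2 = "(ph x, dird y ph x)"
 let ?d = "%z. dird z ph x" and ?dd = "%z. dird z (dird z ph) x"
 note ld = dphi_linear[OF x] and ldd = ddphi_linear[OF x]
 define p where "p a = dird (0, a) D2.E ?z2" for a
 have lp: "linear p" unfolding p_def by (rule B2.p_linear(1)[OF z2])
 define be where "be a b = p (D2.Gz a b ?z2) / 2 + h2 / 2 * D2.g ?z2 a b" for a b
 have lbe: "linear (%a. be a b)" "linear (be a)" for a b
  by (rule linearI; simp add: be_def D2.Gz_simps linear_add[OF lp] linear_scale[OF lp] linear_add[OF D2.g_linear1[OF z2]] linear_scale[OF D2.g_linear1[OF z2]]
    linear_add[OF D2.g_linear2[OF z2]] linear_scale[OF D2.g_linear2[OF z2]] add_divide_distrib algebra_simps)+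
 have BB: "B2.Bf h2 (ph x) (dird y ph x) w = p w + be w w" for w unfolding B2.Bf_expand[OF z2] p_def be_def by simp
 have "compact {?z1}" "{?z1} <= D1.Z" using z1 by auto
 then obtain mu where mu: "mu > 0" "!!xi. mu * (norm xi)\<^sup>2 <= D1.g ?z1 xi xi" using B1.g_lower by (metis insertI1)
 obtain Mp where Mp: "Mp > 0" "!!w. norm (p w) <= Mp * norm w" by (rule linear_norm_bound[OF lp], rule that)
 obtain Md where Md: "Md > 0" "!!w. norm (?d w) <= Md * norm w" by (rule linear_norm_bound[OF ld], rule that)
 obtain Mbe where Mbe: "Mbe > 0" "!!a b. norm (be a b) <= Mbe * norm a * norm b" by (rule bilinear_norm_bound[OF lbe], rule that)
 obtain Mq where Mq: "Mq > 0" "!!a b. norm (dird a (dird b ph) x) <= Mq * norm a * norm b" by (rule bilinear_norm_bound[OF ldd], rule that)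
 \<comment> \<open>The gain from lowering \<open>h\<close> is at least th |z|^2. Half of it pays for
   the Taylor remainder in the momentum, half for the cross terms of the quadratic form.\<close>
 define th where "th = (h1 - h2) / 2 * mu"
 have th: "th > 0" unfolding th_def using h mu(1) by simp
 define et where "et = th / (2 * Mp)"
 have et: "et > 0" "Mp * et = th / 2" unfolding et_def using th Mp(1) by simp_all
 obtain de where de: "de > 0" "!!z. norm z <= de ==> x + z : V & norm (ph (x + z) - ph x - ?d z - (1 / 2) *r ?dd z) <= et * (norm z)\<^sup>2"
  by (rule phi_taylor[OF x et(1)], rule that)
 define Me where "Me = Mq / 2 + et"
 define C where "C = Mbe * (2 * Md * Me + Me * Me)"
 have pos: "Me > 0" "C > 0" unfolding Me_def C_def using Mq(1) et(1) Mbe(1) Md(1) by (auto intro!: mult_pos_pos add_pos_pos)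
 define ep where "ep = min (min 1 de) (th / (2 * C))"
 have ep: "ep > 0" "ep <= 1" "ep <= de" "ep <= th / (2 * C)" unfolding ep_def using de(1) th pos by (auto simp: min_le_iff_disj)
 show thesis
 proof (rule that[OF ep(1)])
  fix z :: "real ^ 'n" assume z: "norm z <= ep"
  define X where "X = norm z"
  have X: "0 <= X" "X <= 1" "norm z <= de" unfolding X_def using z ep by auto
  define r where "r = ph (x + z) - ph x - ?d z - (1 / 2) *r ?dd z"
  define e where "e = (1 / 2) *r ?dd z + r"
  have ps: "ph (x + z) - ph x = ?d z + e" unfolding e_def r_def by simp
  have nr: "norm r <= et * X\<^sup>2" using de(2)[OF X(3)] unfolding r_def X_def by blast
  have ne: "norm e <= Me * X\<^sup>2"
  proof -
   have "norm e <= norm ((1 / 2) *r ?dd z) + norm r" unfolding e_def by (rule norm_triangle_ineq)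
   also have "... <= Mq / 2 * X\<^sup>2 + et * X\<^sup>2" using Mq(2)[of z z] nr by (simp add: X_def power2_eq_square)
   finally show ?thesis unfolding Me_def by (simp add: algebra_simps)
  qed
  have nd: "norm (?d z) <= Md * X" using Md(2)[of z] by (simp add: X_def)
  have b1: "be (?d z) e <= Mbe * (Md * X) * (Me * X\<^sup>2)" "be e (?d z) <= Mbe * (Me * X\<^sup>2) * (Md * X)" "be e e <= Mbe * (Me * X\<^sup>2) * (Me * X\<^sup>2)"
  proof -
   have b: "be a b <= Mbe * A * B'" if "norm a <= A" "norm b <= B'" for a b A B'
   proof -
    have "be a b <= Mbe * norm a * norm b" using Mbe(2)[of a b] by simp
    also have "... <= Mbe * A * B'" using that Mbe(1) order_trans[OF norm_ge_zero that(1)] by (intro mult_mono) auto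
    finally show ?thesis .
   qed
   show "be (?d z) e <= Mbe * (Md * X) * (Me * X\<^sup>2)" "be e (?d z) <= Mbe * (Me * X\<^sup>2) * (Md * X)" "be e e <= Mbe * (Me * X\<^sup>2) * (Me * X\<^sup>2)"
    by (rule b; rule nd ne)+
  qed
  have "be (?d z) e + be e (?d z) + be e e <= (Mbe * (2 * Md * Me + Me * Me * X)) * X * X\<^sup>2"
   using b1 by (simp add: algebra_simps power2_eq_square)
  also have "... <= C * X * X\<^sup>2"
  proof -
   have "Me * Me * X <= Me * Me * 1" using X pos by (intro mult_left_mono) auto
   hence "Mbe * (2 * Md * Me + Me * Me * X) <= C" unfolding C_def using Mbe(1) by (intro mult_left_mono) auto
   thus ?thesis using X(1) by (intro mult_right_mono) auto
  qed
  also have "... <= th / 2 * X\<^sup>2"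
  proof -
   have "X <= th / (2 * C)" using z ep(4) unfolding X_def by simp
   hence "C * X <= th / 2" using pos(2) by (simp add: le_divide_eq mult_ac)
   thus ?thesis by (intro mult_right_mono) auto
  qed
  finally have bnd: "be (?d z) e + be e (?d z) + be e e <= th / 2 * X\<^sup>2" .
  have pr: "p r <= th / 2 * X\<^sup>2"
  proof -
   have "p r <= Mp * norm r" using Mp(2)[of r] by simp
   also have "... <= Mp * (et * X\<^sup>2)" using nr Mp(1) by (intro mult_left_mono) auto
   finally show ?thesis using et(2) by (simp add: mult.assoc[symmetric])
  qed
  have "p (?d z + e) + be (?d z + e) (?d z + e) = p (?d z) + (p (?dd z) / 2 + p r) + (be (?d z) (?d z) + (be (?d z) e + be e (?d z) + be e e))"
   unfolding e_def[symmetric] linear_add[OF lp] linear_add[OF lbe(1)] linear_add[OF lbe(2)]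
   by (simp add: e_def linear_add[OF lp] linear_scale[OF lp])
  also have "... <= p (?d z) + p (?dd z) / 2 + be (?d z) (?d z) + th * X\<^sup>2" using bnd pr by simp
  also have "th * X\<^sup>2 <= (h1 - h2) / 2 * D1.g ?z1 z z"
   unfolding th_def X_def using mult_left_mono[OF mu(2)[of z], of "(h1 - h2) / 2"] h by (simp add: mult_ac)
  also have "p (?d z) + p (?dd z) / 2 + be (?d z) (?d z) + (h1 - h2) / 2 * D1.g ?z1 z z = B1.Bf h1 x y z"
  proof -
   have "p (?d z) = dird (0, z) D1.E ?z1" unfolding p_def by (rule dird_Ey_phi[OF x y, symmetric])
   moreover have "dird (0, D1.Gz z z ?z1) D1.E ?z1 = p (D2.Gz (?d z) (?d z) ?z2) + p (?dd z)"
    unfolding dird_Ey_phi[OF x y] Gz_phi[OF x y] p_def[symmetric] by (rule linear_add[OF lp])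
   moreover have "D1.g ?z1 z z = D2.g ?z2 (?d z) (?d z)" by (rule g_phi[OF x y])
   ultimately show ?thesis unfolding B1.Bf_expand[OF z1] be_def by (simp add: field_simps)
  qed
  finally show "B2.Bf h2 (ph x) (dird y ph x) (ph (x + z) - ph x) <= B1.Bf h1 x y z" unfolding BB ps by simp
 qed
qed

end

section \<open>The certificate and convexity of balls\<close>

text \<open>A shifted solution of the Riccati equation h' = - a^2 - h^2. A larger shift gives a
  smaller value, which is the loss permitted in \<open>Bf_phi\<close>.\<close>

definition hh :: "real => real => real => real" where "hh a et s = a * cot (a * (s + et))"

lemma hh_derivative:
 assumes "0 < a * (s + et)" "a * (s + et) < pi"
 shows "(hh a et has_real_derivative - (a\<^sup>2 + (hh a et s)\<^sup>2)) (at s within I)"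
proof -
 let ?x = "a * (s + et)"
 have sn: "sin ?x > 0" by (rule sin_gt_zero[OF assms])
 have i: "((%s. a * (s + et)) has_real_derivative a) (at s within I)" by (auto intro!: derivative_eq_intros)
 have "(cot has_real_derivative - inverse ((sin ?x)\<^sup>2)) (at ?x)" by (rule DERIV_cot) (use sn in simp)
 from DERIV_cmult[OF DERIV_chain2[OF this i], of a]
 have "(hh a et has_real_derivative a * (- inverse ((sin ?x)\<^sup>2) * a)) (at s within I)"
  unfolding hh_def .
 moreover have "a * (- inverse ((sin ?x)\<^sup>2) * a) = - (a\<^sup>2 + (hh a et s)\<^sup>2)"
 proof -
  define S C where "S = sin ?x" and "C = cos ?x"
  have S: "S ~= 0" "S\<^sup>2 + C\<^sup>2 = 1" using sn unfolding S_def C_def by simp_all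
  have "a\<^sup>2 + (a * (C / S))\<^sup>2 = a\<^sup>2 * (S\<^sup>2 + C\<^sup>2) / S\<^sup>2" using S(1) by (simp add: field_simps)
  hence "a\<^sup>2 + (a * (C / S))\<^sup>2 = a\<^sup>2 / S\<^sup>2" unfolding S(2) by simp
  thus ?thesis unfolding hh_def cot_def S_def[symmetric] C_def[symmetric] by (simp add: divide_inverse power2_eq_square mult_ac)
 qed
 ultimately show ?thesis by simp
qed

lemma hh_strict_decreasing:
 assumes "a > 0" "0 < s + et1" "et1 < et2" "a * (s + et2) < pi"
 shows "hh a et2 s < hh a et1 s"
proof -
 have e: "hh a et s = hh a 0 (s + et)" for et by (simp add: hh_def)
 have "hh a 0 (s + et2) < hh a 0 (s + et1)"
 proof (rule DERIV_neg_imp_decreasing[where f = "hh a 0"])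
  show "s + et1 < s + et2" using assms by simp
  fix x assume x: "s + et1 <= x" "x <= s + et2"
  have "a * x <= a * (s + et2)" using x assms(1) by (intro mult_left_mono) auto
  hence "a * x < pi" using assms(4) by (rule le_less_trans)
  hence "0 < a * (x + 0)" "a * (x + 0) < pi" using x assms(1,2) by auto
  from hh_derivative[OF this, of UNIV] show "EX y. (hh a 0 has_real_derivative y) (at x) & y < 0"
   using add_pos_nonneg[of "a\<^sup>2" "(hh a 0 x)\<^sup>2"] assms(1) by (intro exI conjI) auto
 qed
 thus ?thesis unfolding e .
qed

section \<open>Propagation of the certificate and convexity of balls\<close>

locale berwald_mfd = finsler_complete A F lam
 for A :: "('m::{t2_space, second_countable_topology}, 'n::finite) chart set" and F and lam +
 fixes k :: real
 assumes berwald: "berwald A F" and curv: "flag_curv_le A F k"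
begin

lemma bdom: "c : A ==> berwald_dom (cimg c) (L c) k"
 unfolding berwald_dom_def berwald_dom_axioms_def
 using finsler_dom berwald[unfolded berwald_def] curv[unfolded flag_curv_le_def] by blast

lemma btrans: "c : A ==> d : A ==> berwald_transition (cimg c) (cimg d) (L c) (L d) (ov c d) (tr c d) k"
 unfolding berwald_transition_def using transition bdom by blast

text \<open>The transition from closeness in the distance to closeness of coordinates, uniformly
  along a compact piece of a curve.\<close>

lemma chart_close:
 assumes C: "compact C" and c: "c : A" "C <= cdom c" and e: "e > 0"
 obtains ep where "ep > 0" "!!p q. p : C ==> dst p q < ep ==> q : cdom c & norm (cmap c q - cmap c p) < e"
proof -
 have "EX V ep. open V & p : V & ep > 0 & (ALL p':V. ALL q. dst p' q < ep --> q : cdom c & norm (cmap c q - cmap c p') < e)" if p: "p : C" for p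
 proof -
  define U where "U = cdom c Int cmap c -` ball (cmap c p) (e / 2)"
  have U: "open U" "p : U"
   unfolding U_def using continuous_open_preimage[OF chart_simps(5)[OF c(1)] chartD(1)[OF c(1)] open_ball] p c(2) e by auto
  obtain d where d: "d > 0" "!!q. dst p q < d ==> q : U" by (rule dst_small[OF U], rule that)
  have d2: "d / 2 > 0" using d(1) by simp
  obtain V where V: "open V" "p : V" "!!q. q : V ==> dst p q < d / 2 & dst q p < d / 2" by (rule dst_near[OF d2], rule that)
  have "q : cdom c & norm (cmap c q - cmap c p') < e" if "p' : V" "dst p' q < d / 2" for p' q
  proof -
   have "dst p q < d" using dst_triangle[of p q p'] V(3)[OF that(1)] that(2) by simp
   hence q: "q : U" by (rule d(2))
   have p': "p' : U" using d(2)[of p'] V(3)[OF that(1)] d(1) by simp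
   have "dist (cmap c p') (cmap c q) < e"
    using q p' dist_triangle_half_r[of "cmap c p" "cmap c p'" e "cmap c q"] unfolding U_def by simp
   thus ?thesis using q unfolding U_def by (simp add: dist_norm norm_minus_commute)
  qed
  thus ?thesis using V(1,2) d(1) by (intro exI[of _ V] exI[of _ "d / 2"]) simp
 qed
 then obtain V ep where V: "!!p. p : C ==> open (V p)" "!!p. p : C ==> p : V p" "!!p. p : C ==> ep p > 0"
  "!!p p' q. p : C ==> p' : V p ==> dst p' q < ep p ==> q : cdom c & norm (cmap c q - cmap c p') < e"
  by metis
 obtain C' where C': "C' <= C" "finite C'" "C <= (UN p:C'. V p)"
  by (rule compactE_image[OF C, of C V]) (use V in auto)
 define d where "d = Min (insert 1 (ep ` C'))"
 have d: "d > 0" "!!p. p : C' ==> d <= ep p" unfolding d_def using C' V(3) by (auto simp: subset_iff)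
 show thesis
 proof (rule that[OF d(1)])
  fix p q assume pq: "p : C" "dst p q < d"
  then obtain p' where p': "p' : C'" "p : V p'" using C'(3) by blast
  show "q : cdom c & norm (cmap c q - cmap c p) < e"
   by (rule V(4)[OF _ p'(2)]) (use C'(1) p'(1) pq(2) d(2)[OF p'(1)] in auto)
 qed
qed

lemma mg_velocity:
 assumes g: "mg 0 1 ga m" and s: "s : {0..1}" and c: "c : A" "ga s : cdom c"
 shows "L c (cmap c (ga s)) (velocity A {0..1} ga s c) = m"
  "m > 0 ==> velocity A {0..1} ga s c ~= 0"
  "d : A ==> ga s : cdom d ==> velocity A {0..1} ga s d = dird (velocity A {0..1} ga s c) (tr c d) (cmap c (ga s))"
proof -
 note geo = mg_geodesic[OF g zero_less_one]
 note C1 = geodesic_C1[OF geo]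
 interpret D: finsler_dom "cimg c" "L c" by (rule finsler_dom[OF c(1)])
 show 1: "L c (cmap c (ga s)) (velocity A {0..1} ga s c) = m"
  using mg_speed[OF g zero_less_one s] spd_chart[OF good_Icc[OF zero_less_one] C1 s c] by simp
 show "velocity A {0..1} ga s c ~= 0" if "m > 0"
  using 1 D.F_zero[OF chart_simps(3)[OF c]] that by auto
 show "velocity A {0..1} ga s d = dird (velocity A {0..1} ga s c) (tr c d) (cmap c (ga s))" if d: "d : A" "ga s : cdom d"
 proof -
  have cont: "continuous_on {0..1} ga" using C1 unfolding C1_curve_def by blast
  have "velocity A {0..1} ga s = tvec_of A c (ga s) (velocity A {0..1} ga s c)"
   by (rule velocity_tangent[OF good_Icc[OF zero_less_one] s c cont C1_curve_derivative[OF C1 s c]])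
  thus ?thesis using tvec_of_eq[OF d] by metis
 qed
qed

text \<open>The shift \<open>et\<close> keeps \<open>hh\<close> finite at \<open>s = 0\<close>. It is increased at every step along \<open>c0\<close>: the resulting loss in \<open>hh\<close>
  absorbs the \<open>o(|z|\<^sup>2)\<close> error of the change of charts.\<close>

definition cert :: "(real => 'm) => real => real => real => real => bool" where
 "cert c0 l a s et \<longleftrightarrow> (EX c:A. c0 s : cdom c & (EX ep>0. ALL f ga. mg 0 1 ga f --> ga 0 = c0 0 --> (ALL t:{0..1}. dst (c0 t) (ga t) < ep) -->
   ga s : cdom c & berwald_dom.Bf (L c) (hh a et s) (cmap c (c0 s)) (velocity A {0..1} c0 s c) (cmap c (ga s) - cmap c (c0 s)) <= s / 2 * (f\<^sup>2 - l\<^sup>2)))"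

text \<open>At time 0 the displacement vanishes, so both sides are 0 whatever the shift.\<close>

lemma cert_start:
 assumes g: "mg 0 1 c0 l" and l: "l > 0"
 shows "cert c0 l a 0 et"
proof -
 obtain c :: "('m, 'n) chart" where c: "c : A" "c0 0 : cdom c" using chart_cover by blast
 interpret D: berwald_dom "cimg c" "L c" k by (rule bdom[OF c(1)])
 have "(cmap c (c0 0), velocity A {0..1} c0 0 c) : D.Z"
  unfolding D.Z_iff using mg_velocity(2)[OF g _ c l] chart_simps(3)[OF c] by simp
 from D.Bf_zero[OF this] show ?thesis unfolding cert_def using c
  by (intro bexI[of _ c] conjI exI[of _ 1]) simp_all
qed

text \<open>Near \<open>s0\<close> everything happens in one chart \<open>c\<close>. At time
  \<open>s1\<close> the certificate is moved from its own chart \<open>d\<close> to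
  \<open>c\<close>, which uses up et2 - et1; then \<open>compare\<close> carries it to
  \<open>s2\<close> with the shift fixed.\<close>

lemma cert_step:
 assumes g: "mg 0 1 c0 l" and l: "l > 0" and a: "a > 0" "a\<^sup>2 = k' * l\<^sup>2" and k': "k' > max k 0" and s0: "s0 : {0..1}"
  and etm: "a * (1 + etm) < pi"
 obtains de where "de > 0" "!!s1 s2 et1 et2. s1 <= s2 ==> s1 : {0..1} ==> s2 : {0..1} ==> abs(s1 - s0) < de ==> abs(s2 - s0) < de ==>
   0 < et1 ==> et1 < et2 ==> et2 <= etm ==> cert c0 l a s1 et1 ==> cert c0 l a s2 et2"
proof -
 note geo = mg_geodesic[OF g zero_less_one]
 have I: "good {0..1::real}" by (rule good_Icc[OF zero_less_one])
 have cont: "continuous_on {0..1} c0" using geodesic_C1[OF geo] unfolding C1_curve_def by blast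
 obtain c :: "('m, 'n) chart" where c: "c : A" "c0 s0 : cdom c" using chart_cover by blast
 interpret D: berwald_dom "cimg c" "L c" k by (rule bdom[OF c(1)])
 obtain rh where rh: "rh > 0" "cball (cmap c (c0 s0)) rh <= cimg c"
  using open_contains_cball[THEN iffD1, OF chartD(2)[OF c(1)]] chart_simps(3)[OF c] by blast
 define K where "K = cball (cmap c (c0 s0)) rh"
 have K: "compact K" "convex K" "K <= cimg c" unfolding K_def using rh(2) by auto
 define U where "U = cdom c Int cmap c -` ball (cmap c (c0 s0)) (rh / 2)"
 have U: "open U" "c0 s0 : U"
  unfolding U_def using continuous_open_preimage[OF chart_simps(5)[OF c(1)] chartD(1)[OF c(1)] open_ball] c(2) rh(1) by auto
 have "\<forall>\<^sub>F s in at s0 within {0..1}. c0 s : U"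
  by (rule topological_tendstoD[OF _ U]) (use cont s0 in "auto simp: continuous_on_def")
 then obtain de where de: "de > 0" "!!s. s : {0..1} ==> abs(s - s0) < de ==> c0 s : U"
  unfolding eventually_at dist_real_def using U(2) by metis
 show thesis
 proof (rule that[OF de(1)])
  fix s1 s2 et1 et2 :: real
  assume s12: "s1 <= s2" "s1 : {0..1}" "s2 : {0..1}" "abs(s1 - s0) < de" "abs(s2 - s0) < de"
   and et: "0 < et1" "et1 < et2" "et2 <= etm" and ce: "cert c0 l a s1 et1"
  let ?J = "{s1..s2}"
  have J01: "s : {0..1}" if "s : ?J" for s using that s12 by auto
  have JU: "c0 s : U" if "s : ?J" for s using de(2)[OF J01[OF that]] that s12 by (auto simp: abs_less_iff)
  hence Jc: "c0 s : cdom c" if "s : ?J" for s using that unfolding U_def by blast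
  have JK: "norm (cmap c (c0 s0) - cmap c (c0 s)) < rh / 2" if "s : ?J" for s using JU[OF that] unfolding U_def by (simp add: dist_norm)
  have JJ: "?J <= {0..1}" using J01 by blast
  let ?u = "%s. cmap c (c0 s)" and ?T = "%s. velocity A {0..1} c0 s c"
  have su: "D.sol ?J ?u ?T" using geodesic_Sol[OF I geo c(1) JJ Jc] unfolding Sol_def .
  have uK: "?u s : K" if "s : ?J" for s unfolding K_def using JK[OF that] rh(1) by (simp add: dist_norm)
  have T0: "?T s ~= 0" if "s : ?J" for s using mg_velocity(2)[OF g J01[OF that] c(1) Jc[OF that] l] .
  have ET: "D.E (?u s, ?T s) = l\<^sup>2 / 2" if "s : ?J" for s
   unfolding D.E_def using mg_velocity(1)[OF g J01[OF that] c(1) Jc[OF that]] by simp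
  have dh: "(hh a et2 has_real_derivative - (k' * (2 * D.E (?u s, ?T s)) + (hh a et2 s)\<^sup>2)) (at s within ?J)" if s: "s : ?J" for s
  proof -
   have "a * (s + et2) <= a * (1 + etm)" using J01[OF s] et(3) a(1) by (intro mult_left_mono) auto
   hence 1: "a * (s + et2) < pi" using etm by simp
   have "0 < a * (s + et2)" using J01[OF s] et a(1) by simp
   from hh_derivative[OF this 1, of ?J] show ?thesis unfolding ET[OF s] a(2) by simp
  qed
  obtain ep2 where ep2: "ep2 > 0" "!!c' v. D.sol ?J c' v ==> (!!s. s : ?J ==> c' s : K & norm (c' s - ?u s) <= ep2) ==>
    D.Bf (hh a et2 s2) (?u s2) (?T s2) (c' s2 - ?u s2) - D.Bf (hh a et2 s1) (?u s1) (?T s1) (c' s1 - ?u s1)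
     <= (s2 - s1) * (D.E (c' s1, v s1) - D.E (?u s1, ?T s1))"
  proof (rule D.compare[OF K s12(1) su uK T0 dh k'])
   fix ep assume "ep > 0" "!!c' v. D.sol ?J c' v ==> (!!s. s : ?J ==> c' s : K & norm (c' s - ?u s) <= ep) ==>
     D.Bf (hh a et2 s2) (?u s2) (?T s2) (c' s2 - ?u s2) - D.Bf (hh a et2 s1) (?u s1) (?T s1) (c' s1 - ?u s1)
     <= (s2 - s1) * (D.E (c' s1, v s1) - D.E (?u s1, ?T s1))"
   thus thesis by (rule that)
  qed
  obtain d epd where d: "d : A" "c0 s1 : cdom d" and epd: "epd > 0" "!!f ga. mg 0 1 ga f ==> ga 0 = c0 0 ==> (ALL t:{0..1}. dst (c0 t) (ga t) < epd) ==>
    ga s1 : cdom d & berwald_dom.Bf (L d) (hh a et1 s1) (cmap d (c0 s1)) (velocity A {0..1} c0 s1 d) (cmap d (ga s1) - cmap d (c0 s1)) <= s1 / 2 * (f\<^sup>2 - l\<^sup>2)"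
   using ce unfolding cert_def by (elim bexE conjE exE) (rule that; blast)
  interpret T: berwald_transition "cimg d" "cimg c" "L d" "L c" "ov d c" "tr d c" k by (rule btrans[OF d(1) c(1)])
  have s1J: "s1 : ?J" "s2 : ?J" using s12 by auto
  let ?x = "cmap d (c0 s1)" and ?y = "velocity A {0..1} c0 s1 d"
  have xV: "?x : ov d c" unfolding ov_def using d(2) Jc[OF s1J(1)] by blast
  have y0: "?y ~= 0" by (rule mg_velocity(2)[OF g s12(2) d l])
  have phx: "tr d c ?x = ?u s1" by (rule tr_eq[OF d])
  have dphx: "dird ?y (tr d c) ?x = ?T s1" using mg_velocity(3)[OF g s12(2) d c(1) Jc[OF s1J(1)]] by simp
  have hlt: "hh a et2 s1 < hh a et1 s1"
  proof (rule hh_strict_decreasing[OF a(1) _ et(2)])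
   have "a * (s1 + et2) <= a * (1 + etm)" using s12(2) et(3) a(1) by (intro mult_left_mono) auto
   thus "a * (s1 + et2) < pi" using etm by simp
  qed (use s12(2) et(1) in auto)
  obtain ep1 where ep1: "ep1 > 0" "!!z. norm z <= ep1 ==> berwald_dom.Bf (L c) (hh a et2 s1) (tr d c ?x) (dird ?y (tr d c) ?x) (tr d c (?x + z) - tr d c ?x)
    <= berwald_dom.Bf (L d) (hh a et1 s1) ?x ?y z"
   by (rule T.Bf_phi[OF xV y0 hlt], rule that)
  have cJ: "compact (c0 ` ?J)" "c0 ` ?J <= cdom c"
   using compact_continuous_image[OF continuous_on_subset[OF cont JJ] compact_Icc] Jc by blast+
  have m2: "min ep2 (rh / 2) > 0" using ep2(1) rh(1) by simp
  obtain ep3 where ep3: "ep3 > 0" "!!p q. p : c0 ` ?J ==> dst p q < ep3 ==> q : cdom c & norm (cmap c q - cmap c p) < min ep2 (rh / 2)"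
   by (rule chart_close[OF cJ(1) c(1) cJ(2) m2], rule that)
  have c1: "compact {c0 s1}" "{c0 s1} <= cdom d" using d(2) by auto
  obtain ep4 where ep4: "ep4 > 0" "!!p q. p : {c0 s1} ==> dst p q < ep4 ==> q : cdom d & norm (cmap d q - cmap d p) < ep1"
   by (rule chart_close[OF c1(1) d(1) c1(2) ep1(1)], rule that)
  define ep where "ep = min epd (min ep3 ep4)"
  have ep: "ep > 0" "ep <= epd" "ep <= ep3" "ep <= ep4" unfolding ep_def using epd(1) ep3(1) ep4(1) by auto
  show "cert c0 l a s2 et2"
   unfolding cert_def
  proof (intro bexI[OF _ c(1)] conjI exI[of _ ep] allI impI ep(1) Jc[OF s1J(2)])
   fix f ga assume ga: "mg 0 1 ga f" "ga 0 = c0 0" and close: "ALL t:{0..1}. dst (c0 t) (ga t) < ep"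
   have c3: "ga s : cdom c & norm (cmap c (ga s) - ?u s) < min ep2 (rh / 2)" if "s : ?J" for s
    using ep3(2)[of "c0 s" "ga s"] close J01[OF that] ep(3) that by force
   thus "ga s2 : cdom c" using s1J(2) by blast
   have c4: "ga s1 : cdom d & norm (cmap d (ga s1) - ?x) < ep1"
    using ep4(2)[of "c0 s1" "ga s1"] close s12(2) ep(4) by force
   note geo2 = mg_geodesic[OF ga(1) zero_less_one]
   let ?v = "%s. velocity A {0..1} ga s c"
   have s2: "D.sol ?J (%s. cmap c (ga s)) ?v" using geodesic_Sol[OF I geo2 c(1) JJ] c3 unfolding Sol_def by blast
   have cK: "cmap c (ga s) : K & norm (cmap c (ga s) - ?u s) <= ep2" if "s : ?J" for s
   proof
    show "norm (cmap c (ga s) - ?u s) <= ep2" using c3[OF that] by simp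
    have "norm (?u s0 - cmap c (ga s)) <= norm (?u s0 - ?u s) + norm (cmap c (ga s) - ?u s)"
     using norm_triangle_ineq4[of "?u s0 - ?u s" "cmap c (ga s) - ?u s"] by simp
    thus "cmap c (ga s) : K" unfolding K_def using JK[OF that] c3[OF that] by (simp add: dist_norm)
   qed
   have E2: "D.E (cmap c (ga s1), ?v s1) = f\<^sup>2 / 2"
    unfolding D.E_def using mg_velocity(1)[OF ga(1) s12(2) c(1)] c3[OF s1J(1)] by simp
   have "ALL t:{0..1}. dst (c0 t) (ga t) < epd" using close ep(2) by force
   from epd(2)[OF ga this]
   have B1: "berwald_dom.Bf (L d) (hh a et1 s1) ?x ?y (cmap d (ga s1) - ?x) <= s1 / 2 * (f\<^sup>2 - l\<^sup>2)" by blast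
   have "tr d c (?x + (cmap d (ga s1) - ?x)) = cmap c (ga s1)" using tr_eq[OF d(1), of "ga s1" c] c4 by simp
   hence B2: "D.Bf (hh a et2 s1) (?u s1) (?T s1) (cmap c (ga s1) - ?u s1) <= berwald_dom.Bf (L d) (hh a et1 s1) ?x ?y (cmap d (ga s1) - ?x)"
    using ep1(2)[of "cmap d (ga s1) - ?x"] c4 unfolding phx dphx by simp
   have "D.Bf (hh a et2 s2) (?u s2) (?T s2) (cmap c (ga s2) - ?u s2) - D.Bf (hh a et2 s1) (?u s1) (?T s1) (cmap c (ga s1) - ?u s1)
     <= (s2 - s1) * (D.E (cmap c (ga s1), ?v s1) - D.E (?u s1, ?T s1))"
    by (rule ep2(2)[OF s2 cK])
   hence "D.Bf (hh a et2 s2) (?u s2) (?T s2) (cmap c (ga s2) - ?u s2) <= s1 / 2 * (f\<^sup>2 - l\<^sup>2) + (s2 - s1) * (f\<^sup>2 / 2 - l\<^sup>2 / 2)"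
    using B1 B2 unfolding E2 ET[OF s1J(1)] by simp
   also have "... = s2 / 2 * (f\<^sup>2 - l\<^sup>2)" by (simp add: algebra_simps diff_divide_distrib)
   finally show "D.Bf (hh a et2 s2) (?u s2) (?T s2) (cmap c (ga s2) - ?u s2) <= s2 / 2 * (f\<^sup>2 - l\<^sup>2)" .
  qed
 qed
qed

text \<open>The local steps are chained by bisection of [0,1]. The property \<open>P\<close> is
  quantified over all pairs of shifts, so any positive increase suffices for a step.\<close>

lemma cert_end:
 assumes g: "mg 0 1 c0 l" and l: "l > 0" and a: "a > 0" "a\<^sup>2 = k' * l\<^sup>2" and k': "k' > max k 0"
  and etm: "a * (1 + etm) < pi" "etm > 0"
 shows "cert c0 l a 1 etm"
proof -
 define P where "P s1 s2 \<longleftrightarrow> (0 <= s1 --> s2 <= 1 --> (ALL et1 et2. 0 < et1 --> et1 < et2 --> et2 <= etm --> cert c0 l a s1 et1 --> cert c0 l a s2 et2))" for s1 s2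
 have "P 0 1"
 proof (rule Bolzano)
  fix s1 s2 s3 assume P: "P s1 s2" "P s2 s3" and s: "s1 <= s2" "s2 <= s3"
  show "P s1 s3" unfolding P_def
  proof (intro impI allI)
   fix et1 et2 assume h: "0 <= s1" "s3 <= 1" "0 < et1" "et1 < et2" "et2 <= etm" "cert c0 l a s1 et1"
   \<comment> \<open>The allowed increase of the shift is divided between the two halves.\<close>
   define et where "et = (et1 + et2) / 2"
   have et: "et1 < et" "et < et2" "0 < et" "et <= etm" using h unfolding et_def by auto
   have s2: "0 <= s2" "s2 <= 1" using h s by auto
   have "cert c0 l a s2 et" using P(1) h(1,3,6) s2 et unfolding P_def by blast
   thus "cert c0 l a s3 et2" using P(2) h(2,5) s2 et unfolding P_def by blast
  qed
 next
  fix s0 :: real assume "0 <= s0" "s0 <= 1"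
  hence s0: "s0 : {0..1}" by simp
  obtain de where de: "de > 0" "!!s1 s2 et1 et2. s1 <= s2 ==> s1 : {0..1} ==> s2 : {0..1} ==> abs(s1 - s0) < de ==> abs(s2 - s0) < de ==>
   0 < et1 ==> et1 < et2 ==> et2 <= etm ==> cert c0 l a s1 et1 ==> cert c0 l a s2 et2"
   by (rule cert_step[OF g l a k' s0 etm(1)], rule that)
  show "EX d>0. ALL s1 s2. s1 <= s0 & s0 <= s2 & s2 - s1 < d --> P s1 s2"
  proof (intro exI[of _ de] conjI de(1) allI impI)
   fix s1 s2 assume s: "s1 <= s0 & s0 <= s2 & s2 - s1 < de"
   show "P s1 s2" unfolding P_def
   proof (intro impI allI)
    fix et1 et2 assume "0 <= s1" "s2 <= 1" "0 < et1" "et1 < et2" "et2 <= etm" "cert c0 l a s1 et1"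
    thus "cert c0 l a s2 et2" using s by (intro de(2)[of s1 s2 et1 et2]) auto
   qed
  qed
 qed simp
 thus ?thesis unfolding P_def using cert_start[OF g l, of a "etm / 2"] etm(2)
  by (metis half_gt_zero field_sum_of_halves less_add_same_cancel1 order_refl)
qed

text \<open>The minimizers from \<open>x\<close> to nearby points of \<open>sg\<close> are close to
  \<open>c0\<close> by stability, so the certificate at s = 1 applies to them. If none of them were
  longer than \<open>c0\<close>, \<open>Bf\<close> would be nonpositive along
  \<open>sg\<close>.\<close>

theorem no_interior_max:
 assumes i: "INJ x R" and sg: "geodesic A F {a..b} sg" "a < t0" "t0 < b" and m: "!!t. t : {a..b} ==> spd {a..b} sg t = m" "m > 0"
  and l: "0 < dst x (sg t0)" "dst x (sg t0) < R" and k': "k' > max k 0" "sqrt k' * dst x (sg t0) < pi / 2"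
  and le: "!!t. t : {a..b} ==> dst x (sg t) <= dst x (sg t0)"
 shows False
proof -
 define l where "l = dst x (sg t0)"
 have l0: "l > 0" using l unfolding l_def by simp
 have k0: "k' > 0" using k'(1) by simp
 define al where "al = sqrt k' * l"
 have al: "al > 0" "al\<^sup>2 = k' * l\<^sup>2" "al < pi / 2" unfolding al_def using k0 l0 k'(2) by (simp_all add: power_mult_distrib l_def)
 \<comment> \<open>This puts al (1 + et) midway between al and pi/2, so the cotangent at time 1 is
   positive.\<close>
 define et where "et = (pi / 2 - al) / (2 * al)"
 have et: "et > 0" unfolding et_def using al by simp
 have aet: "al * (1 + et) = al / 2 + pi / 4" unfolding et_def using al(1) by (simp add: field_simps)
 hence aet2: "al * (1 + et) < pi / 2" "0 < al * (1 + et)" using al pi_gt_zero by simp_all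
 hence aet3: "al * (1 + et) < pi" using pi_gt_zero by linarith
 obtain c0 where c0: "mg 0 1 c0 (dst x (sg t0))" "c0 0 = x" "c0 1 = sg t0" by (rule mg_exists)
 have ce: "cert c0 l al 1 et" by (rule cert_end[OF c0(1)[folded l_def] l0 al(1,2) k'(1) aet3 et])
 obtain c ep where c: "c : A" "c0 1 : cdom c" and ep: "ep > 0" "!!f ga. mg 0 1 ga f ==> ga 0 = c0 0 ==> (ALL t:{0..1}. dst (c0 t) (ga t) < ep) ==>
    ga 1 : cdom c & berwald_dom.Bf (L c) (hh al et 1) (cmap c (c0 1)) (velocity A {0..1} c0 1 c) (cmap c (ga 1) - cmap c (c0 1)) <= 1 / 2 * (f\<^sup>2 - l\<^sup>2)"
  using ce unfolding cert_def by (elim bexE conjE exE) (rule that; blast)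
 interpret D: berwald_dom "cimg c" "L c" k by (rule bdom[OF c(1)])
 obtain V where V: "open V" "sg t0 : V" "!!q c s. q : V ==> mg 0 1 c (dst x q) ==> c 0 = x ==> c 1 = q ==> s : {0..1} ==> dst (c0 s) (c s) < ep"
 proof (rule mg_stable[OF c0 _ ep(1)])
  fix c' and t :: real assume "mg 0 1 c' (dst x (sg t0))" "c' 0 = x" "c' 1 = sg t0" "t : {0..1}"
  thus "c' t = c0 t" using mg_unique[OF i l(2) _ _ _ c0] by blast
 qed (rule that)
 have ab: "a < b" "t0 : {a..b}" using sg(2,3) by auto
 have cont: "continuous_on {a..b} sg" using geodesic_C1[OF sg(1)] unfolding C1_curve_def by blast
 have "\<forall>\<^sub>F t in at t0 within {a..b}. sg t : V"
  by (rule topological_tendstoD[OF _ V(1,2)]) (use cont ab(2) in "auto simp: continuous_on_def")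
 then obtain de where de: "de > 0" "!!s. s : {a..b} ==> abs(s - t0) < de ==> sg s : V"
  unfolding eventually_at dist_real_def using V(2) by metis
 define J where "J = {a<..<b} Int ball t0 de"
 have J: "open J" "t0 : J" "J <= {a..b}" unfolding J_def using sg(2,3) de(1) by auto
 have JV: "sg t : V" if "t : J" for t using de(2)[of t] that unfolding J_def by (auto simp: dist_real_def abs_minus_commute)
 have main: "sg t : cdom c & D.Bf (hh al et 1) (cmap c (sg t0)) (velocity A {0..1} c0 1 c) (cmap c (sg t) - cmap c (sg t0)) <= 0" if t: "t : J" for t
 proof -
  obtain ga where ga: "mg 0 1 ga (dst x (sg t))" "ga 0 = x" "ga 1 = sg t" by (rule mg_exists)
  have g0: "ga 0 = c0 0" using ga c0 by simp
  have "ALL s:{0..1}. dst (c0 s) (ga s) < ep" using V(3)[OF JV[OF t] ga] by blast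
  from ep(2)[OF ga(1) g0 this]
  have 1: "sg t : cdom c" "D.Bf (hh al et 1) (cmap c (sg t0)) (velocity A {0..1} c0 1 c) (cmap c (sg t) - cmap c (sg t0)) <= 1 / 2 * ((dst x (sg t))\<^sup>2 - l\<^sup>2)"
   unfolding ga(3) c0(3) by auto
  have "t : {a..b}" using t J(3) by blast
  hence "(dst x (sg t))\<^sup>2 <= l\<^sup>2" unfolding l_def by (intro power_mono le dst_nonneg)
  thus ?thesis using 1 by auto
 qed
 have cJ: "sg t : cdom c" if "t : J" for t using main[OF that] by blast
 let ?v = "%t. velocity A {a..b} sg t c"
 have s: "D.sol J (%t. cmap c (sg t)) ?v" using geodesic_Sol[OF good_Icc[OF ab(1)] sg(1) c(1) J(3) cJ] unfolding Sol_def .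
 have v0: "?v t0 ~= 0"
 proof
  assume "?v t0 = 0"
  hence "spd {a..b} sg t0 = 0"
   using spd_chart[OF good_Icc[OF ab(1)] geodesic_C1[OF sg(1)] ab(2) c(1) cJ[OF J(2)]] D.F_zero[OF chart_simps(3)[OF c(1) cJ[OF J(2)]]] by simp
  thus False using m(1)[OF ab(2)] m(2) by simp
 qed
 have T0: "velocity A {0..1} c0 1 c ~= 0" by (rule mg_velocity(2)[OF c0(1) _ c l(1)]) simp
 have "cos (al * (1 + et)) > 0" "sin (al * (1 + et)) > 0"
  by (rule cos_gt_zero[OF aet2(2,1)], rule sin_gt_zero[OF aet2(2) aet3])
 hence h0: "hh al et 1 > 0" unfolding hh_def cot_def using al(1) by simp
 show False by (rule D.Bf_not_max[OF s J(1,2) v0 T0 h0]) (use main in blast)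
qed

lemma mg_in_ball:
 assumes i: "INJ x R" "INJ p R" and s: "dst x p < s" "dst x q < s" "(1 + lam) * s <= R"
  and k': "!!l. 0 < l ==> l < s ==> EX k'>max k 0. sqrt k' * l < pi / 2"
  and g: "mg 0 1 ga (dst p q)" "ga 0 = p" "ga 1 = q" and t: "t : {0..1}"
 shows "dst x (ga t) < s"
proof -
 define s1 where "s1 = max (dst x p) (dst x q)"
 \<comment> \<open>A level strictly between the distances of both end points and the radius.\<close>
 define s2 where "s2 = (s1 + s) / 2"
 have s12: "0 <= s1" "s1 < s2" "s2 < s" "dst x p <= s1" "dst x q <= s1"
  using s(1,2) dst_nonneg[of x p] unfolding s1_def s2_def by auto
 have s0: "0 < s" using s12 by simp
 have "1 * s <= (1 + lam) * s" using lam_ge_1 s0 by (intro mult_right_mono) auto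
 hence sR: "s <= R" using s(3) by simp
 obtain al where al: "mg 0 1 al (dst x p)" "al 0 = x" "al 1 = p" by (rule mg_exists)
 obtain be where be: "mg 0 1 be (dst x q)" "be 0 = x" "be 1 = q" by (rule mg_exists)
 \<comment> \<open>The path from \<open>p\<close> back to \<open>x\<close> along \<open>al\<close>
   and on to \<open>q\<close> along \<open>be\<close>; its points are no farther from
   \<open>x\<close> than \<open>s1\<close>.\<close>
 define om where "om ta = (if ta <= 1 / 2 then al (1 - 2 * ta) else be (2 * ta - 1))" for ta
 have com: "continuous_on {0..1} om"
 proof -
  have ca: "continuous_on {0..1} al" and cb: "continuous_on {0..1} be"
   using mg_continuous[OF al(1) dst_nonneg] mg_continuous[OF be(1) dst_nonneg] .
  have "continuous_on ({0..1 / 2} Un {1 / 2..1}) (%ta. if ta <= 1 / 2 then al (1 - 2 * ta) else be (2 * ta - 1))"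
  proof (rule continuous_on_If)
   show "continuous_on {0..1 / 2} (%ta. al (1 - 2 * ta))" by (rule continuous_on_compose2[OF ca]) (auto intro!: continuous_intros)
   show "continuous_on {1 / 2..1} (%ta. be (2 * ta - 1))" by (rule continuous_on_compose2[OF cb]) (auto intro!: continuous_intros)
   fix ta :: real assume "ta : {0..1 / 2}" "~ ta <= 1 / 2" thus "al (1 - 2 * ta) = be (2 * ta - 1)" by simp
  next
   fix ta :: real assume "ta : {1 / 2..1}" "ta <= 1 / 2"
   hence "1 - 2 * ta = 0" "2 * ta - 1 = 0" by simp_all
   thus "al (1 - 2 * ta) = be (2 * ta - 1)" using al(2) be(2) by simp
  qed auto
  moreover have "{0..1 / 2} Un {1 / 2..1} = {0..1::real}" by auto
  ultimately show ?thesis unfolding om_def by simp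
 qed
 have oms: "dst x (om ta) <= s1" if ta: "ta : {0..1}" for ta
 proof (cases "ta <= 1 / 2")
  case True
  hence "dst x (om ta) = dst x p * (1 - 2 * ta)" using mgD[OF al(1), of 0 "1 - 2 * ta"] al(2) ta unfolding om_def by simp
  also have "... <= dst x p" using ta True dst_nonneg[of x p] by (intro mult_left_le) auto
  finally show ?thesis using s12 by simp
 next
  case False
  hence "dst x (om ta) = dst x q * (2 * ta - 1)" using mgD[OF be(1), of 0 "2 * ta - 1"] be(2) ta unfolding om_def by simp
  also have "... <= dst x q" using ta False dst_nonneg[of x q] by (intro mult_left_le) auto
  finally show ?thesis using s12 by simp
 qed
 \<comment> \<open>Going back to \<open>x\<close> costs the factor \<open>lam\<close>. This is where
   1 + lam enters; it makes every minimizer from \<open>p\<close> to \<open>om ta\<close> unique,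
   hence stable.\<close>
 have omR: "dst p (om ta) < R" if ta: "ta : {0..1}" for ta
 proof -
  have "dst p (om ta) <= lam * dst x p + dst x (om ta)" using dst_triangle[of p "om ta" x] dst_rev[of p x] by simp
  also have "... < lam * s + s" using s(1) oms[OF ta] s12 lam_ge_1 by (intro add_strict_mono mult_strict_left_mono) auto
  also have "... <= R" using s(3) by (simp add: algebra_simps)
  finally show ?thesis .
 qed
 have "ALL ta. EX c. mg 0 1 c (dst p (om ta)) & c 0 = p & c 1 = om ta" by (meson mg_exists)
 then obtain G where G: "!!ta. mg 0 1 (G ta) (dst p (om ta))" "!!ta. G ta 0 = p" "!!ta. G ta 1 = om ta" by metis
 have "ALL ta. EX t:{0..1}. ALL t':{0..1}. dst x (G ta t') <= dst x (G ta t)"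
  by (intro allI continuous_attains_sup compact_Icc continuous_on_dst continuous_on_const mg_continuous[OF G(1) dst_nonneg]) simp
 then obtain tm where tm: "!!ta. tm ta : {0..1}" "!!ta t'. t' : {0..1} ==> dst x (G ta t') <= dst x (G ta (tm ta))" by metis
 define M where "M ta = dst x (G ta (tm ta))" for ta
 have cM: "continuous_on {0..1} M"
  unfolding continuous_on_iff
 proof (intro ballI allI impI)
  fix ta0 e :: real assume ta0: "ta0 : {0..1}" and e: "0 < e"
  define ep where "ep = e / lam"
  have ep: "ep > 0" "ep <= e" "lam * ep = e" unfolding ep_def using e lam_ge_1 by (auto simp: divide_le_eq mult_le_cancel_left1)
  obtain V where V: "open V" "om ta0 : V" "!!q c s. q : V ==> mg 0 1 c (dst p q) ==> c 0 = p ==> c 1 = q ==> s : {0..1} ==> dst (G ta0 s) (c s) < ep"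
  proof (rule mg_stable[OF G(1)[of ta0] G(2) G(3) _ ep(1)])
   fix c' and t :: real assume "mg 0 1 c' (dst p (om ta0))" "c' 0 = p" "c' 1 = om ta0" "t : {0..1}"
   thus "c' t = G ta0 t" using mg_unique[OF i(2) omR[OF ta0] _ _ _ G(1) G(2) G(3)] by blast
  qed (rule that)
  have "\<forall>\<^sub>F ta in at ta0 within {0..1}. om ta : V"
   by (rule topological_tendstoD[OF _ V(1,2)]) (use com ta0 in "auto simp: continuous_on_def")
  then obtain d where d: "d > 0" "!!ta. ta : {0..1} ==> dist ta ta0 < d ==> om ta : V"
   unfolding eventually_at using V(2) by metis
  have "dist (M ta) (M ta0) < e" if ta: "ta : {0..1}" "dist ta ta0 < d" for ta
  proof -
   have cl: "dst (G ta0 s) (G ta s) < ep" if "s : {0..1}" for s by (rule V(3)[OF d(2)[OF ta] G that])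
   have "M ta <= dst x (G ta0 (tm ta)) + dst (G ta0 (tm ta)) (G ta (tm ta))" unfolding M_def by (rule dst_triangle)
   hence 1: "M ta < M ta0 + e" using cl[OF tm(1)[of ta]] tm(2)[OF tm(1)[of ta], of ta0] ep(2) unfolding M_def by simp
   have "M ta0 <= dst x (G ta (tm ta0)) + dst (G ta (tm ta0)) (G ta0 (tm ta0))" unfolding M_def by (rule dst_triangle)
   also have "dst (G ta (tm ta0)) (G ta0 (tm ta0)) <= lam * dst (G ta0 (tm ta0)) (G ta (tm ta0))" by (rule dst_rev)
   also have "... < lam * ep" using cl[OF tm(1)[of ta0]] lam_ge_1 by (intro mult_strict_left_mono) auto
   finally have 2: "M ta0 < M ta + e" using tm(2)[OF tm(1)[of ta0], of ta] ep(3) unfolding M_def by simp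
   show ?thesis using 1 2 by (simp add: dist_real_def abs_less_iff)
  qed
  thus "EX d>0. ALL ta:{0..1}. dist ta ta0 < d --> dist (M ta) (M ta0) < e" using d(1) by blast
 qed
 have M0: "M 0 < s2"
 proof -
  have "om 0 = p" using al(3) unfolding om_def by simp
  hence "mg 0 1 (G 0) 0" using G(1)[of 0] by simp
  hence "G 0 (tm 0) = p" using mg_zero[of 0 1 "G 0" "tm 0"] tm(1) G(2) by simp
  thus ?thesis unfolding M_def using s12 by simp
 qed
 \<comment> \<open>At a parameter where the maximum equals \<open>s2\<close> it exceeds the values
   at both ends, so it is attained in the interior of a nonconstant geodesic.\<close>
 have "M 1 < s2"
 proof (rule ccontr)
  assume "~ M 1 < s2"
  then obtain ta where ta: "0 <= ta" "ta <= 1" "M ta = s2" using IVT'[of M 0 s2 1] M0 cM by auto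
  let ?t = "tm ta"
  have t01: "0 <= ?t" "?t <= 1" using tm(1)[of ta] by auto
  have "?t ~= 0" using ta(3) G(2)[of ta] s12 unfolding M_def by auto
  moreover have "?t ~= 1" using ta G(3)[of ta] s12 oms[of ta] unfolding M_def by auto
  ultimately have t: "0 < ?t" "?t < 1" using t01 by auto
  define m where "m = dst p (om ta)"
  have m: "m > 0"
  proof (rule ccontr)
   assume "~ m > 0"
   hence "mg 0 1 (G ta) 0" using G(1)[of ta] dst_nonneg[of p "om ta"] unfolding m_def by simp
   hence "G ta ?t = p" using mg_zero[of 0 1 "G ta" ?t] tm(1) G(2) by simp
   thus False using ta(3) s12 unfolding M_def by simp
  qed
  have s2p: "0 < s2" using s12 by simp
  obtain k' where kk: "k' > max k 0" "sqrt k' * s2 < pi / 2" using k'[OF s2p s12(3)] by blast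
  note geo = mg_geodesic[OF G(1)[of ta] zero_less_one]
  have e: "dst x (G ta ?t) = s2" using ta(3) unfolding M_def .
  show False
  proof (rule no_interior_max[OF i(1) geo t _ m _ _ kk(1)])
   show "spd {0..1} (G ta) t = m" if "t : {0..1}" for t unfolding m_def by (rule mg_speed[OF G(1) zero_less_one that])
   show "0 < dst x (G ta ?t)" "dst x (G ta ?t) < R" "sqrt k' * dst x (G ta ?t) < pi / 2" unfolding e using s2p s12 sR kk(2) by auto
   show "dst x (G ta t) <= dst x (G ta ?t)" if "t : {0..1}" for t by (rule tm(2)[OF that])
  qed
 qed
 have o1: "om 1 = q" using be(3) unfolding om_def by simp
 have "ga t = G 1 t" by (rule mg_unique[OF i(2) _ g G(1)[of 1, unfolded o1] G(2) G(3)[of 1, unfolded o1] t]) (use omR[of 1] o1 in simp)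
 thus ?thesis using tm(2)[OF t, of 1] `M 1 < s2` s12 unfolding M_def by simp
qed

lemma ball_strongly_convex:
 assumes i: "!!p. dst x p < r ==> INJ p ((1 + lam) * r)" and s: "s < r"
  and k': "!!l. 0 < l ==> l < r ==> EX k'>max k 0. sqrt k' * l < pi / 2"
 shows "strongly_convex A F (forward_ball A F x s)"
 unfolding strongly_convex_def
proof (intro ballI)
 fix p q assume "p : forward_ball A F x s" "q : forward_ball A F x s"
 hence pq: "dst x p < s" "dst x q < s" unfolding forward_ball_def by auto
 let ?R = "(1 + lam) * r"
 have s0: "0 < s" using pq dst_nonneg[of x p] by simp
 have sR: "(1 + lam) * s < ?R" using s lam_ge_1 by (intro mult_strict_left_mono) auto
 have ix: "INJ x ?R" using i[of x] s s0 by simp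
 have ip: "INJ p ?R" using i[of p] s pq by simp
 have far: "dst p y < (1 + lam) * s" if "dst x y < s" for y
 proof -
  have "dst p y <= lam * dst x p + dst x y" using dst_triangle[of p y x] dst_rev[of p x] by simp
  also have "... < lam * s + s" using pq(1) that lam_ge_1 by (intro add_strict_mono mult_strict_left_mono) auto
  finally show ?thesis by (simp add: algebra_simps)
 qed
 have dR: "dst p q < ?R" using far[OF pq(2)] sR by simp
 obtain ga where ga: "mg 0 1 ga (dst p q)" "ga 0 = p" "ga 1 = q" by (rule mg_exists)
 have uniq: "sg t = ga t" if "mg 0 1 sg (dst p q)" "sg 0 = p" "sg 1 = q" "t : {0..1}" for sg and t :: real
  by (rule mg_unique[OF ip dR that(1-3) ga that(4)])
 have ball: "ga t : forward_ball A F x s" if "t : {0..1}" for t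
 proof -
  have "EX k'>max k 0. sqrt k' * l < pi / 2" if "0 < l" "l < s" for l using k'[of l] that s by simp
  from mg_in_ball[OF ix ip pq less_imp_le[OF sR] this ga that] show ?thesis unfolding forward_ball_def by simp
 qed
 show "EX ga. geodesic_from_to A F p q ga & minimizer A F p q ga & (ALL sg. minimizer A F p q sg --> (ALL t:{0..1}. sg t = ga t)) &
    ga ` {0..1} <= forward_ball A F x s &
    (ALL sg. geodesic_from_to A F p q sg & sg ` {0..1} <= forward_ball A F x s --> (ALL t:{0..1}. sg t = ga t))"
 proof (intro exI[of _ ga] conjI allI impI ballI)
  show "geodesic_from_to A F p q ga" unfolding geodesic_from_to_def using mg_geodesic[OF ga(1) zero_less_one] ga by blast
  show "minimizer A F p q ga" unfolding minimizer_mg using ga by blast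
  show "sg t = ga t" if "minimizer A F p q sg" "t : {0..1}" for sg t using that uniq unfolding minimizer_mg by blast
  show "ga ` {0..1} <= forward_ball A F x s" using ball by blast
  fix sg and t :: real assume sg: "geodesic_from_to A F p q sg & sg ` {0..1} <= forward_ball A F x s" and t: "t : {0..1}"
  hence g: "geodesic A F {0..1} sg" "sg 0 = p" "sg 1 = q" and "sg ` {0..1} <= {q. dst x q < s}"
   unfolding geodesic_from_to_def forward_ball_def by blast+
  hence B: "dst x (sg t) < s" if "t : {0..1}" for t using that by blast
  obtain m where m: "m >= 0" "!!t. t : {0..1} ==> spd {0..1} sg t = m" by (rule geodesic_speed[OF g(1) good_Icc[OF zero_less_one]]) blast
  have ig: "dst p (sg t) = m * t" if "t : {0..1}" "m * t < ?R" for t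
   using INJ_geodesic[OF ip g(1,2) m(2)] that by blast
  \<comment> \<open>A longer geodesic from \<open>p\<close> would still be minimizing at a length
    \<open>R'\<close> between (1 + lam) s and (1 + lam) r, and would be too far from
    \<open>p\<close> at that moment to lie in the ball.\<close>
  have "m < ?R"
  proof (rule ccontr)
   assume mR: "~ m < ?R"
   obtain R' where R': "(1 + lam) * s < R'" "R' < ?R" using dense[OF sR] by blast
   have "0 < (1 + lam) * s" using s0 lam_ge_1 by (intro mult_pos_pos) auto
   hence Rp: "0 < R'" using R'(1) by (rule less_trans)
   have mp: "m > 0" using mR R' Rp by simp
   have t': "R' / m : {0..1}" using Rp mp mR R'(2) by (simp add: divide_le_eq)
   have "dst p (sg (R' / m)) = R'" using ig[OF t'] R'(2) mp by simp
   thus False using far[OF B[OF t']] R'(1) by simp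
  qed
  hence "dst p q = m" using ig[of 1] g(3) by simp
  hence "mg 0 1 sg (dst p q)" using geodesic_mg[OF g(1) good_Icc[OF zero_less_one] m(2), of 0 1] g by simp
  thus "sg t = ga t" using uniq g t by blast
 qed
qed

lemma convexity_radius_at_ge:
 assumes i: "!!p. dst x p < r ==> INJ p ((1 + lam) * r)" and r: "r > 0" "ereal r <= pi_half_over_sqrt k"
 shows "ereal r <= convexity_radius_at A F x"
proof -
 have k': "EX k'>max k 0. sqrt k' * l < pi / 2" if l: "0 < l" "l < r" for l
 proof -
  define ka where "ka = sqrt (max k 0)"
  have ka: "ka >= 0" "ka\<^sup>2 = max k 0" unfolding ka_def by simp_all
  have "ka * l < pi / 2"
  proof (cases "k > 0")
   case True
   hence "r <= pi / (2 * sqrt k)" using r(2) unfolding pi_half_over_sqrt_def by simp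
   hence "l < pi / (2 * sqrt k)" using l by simp
   thus ?thesis using True unfolding ka_def by (simp add: field_simps)
  next
   case False
   thus ?thesis unfolding ka_def by simp
  qed
  hence lt: "ka < pi / (2 * l)" using l by (simp add: field_simps)
  \<comment> \<open>The strict inequality leaves room for k' > max k 0, as the certificate needs a
    curvature constant above the bound.\<close>
  define ka' where "ka' = (ka + pi / (2 * l)) / 2"
  have ka': "ka < ka'" "ka' < pi / (2 * l)" using lt unfolding ka'_def by auto
  have "ka'\<^sup>2 > max k 0" unfolding ka(2)[symmetric] using ka(1) ka'(1) by (intro power_strict_mono) auto
  moreover have "sqrt (ka'\<^sup>2) * l < pi / 2" using ka'(2) ka(1) ka'(1) l by (simp add: field_simps)
  ultimately show ?thesis by blast
 qed
 have "ALL s<r. strongly_convex A F (forward_ball A F x s)" using ball_strongly_convex[OF i _ k'] by blast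
 thus ?thesis unfolding convexity_radius_at_def using r(1) by (intro SUP_upper) simp
qed

end

theorem theorem4p2:
  fixes A :: "('m::{t2_space, second_countable_topology}, 'n::finite) chart set"
    and F :: "('m, 'n) finsler_fun"
    and k \<sigma> lam :: real
  assumes "finsler_manifold A F"
    and "forward_complete A F"
    and "berwald A F"
    and "flag_curv_le A F k"
    and "injectivity_radius A F \<ge> ereal \<sigma>"
    and "reversibility A F \<le> ereal lam"
  shows "convexity_radius A F \<ge> min (pi_half_over_sqrt k) (ereal (\<sigma> / (lam * (1 + lam))))"
proof -
 interpret berwald_mfd A F lam k
  by (unfold_locales) (use assms in auto)
 let ?m = "min (pi_half_over_sqrt k) (ereal (\<sigma> / (lam * (1 + lam))))"
 have lam: "lam >= 1" by (rule lam_ge_1)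
 have "?m <= convexity_radius_at A F x" for x
 proof -
  \<comment> \<open>A positive lower bound at each \<open>x\<close> from the local injectivity
    estimate. It settles the numbers y <= 0 below the minimum, in particular the case of nonpositive
    sigma.\<close>
  obtain V R where V: "open V" "x : V" "R > 0" "!!p. p : V ==> INJ p R" by (rule INJ_local[of x], rule that)
  obtain e where e: "e > 0" "!!q. dst x q < e ==> q : V" by (rule dst_small[OF V(1,2)], rule that)
  define r where "r = min (min e (R / (1 + lam))) (if k > 0 then pi / (2 * sqrt k) else 1)"
  have r: "r > 0" "r <= e" "r <= R / (1 + lam)" unfolding r_def using e(1) V(3) lam by auto
  have "ereal r <= pi_half_over_sqrt k" unfolding r_def pi_half_over_sqrt_def by simp
  moreover have "INJ p ((1 + lam) * r)" if "dst x p < r" for p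
  proof (rule INJ_mono[OF V(4)[OF e(2)]])
   show "dst x p < e" using that r(2) by simp
   show "(1 + lam) * r <= R" using r(3) lam by (simp add: le_divide_eq mult.commute)
  qed
  ultimately have "ereal r <= convexity_radius_at A F x" using convexity_radius_at_ge r(1) by blast
  hence pos: "0 < convexity_radius_at A F x" using r(1) by (meson ereal_less(2) less_le_trans)
  show ?thesis
  proof (rule dense_le)
   fix y assume y: "y < ?m"
   show "y <= convexity_radius_at A F x"
   proof (cases "y <= 0")
    case True
    thus ?thesis using pos by simp
   next
    case False
    then obtain r where yr: "y = ereal r" using y by (cases y) auto
    have r0: "r > 0" using False yr by simp
    have "r < \<sigma> / (lam * (1 + lam))" using y yr by simp
    hence rs: "(1 + lam) * r * lam < \<sigma>" using lam by (simp add: less_divide_eq mult_ac)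
    have "(1 + lam) * r <= (1 + lam) * r * lam" using lam r0 by simp
    hence "(1 + lam) * r <= \<sigma>" using rs by simp
    hence "INJ p ((1 + lam) * r)" for p using INJ_mono[OF INJ_injectivity_radius[OF assms(5)]] by blast
    moreover have "ereal r <= pi_half_over_sqrt k" using y yr by (simp add: less_imp_le)
    ultimately show ?thesis using convexity_radius_at_ge r0 yr by blast
   qed
  qed
 qed
 thus ?thesis unfolding convexity_radius_def by (intro INF_greatest)
qed

end
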